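(* For every irrational $\alpha$, the set $$\{ f \in C(\mathbb{T},\mathbb{R}) : dk_{\alpha,f} \text{ is singular} \}$$ is a dense $G_\delta$ subset of $(C(\mathbb{T},\mathbb{R}), \|\cdot\|_\infty)$.
   Context: $\mathbb{T} = \mathbb{R}/\mathbb{Z}$. For $\alpha \in \mathbb{T}$, $f \in C(\mathbb{T},\mathbb{R})$ and $\omega \in \mathbb{T}$, $H_\omega$ is the operator on $\ell^2(\mathbb{Z})$ given by $[H_\omega\psi](n) = \psi(n+1)+\psi(n-1)+f(\omega+n\alpha)\psi(n)$. The density of states measure $dk_{\alpha,f}$ is the probability measure on $\mathbb{R}$ determined by $\int g\, dk_{\alpha,f} = \int_{\mathbb{T}} \langle\delta_0, g(H_\omega)\delta_0\rangle\, d\omega$ for bounded Borel $g$. "Singular" means singular with respect to Lebesgue measure on $\mathbb{R}$. *)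

theory Defs
  imports "HOL-Probability.Probability"
begin

lemma equivp_diff_Ints: "equivp (\<lambda>x y :: real. x - y \<in> \<int>)"
proof (rule equivpI)
  show "reflp (\<lambda>x y :: real. x - y \<in> \<int>)"
    by (simp add: reflp_def)
  show "symp (\<lambda>x y :: real. x - y \<in> \<int>)"
    unfolding symp_def by (metis Ints_minus minus_diff_eq)
  show "transp (\<lambda>x y :: real. x - y \<in> \<int>)"
  proof (rule transpI)
    fix x y z :: real
    assume "x - y \<in> \<int>" "y - z \<in> \<int>"
    then have "(x - y) + (y - z) \<in> \<int>" by (rule Ints_add)
    then show "x - z \<in> \<int>" by simp
  qed
qed

quotient_type circle = real / "\<lambda>x y. x - y \<in> \<int>"
  morphisms rep_circle to_circle
  by (rule equivp_diff_Ints)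

instantiation circle :: ab_group_add
begin

lift_definition zero_circle :: circle is "0 :: real" .

lift_definition plus_circle :: "circle \<Rightarrow> circle \<Rightarrow> circle" is "(+)"
proof -
  fix a b c d :: real
  assume "a - b \<in> \<int>" "c - d \<in> \<int>"
  then have "(a - b) + (c - d) \<in> \<int>" by (rule Ints_add)
  then show "a + c - (b + d) \<in> \<int>" by (simp add: algebra_simps)
qed

lift_definition minus_circle :: "circle \<Rightarrow> circle \<Rightarrow> circle" is "(-)"
proof -
  fix a b c d :: real
  assume "a - b \<in> \<int>" "c - d \<in> \<int>"
  then have "(a - b) - (c - d) \<in> \<int>" by (rule Ints_diff)
  then show "a - c - (b - d) \<in> \<int>" by (simp add: algebra_simps)
qed

lift_definition uminus_circle :: "circle \<Rightarrow> circle" is "uminus"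
  by (metis Ints_minus minus_diff_eq minus_diff_minus)

instance
  by standard (transfer; simp add: algebra_simps)+

end

lift_definition circle_scale :: "int \<Rightarrow> circle \<Rightarrow> circle" is "\<lambda>n x. of_int n * x"
proof -
  fix n :: int and x y :: real
  assume "x - y \<in> \<int>"
  then have "of_int n * (x - y) \<in> \<int>" by (intro Ints_mult) auto
  then show "of_int n * x - of_int n * y \<in> \<int>" by (simp add: algebra_simps)
qed

instantiation circle :: topological_space
begin

definition open_circle :: "circle set \<Rightarrow> bool"
  where "open_circle U \<longleftrightarrow> open (to_circle -` U)"

instance
  by standard (auto simp: open_circle_def vimage_Int vimage_Union)

end

lemma continuous_on_to_circle: "continuous_on S to_circle"
  by (rule continuous_on_subset[of UNIV])
     (auto simp: continuous_on_open_vimage open_circle_def)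

lemma to_circle_frac: "to_circle (frac x) = to_circle x"
  by (simp add: circle.abs_eq_iff frac_def)

lemma compact_UNIV_circle: "compact (UNIV :: circle set)"
proof -
  have "c \<in> to_circle ` {0..1}" for c
  proof -
    obtain x where "c = to_circle x"
      by (metis Quotient3_abs_rep Quotient3_circle)
    then have "c = to_circle (frac x)" by (simp add: to_circle_frac)
    moreover have "frac x \<in> {0..1}" by (simp add: frac_lt_1 less_imp_le)
    ultimately show ?thesis by blast
  qed
  then have "(UNIV :: circle set) = to_circle ` {0..1}" by auto
  then show ?thesis
    by (metis compact_Icc compact_continuous_image continuous_on_to_circle)
qed

text \<open>
  Every continuous function on the circle is bounded, so \<^typ>\<open>circle \<Rightarrow>\<^sub>C real\<close> with its
  supremum metric is the whole space of continuous real-valued functions.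
\<close>

lemma continuous_circle_bcontfun:
  fixes f :: "circle \<Rightarrow> real"
  shows "f \<in> bcontfun \<longleftrightarrow> continuous_on UNIV f"
  using compact_continuous_image[OF _ compact_UNIV_circle, of f]
  by (auto simp: bcontfun_def dest: compact_imp_bounded)

definition circle_measure :: "circle measure"
  where "circle_measure = distr (restrict_space lborel {0..<1}) borel to_circle"

definition irrational :: "circle \<Rightarrow> bool"
  where "irrational \<alpha> \<longleftrightarrow> \<alpha> \<notin> to_circle ` \<rat>"

definition sq_summable :: "(int \<Rightarrow> complex) \<Rightarrow> bool"
  where "sq_summable \<psi> \<longleftrightarrow> (\<lambda>n. (cmod (\<psi> n))\<^sup>2) summable_on UNIV"

lemma cmod_add_sq_le: "(cmod (a + b))\<^sup>2 \<le> 2 * ((cmod a)\<^sup>2 + (cmod b)\<^sup>2)"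
proof -
  have "(cmod (a + b))\<^sup>2 \<le> (cmod a + cmod b)\<^sup>2"
    by (intro power_mono norm_triangle_ineq) auto
  also have "\<dots> \<le> 2 * ((cmod a)\<^sup>2 + (cmod b)\<^sup>2)"
    using sum_squares_bound[of "cmod a" "cmod b"] by (simp add: power2_sum)
  finally show ?thesis .
qed

lemma sq_summable_bounded_by:
  assumes "g summable_on UNIV" "\<And>n. (cmod (\<psi> n))\<^sup>2 \<le> g n"
  shows "sq_summable \<psi>"
  unfolding sq_summable_def
  by (rule summable_on_comparison_test[OF assms(1)]) (use assms(2) in auto)

lemma sq_summable_zero: "sq_summable (\<lambda>_. 0)"
  by (simp add: sq_summable_def)

lemma sq_summable_add:
  assumes "sq_summable \<phi>" "sq_summable \<psi>"
  shows "sq_summable (\<lambda>n. \<phi> n + \<psi> n)"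
  by (rule sq_summable_bounded_by[where g = "\<lambda>n. 2 * ((cmod (\<phi> n))\<^sup>2 + (cmod (\<psi> n))\<^sup>2)"])
     (use assms cmod_add_sq_le in \<open>auto simp: sq_summable_def simp del: distrib_left_numeral
        intro!: summable_on_cmult_right summable_on_add\<close>)

lemma sq_summable_mult_bounded:
  assumes "sq_summable \<psi>" "\<And>n. cmod (c n) \<le> K"
  shows "sq_summable (\<lambda>n. c n * \<psi> n)"
proof (rule sq_summable_bounded_by[where g = "\<lambda>n. K\<^sup>2 * (cmod (\<psi> n))\<^sup>2"])
  show "(\<lambda>n. K\<^sup>2 * (cmod (\<psi> n))\<^sup>2) summable_on UNIV"
    using assms(1) by (intro summable_on_cmult_right) (simp add: sq_summable_def)
  show "(cmod (c n * \<psi> n))\<^sup>2 \<le> K\<^sup>2 * (cmod (\<psi> n))\<^sup>2" for n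
    using assms(2) by (simp add: norm_mult power_mult_distrib mult_right_mono power_mono)
qed

lemma sq_summable_cmult: "sq_summable \<psi> \<Longrightarrow> sq_summable (\<lambda>n. c * \<psi> n)"
  by (rule sq_summable_mult_bounded[where c = "\<lambda>_. c" and K = "cmod c"]) auto

lemma sq_summable_shift:
  assumes "sq_summable \<psi>"
  shows "sq_summable (\<lambda>n. \<psi> (n + k))"
proof -
  have "bij_betw (\<lambda>n :: int. n + k) UNIV UNIV"
    by (rule bij_betw_byWitness[where f' = "\<lambda>n. n - k"]) auto
  from summable_on_reindex_bij_betw[OF this, of "\<lambda>n. (cmod (\<psi> n))\<^sup>2"] assms
  show ?thesis by (simp add: sq_summable_def)
qed

lemma summable_cnj_mult:
  assumes "sq_summable \<phi>" "sq_summable \<psi>"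
  shows "(\<lambda>n. cnj (\<phi> n) * \<psi> n) summable_on UNIV"
proof (rule abs_summable_summable, rule Infinite_Sum.abs_summable_on_comparison_test')
  show "(\<lambda>n. (cmod (\<phi> n))\<^sup>2 + (cmod (\<psi> n))\<^sup>2) summable_on UNIV"
    using assms by (intro summable_on_add) (auto simp: sq_summable_def)
  fix n
  have "2 * cmod (\<phi> n) * cmod (\<psi> n) \<le> (cmod (\<phi> n))\<^sup>2 + (cmod (\<psi> n))\<^sup>2"
    by (rule sum_squares_bound)
  moreover have "0 \<le> cmod (\<phi> n) * cmod (\<psi> n)" by simp
  ultimately have "cmod (\<phi> n) * cmod (\<psi> n) \<le> (cmod (\<phi> n))\<^sup>2 + (cmod (\<psi> n))\<^sup>2"
    by linarith
  then show "norm (cnj (\<phi> n) * \<psi> n) \<le> (cmod (\<phi> n))\<^sup>2 + (cmod (\<psi> n))\<^sup>2"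
    by (simp add: norm_mult)
qed

typedef ell2 = "{\<psi> :: int \<Rightarrow> complex. sq_summable \<psi>}"
  morphisms ell2_nth Abs_ell2
  using sq_summable_zero by blast

setup_lifting type_definition_ell2

lift_definition delta :: "int \<Rightarrow> ell2" is "\<lambda>m n. if n = m then 1 else 0"
proof -
  fix m :: int
  have "(\<lambda>n. (cmod (if n = m then 1 else 0))\<^sup>2) summable_on {m}"
    by (rule summable_on_finite) simp
  then have "(\<lambda>n. (cmod (if n = m then 1 else 0))\<^sup>2) summable_on UNIV"
    by (rule summable_on_cong_neutral[THEN iffD1, rotated -1]) auto
  then show "sq_summable (\<lambda>n. if n = m then 1 else 0)" by (simp add: sq_summable_def)
qed

lift_definition scaleC :: "complex \<Rightarrow> ell2 \<Rightarrow> ell2" is "\<lambda>c \<psi> n. c * \<psi> n"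
  by (rule sq_summable_cmult)

text \<open>The inner product is linear in its second argument.\<close>

lift_definition cinner :: "ell2 \<Rightarrow> ell2 \<Rightarrow> complex"
  is "\<lambda>\<phi> \<psi>. \<Sum>\<^sub>\<infinity>n. cnj (\<phi> n) * \<psi> n" .

instantiation ell2 :: real_vector
begin

lift_definition zero_ell2 :: ell2 is "\<lambda>_. 0"
  by (rule sq_summable_zero)

lift_definition plus_ell2 :: "ell2 \<Rightarrow> ell2 \<Rightarrow> ell2" is "\<lambda>\<phi> \<psi> n. \<phi> n + \<psi> n"
  by (rule sq_summable_add)

lift_definition uminus_ell2 :: "ell2 \<Rightarrow> ell2" is "\<lambda>\<psi> n. - \<psi> n"
  by (simp add: sq_summable_def)

lift_definition minus_ell2 :: "ell2 \<Rightarrow> ell2 \<Rightarrow> ell2" is "\<lambda>\<phi> \<psi> n. \<phi> n - \<psi> n"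
proof -
  fix \<phi> \<psi> :: "int \<Rightarrow> complex"
  assume "sq_summable \<phi>" "sq_summable \<psi>"
  then have "sq_summable (\<lambda>n. \<phi> n + (- 1) * \<psi> n)"
    by (intro sq_summable_add sq_summable_cmult)
  then show "sq_summable (\<lambda>n. \<phi> n - \<psi> n)" by simp
qed

lift_definition scaleR_ell2 :: "real \<Rightarrow> ell2 \<Rightarrow> ell2" is "\<lambda>r \<psi> n. complex_of_real r * \<psi> n"
  by (rule sq_summable_cmult)

instance
proof
  fix \<phi> \<psi> \<xi> :: ell2 and r s :: real
  show "\<phi> + \<psi> + \<xi> = \<phi> + (\<psi> + \<xi>)" by transfer (simp add: add.assoc)
  show "\<phi> + \<psi> = \<psi> + \<phi>" by transfer (simp add: add.commute)
  show "0 + \<phi> = \<phi>" by transfer simp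
  show "- \<phi> + \<phi> = 0" by transfer simp
  show "\<phi> - \<psi> = \<phi> + - \<psi>" by transfer simp
  show "r *\<^sub>R (\<phi> + \<psi>) = r *\<^sub>R \<phi> + r *\<^sub>R \<psi>" by transfer (simp add: algebra_simps)
  show "(r + s) *\<^sub>R \<phi> = r *\<^sub>R \<phi> + s *\<^sub>R \<phi>" by transfer (simp add: algebra_simps)
  show "r *\<^sub>R s *\<^sub>R \<phi> = (r * s) *\<^sub>R \<phi>" by transfer (simp add: mult.assoc)
  show "1 *\<^sub>R \<phi> = \<phi>" by transfer simp
qed

end

instantiation ell2 :: real_inner
begin

definition inner_ell2 :: "ell2 \<Rightarrow> ell2 \<Rightarrow> real"
  where "inner_ell2 \<phi> \<psi> = Re (cinner \<phi> \<psi>)"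

definition norm_ell2 :: "ell2 \<Rightarrow> real"
  where "norm_ell2 \<psi> = sqrt (inner \<psi> \<psi>)"

definition sgn_ell2 :: "ell2 \<Rightarrow> ell2"
  where "sgn_ell2 \<psi> = \<psi> /\<^sub>R norm \<psi>"

definition dist_ell2 :: "ell2 \<Rightarrow> ell2 \<Rightarrow> real"
  where "dist_ell2 \<phi> \<psi> = norm (\<phi> - \<psi>)"

definition uniformity_ell2 :: "(ell2 \<times> ell2) filter"
  where "uniformity_ell2 = (INF e\<in>{0<..}. principal {(\<phi>, \<psi>). dist \<phi> \<psi> < e})"

definition open_ell2 :: "ell2 set \<Rightarrow> bool"
  where "open_ell2 U \<longleftrightarrow> (\<forall>\<phi>\<in>U. \<forall>\<^sub>F (\<phi>', \<psi>) in uniformity. \<phi>' = \<phi> \<longrightarrow> \<psi> \<in> U)"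

instance
proof
  fix \<phi> \<psi> \<xi> :: ell2 and r :: real
  show "dist \<phi> \<psi> = norm (\<phi> - \<psi>)" by (rule dist_ell2_def)
  show "sgn \<phi> = \<phi> /\<^sub>R norm \<phi>" by (rule sgn_ell2_def)
  show "norm \<phi> = sqrt (inner \<phi> \<phi>)" by (rule norm_ell2_def)
  show "(uniformity :: (ell2 \<times> ell2) filter) = (INF e\<in>{0<..}. principal {(\<phi>, \<psi>). dist \<phi> \<psi> < e})"
    by (rule uniformity_ell2_def)
  show "open U \<longleftrightarrow> (\<forall>\<phi>\<in>U. \<forall>\<^sub>F (\<phi>', \<psi>) in uniformity. \<phi>' = \<phi> \<longrightarrow> \<psi> \<in> U)" for U :: "ell2 set"
    by (rule open_ell2_def)
  have cnj_sym: "cinner \<phi> \<psi> = cnj (cinner \<psi> \<phi>)"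
    by transfer (simp flip: infsum_cnj add: mult.commute)
  then show "inner \<phi> \<psi> = inner \<psi> \<phi>" by (simp add: inner_ell2_def)
  have "cinner (\<phi> + \<psi>) \<xi> = cinner \<phi> \<xi> + cinner \<psi> \<xi>"
    by transfer (simp add: distrib_right infsum_add summable_cnj_mult)
  then show "inner (\<phi> + \<psi>) \<xi> = inner \<phi> \<xi> + inner \<psi> \<xi>" by (simp add: inner_ell2_def)
  have "cinner (r *\<^sub>R \<phi>) \<psi> = complex_of_real r * cinner \<phi> \<psi>"
    by transfer (simp add: mult.assoc infsum_cmult_right summable_cnj_mult)
  then show "inner (r *\<^sub>R \<phi>) \<psi> = r * inner \<phi> \<psi>" by (simp add: inner_ell2_def)
  have inner_sq: "inner \<phi> \<phi> = (\<Sum>\<^sub>\<infinity>n. (cmod (ell2_nth \<phi> n))\<^sup>2)"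
    unfolding inner_ell2_def
    by transfer
       (simp flip: infsum_Re power2_eq_square add: summable_cnj_mult cmod_power2)
  show "0 \<le> inner \<phi> \<phi>" by (simp add: inner_sq infsum_nonneg)
  show "inner \<phi> \<phi> = 0 \<longleftrightarrow> \<phi> = 0"
  proof
    assume "inner \<phi> \<phi> = 0"
    then have 0: "(\<Sum>\<^sub>\<infinity>n. (cmod (ell2_nth \<phi> n))\<^sup>2) \<le> 0" by (simp add: inner_sq)
    have summ: "(\<lambda>n. (cmod (ell2_nth \<phi> n))\<^sup>2) summable_on UNIV"
      using ell2_nth[of \<phi>] by (simp add: sq_summable_def)
    have "(cmod (ell2_nth \<phi> n))\<^sup>2 = 0" for n
      by (rule nonneg_infsum_le_0D[OF 0 summ]) auto
    then show "\<phi> = 0" by (transfer) auto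
  next
    assume "\<phi> = 0"
    then show "inner \<phi> \<phi> = 0" unfolding inner_sq by (transfer) simp
  qed
qed

end

definition bounded_operator :: "(ell2 \<Rightarrow> ell2) \<Rightarrow> bool"
  where "bounded_operator A \<longleftrightarrow> bounded_linear A \<and> (\<forall>c \<psi>. A (scaleC c \<psi>) = scaleC c (A \<psi>))"

definition orthogonal_projection :: "(ell2 \<Rightarrow> ell2) \<Rightarrow> bool"
  where "orthogonal_projection P \<longleftrightarrow>
    bounded_operator P \<and> P \<circ> P = P \<and> (\<forall>\<phi> \<psi>. cinner \<phi> (P \<psi>) = cinner (P \<phi>) \<psi>)"

definition bounded_pvm :: "(real set \<Rightarrow> ell2 \<Rightarrow> ell2) \<Rightarrow> bool"
  where "bounded_pvm E \<longleftrightarrow>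
    (\<forall>B\<in>sets borel. orthogonal_projection (E B)) \<and>
    (\<forall>\<psi>. E {} \<psi> = 0) \<and>
    (\<exists>r. \<forall>\<psi>. E {- r<..<r} \<psi> = \<psi>) \<and>
    (\<forall>B\<in>sets borel. \<forall>C\<in>sets borel. E (B \<inter> C) = E B \<circ> E C) \<and>
    (\<forall>B :: nat \<Rightarrow> real set. range B \<subseteq> sets borel \<longrightarrow> disjoint_family B \<longrightarrow>
      (\<forall>\<psi>. (\<lambda>i. E (B i) \<psi>) sums E (\<Union>i. B i) \<psi>))"

definition spectral_measure :: "(real set \<Rightarrow> ell2 \<Rightarrow> ell2) \<Rightarrow> ell2 \<Rightarrow> real measure"
  where "spectral_measure E \<psi> =
    measure_of UNIV (sets borel) (\<lambda>B. ennreal (Re (cinner \<psi> (E B \<psi>))))"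

definition spectral_resolution :: "(ell2 \<Rightarrow> ell2) \<Rightarrow> (real set \<Rightarrow> ell2 \<Rightarrow> ell2) \<Rightarrow> bool"
  where "spectral_resolution A E \<longleftrightarrow>
    bounded_pvm E \<and>
    (\<forall>\<psi>. cinner \<psi> (A \<psi>) = complex_of_real (\<integral>x. x \<partial>spectral_measure E \<psi>))"

text \<open>
  The quadratic form \<open>\<langle>\<psi>, B \<psi>\<rangle>\<close> determines the bounded operator \<open>B\<close> by polarization, and a bounded
  self-adjoint \<open>A\<close> has exactly one spectral resolution \<open>E\<close> up to the (irrelevant) values of \<open>E\<close> on
  sets that are not Borel, so the description below is definite for such \<open>A\<close>.
\<close>

definition borel_calculus :: "(real \<Rightarrow> complex) \<Rightarrow> (ell2 \<Rightarrow> ell2) \<Rightarrow> ell2 \<Rightarrow> ell2"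
  where "borel_calculus g A = (THE B. bounded_operator B \<and>
    (\<exists>E. spectral_resolution A E \<and>
      (\<forall>\<psi>. cinner \<psi> (B \<psi>) = (\<integral>x. g x \<partial>spectral_measure E \<psi>))))"

lift_definition schrodinger :: "circle \<Rightarrow> (circle \<Rightarrow>\<^sub>C real) \<Rightarrow> circle \<Rightarrow> ell2 \<Rightarrow> ell2"
  is "\<lambda>\<alpha> f \<omega> \<psi> n. \<psi> (n + 1) + \<psi> (n - 1) +
        complex_of_real (apply_bcontfun f (\<omega> + circle_scale n \<alpha>)) * \<psi> n"
proof -
  fix \<alpha> \<omega> :: circle and f :: "circle \<Rightarrow>\<^sub>C real" and \<psi> :: "int \<Rightarrow> complex"
  assume \<psi>: "sq_summable \<psi>"
  have "sq_summable (\<lambda>n. complex_of_real (apply_bcontfun f (\<omega> + circle_scale n \<alpha>)) * \<psi> n)"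
    by (rule sq_summable_mult_bounded[OF \<psi>, where K = "norm f"])
       (use norm_bounded[of f] in auto)
  then show "sq_summable (\<lambda>n. \<psi> (n + 1) + \<psi> (n - 1) +
      complex_of_real (apply_bcontfun f (\<omega> + circle_scale n \<alpha>)) * \<psi> n)"
    using sq_summable_shift[OF \<psi>, of 1] sq_summable_shift[OF \<psi>, of "- 1"]
    by (intro sq_summable_add) auto
qed

definition density_of_states :: "circle \<Rightarrow> (circle \<Rightarrow>\<^sub>C real) \<Rightarrow> real measure"
  where "density_of_states \<alpha> f = (THE k. prob_space k \<and> sets k = sets borel \<and>
    (\<forall>g :: real \<Rightarrow> complex. g \<in> borel_measurable borel \<longrightarrow> bounded (range g) \<longrightarrow>
      (\<integral>x. g x \<partial>k) =
      (\<integral>\<omega>. cinner (delta 0) (borel_calculus g (schrodinger \<alpha> f \<omega>) (delta 0)) \<partial>circle_measure)))"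

definition singular :: "real measure \<Rightarrow> bool"
  where "singular k \<longleftrightarrow> (\<exists>N\<in>sets borel. emeasure lborel N = 0 \<and> emeasure k (- N) = 0)"

end

theory Submission
  imports Defs
begin

text \<open>
  A probability measure is singular iff, for every \<open>n\<close>, some open set of Lebesgue measure below
  \<open>1/(n+1)\<close> carries more than \<open>1 - 1/(n+1)\<close> of its mass (\<open>singular_iff_concentrated\<close>).  The set in
  question is therefore a countable intersection of sets of functions \<open>f\<close>, and by Baire's theorem
  it suffices that each of them is open and dense.

  Openness.  The \<open>n\<close>-th moment of the density of states is the average over the circle of the
  diagonal entry of \<open>H\<^sup>n\<close>, a fixed polynomial in finitely many values of the potential
  (\<open>density_of_states\<close>).  Hence moments depend continuously on \<open>f\<close>; as the supports stay bounded,
  so does the measure in the weak sense, and the mass of an open set is lower semicontinuous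
  (\<open>open_concentrated\<close>).  The moment formula needs the spectral theorem for bounded selfadjoint
  operators, because the density of states is described through a Borel functional calculus: the
  spectral measure of a vector solves a moment problem on an interval, polarization and the Riesz
  representation turn these measures into projections, and normal functionals that agree on
  powers or on indicators are equal.

  Density (\<open>concentrated_near\<close>).  For irrational \<open>a\<close> there are arbitrarily short arcs to which the
  rotation by \<open>a\<close> returns after only two possible times \<open>A\<close> and \<open>B\<close>, both as large as desired
  (\<open>return_times\<close>).  The circle splits into the levels of two towers of heights \<open>A\<close> and \<open>B\<close>; a step
  function that is constant on levels can be chosen close to \<open>f\<close>, and along every orbit its values
  form a concatenation of two words of lengths \<open>A\<close> and \<open>B\<close>.  The letters may still be perturbed
  freely by a small amount.  They are perturbed so that outside a set of energies of small measure
  the two transfer matrices have large norm and the direction expanded by one is transversal to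
  the direction contracted by another, for all pairs (\<open>exists_hyperbolic_words\<close>).  At such an energy
  \<open>E\<close> a vector can be controlled from one block to the next, which bounds the inverse of \<open>H - E\<close>
  uniformly over all concatenations of the two words (\<open>hyperbolic_lower_bound\<close>).

  The step function is discontinuous, but it is right-continuous and hence the pointwise limit of
  its averages over short intervals to the right, which are continuous and close to \<open>f\<close>.
  Their moments converge to those of the step function.  The lower bound for \<open>H - E\<close> is a family
  of inequalities between moments, so in the limit no mass is left near \<open>E\<close>
  (\<open>ball_mass_vanishes\<close>).  By compactness the mass of all the hyperbolic energies tends to zero, and
  the densities of states concentrate on the remaining set of small measure.
\<close>

section \<open>The moment problem on the unit interval\<close>

text \<open>
  Sampling \<open>m\<close> elements from \<open>N\<close> without or with replacement makes little difference when \<open>N\<close> is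
  large compared with \<open>m\<close>.  This error term is what makes the discrete approximants in the moment
  problem converge.
\<close>

lemma binomial_ratio_near_power:
  fixes k N m :: nat
  assumes "k \<le> N" "m \<le> N" "0 < N"
  shows "\<bar>real (k choose m) / real (N choose m) - (real k / real N) ^ m\<bar> \<le> (real m)\<^sup>2 / real N"
  using assms(2)
proof (induction m)
  case 0
  then show ?case by simp
next
  case (Suc m)
  define t where "t = real k / real N"
  have t: "0 \<le> t" "t \<le> 1" using assms by (auto simp: t_def)
  define r where "r j = real (k choose j) / real (N choose j)" for j
  have IH: "\<bar>r m - t ^ m\<bar> \<le> (real m)\<^sup>2 / real N"
    using Suc by (simp add: r_def t_def)
  have goal: "\<bar>r (Suc m) - t ^ Suc m\<bar> \<le> (real m)\<^sup>2 / real N + real m / real N"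
  proof (cases "k < m")
    case True
    then have "r (Suc m) = 0" by (simp add: r_def)
    moreover have "t ^ Suc m \<le> t" using t by (simp add: mult_left_le power_le_one)
    moreover have "t \<le> real m / real N" using True assms by (simp add: t_def divide_right_mono)
    moreover have "0 \<le> t ^ Suc m" using t by simp
    moreover have "0 \<le> (real m)\<^sup>2 / real N" by simp
    ultimately show ?thesis by linarith
  next
    case False
    then have km: "m \<le> k" by simp
    have mN: "m < N" using Suc.prems by simp
    have bs: "real (n choose Suc m) * real (Suc m) = real (n choose m) * (real n - real m)"
      if "m \<le> n" for n
    proof -
      have "(n choose Suc m) * Suc m = (n choose m) * (n - m)"
        by (metis binomial_absorb_comp binomial_absorption mult.commute)
      then show ?thesis using that
        by (metis of_nat_diff of_nat_mult)
    qed
    have pos: "real (N choose m) > 0" "real (N choose Suc m) > 0" "real N - real m > 0"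
      using mN Suc.prems by auto
    have rS: "r (Suc m) = r m * ((real k - real m) / (real N - real m))"
    proof -
      have "r (Suc m) = (real (k choose Suc m) * real (Suc m)) / (real (N choose Suc m) * real (Suc m))"
        unfolding r_def by simp
      also have "\<dots> = (real (k choose m) * (real k - real m)) / (real (N choose m) * (real N - real m))"
        using bs[OF km] bs[of N] mN by simp
      finally show ?thesis by (simp add: r_def)
    qed
    have q: "\<bar>(real k - real m) / (real N - real m) - t\<bar> \<le> real m / real N"
    proof -
      have "(real k - real m) / (real N - real m) - t = - (real m * (real N - real k)) / (real N * (real N - real m))"
        using pos assms unfolding t_def by (simp add: field_simps)
      then have "\<bar>(real k - real m) / (real N - real m) - t\<bar> = (real m / real N) * ((real N - real k) / (real N - real m))"
        using pos assms by (simp add: abs_mult)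
      also have "\<dots> \<le> (real m / real N) * 1"
        using km pos assms by (intro mult_left_mono) (auto simp: divide_le_eq)
      finally show ?thesis by simp
    qed
    have r1: "0 \<le> r m" "r m \<le> 1"
      using binomial_right_mono[OF assms(1), of m] pos by (auto simp: r_def divide_le_eq_1)
    have "r (Suc m) - t ^ Suc m = r m * ((real k - real m) / (real N - real m) - t) + t * (r m - t ^ m)"
      by (simp add: rS algebra_simps)
    also have "\<bar>\<dots>\<bar> \<le> r m * \<bar>(real k - real m) / (real N - real m) - t\<bar> + t * \<bar>r m - t ^ m\<bar>"
      using r1 t by (intro order_trans[OF abs_triangle_ineq]) (simp add: abs_mult)
    also have "\<dots> \<le> 1 * (real m / real N) + 1 * ((real m)\<^sup>2 / real N)"
      using r1 t q IH by (intro add_mono mult_mono) auto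
    finally show ?thesis by simp
  qed
  also have "\<dots> \<le> (real (Suc m))\<^sup>2 / real N"
    by (simp add: add_divide_distrib[symmetric] divide_right_mono power2_eq_square algebra_simps)
  finally show ?case by (simp add: r_def t_def)
qed

definition bernstein_poly :: "nat \<Rightarrow> nat \<Rightarrow> real poly"
  where "bernstein_poly N k = smult (real (N choose k)) ([:0, 1:] ^ k * [:1, -1:] ^ (N - k))"

lemma smult_sum_right: "smult (c::real) (\<Sum>i\<in>I. p i) = (\<Sum>i\<in>I. smult c (p i))"
  by (induction I rule: infinite_finite_induct) (simp_all add: smult_add_right)

lemma sum_choose_binomial_expansion:
  fixes y z :: "real poly"
  assumes "m \<le> N" and yz: "y + z = 1"
  shows "(\<Sum>k\<le>N. smult (real (k choose m)) (smult (real (N choose k)) (y ^ k * z ^ (N - k))))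
    = smult (real (N choose m)) (y ^ m)"
proof -
  let ?a = "\<lambda>k. smult (real (k choose m)) (smult (real (N choose k)) (y ^ k * z ^ (N - k)))"
  let ?b = "\<lambda>j. smult (real (N choose m)) (y ^ m * (of_nat (N - m choose j) * y ^ j * z ^ (N - m - j)))"
  have n: "of_nat j * p = smult (real j) p" for j and p :: "real poly"
    by (simp add: of_nat_poly)
  have "(\<Sum>k\<le>N. ?a k) = (\<Sum>k\<in>{m..N}. ?a k)"
    by (rule sum.mono_neutral_right) (auto simp: not_le)
  also have "\<dots> = (\<Sum>j\<le>N - m. ?b j)"
  proof (rule sum.reindex_bij_witness[where i = "\<lambda>j. j + m" and j = "\<lambda>k. k - m"])
    fix k assume k: "k \<in> {m..N}"
    then have "(N choose k) * (k choose m) = (N choose m) * ((N - m) choose (k - m))"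
      by (intro choose_mult) auto
    then have c: "real (k choose m) * real (N choose k) = real (N choose m) * real ((N - m) choose (k - m))"
      by (metis mult.commute of_nat_mult)
    have "y ^ k = y ^ m * y ^ (k - m)" using k by (metis atLeastAtMost_iff le_add_diff_inverse power_add)
    moreover have "N - m - (k - m) = N - k" using k by auto
    ultimately show "?b (k - m) = ?a k"
      unfolding smult_smult c n mult_smult_left mult_smult_right by (simp only: mult.assoc)
  qed (use assms(1) in auto)
  also have "\<dots> = smult (real (N choose m)) (y ^ m * (\<Sum>j\<le>N - m. of_nat (N - m choose j) * y ^ j * z ^ (N - m - j)))"
    unfolding sum_distrib_left by (rule smult_sum_right[symmetric])
  also have "\<dots> = smult (real (N choose m)) (y ^ m * (y + z) ^ (N - m))"
    by (simp only: binomial_ring)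
  finally show ?thesis by (simp add: yz)
qed

lemma sum_choose_bernstein_poly:
  assumes "m \<le> N"
  shows "(\<Sum>k\<le>N. smult (real (k choose m)) (bernstein_poly N k)) = smult (real (N choose m)) (monom 1 m)"
  unfolding bernstein_poly_def monom_altdef
  by (subst sum_choose_binomial_expansion) (simp_all add: assms one_pCons)

text \<open>
  Hausdorff's construction.  The weights \<open>L (bernstein_poly N k)\<close> are nonnegative; placed at the
  points \<open>k/N\<close> they form measures on \<open>[0, 1]\<close>, whose moments tend to those prescribed by
  \<open>L\<close> because the factorial moments are exact.  A weak limit point is the required measure.
\<close>

theorem hausdorff_moment_unit_interval:
  fixes L :: "real poly \<Rightarrow> real"
  assumes add: "\<And>p q. L (p + q) = L p + L q"
    and smult: "\<And>c p. L (smult c p) = c * L p"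
    and pos: "\<And>k l. 0 \<le> L ([:0, 1:] ^ k * [:1, -1:] ^ l)"
  obtains M :: "real measure" where "finite_measure M" "sets M = sets borel" "emeasure M (- {0..1}) = 0"
    "\<And>m. (\<integral>x. x ^ m \<partial>M) = L (monom 1 m)"
proof -
  have Lsum: "L (\<Sum>i\<in>A. f i) = (\<Sum>i\<in>A. L (f i))" for A :: "nat set" and f
    by (induction A rule: infinite_finite_induct) (use add smult[of 0 0] in auto)
  define w where "w N k = L (bernstein_poly N k)" for N k
  have w0: "w N k \<ge> 0" for N k by (simp add: w_def bernstein_poly_def smult pos)
  have wsum: "(\<Sum>k\<le>N. real (k choose m) * w N k) = real (N choose m) * L (monom 1 m)" if "m \<le> N" for m N
    using arg_cong[OF sum_choose_bernstein_poly[OF that], of L] by (simp add: Lsum smult w_def)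
  have wtot: "(\<Sum>k\<le>N. w N k) = L 1" for N
    using wsum[of 0 N] by simp
  show thesis
  proof (cases "L 1 = 0")
    case True
    have "L (monom 1 m) = 0" for m
    proof -
      have z: "\<forall>k\<in>{..m}. w m k = 0"
        using wtot[of m] True w0 by (subst sum_nonneg_eq_0_iff[symmetric]) auto
      then have "(\<Sum>k\<le>m. real (k choose m) * w m k) = 0" by simp
      then show ?thesis using wsum[of m m] by simp
    qed
    then show thesis
      by (intro that[of "null_measure borel"]) (auto intro!: finite_measureI)
  next
    case False
    then have L1: "L 1 > 0" using pos[of 0 0] by simp
    define P where "P N = point_measure {..N} (\<lambda>k. ennreal (w N k / L 1))" for N
    define \<mu> where "\<mu> n = distr (P (Suc n)) borel (\<lambda>k. real k / real (Suc n))" for n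
    have prP: "prob_space (P N)" for N
    proof
      have "emeasure (P N) {..N} = (\<Sum>k\<le>N. ennreal (w N k / L 1))"
        unfolding P_def by (subst emeasure_point_measure_finite) auto
      also have "\<dots> = ennreal (\<Sum>k\<le>N. w N k / L 1)"
        by (rule sum_ennreal) (use w0 L1 in auto)
      also have "(\<Sum>k\<le>N. w N k / L 1) = 1"
        using wtot[of N] L1 by (simp add: sum_divide_distrib[symmetric])
      finally show "emeasure (P N) (space (P N)) = 1"
        by (simp add: P_def space_point_measure)
    qed
    have meas[measurable]: "h \<in> P N \<rightarrow>\<^sub>M borel" for h :: "nat \<Rightarrow> real" and N
      by (simp add: P_def measurable_point_measure_eq1)
    have rd: "real_distribution (\<mu> n)" for n
      unfolding \<mu>_def real_distribution_def real_distribution_axioms_def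
      by (auto intro!: prob_space.prob_space_distr[OF prP] meas)
    have int\<mu>: "(\<integral>x. h x \<partial>\<mu> n) = (\<Sum>k\<le>Suc n. w (Suc n) k / L 1 * h (real k / real (Suc n)))"
      if "h \<in> borel_measurable borel" for h :: "real \<Rightarrow> real" and n
    proof -
      have "(\<integral>x. h x \<partial>\<mu> n) = (\<integral>k. h (real k / real (Suc n)) \<partial>P (Suc n))"
        unfolding \<mu>_def by (rule integral_distr[OF meas that])
      also have "\<dots> = (\<Sum>k\<le>Suc n. w (Suc n) k / L 1 * h (real k / real (Suc n)))"
        unfolding P_def by (subst lebesgue_integral_point_measure_finite) (use w0 L1 in auto)
      finally show ?thesis .
    qed
    have "tight \<mu>"
      unfolding tight_def
    proof (intro conjI allI impI rd)
      fix e :: real assume e: "e > 0"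
      have "measure (\<mu> n) {-1<..1} = 1" for n
      proof -
        interpret p: prob_space "P (Suc n)" by (rule prP)
        have "measure (\<mu> n) {-1<..1} = measure (P (Suc n)) ((\<lambda>k. real k / real (Suc n)) -` {-1<..1} \<inter> space (P (Suc n)))"
          unfolding \<mu>_def by (rule measure_distr) auto
        also have "(\<lambda>k. real k / real (Suc n)) -` {-1<..1} \<inter> space (P (Suc n)) = space (P (Suc n))"
          by (auto simp: P_def space_point_measure field_simps intro: less_le_trans[of _ 0])
        finally show ?thesis by (simp add: p.prob_space)
      qed
      then show "\<exists>a b. a < b \<and> (\<forall>n. 1 - e < measure (\<mu> n) {a<..b})"
        using e by (intro exI[of _ "-1"] exI[of _ 1]) auto
    qed
    then obtain r M where r: "strict_mono r" and M: "real_distribution M" and wc: "weak_conv_m (\<mu> \<circ> id \<circ> r) M"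
      using tight_imp_convergent_subsubsequence[of \<mu> id] strict_mono_id by (auto simp: id_def strict_mono_def)
    interpret M: real_distribution M by (rule M)
    have lim: "(\<lambda>n. \<integral>x. h x \<partial>\<mu> (r n)) \<longlonglongrightarrow> (\<integral>x. h x \<partial>M)"
      if "\<And>x. isCont h x" "\<And>x. norm (h x) \<le> B" for h :: "real \<Rightarrow> real" and B
      using weak_conv_imp_integral_bdd_continuous_conv[of "\<mu> \<circ> id \<circ> r" M h B] rd M wc that by simp
    (* A continuous function that vanishes exactly on the unit interval: it shows that the limit measure
       has no mass outside, although weak convergence sees only continuous functions. *)
    define d where "d = (\<lambda>x::real. min 1 (max 0 (max (- x) (x - 1))))"
    have "(\<lambda>n. \<integral>x. d x \<partial>\<mu> (r n)) \<longlonglongrightarrow> (\<integral>x. d x \<partial>M)"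
    proof (rule lim[of d 1])
      show "isCont d x" for x
        unfolding d_def by (intro continuous_intros)
      show "norm (d x) \<le> 1" for x
        by (simp add: d_def)
    qed
    moreover have "(\<integral>x. d x \<partial>\<mu> n) = 0" for n
    proof -
      have "d (real k / real (Suc n)) = 0" if "k \<le> Suc n" for k
      proof -
        have "0 \<le> real k / real (Suc n)" "real k / real (Suc n) \<le> 1" using that by auto
        then show ?thesis unfolding d_def by linarith
      qed
      then show ?thesis by (subst int\<mu>) (auto simp: d_def)
    qed
    ultimately have d0: "(\<integral>x. d x \<partial>M) = 0"
      by (simp add: LIMSEQ_const_iff)
    have "integrable M d"
      by (rule M.integrable_const_bound[where B = 1]) (auto simp: d_def)
    then have "AE x in M. d x = 0"
      using d0 integral_nonneg_eq_0_iff_AE[of M d] by (simp add: d_def)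
    then have ae: "AE x in M. x \<in> {0..1}"
    proof eventually_elim
      case (elim x)
      then show ?case by (auto simp: d_def min_def max_def split: if_splits)
    qed
    then have out: "emeasure M (- {0..1}) = 0"
    proof -
      have "{x \<in> space M. x \<notin> {0..1}} = - {0..1::real}" by auto
      from AE_iff_measurable[OF _ this] ae show ?thesis by simp
    qed
    (* Powers are unbounded; composed with the retraction onto the unit interval they become bounded
       continuous test functions. *)
    define c where "c x = max 0 (min 1 x)" for x :: real
    have mom: "(\<integral>x. x ^ m \<partial>M) = L (monom 1 m) / L 1" for m
    proof -
      have "(\<lambda>n. \<integral>x. c x ^ m \<partial>\<mu> (r n)) \<longlonglongrightarrow> (\<integral>x. c x ^ m \<partial>M)"
      proof (rule lim[of _ 1])
        show "isCont (\<lambda>x. c x ^ m) x" for x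
          unfolding c_def by (intro continuous_intros)
        show "norm (c x ^ m) \<le> 1" for x
          unfolding norm_power by (rule power_le_one) (auto simp: c_def)
      qed
      moreover have "(\<lambda>n. \<integral>x. c x ^ m \<partial>\<mu> n) \<longlonglongrightarrow> L (monom 1 m) / L 1"
      proof (rule LIMSEQ_I)
        fix e :: real assume e: "e > 0"
        obtain n0 where n0: "(real m)\<^sup>2 / e < real n0" using reals_Archimedean2 by blast
        show "\<exists>n0. \<forall>n\<ge>n0. norm ((\<integral>x. c x ^ m \<partial>\<mu> n) - L (monom 1 m) / L 1) < e"
        proof (intro exI[of _ "n0 + m"] allI impI)
          fix n assume n: "n \<ge> n0 + m"
          let ?N = "Suc n"
          have mN: "m \<le> ?N" using n by simp
          have ck: "c (real k / real ?N) = real k / real ?N" if "k \<le> ?N" for k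
          proof -
            have "0 \<le> real k / real ?N" "real k / real ?N \<le> 1" using that by auto
            then show ?thesis unfolding c_def by linarith
          qed
          have cN: "real (?N choose m) > 0" using mN by simp
          have i: "(\<integral>x. c x ^ m \<partial>\<mu> n) = (\<Sum>k\<le>?N. w ?N k / L 1 * (real k / real ?N) ^ m)"
          proof -
            have "(\<lambda>x. c x ^ m) \<in> borel_measurable borel"
              unfolding c_def by measurable
            show ?thesis
              unfolding int\<mu>[OF \<open>(\<lambda>x. c x ^ m) \<in> borel_measurable borel\<close>] by (intro sum.cong refl) (simp only: ck atMost_iff)
          qed
          have l: "L (monom 1 m) / L 1 = (\<Sum>k\<le>?N. w ?N k / L 1 * (real (k choose m) / real (?N choose m)))"
          proof -
            have "L (monom 1 m) = (\<Sum>k\<le>?N. real (k choose m) * w ?N k) / real (?N choose m)"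
              using wsum[OF mN] cN by simp
            then show ?thesis by (simp add: sum_divide_distrib mult.commute del: sum.atMost_Suc)
          qed
          have "(\<integral>x. c x ^ m \<partial>\<mu> n) - L (monom 1 m) / L 1 =
              (\<Sum>k\<le>?N. w ?N k / L 1 * ((real k / real ?N) ^ m - real (k choose m) / real (?N choose m)))"
            unfolding i l by (simp add: sum_subtractf[symmetric] right_diff_distrib)
          also have "norm \<dots> \<le> (\<Sum>k\<le>?N. w ?N k / L 1 * ((real m)\<^sup>2 / real ?N))"
          proof (rule sum_norm_le)
            fix k assume "k \<in> {..?N}"
            then have "\<bar>(real k / real ?N) ^ m - real (k choose m) / real (?N choose m)\<bar> \<le> (real m)\<^sup>2 / real ?N"
              using binomial_ratio_near_power[of k ?N m] mN by (simp add: abs_minus_commute)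
            then show "norm (w ?N k / L 1 * ((real k / real ?N) ^ m - real (k choose m) / real (?N choose m)))
              \<le> w ?N k / L 1 * ((real m)\<^sup>2 / real ?N)"
              unfolding real_norm_def abs_mult using w0 L1 by (intro mult_mono) auto
          qed
          also have "\<dots> = (real m)\<^sup>2 / real ?N"
            using wtot[of ?N] L1 by (simp add: sum_distrib_right[symmetric] sum_divide_distrib[symmetric] del: sum.atMost_Suc)
          also have "\<dots> < e"
          proof -
            have "real n0 < real ?N" using n by simp
            then have "(real m)\<^sup>2 / e < real ?N" using n0 by linarith
            then show ?thesis using e by (simp add: field_simps)
          qed
          finally show "norm ((\<integral>x. c x ^ m \<partial>\<mu> n) - L (monom 1 m) / L 1) < e" .
        qed
      qed
      then have "(\<lambda>n. \<integral>x. c x ^ m \<partial>\<mu> (r n)) \<longlonglongrightarrow> L (monom 1 m) / L 1"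
        using r by (rule LIMSEQ_subseq_LIMSEQ[unfolded comp_def])
      ultimately have "(\<integral>x. c x ^ m \<partial>M) = L (monom 1 m) / L 1"
        by (rule LIMSEQ_unique)
      moreover have "(\<integral>x. c x ^ m \<partial>M) = (\<integral>x. x ^ m \<partial>M)"
      proof (rule integral_cong_AE)
        show "AE x in M. c x ^ m = x ^ m"
          using ae by eventually_elim (auto simp: c_def)
      qed (auto simp: c_def)
      ultimately show ?thesis by simp
    qed
    show thesis
    proof (rule that[of "density M (\<lambda>_. ennreal (L 1))"])
      show "finite_measure (density M (\<lambda>_. ennreal (L 1)))"
        by (rule finite_measureI) (simp add: emeasure_density_const ennreal_mult_eq_top_iff M.emeasure_eq_measure)
      show "(\<integral>x. x ^ m \<partial>density M (\<lambda>_. ennreal (L 1))) = L (monom 1 m)" for m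
        using L1 mom[of m] by (subst integral_density) auto
    qed (use out in \<open>auto simp: emeasure_density_const\<close>)
  qed
qed

section \<open>Induction over bounded Borel functions\<close>

text \<open>
  The functions are controlled on \<open>[-R, R]\<close> only, as all measures below live there.  Values outside
  the interval are changed by the limit rule itself, applied to a constant sequence.
\<close>

lemma bounded_borel_induct_set [consumes 2, case_names set lin lim]:
  fixes P :: "(real \<Rightarrow> complex) \<Rightarrow> bool" and g :: "real \<Rightarrow> complex"
  assumes g: "g \<in> borel_measurable borel" and bdd: "\<And>x. \<bar>x\<bar> \<le> R \<Longrightarrow> cmod (g x) \<le> C"
    and ind: "\<And>A. A \<in> sets borel \<Longrightarrow> P (indicator A)"
    and lin: "\<And>c g h. P g \<Longrightarrow> P h \<Longrightarrow> P (\<lambda>x. c * g x + h x)"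
    and lim: "\<And>F h B. (\<And>n. P (F n)) \<Longrightarrow> (\<And>n. F n \<in> borel_measurable borel) \<Longrightarrow> h \<in> borel_measurable borel \<Longrightarrow>
       (\<And>n x. \<bar>x\<bar> \<le> R \<Longrightarrow> cmod (F n x) \<le> B) \<Longrightarrow> (\<And>x. \<bar>x\<bar> \<le> R \<Longrightarrow> (\<lambda>n. F n x) \<longlonglongrightarrow> h x) \<Longrightarrow> P h"
  shows "P g"
proof -
  have P1: "P (\<lambda>x. 1)" using ind[of UNIV] by simp
  have Pc: "P (\<lambda>x. c)" for c
    using lin[OF P1 P1, of "c - 1"] by (simp add: algebra_simps)
  have Psc: "P (\<lambda>x. c * h x)" if "P h" for c h
    using lin[OF that Pc[of 0], of c] by simp
  have Padd: "P (\<lambda>x. h x + h' x)" if "P h" "P h'" for h h'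
    using lin[OF that, of 1] by simp
  have Psum: "P (\<lambda>x. \<Sum>i\<in>I. h i x)" if "finite I" "\<And>i. i \<in> I \<Longrightarrow> P (h i)" for I :: "nat set" and h
    using that by (induction I) (auto intro!: Pc Padd)
  have realfun: "P (\<lambda>x. of_real (h x))" if h: "h \<in> borel_measurable borel" "\<And>x. 0 \<le> h x" "\<And>x. h x \<le> B" for h :: "real \<Rightarrow> real" and B
  proof -
    define S where "S n x = real_of_int \<lfloor>h x * real (Suc n)\<rfloor> / real (Suc n)" for n x
    have S1: "S n x \<le> h x" "h x - S n x \<le> 1 / real (Suc n)" for n x
    proof -
      show "S n x \<le> h x" unfolding S_def by (simp add: divide_le_eq del: of_nat_Suc)
      have "h x * real (Suc n) - real_of_int \<lfloor>h x * real (Suc n)\<rfloor> \<le> 1" by linarith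
      then have "(h x * real (Suc n) - real_of_int \<lfloor>h x * real (Suc n)\<rfloor>) / real (Suc n) \<le> 1 / real (Suc n)"
        by (rule divide_right_mono) simp
      then show "h x - S n x \<le> 1 / real (Suc n)" unfolding S_def
        by (simp add: diff_divide_distrib del: of_nat_Suc)
    qed
    have S0: "0 \<le> S n x" for n x unfolding S_def using h(2)[of x] by simp
    have Smeas: "S n \<in> borel_measurable borel" for n unfolding S_def using h(1) by measurable
    show ?thesis
    proof (rule lim[of "\<lambda>n x. of_real (S n x)" _ B])
      fix n
      define K where "K = nat \<lfloor>B * real (Suc n)\<rfloor>"
      have eq: "complex_of_real (S n x) = (\<Sum>k\<le>K. of_real (real k / real (Suc n)) * indicator {y. \<lfloor>h y * real (Suc n)\<rfloor> = int k} x)" for x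
      proof -
        have nn: "0 \<le> \<lfloor>h x * real (Suc n)\<rfloor>" using h(2)[of x] by (simp only: zero_le_floor) simp
        have le: "\<lfloor>h x * real (Suc n)\<rfloor> \<le> \<lfloor>B * real (Suc n)\<rfloor>"
          by (intro floor_mono mult_right_mono h) auto
        define j where "j = nat \<lfloor>h x * real (Suc n)\<rfloor>"
        have j: "\<lfloor>h x * real (Suc n)\<rfloor> = int j" "j \<le> K"
          using nn le by (auto simp: j_def K_def nat_mono)
        have "(\<Sum>k\<le>K. of_real (real k / real (Suc n)) * indicator {y. \<lfloor>h y * real (Suc n)\<rfloor> = int k} x)
          = (\<Sum>k\<le>K. if k = j then complex_of_real (real k / real (Suc n)) else 0)"
          by (intro sum.cong) (auto simp: j(1) indicator_def simp del: of_nat_Suc)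
        also have "\<dots> = of_real (real j / real (Suc n))" using j(2) by simp
        finally show ?thesis by (simp add: S_def j(1) del: of_nat_Suc)
      qed
      show "P (\<lambda>x. of_real (S n x))"
        unfolding eq using h(1)
        by (intro Psum Psc ind) (auto simp del: of_nat_Suc)
      show "(\<lambda>x. complex_of_real (S n x)) \<in> borel_measurable borel" using Smeas by simp
      show "cmod (of_real (S n x)) \<le> B" for x
        using S0[of n x] S1(1)[of n x] h(3)[of x] by simp
    next
      show "(\<lambda>x. complex_of_real (h x)) \<in> borel_measurable borel" using h(1) by simp
      fix x
      have "(\<lambda>n. S n x) \<longlonglongrightarrow> h x"
      proof (rule LIMSEQ_I)
        fix e :: real assume "e > 0"
        then obtain n0 where n0: "1 / real (Suc n0) < e" using nat_approx_posE by metis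
        show "\<exists>n0. \<forall>n\<ge>n0. norm (S n x - h x) < e"
        proof (intro exI allI impI)
          fix n assume "n \<ge> n0"
          then have "1 / real (Suc n) \<le> 1 / real (Suc n0)" by (simp add: field_simps)
          then show "norm (S n x - h x) < e" using S1[where n=n and x=x] n0 by simp
        qed
      qed
      then show "(\<lambda>n. complex_of_real (S n x)) \<longlonglongrightarrow> of_real (h x)" by (rule tendsto_of_real)
    qed
  qed
  have realfun': "P (\<lambda>x. of_real (h x))" if h: "h \<in> borel_measurable borel" "\<And>x. \<bar>h x\<bar> \<le> B" for h :: "real \<Rightarrow> real" and B
  proof -
    have "P (\<lambda>x. of_real (h x + B))"
      by (rule realfun[of _ "2 * B"]) (use h in \<open>auto simp: abs_le_iff\<close>, (smt (verit) h(2))+)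
    from lin[OF this Pc[of "- of_real B"], of 1] show ?thesis by simp
  qed
  define G where "G x = (if \<bar>x\<bar> \<le> R then g x else 0)" for x
  have Gm: "G \<in> borel_measurable borel" unfolding G_def using g by measurable
  have Gb: "cmod (G x) \<le> \<bar>C\<bar>" for x unfolding G_def using bdd[of x] by auto
  have "P (\<lambda>x. \<i> * of_real (Im (G x)) + of_real (Re (G x)))"
    by (intro lin realfun'[of _ "\<bar>C\<bar>"])
      (use Gm order_trans[OF abs_Im_le_cmod Gb] order_trans[OF abs_Re_le_cmod Gb] in auto)
  moreover have "(\<lambda>x. \<i> * of_real (Im (G x)) + of_real (Re (G x))) = G"
    by (auto simp: complex_eq_iff)
  ultimately have PG: "P G" by simp
  show "P g"
    by (rule lim[of "\<lambda>n. G" g C]) (use PG Gm g bdd in \<open>auto simp: G_def\<close>)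
qed

text \<open>
  Powers suffice as a starting point: they give continuous functions by Weierstrass, then
  indicators of half-lines by pointwise limits, and then all Borel indicators by Dynkin's lemma.
\<close>

lemma bounded_borel_induct [consumes 2, case_names power lin lim]:
  fixes P :: "(real \<Rightarrow> complex) \<Rightarrow> bool" and g :: "real \<Rightarrow> complex"
  assumes g: "g \<in> borel_measurable borel" and bdd: "\<And>x. \<bar>x\<bar> \<le> R \<Longrightarrow> cmod (g x) \<le> C"
    and power: "\<And>n. P (\<lambda>x. of_real (x ^ n))"
    and lin: "\<And>c g h. P g \<Longrightarrow> P h \<Longrightarrow> P (\<lambda>x. c * g x + h x)"
    and lim: "\<And>F h B. (\<And>n. P (F n)) \<Longrightarrow> (\<And>n. F n \<in> borel_measurable borel) \<Longrightarrow> h \<in> borel_measurable borel \<Longrightarrow>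
       (\<And>n x. \<bar>x\<bar> \<le> R \<Longrightarrow> cmod (F n x) \<le> B) \<Longrightarrow> (\<And>x. \<bar>x\<bar> \<le> R \<Longrightarrow> (\<lambda>n. F n x) \<longlonglongrightarrow> h x) \<Longrightarrow> P h"
  shows "P g"
proof -
  have P1: "P (\<lambda>x. 1)" using power[of 0] by simp
  have Pc: "P (\<lambda>x. c)" for c
    using lin[OF P1 P1, of "c - 1"] by (simp add: algebra_simps)
  have Psc: "P (\<lambda>x. c * h x)" if "P h" for c h
    using lin[OF that Pc[of 0], of c] by simp
  have Padd: "P (\<lambda>x. h x + h' x)" if "P h" "P h'" for h h'
    using lin[OF that, of 1] by simp
  have Psum: "P (\<lambda>x. \<Sum>i\<in>I. h i x)" if "finite I" "\<And>i. i \<in> I \<Longrightarrow> P (h i)" for I :: "nat set" and h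
    using that by (induction I) (auto intro!: Pc Padd)
  have cont: "P (\<lambda>x. of_real (h x))" if h: "continuous_on UNIV h" for h :: "real \<Rightarrow> real"
  proof -
    have "\<exists>p. real_polynomial_function p \<and> (\<forall>x\<in>{-R..R}. \<bar>h x - p x\<bar> < 1 / real (Suc n))" for n
    proof -
      have "0 < 1 / real (Suc n)" by simp
      from Stone_Weierstrass_real_polynomial_function[OF compact_Icc continuous_on_subset[OF h subset_UNIV] this]
      show ?thesis by metis
    qed
    then obtain p where p: "\<And>n. real_polynomial_function (p n)"
        "\<And>n x. x \<in> {-R..R} \<Longrightarrow> \<bar>h x - p n x\<bar> < 1 / real (Suc n)"
      by metis
    have "compact (h ` {-R..R})"
      by (intro compact_continuous_image continuous_on_subset[OF h]) auto
    then obtain B where B: "\<And>x. x \<in> {-R..R} \<Longrightarrow> \<bar>h x\<bar> \<le> B"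
      using compact_imp_bounded[of "h ` {-R..R}"] unfolding bounded_iff by force
    show ?thesis
    proof (rule lim[of "\<lambda>n x. of_real (p n x)" _ "B + 1"])
      fix n
      obtain a N where "p n = (\<lambda>x. \<Sum>i\<le>N. a i * x ^ i)"
        using p(1)[of n] real_polynomial_function_iff_sum by auto
      then show "P (\<lambda>x. of_real (p n x))"
        by (simp del: of_real_power) (intro Psum Psc power, auto)
      have "continuous_on UNIV (p n)"
        using p(1)[of n] continuous_real_polymonial_function by (auto simp: continuous_on_eq_continuous_within intro: continuous_at_imp_continuous_within)
      then show "(\<lambda>x. complex_of_real (p n x)) \<in> borel_measurable borel"
        by (intro borel_measurable_of_real borel_measurable_continuous_onI) auto
      fix x :: real assume x: "\<bar>x\<bar> \<le> R"
      have "1 / real (Suc n) \<le> 1" by simp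
      then show "cmod (of_real (p n x)) \<le> B + 1"
        using p(2)[of x n] B[of x] x by (simp only: norm_of_real atLeastAtMost_iff) linarith
    next
      show "(\<lambda>x. complex_of_real (h x)) \<in> borel_measurable borel"
        using h by (intro borel_measurable_of_real borel_measurable_continuous_onI) auto
      fix x :: real assume x: "\<bar>x\<bar> \<le> R"
      have "(\<lambda>n. p n x) \<longlonglongrightarrow> h x"
      proof (rule LIMSEQ_I)
        fix e :: real assume "e > 0"
        then obtain n0 where n0: "1 / real (Suc n0) < e" using nat_approx_posE by metis
        show "\<exists>n0. \<forall>n\<ge>n0. norm (p n x - h x) < e"
        proof (intro exI allI impI)
          fix n assume "n \<ge> n0"
          then have "1 / real (Suc n) \<le> 1 / real (Suc n0)" by (simp add: field_simps)
          moreover have "x \<in> {-R..R}" using x by auto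
          ultimately show "norm (p n x - h x) < e" using p(2)[of x n] n0 by (simp add: abs_minus_commute)
        qed
      qed
      then show "(\<lambda>n. complex_of_real (p n x)) \<longlonglongrightarrow> of_real (h x)" by (rule tendsto_of_real)
    qed
  qed
  have half: "P (indicator {a<..})" for a :: real
  proof (rule lim[of "\<lambda>n x. of_real (min 1 (max 0 (real n * (x - a))))" _ 1])
    show "P (\<lambda>x. of_real (min 1 (max 0 (real n * (x - a)))))" for n
      by (rule cont) (intro continuous_intros)
    fix x :: real
    show "(\<lambda>n. complex_of_real (min 1 (max 0 (real n * (x - a))))) \<longlonglongrightarrow> indicator {a<..} x"
    proof (cases "x > a")
      case True
      obtain n0 where n0: "1 / (x - a) < real n0" using reals_Archimedean2 by blast
      have "\<forall>\<^sub>F n in sequentially. complex_of_real (min 1 (max 0 (real n * (x - a)))) = 1"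
        using eventually_ge_at_top[of n0]
      proof eventually_elim
        case (elim n)
        have "1 < real n0 * (x - a)" using n0 True by (simp add: field_simps)
        also have "\<dots> \<le> real n * (x - a)" using elim True by (intro mult_right_mono) auto
        finally show ?case by simp
      qed
      then show ?thesis using True by (simp add: tendsto_eventually)
    next
      case False
      then have "max 0 (real n * (x - a)) = 0" for n
        by (intro max_absorb1) (simp add: mult_nonneg_nonpos)
      then show ?thesis using False by simp
    qed
  qed (auto simp: indicator_def)
  have ind: "P (indicator A)" if "A \<in> sets borel" for A :: "real set"
  proof -
    have sg: "A \<in> sigma_sets UNIV (range greaterThan)"
      using that by (simp add: borel_Ioi sets_measure_of_conv)
    have stable: "Int_stable (range (greaterThan :: real \<Rightarrow> real set))"
    proof (rule Int_stableI)
      fix A B :: "real set" assume "A \<in> range greaterThan" "B \<in> range greaterThan"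
      then obtain a b where "A = {a<..}" "B = {b<..}" by auto
      then have "A \<inter> B = {max a b<..}" by auto
      then show "A \<inter> B \<in> range greaterThan" by simp
    qed
    have pw: "range (greaterThan :: real \<Rightarrow> real set) \<subseteq> Pow UNIV" by simp
    show ?thesis
      using stable pw sg
    proof (induction rule: sigma_sets_induct_disjoint)
      case (basic A)
      then show ?case using half by auto
    next
      case empty
      have "(indicator {} :: real \<Rightarrow> complex) = (\<lambda>x. 0)" by auto
      then show ?case using Pc[of 0] by simp
    next
      case (compl A)
      have "(indicator (UNIV - A) :: real \<Rightarrow> complex) = (\<lambda>x. (-1) * indicator A x + 1)"
        by (auto simp: fun_eq_iff indicator_def)
      then show ?case using lin[OF compl.IH P1, of "-1"] by simp
    next
      case (union A)
      have A: "A i \<in> sets borel" for i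
        using union.hyps(2) by (auto simp: borel_Ioi sets_measure_of_conv)
      show ?case
      proof (rule lim[of "\<lambda>n x. \<Sum>i<n. indicator (A i) x" _ 1])
        show "P (\<lambda>x. \<Sum>i<n. indicator (A i) x)" for n
          by (intro Psum union.IH) auto
        have *: "(\<Sum>i<n. indicator (A i) x) = (indicator (\<Union>i<n. A i) x :: complex)" for n x
        proof -
          have "disjoint_family_on A {..<n}" using union.hyps(1) by (auto simp: disjoint_family_on_def)
          then show ?thesis by (subst indicator_UN_disjoint) auto
        qed
        show "cmod (\<Sum>i<n. indicator (A i) x) \<le> 1" for n x
          unfolding * by (simp add: indicator_def)
        fix x :: real
        show "(\<lambda>n. \<Sum>i<n. indicator (A i) x) \<longlonglongrightarrow> (indicator (\<Union> (range A)) x :: complex)"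
          unfolding * by (rule LIMSEQ_indicator_UN)
      qed (use A in auto)
    qed
  qed
  show "P g"
    by (rule bounded_borel_induct_set[OF g bdd ind lin lim])
qed

section \<open>Moment measures of a bounded selfadjoint operator\<close>

lemma hausdorff_integral_poly:
  fixes L :: "real poly \<Rightarrow> real"
  assumes add: "\<And>p q. L (p + q) = L p + L q" and smult: "\<And>c p. L (smult c p) = c * L p"
    and M: "finite_measure M" "sets M = sets borel" "emeasure M (- {0..1}) = 0" "\<And>m. (\<integral>x. x ^ m \<partial>M) = L (monom 1 m)"
  shows "(\<integral>x. poly p x \<partial>M) = L p"
proof -
  interpret finite_measure M by fact
  have Lsum: "L (\<Sum>i\<in>A. f i) = (\<Sum>i\<in>A. L (f i))" for A :: "nat set" and f
    by (induction A rule: infinite_finite_induct) (use add smult[of 0 0] in auto)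
  have ae: "AE x in M. x \<in> {0..1}"
    using M(2,3) by (intro AE_I[of _ _ "- {0..1}"]) auto
  have int: "integrable M (\<lambda>x. x ^ m)" for m
  proof (rule integrable_const_bound[of _ 1])
    show "AE x in M. norm (x ^ m) \<le> 1" using ae by eventually_elim (auto simp: power_le_one)
  qed (use M(2) in \<open>simp add: measurable_cong_sets[OF M(2) refl]\<close>)
  have "(\<integral>x. poly p x \<partial>M) = (\<Sum>i\<le>degree p. coeff p i * (\<integral>x. x ^ i \<partial>M))"
    unfolding poly_altdef using int by (subst Bochner_Integration.integral_sum) auto
  also have "\<dots> = L (\<Sum>i\<le>degree p. monom (coeff p i) i)"
    by (simp add: M(4) Lsum smult[symmetric] smult_monom)
  finally show ?thesis by (simp add: poly_as_sum_of_monoms)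
qed

lemma ell2_eqI: "(\<And>n. ell2_nth \<phi> n = ell2_nth \<psi> n) \<Longrightarrow> \<phi> = \<psi>"
  by (metis ell2_nth_inject ext)

lemma cinner_commute: "cinner \<phi> \<psi> = cnj (cinner \<psi> \<phi>)"
  by transfer (simp flip: infsum_cnj add: mult.commute)

lemma cinner_add_left: "cinner (\<phi> + \<psi>) \<xi> = cinner \<phi> \<xi> + cinner \<psi> \<xi>"
  by transfer (simp add: distrib_right infsum_add summable_cnj_mult)

lemma cinner_add_right: "cinner \<xi> (\<phi> + \<psi>) = cinner \<xi> \<phi> + cinner \<xi> \<psi>"
  by (metis cinner_add_left cinner_commute complex_cnj_add)

lemma cinner_scaleC_right: "cinner \<phi> (scaleC c \<psi>) = c * cinner \<phi> \<psi>"
proof transfer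
  fix \<phi> \<psi> :: "int \<Rightarrow> complex" and c
  have "(\<lambda>n. cnj (\<phi> n) * (c * \<psi> n)) = (\<lambda>n. c * (cnj (\<phi> n) * \<psi> n))" by (auto simp: mult_ac)
  moreover assume "sq_summable \<phi>" "sq_summable \<psi>"
  ultimately show "(\<Sum>\<^sub>\<infinity>n. cnj (\<phi> n) * (c * \<psi> n)) = c * (\<Sum>\<^sub>\<infinity>n. cnj (\<phi> n) * \<psi> n)"
    by (simp add: infsum_cmult_right summable_cnj_mult)
qed

lemma cinner_scaleC_left: "cinner (scaleC c \<phi>) \<psi> = cnj c * cinner \<phi> \<psi>"
  by (metis cinner_scaleC_right cinner_commute complex_cnj_mult)

lemma scaleR_eq_scaleC: "r *\<^sub>R \<psi> = scaleC (complex_of_real r) \<psi>"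
  by transfer simp

lemma minus_eq_scaleC: "\<phi> - \<psi> = \<phi> + scaleC (-1) \<psi>"
  by transfer simp

lemma cinner_minus_left: "cinner (\<phi> - \<psi>) \<xi> = cinner \<phi> \<xi> - cinner \<psi> \<xi>"
  by (simp add: minus_eq_scaleC cinner_add_left cinner_scaleC_left)

lemma cinner_minus_right: "cinner \<xi> (\<phi> - \<psi>) = cinner \<xi> \<phi> - cinner \<xi> \<psi>"
  by (simp add: minus_eq_scaleC cinner_add_right cinner_scaleC_right)

lemma cinner_scaleR_right: "cinner \<phi> (r *\<^sub>R \<psi>) = of_real r * cinner \<phi> \<psi>"
  by (simp add: scaleR_eq_scaleC cinner_scaleC_right)

lemma cinner_scaleR_left: "cinner (r *\<^sub>R \<phi>) \<psi> = of_real r * cinner \<phi> \<psi>"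
  by (simp add: scaleR_eq_scaleC cinner_scaleC_left)

lemma cinner_zero_left [simp]: "cinner 0 \<psi> = 0"
  using cinner_minus_left[of 0 0 \<psi>] by simp

lemma cinner_zero_right [simp]: "cinner \<psi> 0 = 0"
  using cinner_minus_right[of \<psi> 0 0] by simp

lemma cinner_sum_left: "cinner (\<Sum>i\<in>I. f i) \<psi> = (\<Sum>i\<in>I. cinner (f i) \<psi>)"
  by (induction I rule: infinite_finite_induct) (auto simp: cinner_add_left)

lemma cinner_self: "cinner \<psi> \<psi> = of_real ((norm \<psi>)\<^sup>2)"
proof -
  have "Im (cinner \<psi> \<psi>) = 0"
    using arg_cong[OF cinner_commute[of \<psi> \<psi>], of Im] by simp
  moreover have "Re (cinner \<psi> \<psi>) = (norm \<psi>)\<^sup>2"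
    by (simp add: power2_norm_eq_inner inner_ell2_def)
  ultimately show ?thesis by (simp add: complex_eq_iff)
qed

lemma norm_scaleC: "norm (scaleC c \<psi>) = cmod c * norm \<psi>"
proof -
  have "complex_of_real ((norm (scaleC c \<psi>))\<^sup>2) = cnj c * (c * cinner \<psi> \<psi>)"
    unfolding cinner_self[symmetric] by (simp add: cinner_scaleC_left cinner_scaleC_right)
  also have "\<dots> = of_real ((cmod c * norm \<psi>)\<^sup>2)"
  proof -
    have "cnj c * c = (complex_of_real (cmod c))\<^sup>2"
      using complex_norm_square[of c] by (simp add: mult.commute)
    then show ?thesis by (simp add: cinner_self power_mult_distrib mult.assoc[symmetric])
  qed
  finally have "(norm (scaleC c \<psi>))\<^sup>2 = (cmod c * norm \<psi>)\<^sup>2" by (simp only: of_real_eq_iff)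
  then show ?thesis by (simp add: power2_eq_iff_nonneg)
qed

lemma cmod_cinner_le: "cmod (cinner \<phi> \<psi>) \<le> norm \<phi> * norm \<psi>"
proof (cases "cinner \<phi> \<psi> = 0")
  case False
  let ?z = "cinner \<phi> \<psi>"
  let ?c = "cnj ?z / of_real (cmod ?z)"
  have "cinner \<phi> (scaleC ?c \<psi>) = of_real (cmod ?z)"
    using False by (simp add: cinner_scaleC_right mult.commute complex_norm_square[symmetric] power2_eq_square)
  then have "cmod ?z = inner \<phi> (scaleC ?c \<psi>)" by (simp add: inner_ell2_def)
  also have "\<dots> \<le> norm \<phi> * norm (scaleC ?c \<psi>)" by (rule norm_cauchy_schwarz)
  also have "norm (scaleC ?c \<psi>) = norm \<psi>" using False by (simp add: norm_scaleC norm_divide)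
  finally show ?thesis .
qed simp

lemma ell2_nth_delta: "ell2_nth (delta m) n = (if n = m then 1 else 0)"
  by transfer simp

lemma cinner_delta: "cinner (delta m) \<psi> = ell2_nth \<psi> m"
proof transfer
  fix m :: int and \<psi> :: "int \<Rightarrow> complex"
  have "(\<Sum>\<^sub>\<infinity>n. cnj (if n = m then 1 else 0) * \<psi> n) = (\<Sum>\<^sub>\<infinity>n\<in>{m}. \<psi> n)"
    by (rule infsum_cong_neutral) auto
  then show "(\<Sum>\<^sub>\<infinity>n. cnj (if n = m then 1 else 0) * \<psi> n) = \<psi> m" by simp
qed

lemma cinner_extI: "(\<And>\<phi>. cinner \<phi> a = cinner \<phi> b) \<Longrightarrow> a = b"
  by (rule ell2_eqI) (metis cinner_delta)

lemma scaleC_simps: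
  "scaleC c (\<phi> + \<psi>) = scaleC c \<phi> + scaleC c \<psi>" "scaleC c (scaleC d \<phi>) = scaleC (c * d) \<phi>" "scaleC c 0 = 0"
  by (transfer; simp add: algebra_simps)+

lemma bounded_operator_simps:
  assumes "bounded_operator A"
  shows "A (\<phi> + \<psi>) = A \<phi> + A \<psi>" "A (scaleC c \<phi>) = scaleC c (A \<phi>)" "A 0 = 0" "A (\<phi> - \<psi>) = A \<phi> - A \<psi>" "A (r *\<^sub>R \<phi>) = r *\<^sub>R A \<phi>"
proof -
  have b: "bounded_linear A" and c: "A (scaleC c \<phi>) = scaleC c (A \<phi>)" for c \<phi>
    using assms by (auto simp: bounded_operator_def)
  interpret bounded_linear A by (rule b)
  show "A (\<phi> + \<psi>) = A \<phi> + A \<psi>" "A (scaleC c \<phi>) = scaleC c (A \<phi>)" "A 0 = 0" "A (\<phi> - \<psi>) = A \<phi> - A \<psi>" "A (r *\<^sub>R \<phi>) = r *\<^sub>R A \<phi>"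
    by (auto simp: add c zero diff scaleR)
qed

text \<open>
  The sesquilinear form with diagonal \<open>q\<close>, if there is one, in the convention that is linear in the
  second argument.
\<close>

definition polarize :: "(ell2 \<Rightarrow> complex) \<Rightarrow> ell2 \<Rightarrow> ell2 \<Rightarrow> complex"
  where "polarize q \<phi> \<psi> = (q (\<phi> + \<psi>) - q (\<phi> - \<psi>) - \<i> * q (\<phi> + scaleC \<i> \<psi>) + \<i> * q (\<phi> - scaleC \<i> \<psi>)) / 4"

lemma polarize_form:
  assumes "\<And>\<phi> \<psi>. B (\<phi> + \<psi>) = B \<phi> + B \<psi>" "\<And>c \<phi>. B (scaleC c \<phi>) = scaleC c (B \<phi>)"
  shows "polarize (\<lambda>\<psi>. cinner \<psi> (B \<psi>)) \<phi> \<psi> = cinner \<phi> (B \<psi>)"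
proof -
  have m: "B (a - b) = B a - B b" for a b
    by (simp add: minus_eq_scaleC assms)
  show ?thesis
    unfolding polarize_def assms m cinner_add_left cinner_add_right cinner_minus_left cinner_minus_right
      cinner_scaleC_left cinner_scaleC_right
    by (simp add: algebra_simps)
qed

lemma operator_eqI:
  assumes A: "bounded_operator A" and B: "bounded_operator B" and eq: "\<And>\<psi>. cinner \<psi> (A \<psi>) = cinner \<psi> (B \<psi>)"
  shows "A = B"
proof
  fix \<psi>
  show "A \<psi> = B \<psi>"
  proof (rule cinner_extI)
    fix \<phi>
    show "cinner \<phi> (A \<psi>) = cinner \<phi> (B \<psi>)"
      using polarize_form[of A \<phi> \<psi>] polarize_form[of B \<phi> \<psi>] eq bounded_operator_simps(1,2)[OF A] bounded_operator_simps(1,2)[OF B]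
      by simp
  qed
qed

text \<open>
  The operator \<open>p(A)\<close>, evaluated by Horner's scheme.
\<close>

definition poly_op :: "(ell2 \<Rightarrow> ell2) \<Rightarrow> real poly \<Rightarrow> ell2 \<Rightarrow> ell2"
  where "poly_op A p = fold_coeffs (\<lambda>a f \<psi>. a *\<^sub>R \<psi> + A (f \<psi>)) p (\<lambda>_. 0)"

locale bounded_selfadjoint =
  fixes A :: "ell2 \<Rightarrow> ell2" and R :: real
  assumes bop: "bounded_operator A"
    and sym: "cinner \<phi> (A \<psi>) = cinner (A \<phi>) \<psi>"
    and bound: "norm (A \<psi>) \<le> R * norm \<psi>"
    and R: "R > 0"
begin

lemmas A_simps = bounded_operator_simps[OF bop]

lemma poly_op_0: "poly_op A 0 \<psi> = 0"
  by (simp add: poly_op_def)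

lemma poly_op_pCons: "poly_op A (pCons a p) \<psi> = a *\<^sub>R \<psi> + A (poly_op A p \<psi>)"
  by (cases "a = 0 \<and> p = 0") (auto simp: poly_op_def A_simps)

lemma poly_op_add: "poly_op A (p + q) \<psi> = poly_op A p \<psi> + poly_op A q \<psi>"
proof (induction p arbitrary: q)
  case (pCons a p)
  then show ?case by (cases q) (simp add: poly_op_pCons A_simps algebra_simps)
qed (simp add: poly_op_0)

lemma poly_op_smult: "poly_op A (smult c p) \<psi> = c *\<^sub>R poly_op A p \<psi>"
  by (induction p) (auto simp: poly_op_0 poly_op_pCons A_simps algebra_simps)

lemma poly_op_mult: "poly_op A (p * q) \<psi> = poly_op A p (poly_op A q \<psi>)"
  by (induction p) (auto simp: poly_op_0 poly_op_pCons A_simps poly_op_add poly_op_smult)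

lemma poly_op_sym: "cinner \<phi> (poly_op A p \<psi>) = cinner (poly_op A p \<phi>) \<psi>"
proof (induction p arbitrary: \<phi> \<psi>)
  case (pCons a p)
  have comm: "poly_op A p (A \<psi>) = A (poly_op A p \<psi>)" for \<psi>
    using poly_op_mult[of p "[:0, 1:]" \<psi>] poly_op_mult[of "[:0, 1:]" p \<psi>]
    by (simp add: poly_op_pCons poly_op_0 mult.commute A_simps)
  show ?case
    by (simp add: poly_op_pCons cinner_add_left cinner_add_right cinner_scaleR_left cinner_scaleR_right sym pCons flip: comm)
qed (simp add: poly_op_0)

lemma poly_op_monom: "poly_op A (monom 1 n) = A ^^ n"
proof (induction n)
  case 0
  show ?case by (auto simp: fun_eq_iff one_pCons poly_op_pCons poly_op_0 A_simps)
next
  case (Suc n)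
  then show ?case by (auto simp: fun_eq_iff monom_Suc poly_op_pCons)
qed

lemma form_real: "cinner \<psi> (poly_op A p \<psi>) = of_real (Re (cinner \<psi> (poly_op A p \<psi>)))"
proof -
  have "Im (cinner \<psi> (poly_op A p \<psi>)) = 0"
    using arg_cong[OF cinner_commute[of \<psi> "poly_op A p \<psi>"], of Im] by (simp add: poly_op_sym)
  then show ?thesis by (simp add: complex_eq_iff)
qed

lemma form_square:
  "Re (cinner \<psi> (poly_op A (p * p * q) \<psi>)) = Re (cinner (poly_op A p \<psi>) (poly_op A q (poly_op A p \<psi>)))"
proof -
  have "p * p * q = p * (q * p)" by (simp add: mult_ac)
  then show ?thesis by (simp only: poly_op_mult poly_op_sym)
qed

end

text \<open>
  Even powers are absorbed by the substitution \<open>\<psi> := p(A) \<psi>\<close>, so that exponents can be reduced to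
  zero or one.  In the remaining case \<open>x (1 - x) = x\<^sup>2 (1 - x) + (1 - x)\<^sup>2 x\<close>, and both terms contain a square.
\<close>

lemma bernstein_form_nonneg:
  fixes Q :: "ell2 \<Rightarrow> real poly \<Rightarrow> real"
  assumes sq: "\<And>\<psi> p q. Q \<psi> (p * p * q) = Q (T p \<psi>) q"
    and add: "\<And>\<psi> p q. Q \<psi> (p + q) = Q \<psi> p + Q \<psi> q"
    and "\<And>\<psi>. 0 \<le> Q \<psi> 1" "\<And>\<psi>. 0 \<le> Q \<psi> [:0, 1:]" "\<And>\<psi>. 0 \<le> Q \<psi> [:1, -1:]"
  shows "0 \<le> Q \<psi> ([:0, 1:] ^ k * [:1, -1:] ^ l)"
proof -
  define y z where "y = ([:0, 1:] :: real poly)" and "z = ([:1, -1:] :: real poly)"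
  have yz: "y + z = 1" by (simp add: y_def z_def one_pCons)
  have pos: "0 \<le> Q \<psi> 1" "0 \<le> Q \<psi> y" "0 \<le> Q \<psi> z" for \<psi> using assms by (auto simp: y_def z_def)
  have "y * z = y * z * (y + z)" by (simp add: yz)
  then have "y * z = y * y * z + z * z * y" by (simp add: algebra_simps)
  then have posyz: "0 \<le> Q \<psi> (y * z)" for \<psi>
    using pos by (simp add: add sq)
  have pw: "w ^ n = w ^ (n div 2) * w ^ (n div 2) * w ^ (n mod 2)" for w :: "real poly" and n
    by (metis div_mult_mod_eq mult.commute mult_2 power_add)
  have "y ^ k * z ^ l = (y ^ (k div 2) * z ^ (l div 2)) * (y ^ (k div 2) * z ^ (l div 2)) * (y ^ (k mod 2) * z ^ (l mod 2))"
    by (subst pw[of y k], subst pw[of z l]) (simp only: mult_ac)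
  moreover have "0 \<le> Q \<phi> (y ^ (k mod 2) * z ^ (l mod 2))" for \<phi>
    by (cases "even k"; cases "even l") (use pos posyz in \<open>auto simp: even_iff_mod_2_eq_zero odd_iff_mod_2_eq_one\<close>)
  ultimately show ?thesis by (simp add: sq y_def z_def)
qed

context bounded_selfadjoint
begin

text \<open>
  The affine change of variable \<open>A' = (A + R) / (2 R)\<close> moves the spectrum into \<open>[0, 1]\<close>: both \<open>A'\<close> and
  \<open>1 - A'\<close> are nonnegative by the bound on \<open>A\<close>, which is the hypothesis of the moment problem.  The
  measure is then carried back by the inverse change of variable.
\<close>

lemma exists_moment_measure:
  "\<exists>M. finite_measure M \<and> sets M = sets borel \<and> emeasure M (- {-R..R}) = 0 \<and>
     (\<forall>n. complex_of_real (\<integral>x. x ^ n \<partial>M) = cinner \<psi> ((A ^^ n) \<psi>))"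
proof -
  define A' where "A' \<psi> = (1 / (2 * R)) *\<^sub>R (A \<psi> + R *\<^sub>R \<psi>)" for \<psi>
  have A'b: "norm (A' \<psi>) \<le> norm \<psi>" for \<psi>
  proof -
    have "norm (A \<psi> + R *\<^sub>R \<psi>) \<le> R * norm \<psi> + R * norm \<psi>"
      using norm_triangle_ineq[of "A \<psi>" "R *\<^sub>R \<psi>"] bound[of \<psi>] R by simp
    then have "norm (A' \<psi>) \<le> 1 / (2 * R) * (R * norm \<psi> + R * norm \<psi>)"
      unfolding A'_def norm_scaleR using R by (intro mult_mono) auto
    also have "\<dots> = norm \<psi>" using R by (simp add: field_simps)
    finally show ?thesis .
  qed
  interpret A': bounded_selfadjoint A' 1
  proof
    have add: "A' (\<phi> + \<psi>) = A' \<phi> + A' \<psi>" for \<phi> \<psi>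
      by (simp add: A'_def A_simps algebra_simps)
    have sc: "A' (scaleC c \<psi>) = scaleC c (A' \<psi>)" for c \<psi>
      by (simp add: A'_def A_simps scaleR_eq_scaleC scaleC_simps mult.commute)
    have "bounded_linear A'"
      by (rule bounded_linear_intro[of _ 1]) (use add sc A'b in \<open>auto simp: scaleR_eq_scaleC\<close>)
    then show "bounded_operator A'" using sc by (simp add: bounded_operator_def)
    show "cinner \<phi> (A' \<psi>) = cinner (A' \<phi>) \<psi>" for \<phi> \<psi>
      by (simp add: A'_def cinner_scaleR_left cinner_scaleR_right cinner_add_left cinner_add_right sym)
    show "norm (A' \<psi>) \<le> 1 * norm \<psi>" for \<psi> using A'b by simp
  qed simp
  define Q where "Q \<psi> p = Re (cinner \<psi> (poly_op A' p \<psi>))" for \<psi> p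
  have p1: "poly_op A' 1 \<psi> = \<psi>" for \<psi>
    by (simp add: one_pCons A'.poly_op_pCons A'.poly_op_0 A'.A_simps)
  have Qadd: "Q \<psi> (p + q) = Q \<psi> p + Q \<psi> q" for \<psi> p q
    by (simp add: Q_def A'.poly_op_add cinner_add_right)
  have Qsm: "Q \<psi> (smult c p) = c * Q \<psi> p" for \<psi> c p
    by (simp add: Q_def A'.poly_op_smult cinner_scaleR_right)
  have Qy: "Q \<psi> [:0, 1:] = Re (cinner \<psi> (A' \<psi>))" for \<psi>
    by (simp add: Q_def A'.poly_op_pCons A'.poly_op_0 A'.A_simps)
  have Ry: "Re (cinner \<psi> (A \<psi>)) \<le> R * (norm \<psi>)\<^sup>2" "- (R * (norm \<psi>)\<^sup>2) \<le> Re (cinner \<psi> (A \<psi>))" for \<psi>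
  proof -
    have "\<bar>Re (cinner \<psi> (A \<psi>))\<bar> \<le> norm \<psi> * norm (A \<psi>)"
      using abs_Re_le_cmod cmod_cinner_le order_trans by blast
    also have "\<dots> \<le> norm \<psi> * (R * norm \<psi>)" by (intro mult_left_mono bound) auto
    also have "\<dots> = R * (norm \<psi>)\<^sup>2" by (simp add: power2_eq_square)
    finally show "Re (cinner \<psi> (A \<psi>)) \<le> R * (norm \<psi>)\<^sup>2" "- (R * (norm \<psi>)\<^sup>2) \<le> Re (cinner \<psi> (A \<psi>))" by linarith+
  qed
  have y: "Q \<psi> [:0, 1:] = (Re (cinner \<psi> (A \<psi>)) + R * (norm \<psi>)\<^sup>2) / (2 * R)" for \<psi>
    unfolding Qy A'_def by (simp add: cinner_scaleR_right cinner_add_right cinner_self field_simps flip: of_real_power)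
  have Q1: "Q \<psi> 1 = (norm \<psi>)\<^sup>2" for \<psi> by (simp add: Q_def p1 cinner_self flip: of_real_power)
  have Qz: "Q \<psi> [:1, -1:] = Q \<psi> 1 - Q \<psi> [:0, 1:]" for \<psi>
  proof -
    have "[:1, -1:] = 1 + smult (-1) ([:0, 1:] :: real poly)" by (simp add: one_pCons)
    then show ?thesis by (simp only: Qadd Qsm)
  qed
  have nonneg: "0 \<le> Q \<psi> ([:0, 1:] ^ k * [:1, -1:] ^ l)" for \<psi> k l
  proof (rule bernstein_form_nonneg[where T = "poly_op A'"])
    show "Q \<psi> (p * p * q) = Q (poly_op A' p \<psi>) q" for \<psi> p q
      unfolding Q_def by (rule A'.form_square)
    show "0 \<le> Q \<psi> [:0, 1:]" for \<psi> unfolding y using Ry[of \<psi>] R by simp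
    show "0 \<le> Q \<psi> [:1, -1:]" for \<psi> unfolding Qz Q1 y using Ry[of \<psi>] R by (simp add: field_simps)
  qed (auto simp: Qadd Q1)
  obtain M where M: "finite_measure M" "sets M = sets borel" "emeasure M (- {0..1}) = 0" "\<And>m. (\<integral>x. x ^ m \<partial>M) = Q \<psi> (monom 1 m)"
    using hausdorff_moment_unit_interval[of "Q \<psi>", OF Qadd Qsm nonneg] by metis
  have MQ: "(\<integral>x. poly p x \<partial>M) = Q \<psi> p" for p
    by (rule hausdorff_integral_poly[OF Qadd Qsm M])
  define g where "g x = 2 * R * x - R" for x :: real
  have g[measurable]: "g \<in> M \<rightarrow>\<^sub>M borel"
    unfolding measurable_cong_sets[OF M(2) refl] g_def by measurable
  let ?q = "[:- R, 2 * R:]"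
  have q: "poly_op A' ?q \<psi> = A \<psi>" for \<psi>
    using R by (simp add: A'.poly_op_pCons A'.poly_op_0 A'.A_simps) (simp add: A'_def scaleR_add_right)
  have qn: "poly_op A' (?q ^ n) = A ^^ n" for n
  proof (induction n)
    case 0
    show ?case by (auto simp: fun_eq_iff p1)
  next
    case (Suc n)
    show ?case by (rule ext) (simp only: power_Suc A'.poly_op_mult q Suc funpow.simps o_apply)
  qed
  show ?thesis
  proof (intro exI[of _ "distr M borel g"] conjI allI)
    show "finite_measure (distr M borel g)" by (rule finite_measure.finite_measure_distr[OF M(1) g])
    have "emeasure (distr M borel g) (- {-R..R}) = emeasure M (g -` (- {-R..R}) \<inter> space M)"
      by (rule emeasure_distr) auto
    also have "\<dots> \<le> emeasure M (- {0..1})"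
    proof (rule emeasure_mono)
      show "g -` (- {-R..R}) \<inter> space M \<subseteq> - {0..1}"
      proof safe
        fix x assume "g x \<notin> {-R..R}" "x \<in> {0..1}"
        moreover from this have "0 \<le> R * x" "R * x \<le> R * 1" using R by (auto intro!: mult_left_mono)
        ultimately show False by (simp add: g_def)
      qed
    qed (simp add: M(2))
    finally show "emeasure (distr M borel g) (- {-R..R}) = 0" using M(3) by simp
    fix n
    have "(\<integral>x. x ^ n \<partial>distr M borel g) = (\<integral>x. g x ^ n \<partial>M)"
      by (rule integral_distr[OF g]) simp
    also have "\<dots> = (\<integral>x. poly (?q ^ n) x \<partial>M)" by (simp add: g_def algebra_simps)
    also have "\<dots> = Re (cinner \<psi> ((A ^^ n) \<psi>))" unfolding MQ Q_def qn ..
    finally show "complex_of_real (\<integral>x. x ^ n \<partial>distr M borel g) = cinner \<psi> ((A ^^ n) \<psi>)"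
      using form_real[of \<psi> "monom 1 n"] by (simp add: poly_op_monom)
  qed simp
qed

end

section \<open>Normal functionals and sesquilinear forms\<close>

definition bounded_borel :: "real \<Rightarrow> (real \<Rightarrow> complex) \<Rightarrow> bool"
  where "bounded_borel R g \<longleftrightarrow> g \<in> borel_measurable borel \<and> (\<exists>C. \<forall>x. \<bar>x\<bar> \<le> R \<longrightarrow> cmod (g x) \<le> C)"

text \<open>
  Linearity together with bounded pointwise convergence.  It is stated for functionals instead of
  measures so that sesquilinear forms such as \<open>g \<mapsto> \<langle>\<phi>, g(A) \<psi>\<rangle>\<close>, which are combinations
  of four integrals, are covered as well.
\<close>

definition normal_functional :: "real \<Rightarrow> ((real \<Rightarrow> complex) \<Rightarrow> complex) \<Rightarrow> bool"
  where "normal_functional R \<Lambda> \<longleftrightarrow>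
    (\<forall>c g h. bounded_borel R g \<longrightarrow> bounded_borel R h \<longrightarrow> \<Lambda> (\<lambda>x. c * g x + h x) = c * \<Lambda> g + \<Lambda> h) \<and>
    (\<forall>F h B. (\<forall>n. bounded_borel R (F n)) \<longrightarrow> bounded_borel R h \<longrightarrow> (\<forall>n x. \<bar>x\<bar> \<le> R \<longrightarrow> cmod (F n x) \<le> B) \<longrightarrow>
       (\<forall>x. \<bar>x\<bar> \<le> R \<longrightarrow> (\<lambda>n. F n x) \<longlonglongrightarrow> h x) \<longrightarrow> (\<lambda>n. \<Lambda> (F n)) \<longlonglongrightarrow> \<Lambda> h)"

lemma bounded_borel_lin:
  assumes "bounded_borel R g" "bounded_borel R h"
  shows "bounded_borel R (\<lambda>x. c * g x + h x)"
proof -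
  obtain C D where "\<forall>x. \<bar>x\<bar> \<le> R \<longrightarrow> cmod (g x) \<le> C" "\<forall>x. \<bar>x\<bar> \<le> R \<longrightarrow> cmod (h x) \<le> D"
    using assms by (auto simp: bounded_borel_def)
  then have "\<forall>x. \<bar>x\<bar> \<le> R \<longrightarrow> cmod (c * g x + h x) \<le> cmod c * C + D"
    by (auto intro!: norm_triangle_le add_mono simp: norm_mult mult_left_mono)
  then show ?thesis using assms by (auto simp: bounded_borel_def)
qed

lemma bounded_borel_mult:
  assumes "bounded_borel R g" "bounded_borel R h"
  shows "bounded_borel R (\<lambda>x. g x * h x)"
proof -
  obtain C D where CD: "\<forall>x. \<bar>x\<bar> \<le> R \<longrightarrow> cmod (g x) \<le> C" "\<forall>x. \<bar>x\<bar> \<le> R \<longrightarrow> cmod (h x) \<le> D"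
    using assms by (auto simp: bounded_borel_def)
  have "cmod (g x * h x) \<le> \<bar>C\<bar> * \<bar>D\<bar>" if "\<bar>x\<bar> \<le> R" for x
    using CD that unfolding norm_mult by (intro mult_mono) (auto intro: order_trans[OF _ abs_ge_self])
  then show ?thesis using assms by (auto simp: bounded_borel_def)
qed

lemma bounded_borel_cnj: "bounded_borel R g \<Longrightarrow> bounded_borel R (\<lambda>x. cnj (g x))"
  unfolding bounded_borel_def by (auto intro: borel_measurable_continuous_on[of cnj] continuous_intros)

lemma bounded_borel_indicator: "A \<in> sets borel \<Longrightarrow> bounded_borel R (indicator A)"
  unfolding bounded_borel_def by (auto intro!: exI[of _ 1] simp: indicator_def)

lemma bounded_borel_power: "bounded_borel R (\<lambda>x. of_real (x ^ n))"
  unfolding bounded_borel_def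
proof (intro conjI exI[of _ "R ^ n"] allI impI)
  fix x :: real assume "\<bar>x\<bar> \<le> R"
  then show "cmod (of_real (x ^ n)) \<le> R ^ n"
    unfolding norm_of_real power_abs by (intro power_mono) auto
qed simp

lemma bounded_borel_of_bounded: "g \<in> borel_measurable borel \<Longrightarrow> bounded (range g) \<Longrightarrow> bounded_borel R g"
  unfolding bounded_borel_def bounded_iff by auto

lemma bounded_borel_lim:
  assumes "h \<in> borel_measurable borel" "\<And>n x. \<bar>x\<bar> \<le> R \<Longrightarrow> cmod (F n x) \<le> B" "\<And>x. \<bar>x\<bar> \<le> R \<Longrightarrow> (\<lambda>n. F n x) \<longlonglongrightarrow> h x"
  shows "bounded_borel R h"
  unfolding bounded_borel_def
proof (intro conjI exI allI impI assms(1))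
  fix x :: real assume x: "\<bar>x\<bar> \<le> R"
  show "cmod (h x) \<le> B"
    using assms(2)[OF x] by (intro LIMSEQ_le_const2[OF tendsto_norm[OF assms(3)[OF x]]]) auto
qed

lemma normal_functional_lin:
  "normal_functional R \<Lambda> \<Longrightarrow> bounded_borel R g \<Longrightarrow> bounded_borel R h \<Longrightarrow> \<Lambda> (\<lambda>x. c * g x + h x) = c * \<Lambda> g + \<Lambda> h"
  by (simp add: normal_functional_def)

lemma normal_functional_lim:
  "normal_functional R \<Lambda> \<Longrightarrow> (\<And>n. bounded_borel R (F n)) \<Longrightarrow> bounded_borel R h \<Longrightarrow>
   (\<And>n x. \<bar>x\<bar> \<le> R \<Longrightarrow> cmod (F n x) \<le> B) \<Longrightarrow> (\<And>x. \<bar>x\<bar> \<le> R \<Longrightarrow> (\<lambda>n. F n x) \<longlonglongrightarrow> h x) \<Longrightarrow> (\<lambda>n. \<Lambda> (F n)) \<longlonglongrightarrow> \<Lambda> h"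
  unfolding normal_functional_def by blast

lemma normal_functional_eqI_power:
  assumes "normal_functional R \<Lambda>" "normal_functional R \<Lambda>'" and g: "bounded_borel R g"
    and eq: "\<And>n. \<Lambda> (\<lambda>x. of_real (x ^ n)) = \<Lambda>' (\<lambda>x. of_real (x ^ n))"
  shows "\<Lambda> g = \<Lambda>' g"
proof -
  obtain C where gC: "g \<in> borel_measurable borel" "\<And>x. \<bar>x\<bar> \<le> R \<Longrightarrow> cmod (g x) \<le> C" using g by (auto simp: bounded_borel_def)
  have "bounded_borel R g \<and> \<Lambda> g = \<Lambda>' g"
  proof (rule bounded_borel_induct[OF gC, where P = "\<lambda>g. bounded_borel R g \<and> \<Lambda> g = \<Lambda>' g"])
    fix n :: nat
    show "bounded_borel R (\<lambda>x. of_real (x ^ n)) \<and> \<Lambda> (\<lambda>x. of_real (x ^ n)) = \<Lambda>' (\<lambda>x. of_real (x ^ n))" using bounded_borel_power eq by blast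
  next
    fix c g h assume "bounded_borel R g \<and> \<Lambda> g = \<Lambda>' g" "bounded_borel R h \<and> \<Lambda> h = \<Lambda>' h"
    then show "bounded_borel R (\<lambda>x. c * g x + h x) \<and> \<Lambda> (\<lambda>x. c * g x + h x) = \<Lambda>' (\<lambda>x. c * g x + h x)" using normal_functional_lin assms(1,2) bounded_borel_lin by metis
  next
    fix F h B
    assume lim: "\<And>n :: nat. bounded_borel R (F n) \<and> \<Lambda> (F n) = \<Lambda>' (F n)" "\<And>n :: nat. F n \<in> borel_measurable borel" "h \<in> borel_measurable borel"
       "\<And>n x. \<bar>x\<bar> \<le> R \<Longrightarrow> cmod (F n x) \<le> B" "\<And>x. \<bar>x\<bar> \<le> R \<Longrightarrow> (\<lambda>n. F n x) \<longlonglongrightarrow> h x"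
    have h: "bounded_borel R h" using lim(3,4,5) by (rule bounded_borel_lim)
    have "(\<lambda>n. \<Lambda> (F n)) \<longlonglongrightarrow> \<Lambda> h" by (rule normal_functional_lim[OF assms(1) _ h lim(4,5)]) (use lim(1) in auto)
    moreover have "(\<lambda>n. \<Lambda> (F n)) \<longlonglongrightarrow> \<Lambda>' h"
      using normal_functional_lim[OF assms(2) _ h lim(4,5)] lim(1) by auto
    ultimately show "bounded_borel R h \<and> \<Lambda> h = \<Lambda>' h" using h LIMSEQ_unique by blast
  qed
  then show ?thesis by simp
qed

lemma normal_functional_eqI_indicator:
  assumes "normal_functional R \<Lambda>" "normal_functional R \<Lambda>'" and g: "bounded_borel R g"
    and eq: "\<And>A. A \<in> sets borel \<Longrightarrow> \<Lambda> (indicator A) = \<Lambda>' (indicator A)"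
  shows "\<Lambda> g = \<Lambda>' g"
proof -
  obtain C where gC: "g \<in> borel_measurable borel" "\<And>x. \<bar>x\<bar> \<le> R \<Longrightarrow> cmod (g x) \<le> C" using g by (auto simp: bounded_borel_def)
  have "bounded_borel R g \<and> \<Lambda> g = \<Lambda>' g"
  proof (rule bounded_borel_induct_set[OF gC, where P = "\<lambda>g. bounded_borel R g \<and> \<Lambda> g = \<Lambda>' g"])
    fix A :: "real set" assume "A \<in> sets borel"
    then show "bounded_borel R (indicator A) \<and> \<Lambda> (indicator A) = \<Lambda>' (indicator A)" using bounded_borel_indicator eq by blast
  next
    fix c g h assume "bounded_borel R g \<and> \<Lambda> g = \<Lambda>' g" "bounded_borel R h \<and> \<Lambda> h = \<Lambda>' h"
    then show "bounded_borel R (\<lambda>x. c * g x + h x) \<and> \<Lambda> (\<lambda>x. c * g x + h x) = \<Lambda>' (\<lambda>x. c * g x + h x)" using normal_functional_lin assms(1,2) bounded_borel_lin by metis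
  next
    fix F h B
    assume lim: "\<And>n :: nat. bounded_borel R (F n) \<and> \<Lambda> (F n) = \<Lambda>' (F n)" "\<And>n :: nat. F n \<in> borel_measurable borel" "h \<in> borel_measurable borel"
       "\<And>n x. \<bar>x\<bar> \<le> R \<Longrightarrow> cmod (F n x) \<le> B" "\<And>x. \<bar>x\<bar> \<le> R \<Longrightarrow> (\<lambda>n. F n x) \<longlonglongrightarrow> h x"
    have h: "bounded_borel R h" using lim(3,4,5) by (rule bounded_borel_lim)
    have "(\<lambda>n. \<Lambda> (F n)) \<longlonglongrightarrow> \<Lambda> h" by (rule normal_functional_lim[OF assms(1) _ h lim(4,5)]) (use lim(1) in auto)
    moreover have "(\<lambda>n. \<Lambda> (F n)) \<longlonglongrightarrow> \<Lambda>' h"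
      using normal_functional_lim[OF assms(2) _ h lim(4,5)] lim(1) by auto
    ultimately show "bounded_borel R h \<and> \<Lambda> h = \<Lambda>' h" using h LIMSEQ_unique by blast
  qed
  then show ?thesis by simp
qed

lemma normal_functional_combine:
  assumes "normal_functional R \<Lambda>" "normal_functional R \<Lambda>'"
  shows "normal_functional R (\<lambda>g. a * \<Lambda> g + b * \<Lambda>' g)"
  unfolding normal_functional_def
proof (intro conjI allI impI)
  fix c g h assume "bounded_borel R g" "bounded_borel R h"
  then show "a * \<Lambda> (\<lambda>x. c * g x + h x) + b * \<Lambda>' (\<lambda>x. c * g x + h x) = c * (a * \<Lambda> g + b * \<Lambda>' g) + (a * \<Lambda> h + b * \<Lambda>' h)"
    using normal_functional_lin[OF assms(1)] normal_functional_lin[OF assms(2)] by (simp add: algebra_simps)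
next
  fix F h B
  assume *: "\<forall>n. bounded_borel R (F n)" "bounded_borel R h" "\<forall>n x. \<bar>x\<bar> \<le> R \<longrightarrow> cmod (F n x) \<le> B"
       "\<forall>x. \<bar>x\<bar> \<le> R \<longrightarrow> (\<lambda>n. F n x) \<longlonglongrightarrow> h x"
  show "(\<lambda>n. a * \<Lambda> (F n) + b * \<Lambda>' (F n)) \<longlonglongrightarrow> a * \<Lambda> h + b * \<Lambda>' h"
    by (intro tendsto_intros normal_functional_lim[OF assms(1), of F h B] normal_functional_lim[OF assms(2), of F h B])
      (use * in auto)
qed

lemma normal_functional_mult:
  assumes "normal_functional R \<Lambda>" "bounded_borel R k"
  shows "normal_functional R (\<lambda>g. \<Lambda> (\<lambda>x. g x * k x))"
  unfolding normal_functional_def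
proof (intro conjI allI impI)
  fix c g h assume gh: "bounded_borel R g" "bounded_borel R h"
  have "(\<lambda>x. (c * g x + h x) * k x) = (\<lambda>x. c * (g x * k x) + h x * k x)" by (auto simp: algebra_simps)
  then show "\<Lambda> (\<lambda>x. (c * g x + h x) * k x) = c * \<Lambda> (\<lambda>x. g x * k x) + \<Lambda> (\<lambda>x. h x * k x)"
    using normal_functional_lin[OF assms(1) bounded_borel_mult[OF gh(1) assms(2)] bounded_borel_mult[OF gh(2) assms(2)]] by simp
next
  fix F h B
  assume *: "\<forall>n. bounded_borel R (F n)" "bounded_borel R h" "\<forall>n x. \<bar>x\<bar> \<le> R \<longrightarrow> cmod (F n x) \<le> B"
       "\<forall>x. \<bar>x\<bar> \<le> R \<longrightarrow> (\<lambda>n. F n x) \<longlonglongrightarrow> h x"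
  obtain C where C: "\<forall>x. \<bar>x\<bar> \<le> R \<longrightarrow> cmod (k x) \<le> C" using assms by (auto simp: bounded_borel_def)
  show "(\<lambda>n. \<Lambda> (\<lambda>x. F n x * k x)) \<longlonglongrightarrow> \<Lambda> (\<lambda>x. h x * k x)"
  proof (rule normal_functional_lim[OF assms(1)])
    show "cmod (F n x * k x) \<le> \<bar>B\<bar> * \<bar>C\<bar>" if "\<bar>x\<bar> \<le> R" for n x
      using * C that unfolding norm_mult by (intro mult_mono) (auto intro: order_trans[OF _ abs_ge_self])
  qed (use * assms(2) in \<open>auto intro!: bounded_borel_mult tendsto_intros\<close>)
qed

lemma normal_functional_cnj:
  assumes "normal_functional R \<Lambda>"
  shows "normal_functional R (\<lambda>g. cnj (\<Lambda> (\<lambda>x. cnj (g x))))"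
  unfolding normal_functional_def
proof (intro conjI allI impI)
  fix c g h assume gh: "bounded_borel R g" "bounded_borel R h"
  show "cnj (\<Lambda> (\<lambda>x. cnj (c * g x + h x))) = c * cnj (\<Lambda> (\<lambda>x. cnj (g x))) + cnj (\<Lambda> (\<lambda>x. cnj (h x)))"
    using normal_functional_lin[OF assms bounded_borel_cnj[OF gh(1)] bounded_borel_cnj[OF gh(2)], of "cnj c"] by simp
next
  fix F h B
  assume *: "\<forall>n. bounded_borel R (F n)" "bounded_borel R h" "\<forall>n x. \<bar>x\<bar> \<le> R \<longrightarrow> cmod (F n x) \<le> B"
       "\<forall>x. \<bar>x\<bar> \<le> R \<longrightarrow> (\<lambda>n. F n x) \<longlonglongrightarrow> h x"
  show "(\<lambda>n. cnj (\<Lambda> (\<lambda>x. cnj (F n x)))) \<longlonglongrightarrow> cnj (\<Lambda> (\<lambda>x. cnj (h x)))"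
    by (intro tendsto_cnj normal_functional_lim[OF assms, where B = B]) (use * in \<open>auto intro!: bounded_borel_cnj tendsto_intros\<close>)
qed

text \<open>
  No relation between the measures of different vectors is assumed: the constant family of a single
  measure is an instance, and is used for integrals against one measure.
\<close>

locale spectral_family =
  fixes m :: "ell2 \<Rightarrow> real measure" and R :: real
  assumes fin: "finite_measure (m \<psi>)" and sets_m: "sets (m \<psi>) = sets borel" and supp: "emeasure (m \<psi>) (- {-R..R}) = 0"
begin

lemma AE_m: "AE x in m \<psi>. \<bar>x\<bar> \<le> R"
  using supp[of \<psi>] by (intro AE_I[of _ _ "- {-R..R}"]) (auto simp: sets_m)

lemma meas_m: "g \<in> borel_measurable borel \<Longrightarrow> g \<in> borel_measurable (m \<psi>)"
  by (simp add: measurable_cong_sets[OF sets_m refl])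

lemma integrable_m: "bounded_borel R g \<Longrightarrow> integrable (m \<psi>) g"
proof -
  assume g: "bounded_borel R g"
  then obtain C where C: "\<And>x. \<bar>x\<bar> \<le> R \<Longrightarrow> cmod (g x) \<le> C" by (auto simp: bounded_borel_def)
  interpret finite_measure "m \<psi>" by (rule fin)
  show ?thesis
  proof (rule integrable_const_bound[of _ C])
    show "AE x in m \<psi>. cmod (g x) \<le> C" using AE_m by eventually_elim (rule C)
  qed (use g in \<open>auto simp: bounded_borel_def intro: meas_m\<close>)
qed

lemma normal_integral: "normal_functional R (\<lambda>g. \<integral>x. g x \<partial>m \<psi>)"
  unfolding normal_functional_def
proof (intro conjI allI impI)
  fix c g h assume "bounded_borel R g" "bounded_borel R h"
  then show "(\<integral>x. c * g x + h x \<partial>m \<psi>) = c * (\<integral>x. g x \<partial>m \<psi>) + (\<integral>x. h x \<partial>m \<psi>)"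
    using integrable_m by simp
next
  fix F h B
  assume *: "\<forall>n. bounded_borel R (F n)" "bounded_borel R h" "\<forall>n x. \<bar>x\<bar> \<le> R \<longrightarrow> cmod (F n x) \<le> B"
       "\<forall>x. \<bar>x\<bar> \<le> R \<longrightarrow> (\<lambda>n. F n x) \<longlonglongrightarrow> h x"
  interpret finite_measure "m \<psi>" by (rule fin)
  show "(\<lambda>n. \<integral>x. F n x \<partial>m \<psi>) \<longlonglongrightarrow> (\<integral>x. h x \<partial>m \<psi>)"
  proof (rule integral_dominated_convergence[where w = "\<lambda>_. B"])
    show "AE x in m \<psi>. (\<lambda>n. F n x) \<longlonglongrightarrow> h x" using AE_m by eventually_elim (use * in auto)
    show "AE x in m \<psi>. cmod (F n x) \<le> B" for n using AE_m by eventually_elim (use * in auto)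
  qed (use * in \<open>auto simp: bounded_borel_def intro: meas_m\<close>)
qed

definition form :: "(real \<Rightarrow> complex) \<Rightarrow> ell2 \<Rightarrow> ell2 \<Rightarrow> complex"
  where "form g = polarize (\<lambda>\<psi>. \<integral>x. g x \<partial>m \<psi>)"

lemma normal_form: "normal_functional R (\<lambda>g. form g \<phi> \<psi>)"
proof -
  let ?I = "\<lambda>\<zeta> g. \<integral>x. g x \<partial>m \<zeta>"
  have eq: "(\<lambda>g. form g \<phi> \<psi>) = (\<lambda>g. 1 * ((1/4) * ?I (\<phi> + \<psi>) g + (-1/4) * ?I (\<phi> - \<psi>) g) +
      1 * ((- \<i>/4) * ?I (\<phi> + scaleC \<i> \<psi>) g + (\<i>/4) * ?I (\<phi> - scaleC \<i> \<psi>) g))"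
    unfolding form_def polarize_def by (rule ext) (simp add: field_simps)
  show ?thesis unfolding eq by (intro normal_functional_combine normal_integral)
qed

end

context bounded_selfadjoint
begin

definition \<mu> :: "ell2 \<Rightarrow> real measure"
  where "\<mu> \<psi> = (SOME M. finite_measure M \<and> sets M = sets borel \<and> emeasure M (- {-R..R}) = 0 \<and>
     (\<forall>n. complex_of_real (\<integral>x. x ^ n \<partial>M) = cinner \<psi> ((A ^^ n) \<psi>)))"

lemma \<mu>: "finite_measure (\<mu> \<psi>)" "sets (\<mu> \<psi>) = sets borel" "emeasure (\<mu> \<psi>) (- {-R..R}) = 0"
    "complex_of_real (\<integral>x. x ^ n \<partial>\<mu> \<psi>) = cinner \<psi> ((A ^^ n) \<psi>)"
  using someI_ex[OF exists_moment_measure[of \<psi>]] unfolding \<mu>_def by blast+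

sublocale spectral_family \<mu> R
  by (rule spectral_family.intro) (rule \<mu>)+

lemma funpow_A_add: "(A ^^ n) (\<phi> + \<psi>) = (A ^^ n) \<phi> + (A ^^ n) \<psi>"
  and funpow_A_scaleC: "(A ^^ n) (scaleC c \<phi>) = scaleC c ((A ^^ n) \<phi>)"
  and funpow_A_sym: "cinner \<phi> ((A ^^ n) \<psi>) = cinner ((A ^^ n) \<phi>) \<psi>"
proof -
  show "(A ^^ n) (\<phi> + \<psi>) = (A ^^ n) \<phi> + (A ^^ n) \<psi>" by (induction n) (auto simp: A_simps)
  show "(A ^^ n) (scaleC c \<phi>) = scaleC c ((A ^^ n) \<phi>)" by (induction n) (auto simp: A_simps)
  show "cinner \<phi> ((A ^^ n) \<psi>) = cinner ((A ^^ n) \<phi>) \<psi>"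
    by (metis poly_op_monom poly_op_sym)
qed

lemma integral_power: "(\<integral>x. complex_of_real (x ^ n) \<partial>\<mu> \<psi>) = cinner \<psi> ((A ^^ n) \<psi>)"
  using \<mu>(4)[where n = n and \<psi> = \<psi>] by (simp only: integral_complex_of_real)

lemma form_power: "form (\<lambda>x. of_real (x ^ n)) \<phi> \<psi> = cinner \<phi> ((A ^^ n) \<psi>)"
  unfolding form_def integral_power by (rule polarize_form) (rule funpow_A_add funpow_A_scaleC)+

lemma form_add_right:
  assumes "bounded_borel R g"
  shows "form g \<phi> (\<psi> + \<zeta>) = form g \<phi> \<psi> + form g \<phi> \<zeta>"
proof -
  have "form g \<phi> (\<psi> + \<zeta>) = 1 * form g \<phi> \<psi> + 1 * form g \<phi> \<zeta>"
    by (rule normal_functional_eqI_power[OF normal_form normal_functional_combine[OF normal_form normal_form] assms])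
      (simp only: form_power funpow_A_add cinner_add_right mult_1)
  then show ?thesis by simp
qed

lemma form_scaleC_right:
  assumes "bounded_borel R g"
  shows "form g \<phi> (scaleC c \<psi>) = c * form g \<phi> \<psi>"
proof -
  have "form g \<phi> (scaleC c \<psi>) = c * form g \<phi> \<psi> + 0 * form g \<phi> \<psi>"
    by (rule normal_functional_eqI_power[OF normal_form normal_functional_combine[OF normal_form normal_form] assms])
      (simp only: form_power funpow_A_scaleC cinner_scaleC_right mult_zero_left add_0_right)
  then show ?thesis by simp
qed

lemma form_cnj:
  assumes "bounded_borel R g"
  shows "form g \<phi> \<psi> = cnj (form (\<lambda>x. cnj (g x)) \<psi> \<phi>)"
proof (rule normal_functional_eqI_power[OF normal_form normal_functional_cnj[OF normal_form] assms])
  fix n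
  show "form (\<lambda>x. of_real (x ^ n)) \<phi> \<psi> = cnj (form (\<lambda>x. cnj (of_real (x ^ n))) \<psi> \<phi>)"
    unfolding complex_cnj_complex_of_real form_power
    by (subst cinner_commute) (simp only: funpow_A_sym)
qed

lemma form_diag:
  assumes "bounded_borel R g"
  shows "form g \<psi> \<psi> = (\<integral>x. g x \<partial>\<mu> \<psi>)"
  by (rule normal_functional_eqI_power[OF normal_form normal_integral assms]) (simp only: form_power integral_power)

lemma form_add_left:
  assumes "bounded_borel R g"
  shows "form g (\<phi> + \<zeta>) \<psi> = form g \<phi> \<psi> + form g \<zeta> \<psi>"
  unfolding form_cnj[OF assms] form_add_right[OF bounded_borel_cnj[OF assms]] by simp

lemma form_scaleC_left:
  assumes "bounded_borel R g"
  shows "form g (scaleC c \<phi>) \<psi> = cnj c * form g \<phi> \<psi>"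
  unfolding form_cnj[OF assms] form_scaleC_right[OF bounded_borel_cnj[OF assms]] by simp

lemma integral_bound:
  assumes g: "bounded_borel R g" "\<And>x. \<bar>x\<bar> \<le> R \<Longrightarrow> cmod (g x) \<le> C"
  shows "cmod (\<integral>x. g x \<partial>\<mu> \<psi>) \<le> C * (norm \<psi>)\<^sup>2"
proof -
  interpret finite_measure "\<mu> \<psi>" by (rule \<mu>)
  have "complex_of_real (measure (\<mu> \<psi>) (space (\<mu> \<psi>))) = of_real ((norm \<psi>)\<^sup>2)"
    using \<mu>(4)[where n = 0 and \<psi> = \<psi>] by (simp add: cinner_self)
  then have mass: "measure (\<mu> \<psi>) (space (\<mu> \<psi>)) = (norm \<psi>)\<^sup>2" by (simp only: of_real_eq_iff)
  have "cmod (\<integral>x. g x \<partial>\<mu> \<psi>) \<le> (\<integral>x. cmod (g x) \<partial>\<mu> \<psi>)" by (rule integral_norm_bound)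
  also have "\<dots> \<le> (\<integral>x. C \<partial>\<mu> \<psi>)"
  proof (rule integral_mono_AE)
    show "AE x in \<mu> \<psi>. cmod (g x) \<le> C" using AE_m by eventually_elim (rule g(2))
  qed (use integrable_m[OF g(1)] in auto)
  also have "\<dots> = C * (norm \<psi>)\<^sup>2" by (simp add: mass)
  finally show ?thesis .
qed

text \<open>
  Polarization alone gives a bound by the square of \<open>norm \<phi> + norm \<psi>\<close>; the product form follows by
  scaling both vectors to length one.
\<close>

lemma form_bound:
  assumes g: "bounded_borel R g" "\<And>x. \<bar>x\<bar> \<le> R \<Longrightarrow> cmod (g x) \<le> C"
  shows "cmod (form g \<phi> \<psi>) \<le> 4 * C * norm \<phi> * norm \<psi>"
proof -
  have C: "0 \<le> C" using g(2)[of 0] R by (auto intro: order_trans[OF norm_ge_zero])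
  have b: "cmod (form g \<phi> \<psi>) \<le> C * (norm \<phi> + norm \<psi>)\<^sup>2" for \<phi> \<psi>
  proof -
    have i: "cmod (\<integral>x. g x \<partial>\<mu> \<zeta>) \<le> C * (norm \<phi> + norm \<psi>)\<^sup>2" if "norm \<zeta> \<le> norm \<phi> + norm \<psi>" for \<zeta>
    proof -
      have "(norm \<zeta>)\<^sup>2 \<le> (norm \<phi> + norm \<psi>)\<^sup>2" using that by (intro power_mono) auto
      then have "C * (norm \<zeta>)\<^sup>2 \<le> C * (norm \<phi> + norm \<psi>)\<^sup>2" using C by (rule mult_left_mono)
      then show ?thesis using integral_bound[OF g, where \<psi> = \<zeta>] by linarith
    qed
    have n: "norm (\<phi> + \<psi>) \<le> norm \<phi> + norm \<psi>" "norm (\<phi> - \<psi>) \<le> norm \<phi> + norm \<psi>"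
       "norm (\<phi> + scaleC \<i> \<psi>) \<le> norm \<phi> + norm \<psi>" "norm (\<phi> - scaleC \<i> \<psi>) \<le> norm \<phi> + norm \<psi>"
      using norm_triangle_ineq[of \<phi> \<psi>] norm_triangle_ineq4[of \<phi> \<psi>]
        norm_triangle_ineq[of \<phi> "scaleC \<i> \<psi>"] norm_triangle_ineq4[of \<phi> "scaleC \<i> \<psi>"] by (simp_all add: norm_scaleC)
    let ?q = "\<lambda>\<zeta>. \<integral>x. g x \<partial>\<mu> \<zeta>"
    have "cmod (?q (\<phi> + \<psi>) - ?q (\<phi> - \<psi>) - \<i> * ?q (\<phi> + scaleC \<i> \<psi>) + \<i> * ?q (\<phi> - scaleC \<i> \<psi>))
      \<le> cmod (?q (\<phi> + \<psi>)) + cmod (?q (\<phi> - \<psi>)) + cmod (\<i> * ?q (\<phi> + scaleC \<i> \<psi>)) + cmod (\<i> * ?q (\<phi> - scaleC \<i> \<psi>))"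
      by (intro norm_triangle_le norm_triangle_le_diff add_mono) auto
    also have "\<dots> \<le> 4 * (C * (norm \<phi> + norm \<psi>)\<^sup>2)"
      using i[OF n(1)] i[OF n(2)] i[OF n(3)] i[OF n(4)] by (simp add: norm_mult)
    finally show ?thesis unfolding form_def polarize_def by (simp add: norm_divide)
  qed
  show ?thesis
  proof (cases "norm \<phi> = 0 \<or> norm \<psi> = 0")
    case True
    have 0: "scaleC 0 \<zeta> = 0" for \<zeta> by transfer simp
    have "form g 0 \<psi> = 0" "form g \<phi> 0 = 0"
      using form_scaleC_left[OF g(1), of 0 \<phi> \<psi>] form_scaleC_right[OF g(1), of \<phi> 0 \<psi>] by (simp_all add: 0)
    then show ?thesis using True by auto
  next
    case False
    define a where "a = norm \<phi>"
    define b where "b = norm \<psi>"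
    have ab: "a > 0" "b > 0" using False by (auto simp: a_def b_def)
    let ?\<phi> = "scaleC (of_real (1 / a)) \<phi>" and ?\<psi> = "scaleC (of_real (1 / b)) \<psi>"
    have "cmod (form g ?\<phi> ?\<psi>) \<le> C * (norm ?\<phi> + norm ?\<psi>)\<^sup>2" by (rule \<open>\<And>\<psi> \<phi>. cmod (form g \<phi> \<psi>) \<le> C * (norm \<phi> + norm \<psi>)\<^sup>2\<close>)
    moreover have "norm ?\<phi> = 1" "norm ?\<psi> = 1" using ab by (auto simp: norm_scaleC a_def b_def norm_divide)
    ultimately have "cmod (form g ?\<phi> ?\<psi>) \<le> 4 * C" by simp
    moreover have "form g ?\<phi> ?\<psi> = of_real (1 / a) * (of_real (1 / b) * form g \<phi> \<psi>)"
      using form_scaleC_left[OF g(1)] form_scaleC_right[OF g(1)] by simp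
    ultimately have "cmod (form g \<phi> \<psi>) / (a * b) \<le> 4 * C" using ab by (simp add: norm_mult norm_divide)
    then show ?thesis using ab by (simp add: field_simps a_def b_def)
  qed
qed

end

definition truncate :: "int set \<Rightarrow> ell2 \<Rightarrow> ell2"
  where "truncate F \<psi> = (\<Sum>n\<in>F. scaleC (ell2_nth \<psi> n) (delta n))"

lemma cinner_truncate_left: "cinner (truncate F \<psi>) \<phi> = (\<Sum>n\<in>F. cnj (ell2_nth \<psi> n) * ell2_nth \<phi> n)"
  unfolding truncate_def cinner_sum_left by (simp add: cinner_scaleC_left cinner_delta)

lemma norm_sq_summable: "(\<lambda>n. (cmod (ell2_nth \<psi> n))\<^sup>2) summable_on UNIV"
  using ell2_nth[of \<psi>] by (simp add: sq_summable_def)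

lemma norm_sq_infsum: "(norm \<psi>)\<^sup>2 = (\<Sum>\<^sub>\<infinity>n. (cmod (ell2_nth \<psi> n))\<^sup>2)"
proof -
  have "complex_of_real ((norm \<psi>)\<^sup>2) = (\<Sum>\<^sub>\<infinity>n. cnj (ell2_nth \<psi> n) * ell2_nth \<psi> n)"
    unfolding cinner_self[symmetric] by transfer simp
  also have "\<dots> = (\<Sum>\<^sub>\<infinity>n. complex_of_real ((cmod (ell2_nth \<psi> n))\<^sup>2))"
    by (rule infsum_cong) (simp only: complex_norm_square mult.commute)
  also have "\<dots> = of_real (\<Sum>\<^sub>\<infinity>n. (cmod (ell2_nth \<psi> n))\<^sup>2)"
    by (rule infsumI) (rule has_sum_of_real[OF has_sum_infsum[OF norm_sq_summable]])
  finally show ?thesis by (simp only: of_real_eq_iff)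
qed

lemma exists_truncate_near:
  assumes "e > 0"
  shows "\<exists>F. finite F \<and> norm (\<psi> - truncate F \<psi>) < e"
proof -
  let ?f = "\<lambda>n. (cmod (ell2_nth \<psi> n))\<^sup>2"
  have "(?f has_sum (norm \<psi>)\<^sup>2) UNIV"
    using norm_sq_summable norm_sq_infsum by (metis has_sum_infsum)
  then have "(sum ?f \<longlongrightarrow> (norm \<psi>)\<^sup>2) (finite_subsets_at_top UNIV)" by (simp add: has_sum_def)
  then have "\<forall>\<^sub>F F in finite_subsets_at_top UNIV. dist (sum ?f F) ((norm \<psi>)\<^sup>2) < e\<^sup>2"
    using assms by (intro tendstoD) auto
  then obtain F where F: "finite F" "dist (sum ?f F) ((norm \<psi>)\<^sup>2) < e\<^sup>2"
    unfolding eventually_finite_subsets_at_top by auto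
  have tn: "ell2_nth (truncate F \<psi>) n = (if n \<in> F then ell2_nth \<psi> n else 0)" for n
  proof -
    have "ell2_nth (truncate F \<psi>) n = cnj (cinner (truncate F \<psi>) (delta n))"
      by (metis cinner_commute cinner_delta)
    then show ?thesis using F(1) by (simp add: cinner_truncate_left ell2_nth_delta if_distrib cong: if_cong)
  qed
  have "cinner (truncate F \<psi>) \<psi> = of_real (sum ?f F)"
    unfolding cinner_truncate_left of_real_sum by (rule sum.cong) (simp_all only: complex_norm_square mult.commute)
  moreover have "cinner (truncate F \<psi>) (truncate F \<psi>) = of_real (sum ?f F)"
    unfolding cinner_truncate_left of_real_sum by (rule sum.cong) (simp_all only: tn complex_norm_square mult.commute if_True)
  moreover have "cinner \<psi> (truncate F \<psi>) = of_real (sum ?f F)"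
    using calculation(1) by (subst cinner_commute) simp
  ultimately have "complex_of_real ((norm (\<psi> - truncate F \<psi>))\<^sup>2) = of_real ((norm \<psi>)\<^sup>2 - sum ?f F)"
    unfolding cinner_self[symmetric] cinner_minus_left cinner_minus_right by (simp add: cinner_self)
  then have "(norm (\<psi> - truncate F \<psi>))\<^sup>2 = (norm \<psi>)\<^sup>2 - sum ?f F" by (simp only: of_real_eq_iff)
  also have "\<dots> < e\<^sup>2" using F(2) by (simp add: dist_real_def abs_less_iff)
  finally have "norm (\<psi> - truncate F \<psi>) < e" using assms by (simp add: power_less_imp_less_base)
  then show ?thesis using F(1) by auto
qed

text \<open>
  The Riesz representation, done in coordinates: \<open>B \<psi>\<close> has entries \<open>s (delta n) \<psi>\<close>.  That these are
  square summable follows by testing the bound on the finite truncations of \<open>B \<psi>\<close> itself.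
\<close>

lemma operator_of_form:
  fixes s :: "ell2 \<Rightarrow> ell2 \<Rightarrow> complex"
  assumes add_left: "\<And>\<phi> \<zeta> \<psi>. s (\<phi> + \<zeta>) \<psi> = s \<phi> \<psi> + s \<zeta> \<psi>"
    and scale_left: "\<And>c \<phi> \<psi>. s (scaleC c \<phi>) \<psi> = cnj c * s \<phi> \<psi>"
    and add_right: "\<And>\<phi> \<zeta> \<psi>. s \<phi> (\<psi> + \<zeta>) = s \<phi> \<psi> + s \<phi> \<zeta>"
    and scale_right: "\<And>c \<phi> \<psi>. s \<phi> (scaleC c \<psi>) = c * s \<phi> \<psi>"
    and bound: "\<And>\<phi> \<psi>. cmod (s \<phi> \<psi>) \<le> C * norm \<phi> * norm \<psi>"
  obtains B where "bounded_operator B" "\<And>\<phi> \<psi>. cinner \<phi> (B \<psi>) = s \<phi> \<psi>"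
proof -
  have zero_left: "s 0 \<psi> = 0" for \<psi> using add_left[of 0 0 \<psi>] by simp
  have sum_left: "s (\<Sum>n\<in>F. f n) \<psi> = (\<Sum>n\<in>F. s (f n) \<psi>)" for F :: "int set" and f \<psi>
    by (induction F rule: infinite_finite_induct) (auto simp: add_left zero_left)
  define c where "c \<psi> n = s (delta n) \<psi>" for \<psi> n
  have sq: "sq_summable (c \<psi>)" for \<psi>
    unfolding sq_summable_def
  proof (rule nonneg_bdd_above_summable_on)
    show "bdd_above (sum (\<lambda>n. (cmod (c \<psi> n))\<^sup>2) ` {F. F \<subseteq> UNIV \<and> finite F})"
    proof (rule bdd_aboveI2[where M = "(C * norm \<psi>)\<^sup>2"], safe)
      fix F :: "int set" assume F: "finite F"
      define \<zeta> where "\<zeta> = (\<Sum>n\<in>F. scaleC (c \<psi> n) (delta n))"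
      define N where "N = (\<Sum>n\<in>F. (cmod (c \<psi> n))\<^sup>2)"
      have N0: "0 \<le> N" unfolding N_def by (intro sum_nonneg) auto
      have "s \<zeta> \<psi> = of_real N"
        unfolding \<zeta>_def N_def sum_left of_real_sum
        by (rule sum.cong) (simp_all add: scale_left c_def[symmetric] complex_norm_square mult.commute del: of_real_power)
      moreover have nth: "ell2_nth \<zeta> n = (if n \<in> F then c \<psi> n else 0)" for n
      proof -
        have "ell2_nth \<zeta> n = cnj (cinner \<zeta> (delta n))" by (metis cinner_commute cinner_delta)
        then show ?thesis unfolding \<zeta>_def cinner_sum_left using F
          by (simp add: cinner_scaleC_left cinner_delta ell2_nth_delta if_distrib cong: if_cong)
      qed
      have "cinner \<zeta> \<zeta> = of_real N"
        unfolding N_def of_real_sum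
        by (subst (1) \<zeta>_def, unfold cinner_sum_left, rule sum.cong)
          (simp_all add: cinner_scaleC_left cinner_delta nth complex_norm_square mult.commute del: of_real_power)
      then have "(norm \<zeta>)\<^sup>2 = N" unfolding cinner_self by (simp only: of_real_eq_iff)
      ultimately have "(norm \<zeta>)\<^sup>2 \<le> C * norm \<zeta> * norm \<psi>"
        using bound[of \<zeta> \<psi>] N0 by simp
      then have "norm \<zeta> * norm \<zeta> \<le> norm \<zeta> * (C * norm \<psi>)" by (simp add: power2_eq_square mult_ac)
      then have "norm \<zeta> \<le> C * norm \<psi> \<or> norm \<zeta> = 0"
        by (metis mult_le_cancel_left_pos norm_ge_zero order_le_less)
      then have "(norm \<zeta>)\<^sup>2 \<le> (C * norm \<psi>)\<^sup>2"
        by (auto intro: power_mono)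
      then show "(\<Sum>n\<in>F. (cmod (c \<psi> n))\<^sup>2) \<le> (C * norm \<psi>)\<^sup>2"
        using \<open>(norm \<zeta>)\<^sup>2 = N\<close> by (simp add: N_def)
    qed
  qed auto
  define B where "B \<psi> = Abs_ell2 (c \<psi>)" for \<psi>
  have Bn: "ell2_nth (B \<psi>) n = s (delta n) \<psi>" for \<psi> n
    unfolding B_def using sq by (simp add: Abs_ell2_inverse c_def)
  have B: "cinner \<phi> (B \<psi>) = s \<phi> \<psi>" for \<phi> \<psi>
  proof -
    have tr: "cinner (truncate F \<phi>) (B \<psi>) = s (truncate F \<phi>) \<psi>" for F
      unfolding cinner_truncate_left Bn by (simp add: truncate_def sum_left scale_left)
    have "cmod (cinner \<phi> (B \<psi>) - s \<phi> \<psi>) \<le> 0"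
    proof (rule field_le_epsilon)
      fix e :: real assume e: "e > 0"
      let ?K = "norm (B \<psi>) + \<bar>C\<bar> * norm \<psi> + 1"
      have K: "?K > 0" by (simp add: add_nonneg_pos)
      obtain F where F: "norm (\<phi> - truncate F \<phi>) < e / ?K"
        using exists_truncate_near[of "e / ?K" \<phi>] e K by auto
      let ?d = "\<phi> - truncate F \<phi>"
      have \<phi>: "\<phi> = truncate F \<phi> + ?d" by simp
      have "cinner \<phi> (B \<psi>) - s \<phi> \<psi> = cinner ?d (B \<psi>) - s ?d \<psi>"
        by (subst (1 2) \<phi>) (simp only: cinner_add_left add_left tr, simp)
      then have "cmod (cinner \<phi> (B \<psi>) - s \<phi> \<psi>) \<le> cmod (cinner ?d (B \<psi>)) + cmod (s ?d \<psi>)"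
        by (simp add: norm_triangle_ineq4)
      also have "\<dots> \<le> norm ?d * norm (B \<psi>) + C * norm ?d * norm \<psi>"
        by (intro add_mono cmod_cinner_le bound)
      also have "\<dots> \<le> norm ?d * norm (B \<psi>) + norm ?d * (\<bar>C\<bar> * norm \<psi>)"
      proof -
        have "C * norm ?d * norm \<psi> \<le> \<bar>C\<bar> * norm ?d * norm \<psi>" by (intro mult_right_mono) auto
        then show ?thesis by (simp add: mult_ac)
      qed
      also have "\<dots> \<le> norm ?d * ?K" by (simp add: algebra_simps)
      also have "\<dots> \<le> e / ?K * ?K" using F K by (intro mult_right_mono) auto
      finally show "cmod (cinner \<phi> (B \<psi>) - s \<phi> \<psi>) \<le> 0 + e" using K by simp
    qed
    then show ?thesis by simp
  qed
  have Badd: "B (\<psi> + \<zeta>) = B \<psi> + B \<zeta>" for \<psi> \<zeta>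
    by (rule cinner_extI) (simp add: B cinner_add_right add_right)
  have Bsc: "B (scaleC a \<psi>) = scaleC a (B \<psi>)" for a \<psi>
    by (rule cinner_extI) (simp add: B cinner_scaleC_right scale_right)
  have Bb: "norm (B \<psi>) \<le> norm \<psi> * \<bar>C\<bar>" for \<psi>
  proof -
    have "(norm (B \<psi>))\<^sup>2 = cmod (cinner (B \<psi>) (B \<psi>))" by (simp add: cinner_self norm_power)
    also have "\<dots> \<le> C * norm (B \<psi>) * norm \<psi>" unfolding B by (rule bound)
    also have "\<dots> \<le> \<bar>C\<bar> * norm (B \<psi>) * norm \<psi>" by (intro mult_right_mono) auto
    finally have "norm (B \<psi>) * norm (B \<psi>) \<le> norm (B \<psi>) * (norm \<psi> * \<bar>C\<bar>)" by (simp add: power2_eq_square mult_ac)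
    then show ?thesis by (metis mult_le_cancel_left_pos norm_ge_zero order_le_less abs_ge_zero mult_nonneg_nonneg)
  qed
  have "bounded_linear B"
    by (rule bounded_linear_intro[of _ "\<bar>C\<bar>"]) (simp_all add: Badd Bsc scaleR_eq_scaleC Bb)
  then show thesis
    using that[of B] B Bsc by (simp add: bounded_operator_def)
qed

section \<open>The spectral theorem for bounded selfadjoint operators\<close>

lemma normal_functional_cong:
  assumes "normal_functional R \<Lambda>" "bounded_borel R g" "bounded_borel R h" "\<And>x. \<bar>x\<bar> \<le> R \<Longrightarrow> g x = h x"
  shows "\<Lambda> g = \<Lambda> h"
proof -
  obtain C where "\<And>x. \<bar>x\<bar> \<le> R \<Longrightarrow> cmod (g x) \<le> C" using assms(2) by (auto simp: bounded_borel_def)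
  then have "(\<lambda>n :: nat. \<Lambda> g) \<longlonglongrightarrow> \<Lambda> h"
    by (intro normal_functional_lim[OF assms(1), of "\<lambda>_. g" h C]) (use assms in auto)
  then show ?thesis by (simp add: LIMSEQ_const_iff)
qed

lemma indicator_Int_mult: "(indicator (A \<inter> B) :: real \<Rightarrow> complex) = (\<lambda>x. indicator A x * indicator B x)"
  by (auto simp: indicator_def)

context bounded_selfadjoint
begin

definition fcalc :: "(real \<Rightarrow> complex) \<Rightarrow> ell2 \<Rightarrow> ell2"
  where "fcalc g = (SOME B. bounded_operator B \<and> (\<forall>\<phi> \<psi>. cinner \<phi> (B \<psi>) = form g \<phi> \<psi>))"

lemma fcalc:
  assumes "bounded_borel R g"
  shows bounded_operator_fcalc: "bounded_operator (fcalc g)" and cinner_fcalc: "cinner \<phi> (fcalc g \<psi>) = form g \<phi> \<psi>"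
proof -
  obtain C where C: "\<And>x. \<bar>x\<bar> \<le> R \<Longrightarrow> cmod (g x) \<le> C" using assms by (auto simp: bounded_borel_def)
  obtain B where "bounded_operator B" "\<And>\<phi> \<psi>. cinner \<phi> (B \<psi>) = form g \<phi> \<psi>"
    using operator_of_form[of "form g" "4 * C"] form_add_left[OF assms] form_scaleC_left[OF assms]
      form_add_right[OF assms] form_scaleC_right[OF assms] form_bound[OF assms C] by blast
  then have "\<exists>B. bounded_operator B \<and> (\<forall>\<phi> \<psi>. cinner \<phi> (B \<psi>) = form g \<phi> \<psi>)" by blast
  from someI_ex[OF this] show "bounded_operator (fcalc g)" "cinner \<phi> (fcalc g \<psi>) = form g \<phi> \<psi>"
    unfolding fcalc_def by blast+
qed

text \<open>
  Multiplicativity of the calculus is reached in two steps, first with a power as one factor and then,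
  by the same uniqueness argument in the other factor, for two arbitrary bounded Borel functions.
\<close>

lemma form_mult_power:
  assumes "bounded_borel R h"
  shows "form (\<lambda>x. h x * of_real (x ^ n)) \<phi> \<psi> = form h ((A ^^ n) \<phi>) \<psi>"
proof (rule normal_functional_eqI_power[OF normal_functional_mult[OF normal_form bounded_borel_power] normal_form assms])
  fix m
  have "(\<lambda>x. complex_of_real (x ^ m) * complex_of_real (x ^ n)) = (\<lambda>x. of_real (x ^ (n + m)))"
    by (simp add: power_add mult.commute)
  then show "form (\<lambda>x. complex_of_real (x ^ m) * complex_of_real (x ^ n)) \<phi> \<psi> = form (\<lambda>x. of_real (x ^ m)) ((A ^^ n) \<phi>) \<psi>"
    by (simp only: form_power funpow_add o_apply funpow_A_sym)
qed

lemma form_mult: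
  assumes g: "bounded_borel R g" and h: "bounded_borel R h"
  shows "form (\<lambda>x. g x * h x) \<phi> \<psi> = form g \<phi> (fcalc h \<psi>)"
proof (rule normal_functional_eqI_power[OF normal_functional_mult[OF normal_form h] normal_form g])
  fix n
  have "(\<lambda>x. complex_of_real (x ^ n) * h x) = (\<lambda>x. h x * complex_of_real (x ^ n))" by (simp add: mult.commute)
  then have "form (\<lambda>x. complex_of_real (x ^ n) * h x) \<phi> \<psi> = cinner ((A ^^ n) \<phi>) (fcalc h \<psi>)"
    by (simp only: form_mult_power[OF h] cinner_fcalc[OF h])
  then show "form (\<lambda>x. complex_of_real (x ^ n) * h x) \<phi> \<psi> = form (\<lambda>x. of_real (x ^ n)) \<phi> (fcalc h \<psi>)"
    by (simp only: form_power funpow_A_sym)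
qed

lemma fcalc_mult:
  assumes g: "bounded_borel R g" and h: "bounded_borel R h"
  shows "fcalc (\<lambda>x. g x * h x) \<psi> = fcalc g (fcalc h \<psi>)"
  by (rule cinner_extI) (simp only: cinner_fcalc[OF bounded_borel_mult[OF g h]] cinner_fcalc[OF g] form_mult[OF g h])

definition E :: "real set \<Rightarrow> ell2 \<Rightarrow> ell2"
  where "E B = fcalc (indicator B)"

lemmas ind = bounded_borel_indicator[of _ R]

lemma E_form: "B \<in> sets borel \<Longrightarrow> cinner \<phi> (E B \<psi>) = form (indicator B) \<phi> \<psi>"
  unfolding E_def by (rule cinner_fcalc[OF ind])

lemma E_Int: "B \<in> sets borel \<Longrightarrow> C \<in> sets borel \<Longrightarrow> E (B \<inter> C) \<psi> = E B (E C \<psi>)"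
  unfolding E_def indicator_Int_mult by (rule fcalc_mult[OF ind ind])

lemma E_sym: "B \<in> sets borel \<Longrightarrow> cinner \<phi> (E B \<psi>) = cinner (E B \<phi>) \<psi>"
proof -
  assume B: "B \<in> sets borel"
  have "(\<lambda>x. cnj (indicator B x)) = (indicator B :: real \<Rightarrow> complex)" by (auto simp: indicator_def)
  then show ?thesis using form_cnj[OF ind[OF B], of \<phi> \<psi>] B
    by (subst (2) cinner_commute) (simp add: E_form)
qed

lemma E_disjoint_Un:
  assumes "B \<in> sets borel" "C \<in> sets borel" "B \<inter> C = {}"
  shows "E (B \<union> C) \<psi> = E B \<psi> + E C \<psi>"
proof (rule cinner_extI)
  fix \<phi>
  have "(indicator (B \<union> C) :: real \<Rightarrow> complex) = (\<lambda>x. 1 * indicator B x + indicator C x)"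
    using assms(3) by (auto simp: indicator_def fun_eq_iff)
  then show "cinner \<phi> (E (B \<union> C) \<psi>) = cinner \<phi> (E B \<psi> + E C \<psi>)"
    using normal_functional_lin[OF normal_form ind[OF assms(1)] ind[OF assms(2)], of 1 \<phi> \<psi>] assms
    by (simp add: E_form cinner_add_right)
qed

lemma E_empty: "E {} \<psi> = 0"
  using E_disjoint_Un[of "{}" "{}" \<psi>] by simp

lemma E_diag: "B \<in> sets borel \<Longrightarrow> cinner \<psi> (E B \<psi>) = of_real (measure (\<mu> \<psi>) B)"
proof -
  assume B: "B \<in> sets borel"
  have "cinner \<psi> (E B \<psi>) = (\<integral>x. indicator B x \<partial>\<mu> \<psi>)" by (simp add: E_form[OF B] form_diag[OF ind[OF B]])
  also have "(\<lambda>x. indicator B x :: complex) = (\<lambda>x. complex_of_real (indicator B x))" by (auto simp: indicator_def)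
  also have "(\<integral>x. complex_of_real (indicator B x) \<partial>\<mu> \<psi>) = of_real (\<integral>x. indicator B x \<partial>\<mu> \<psi>)"
    by (rule integral_complex_of_real)
  finally show ?thesis using B sets_eq_imp_space_eq[OF \<mu>(2)[of \<psi>]] by simp
qed

lemma E_norm: "B \<in> sets borel \<Longrightarrow> (norm (E B \<psi>))\<^sup>2 = measure (\<mu> \<psi>) B"
proof -
  assume B: "B \<in> sets borel"
  have "complex_of_real ((norm (E B \<psi>))\<^sup>2) = cinner \<psi> (E B (E B \<psi>))"
    unfolding cinner_self[symmetric] by (simp add: E_sym[OF B])
  also have "\<dots> = of_real (measure (\<mu> \<psi>) B)"
    using E_Int[OF B B, of \<psi>] E_diag[OF B] by simp
  finally show ?thesis by (simp only: of_real_eq_iff)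
qed

lemma E_full:
  assumes "r > R"
  shows "E {-r<..<r} \<psi> = \<psi>"
proof (rule cinner_extI)
  fix \<phi>
  have "form (indicator {-r<..<r}) \<phi> \<psi> = form (\<lambda>x. of_real (x ^ 0)) \<phi> \<psi>"
    by (rule normal_functional_cong[OF normal_form ind bounded_borel_power]) (use assms in \<open>auto simp: indicator_def\<close>)
  then show "cinner \<phi> (E {-r<..<r} \<psi>) = cinner \<phi> \<psi>" unfolding form_power by (simp add: E_form)
qed

lemma E_countably_additive:
  fixes B :: "nat \<Rightarrow> real set"
  assumes B: "range B \<subseteq> sets borel" "disjoint_family B"
  shows "(\<lambda>i. E (B i) \<psi>) sums E (\<Union>i. B i) \<psi>"
proof -
  interpret finite_measure "\<mu> \<psi>" by (rule \<mu>)
  define T where "T n = (\<Union>i. B i) - (\<Union>i<n. B i)" for n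
  have Bi[measurable]: "B i \<in> sets borel" for i using B(1) by auto
  have T[measurable]: "T n \<in> sets borel" for n unfolding T_def by measurable
  have step: "T n = B n \<union> T (Suc n)" "B n \<inter> T (Suc n) = {}" for n
  proof -
    have "x \<notin> B i" if "x \<in> B n" "i < n" for x i
      using that B(2) unfolding disjoint_family_on_def by (metis UNIV_I disjoint_iff less_irrefl)
    then show "T n = B n \<union> T (Suc n)" "B n \<inter> T (Suc n) = {}" by (auto simp: T_def less_Suc_eq)
  qed
  have "E (\<Union>i. B i) \<psi> = (\<Sum>i<n. E (B i) \<psi>) + E (T n) \<psi>" for n
  proof (induction n)
    case 0
    show ?case by (simp add: T_def)
  next
    case (Suc n)
    have "E (T n) \<psi> = E (B n) \<psi> + E (T (Suc n)) \<psi>"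
      unfolding step(1)[of n] using E_disjoint_Un[OF Bi T step(2)] .
    then show ?case unfolding Suc by simp
  qed
  then have S: "(\<Sum>i<n. E (B i) \<psi>) = E (\<Union>i. B i) \<psi> - E (T n) \<psi>" for n by (simp add: algebra_simps)
  have "(\<lambda>n. measure (\<mu> \<psi>) (T n)) \<longlonglongrightarrow> measure (\<mu> \<psi>) (\<Inter>n. T n)"
  proof (rule finite_Lim_measure_decseq)
    show "range T \<subseteq> sets (\<mu> \<psi>)" using T \<mu>(2) by auto
    show "decseq T" unfolding decseq_def T_def by auto
  qed
  moreover have "(\<Inter>n. T n) = {}" unfolding T_def by auto
  ultimately have "(\<lambda>n. (norm (E (T n) \<psi>))\<^sup>2) \<longlonglongrightarrow> 0" by (simp add: E_norm)
  then have "(\<lambda>n. sqrt ((norm (E (T n) \<psi>))\<^sup>2)) \<longlonglongrightarrow> sqrt 0" by (rule tendsto_real_sqrt)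
  then have "(\<lambda>n. E (T n) \<psi>) \<longlonglongrightarrow> 0" by (simp add: tendsto_norm_zero_iff)
  then have "(\<lambda>n. E (\<Union>i. B i) \<psi> - E (T n) \<psi>) \<longlonglongrightarrow> E (\<Union>i. B i) \<psi> - 0" by (intro tendsto_intros)
  then show ?thesis unfolding sums_def S by simp
qed

lemma pvm_E: "bounded_pvm E"
  unfolding bounded_pvm_def
proof (intro conjI ballI allI impI)
  fix B :: "real set" assume B: "B \<in> sets borel"
  show "orthogonal_projection (E B)"
    unfolding orthogonal_projection_def
  proof (intro conjI allI)
    show "bounded_operator (E B)" unfolding E_def by (rule bounded_operator_fcalc[OF ind[OF B]])
    show "E B \<circ> E B = E B" using E_Int[OF B B] by (auto simp: fun_eq_iff)
    show "cinner \<phi> (E B \<psi>) = cinner (E B \<phi>) \<psi>" for \<phi> \<psi> by (rule E_sym[OF B])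
  qed
next
  show "\<exists>r. \<forall>\<psi>. E {-r<..<r} \<psi> = \<psi>" by (intro exI[of _ "R + 1"] allI E_full) simp
qed (auto simp: E_empty E_Int fun_eq_iff intro: E_countably_additive)

lemma spectral_measure_E: "spectral_measure E \<psi> = \<mu> \<psi>"
proof -
  interpret finite_measure "\<mu> \<psi>" by (rule \<mu>)
  have "spectral_measure E \<psi> = measure_of UNIV (sets borel) (emeasure (\<mu> \<psi>))"
    unfolding spectral_measure_def
  proof (rule measure_of_eq)
    fix B :: "real set" assume "B \<in> sigma_sets UNIV (sets borel)"
    then have "B \<in> sets borel" using sets.sigma_sets_eq[of "borel :: real measure"] by simp
    then show "ennreal (Re (cinner \<psi> (E B \<psi>))) = emeasure (\<mu> \<psi>) B"
      by (simp add: E_diag emeasure_eq_measure)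
  qed simp
  also have "\<dots> = \<mu> \<psi>"
    using measure_of_of_measure[of "\<mu> \<psi>"] \<mu>(2)[of \<psi>] sets_eq_imp_space_eq[OF \<mu>(2)[of \<psi>]] by simp
  finally show ?thesis .
qed

lemma spectral_resolution_E: "spectral_resolution A E"
  unfolding spectral_resolution_def spectral_measure_E
  using pvm_E \<mu>(4)[where n = 1] by simp

end

lemma spectral_measure_pvm:
  assumes "bounded_pvm E"
  shows "sets (spectral_measure E \<psi>) = sets borel"
    and "B \<in> sets borel \<Longrightarrow> emeasure (spectral_measure E \<psi>) B = ennreal (Re (cinner \<psi> (E B \<psi>)))"
    and "B \<in> sets borel \<Longrightarrow> cinner \<psi> (E B \<psi>) = of_real ((norm (E B \<psi>))\<^sup>2)"
proof -
  note E = assms[unfolded bounded_pvm_def]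
  have op: "bounded_operator (E B)" "E B (E B \<psi>) = E B \<psi>" "cinner \<phi> (E B \<psi>) = cinner (E B \<phi>) \<psi>" if "B \<in> sets borel" for B \<phi> \<psi>
    using E that by (auto simp: orthogonal_projection_def fun_eq_iff)
  have nn: "cinner \<psi> (E B \<psi>) = of_real ((norm (E B \<psi>))\<^sup>2)" if "B \<in> sets borel" for B
    unfolding cinner_self[symmetric] using op(2,3)[OF that] by metis
  show "B \<in> sets borel \<Longrightarrow> cinner \<psi> (E B \<psi>) = of_real ((norm (E B \<psi>))\<^sup>2)" by (rule nn)
  show "sets (spectral_measure E \<psi>) = sets borel"
    unfolding spectral_measure_def using sets.sigma_sets_eq[of "borel :: real measure"] by simp
  assume B: "B \<in> sets borel"
  have ss: "sigma_sets UNIV (sets (borel :: real measure)) = sets borel" using sets.sigma_sets_eq[of "borel :: real measure"] by simp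
  show "emeasure (spectral_measure E \<psi>) B = ennreal (Re (cinner \<psi> (E B \<psi>)))"
  proof (rule emeasure_measure_of[OF spectral_measure_def])
    show "sets borel \<subseteq> Pow (UNIV :: real set)" by simp
    show "B \<in> sets (spectral_measure E \<psi>)" unfolding spectral_measure_def using ss B by simp
    show "positive (sets (spectral_measure E \<psi>)) (\<lambda>B. ennreal (Re (cinner \<psi> (E B \<psi>))))"
      using E by (simp add: positive_def)
    show "countably_additive (sets (spectral_measure E \<psi>)) (\<lambda>B. ennreal (Re (cinner \<psi> (E B \<psi>))))"
      unfolding countably_additive_def
    proof (intro allI impI)
      fix C :: "nat \<Rightarrow> real set"
      assume C: "range C \<subseteq> sets (spectral_measure E \<psi>)" "disjoint_family C"
      have C': "range C \<subseteq> sets borel" using C(1) unfolding spectral_measure_def by (simp add: ss)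
      have "(\<lambda>i. E (C i) \<psi>) sums E (\<Union>i. C i) \<psi>" using E C' C(2) by blast
      then have "(\<lambda>i. inner \<psi> (E (C i) \<psi>)) sums inner \<psi> (E (\<Union>i. C i) \<psi>)"
        by (rule bounded_linear.sums[OF bounded_linear_inner_right])
      moreover have "0 \<le> inner \<psi> (E (C i) \<psi>)" for i
        using nn[of "C i"] C' by (auto simp: inner_ell2_def)
      ultimately show "(\<Sum>i. ennreal (Re (cinner \<psi> (E (C i) \<psi>)))) = ennreal (Re (cinner \<psi> (E (\<Union> (range C)) \<psi>)))"
        unfolding inner_ell2_def[symmetric] by (intro suminf_ennreal_eq) auto
    qed
  qed
qed

context bounded_selfadjoint
begin

text \<open>
  Any spectral resolution \<open>F\<close> of \<open>A\<close> must have the moments of \<open>A\<close>.  The hypothesis gives the first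
  moment only.  Multiplicativity of \<open>F\<close> on intersections makes the form of \<open>F\<close> multiplicative
  against indicators (facts 1 and 2), hence against the identity function (fact 3), and induction
  yields all powers.  Two normal functionals that agree on powers agree.
\<close>

lemma spectral_measure_unique:
  fixes g :: "real \<Rightarrow> complex"
  assumes F: "spectral_resolution A F" and g: "g \<in> borel_measurable borel" "bounded (range g)"
  shows "(\<integral>x. g x \<partial>spectral_measure F \<psi>) = (\<integral>x. g x \<partial>\<mu> \<psi>)"
proof -
  have pvm: "bounded_pvm F" and FA: "\<And>\<psi>. cinner \<psi> (A \<psi>) = complex_of_real (\<integral>x. x \<partial>spectral_measure F \<psi>)"
    using F by (auto simp: spectral_resolution_def)
  note FF = pvm[unfolded bounded_pvm_def]
  have op: "bounded_operator (F B)" "F B (F B \<psi>) = F B \<psi>" "cinner \<phi> (F B \<psi>) = cinner (F B \<phi>) \<psi>" if "B \<in> sets borel" for B \<phi> \<psi>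
    using FF that by (auto simp: orthogonal_projection_def fun_eq_iff)
  have Fint: "F (B \<inter> C) \<psi> = F B (F C \<psi>)" if "B \<in> sets borel" "C \<in> sets borel" for B C \<psi>
    using FF that by (metis o_apply)
  obtain r where r: "\<And>\<psi>. F {-r<..<r} \<psi> = \<psi>" using FF by blast
  define \<nu> where "\<nu> = spectral_measure F"
  define R' where "R' = max r R"
  note sm = spectral_measure_pvm[OF pvm, folded \<nu>_def]
  have out: "F B \<psi> = 0" if "B \<in> sets borel" "B \<inter> {-r<..<r} = {}" for B \<psi>
    using Fint[OF that(1), of "{-r<..<r}" \<psi>] that(2) FF by (simp add: r)
  have FU: "F UNIV \<psi> = \<psi>" for \<psi>
    using Fint[of UNIV "{-r<..<r}" \<psi>] by (simp add: r)
  interpret N: spectral_family \<nu> R'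
  proof (rule spectral_family.intro)
    show "finite_measure (\<nu> \<psi>)" for \<psi>
    proof (rule finite_measureI)
      have "space (\<nu> \<psi>) = UNIV" using sets_eq_imp_space_eq[OF sm(1)[of \<psi>]] by simp
      then show "emeasure (\<nu> \<psi>) (space (\<nu> \<psi>)) \<noteq> \<infinity>" by (simp add: sm(2))
    qed
    show "sets (\<nu> \<psi>) = sets borel" for \<psi> by (rule sm(1))
    show "emeasure (\<nu> \<psi>) (- {-R'..R'}) = 0" for \<psi>
    proof -
      have "F (- {-R'..R'}) \<psi> = 0" by (rule out) (auto simp: R'_def)
      then show ?thesis by (simp add: sm(2))
    qed
  qed
  interpret M: spectral_family \<mu> R'
  proof (rule spectral_family.intro)
    show "emeasure (\<mu> \<psi>) (- {-R'..R'}) = 0" for \<psi>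
    proof -
      have "emeasure (\<mu> \<psi>) (- {-R'..R'}) \<le> emeasure (\<mu> \<psi>) (- {-R..R})"
        by (rule emeasure_mono) (auto simp: R'_def \<mu>(2))
      then show ?thesis using \<mu>(3) by simp
    qed
  qed (rule \<mu>)+
  note bi = bounded_borel_indicator[of _ R']
  have id: "bounded_borel R' (\<lambda>x. of_real x)" using bounded_borel_power[of R' 1] by simp
  have int_ind: "(\<integral>x. indicator B x \<partial>\<nu> \<psi>) = cinner \<psi> (F B \<psi>)" if B: "B \<in> sets borel" for B \<psi>
  proof -
    have "(\<lambda>x. indicator B x :: complex) = (\<lambda>x. complex_of_real (indicator B x))" by (auto simp: indicator_def)
    then have "(\<integral>x. (indicator B x :: complex) \<partial>\<nu> \<psi>) = of_real (measure (\<nu> \<psi>) B)"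
      using sets_eq_imp_space_eq[OF sm(1)[of \<psi>]] by (simp add: integral_complex_of_real)
    also have "measure (\<nu> \<psi>) B = Re (cinner \<psi> (F B \<psi>))"
      using sm(2)[OF B, of \<psi>] sm(3)[OF B, of \<psi>] by (simp add: measure_def)
    finally show ?thesis using sm(3)[OF B, of \<psi>] by simp
  qed
  have form_ind: "N.form (indicator B) \<phi> \<psi> = cinner \<phi> (F B \<psi>)" if B: "B \<in> sets borel" for B \<phi> \<psi>
    unfolding N.form_def int_ind[OF B] by (rule polarize_form) (simp_all add: bounded_operator_simps[OF op(1)[OF B]])
  have form_id: "N.form (\<lambda>x. of_real x) \<phi> \<psi> = cinner \<phi> (A \<psi>)" for \<phi> \<psi>
  proof -
    have "(\<integral>x. of_real x \<partial>\<nu> \<psi>) = cinner \<psi> (A \<psi>)" for \<psi>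
      unfolding FA \<nu>_def by (rule integral_complex_of_real)
    then show ?thesis unfolding N.form_def by (simp add: polarize_form A_simps)
  qed
  have 1: "N.form g (F B \<phi>) \<psi> = N.form g \<phi> (F B \<psi>)" if B: "B \<in> sets borel" and g: "bounded_borel R' g" for B g \<phi> \<psi>
  proof (rule normal_functional_eqI_indicator[OF N.normal_form N.normal_form g])
    fix C :: "real set" assume C: "C \<in> sets borel"
    show "N.form (indicator C) (F B \<phi>) \<psi> = N.form (indicator C) \<phi> (F B \<psi>)"
      unfolding form_ind[OF C] using op(3)[OF B] Fint[OF B C] Fint[OF C B] by (metis Int_commute)
  qed
  have 2: "N.form (\<lambda>x. g x * indicator B x) \<phi> \<psi> = N.form g \<phi> (F B \<psi>)" if B: "B \<in> sets borel" and g: "bounded_borel R' g" for B g \<phi> \<psi>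
  proof (rule normal_functional_eqI_indicator[OF normal_functional_mult[OF N.normal_form bi[OF B]] N.normal_form g])
    fix C :: "real set" assume C: "C \<in> sets borel"
    have "C \<inter> B \<in> sets borel" using B C by simp
    then show "N.form (\<lambda>x. indicator C x * indicator B x) \<phi> \<psi> = N.form (indicator C) \<phi> (F B \<psi>)"
      unfolding indicator_Int_mult[symmetric] using form_ind Fint[OF C B] C by simp
  qed
  have 3: "N.form g \<phi> (A \<psi>) = N.form (\<lambda>x. g x * of_real x) \<phi> \<psi>" if g: "bounded_borel R' g" for g \<phi> \<psi>
  proof (rule normal_functional_eqI_indicator[OF N.normal_form normal_functional_mult[OF N.normal_form id] g])
    fix B :: "real set" assume B: "B \<in> sets borel"
    have "N.form (indicator B) \<phi> (A \<psi>) = cinner (F B \<phi>) (A \<psi>)" by (simp add: form_ind[OF B] op(3)[OF B])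
    also have "\<dots> = N.form (\<lambda>x. of_real x) \<phi> (F B \<psi>)" by (simp add: form_id[symmetric] 1[OF B id])
    also have "\<dots> = N.form (\<lambda>x. of_real x * indicator B x) \<phi> \<psi>" by (rule 2[OF B id, symmetric])
    finally show "N.form (indicator B) \<phi> (A \<psi>) = N.form (\<lambda>x. indicator B x * of_real x) \<phi> \<psi>" by (simp add: mult.commute)
  qed
  have pow: "N.form (\<lambda>x. of_real (x ^ n)) \<phi> \<psi> = cinner \<phi> ((A ^^ n) \<psi>)" for n \<phi> \<psi>
  proof (induction n arbitrary: \<psi>)
    case 0
    have "(\<lambda>x. complex_of_real (x ^ 0)) = indicator UNIV" by (auto simp: indicator_def)
    then show ?case using form_ind[of UNIV \<phi> \<psi>] by (simp add: FU)
  next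
    case (Suc n)
    have "(\<lambda>x. complex_of_real (x ^ Suc n)) = (\<lambda>x. of_real (x ^ n) * of_real x)" by (simp add: mult.commute)
    then have "N.form (\<lambda>x. of_real (x ^ Suc n)) \<phi> \<psi> = N.form (\<lambda>x. of_real (x ^ n)) \<phi> (A \<psi>)"
      by (simp only: 3[OF bounded_borel_power])
    then show ?case by (simp only: Suc funpow_swap1 funpow.simps o_apply)
  qed
  have diag: "N.form g \<psi> \<psi> = (\<integral>x. g x \<partial>\<nu> \<psi>)" if g: "bounded_borel R' g" for g
    by (rule normal_functional_eqI_indicator[OF N.normal_form N.normal_integral g]) (simp add: form_ind int_ind)
  have "(\<integral>x. g x \<partial>\<nu> \<psi>) = (\<integral>x. g x \<partial>\<mu> \<psi>)"
    by (rule normal_functional_eqI_power[OF N.normal_integral M.normal_integral bounded_borel_of_bounded[OF g]])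
      (simp only: diag[OF bounded_borel_power, symmetric] pow integral_power)
  then show ?thesis by (simp add: \<nu>_def)
qed

text \<open>
  The definite description in the Borel calculus is met by \<open>fcalc g\<close>, and only by it since an operator is
  determined by its quadratic form.
\<close>

theorem cinner_borel_calculus:
  assumes g: "g \<in> borel_measurable borel" "bounded (range g)"
  shows "cinner \<psi> (borel_calculus g A \<psi>) = (\<integral>x. g x \<partial>\<mu> \<psi>)"
proof -
  have bb: "bounded_borel R g" by (rule bounded_borel_of_bounded[OF g])
  have "borel_calculus g A = fcalc g"
    unfolding borel_calculus_def
  proof (rule the_equality)
    show "bounded_operator (fcalc g) \<and> (\<exists>E. spectral_resolution A E \<and> (\<forall>\<psi>. cinner \<psi> (fcalc g \<psi>) = (\<integral>x. g x \<partial>spectral_measure E \<psi>)))"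
      using bounded_operator_fcalc[OF bb] spectral_resolution_E
      by (auto intro!: exI[of _ E] simp: spectral_measure_E cinner_fcalc[OF bb] form_diag[OF bb])
    fix B
    assume B: "bounded_operator B \<and> (\<exists>E. spectral_resolution A E \<and> (\<forall>\<psi>. cinner \<psi> (B \<psi>) = (\<integral>x. g x \<partial>spectral_measure E \<psi>)))"
    then show "B = fcalc g"
      using bounded_operator_fcalc[OF bb] spectral_measure_unique[OF _ g]
      by (intro operator_eqI) (auto simp: cinner_fcalc[OF bb] form_diag[OF bb])
  qed
  then show ?thesis by (simp add: cinner_fcalc[OF bb] form_diag[OF bb])
qed

end

section \<open>The density of states and its moments\<close>

text \<open>
  The operator on arbitrary two-sided sequences.  Powers applied to \<open>site0\<close> stay finitely
  supported, so moments are finite computations and need no Hilbert space.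
\<close>

definition jacobi :: "(int \<Rightarrow> real) \<Rightarrow> (int \<Rightarrow> real) \<Rightarrow> int \<Rightarrow> real"
  where "jacobi v u n = u (n + 1) + u (n - 1) + v n * u n"

definition site0 :: "int \<Rightarrow> real"
  where "site0 n = (if n = 0 then 1 else 0)"

definition moment :: "(int \<Rightarrow> real) \<Rightarrow> nat \<Rightarrow> real"
  where "moment v k = (jacobi v ^^ k) site0 0"

definition potential :: "circle \<Rightarrow> (circle \<Rightarrow>\<^sub>C real) \<Rightarrow> circle \<Rightarrow> int \<Rightarrow> real"
  where "potential \<alpha> f \<omega> n = apply_bcontfun f (\<omega> + circle_scale n \<alpha>)"

lemma ell2_nth_schrodinger:
  "ell2_nth (schrodinger \<alpha> f \<omega> \<psi>) n = ell2_nth \<psi> (n + 1) + ell2_nth \<psi> (n - 1) + of_real (potential \<alpha> f \<omega> n) * ell2_nth \<psi> n"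
  by (simp add: schrodinger.rep_eq potential_def)

lemma schrodinger_power_delta:
  "ell2_nth ((schrodinger \<alpha> f \<omega> ^^ k) (delta 0)) n = of_real ((jacobi (potential \<alpha> f \<omega>) ^^ k) site0 n)"
proof (induction k arbitrary: n)
  case 0
  show ?case by (simp add: ell2_nth_delta site0_def)
next
  case (Suc k)
  show ?case by (simp add: ell2_nth_schrodinger Suc jacobi_def)
qed

lemma ell2_nth_add: "ell2_nth (\<phi> + \<psi>) n = ell2_nth \<phi> n + ell2_nth \<psi> n"
  by (simp add: plus_ell2.rep_eq)

lemma ell2_nth_scaleC: "ell2_nth (scaleC c \<psi>) n = c * ell2_nth \<psi> n"
  by (simp add: scaleC.rep_eq)

lift_definition shift :: "int \<Rightarrow> ell2 \<Rightarrow> ell2" is "\<lambda>k \<psi> n. \<psi> (n + k)"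
  by (rule sq_summable_shift)

lift_definition mult_potential :: "circle \<Rightarrow> (circle \<Rightarrow>\<^sub>C real) \<Rightarrow> circle \<Rightarrow> ell2 \<Rightarrow> ell2"
  is "\<lambda>\<alpha> f \<omega> \<psi> n. complex_of_real (potential \<alpha> f \<omega> n) * \<psi> n"
proof -
  fix \<alpha> \<omega> :: circle and f :: "circle \<Rightarrow>\<^sub>C real" and \<psi> :: "int \<Rightarrow> complex"
  assume "sq_summable \<psi>"
  then show "sq_summable (\<lambda>n. complex_of_real (potential \<alpha> f \<omega> n) * \<psi> n)"
    by (rule sq_summable_mult_bounded[where K = "norm f"]) (use norm_bounded[of f] in \<open>auto simp: potential_def\<close>)
qed

lemma ell2_nth_shift: "ell2_nth (shift k \<psi>) n = ell2_nth \<psi> (n + k)"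
  by (simp add: shift.rep_eq)

lemma ell2_nth_mult_potential: "ell2_nth (mult_potential \<alpha> f \<omega> \<psi>) n = of_real (potential \<alpha> f \<omega> n) * ell2_nth \<psi> n"
  by (simp add: mult_potential.rep_eq)

lemma schrodinger_decomp: "schrodinger \<alpha> f \<omega> \<psi> = shift 1 \<psi> + shift (-1) \<psi> + mult_potential \<alpha> f \<omega> \<psi>"
  by (rule ell2_eqI) (simp add: ell2_nth_schrodinger ell2_nth_add ell2_nth_shift ell2_nth_mult_potential)

lemma bij_int_shift: "bij_betw (\<lambda>n :: int. n + k) UNIV UNIV"
  by (rule bij_betw_byWitness[where f' = "\<lambda>n. n - k"]) auto

lemma norm_shift: "norm (shift k \<psi>) = norm \<psi>"
proof -
  have "(norm (shift k \<psi>))\<^sup>2 = (norm \<psi>)\<^sup>2"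
    unfolding norm_sq_infsum ell2_nth_shift
    by (rule infsum_reindex_bij_betw[OF bij_int_shift, of "\<lambda>n. (cmod (ell2_nth \<psi> n))\<^sup>2" k])
  then show ?thesis by (simp add: power2_eq_iff_nonneg)
qed

lemma norm_mult_potential: "norm (mult_potential \<alpha> f \<omega> \<psi>) \<le> norm f * norm \<psi>"
proof (rule power2_le_imp_le)
  have "(norm (mult_potential \<alpha> f \<omega> \<psi>))\<^sup>2 \<le> (\<Sum>\<^sub>\<infinity>n. (norm f)\<^sup>2 * (cmod (ell2_nth \<psi> n))\<^sup>2)"
    unfolding norm_sq_infsum
  proof (rule infsum_mono)
    show "(cmod (ell2_nth (mult_potential \<alpha> f \<omega> \<psi>) n))\<^sup>2 \<le> (norm f)\<^sup>2 * (cmod (ell2_nth \<psi> n))\<^sup>2" for n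
    proof -
      have "\<bar>potential \<alpha> f \<omega> n\<bar> \<le> norm f" unfolding potential_def using norm_bounded[of f] by (simp only: real_norm_def)
      then have "\<bar>potential \<alpha> f \<omega> n\<bar>\<^sup>2 \<le> (norm f)\<^sup>2" by (intro power_mono) auto
      then show ?thesis by (simp add: ell2_nth_mult_potential norm_mult power_mult_distrib mult_right_mono)
    qed
  qed (auto intro!: summable_on_cmult_right norm_sq_summable)
  also have "\<dots> = (norm f * norm \<psi>)\<^sup>2"
    unfolding power_mult_distrib norm_sq_infsum[of \<psi>] by (rule infsum_cmult_right) (use norm_sq_summable in auto)
  finally show "(norm (mult_potential \<alpha> f \<omega> \<psi>))\<^sup>2 \<le> (norm f * norm \<psi>)\<^sup>2" .
qed simp

lemma cinner_nth: "cinner \<phi> \<psi> = (\<Sum>\<^sub>\<infinity>n. cnj (ell2_nth \<phi> n) * ell2_nth \<psi> n)"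
  by (simp add: cinner.rep_eq)

lemma cinner_shift: "cinner \<phi> (shift k \<psi>) = cinner (shift (- k) \<phi>) \<psi>"
  unfolding cinner_nth ell2_nth_shift
  using infsum_reindex_bij_betw[OF bij_int_shift, of "\<lambda>n. cnj (ell2_nth \<phi> (n + - k)) * ell2_nth \<psi> n" k] by simp

lemma cinner_mult_potential: "cinner \<phi> (mult_potential \<alpha> f \<omega> \<psi>) = cinner (mult_potential \<alpha> f \<omega> \<phi>) \<psi>"
  unfolding cinner_nth ell2_nth_mult_potential by (simp add: mult_ac)

lemma selfadjoint_schrodinger: "bounded_selfadjoint (schrodinger \<alpha> f \<omega>) (norm f + 2)"
proof
  let ?H = "schrodinger \<alpha> f \<omega>"
  have add: "?H (\<phi> + \<psi>) = ?H \<phi> + ?H \<psi>" for \<phi> \<psi>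
    by (rule ell2_eqI) (simp add: ell2_nth_schrodinger ell2_nth_add algebra_simps)
  have sc: "?H (scaleC c \<psi>) = scaleC c (?H \<psi>)" for c \<psi>
    by (rule ell2_eqI) (simp add: ell2_nth_schrodinger ell2_nth_scaleC algebra_simps)
  show b: "norm (?H \<psi>) \<le> (norm f + 2) * norm \<psi>" for \<psi>
  proof -
    have "norm (?H \<psi>) \<le> norm (shift 1 \<psi>) + norm (shift (-1) \<psi>) + norm (mult_potential \<alpha> f \<omega> \<psi>)"
      unfolding schrodinger_decomp by (intro order_trans[OF norm_triangle_ineq] add_mono norm_triangle_ineq order_refl)
    then show ?thesis using norm_mult_potential[of \<alpha> f \<omega> \<psi>] by (simp add: norm_shift algebra_simps)
  qed
  have "bounded_linear ?H"
    by (rule bounded_linear_intro[of _ "norm f + 2"]) (simp_all add: add sc scaleR_eq_scaleC b[unfolded mult.commute[of _ "norm _"]])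
  then show "bounded_operator ?H" using sc by (simp add: bounded_operator_def)
  show "cinner \<phi> (?H \<psi>) = cinner (?H \<phi>) \<psi>" for \<phi> \<psi>
    unfolding schrodinger_decomp cinner_add_left cinner_add_right
    using cinner_shift[of \<phi> 1 \<psi>] cinner_shift[of \<phi> "-1" \<psi>] cinner_mult_potential by simp
  show "0 < norm f + 2" by (simp add: add_nonneg_pos)
qed

lemma continuous_translate_circle: "continuous_on UNIV (\<lambda>\<omega> :: circle. \<omega> + c)"
proof -
  obtain c' where c: "c = to_circle c'" by (metis Quotient3_abs_rep Quotient3_circle)
  have "open ((\<lambda>\<omega>. \<omega> + c) -` U)" if "open U" for U :: "circle set"
  proof -
    have "to_circle -` ((\<lambda>\<omega>. \<omega> + c) -` U) = (\<lambda>x. x + c') -` (to_circle -` U)"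
      by (auto simp: c plus_circle.abs_eq)
    moreover have "open (to_circle -` U)" using that by (simp add: open_circle_def)
    ultimately show ?thesis unfolding open_circle_def
      by (auto intro!: open_vimage continuous_intros)
  qed
  then show ?thesis by (simp add: continuous_on_open_vimage)
qed

lemma continuous_potential: "continuous_on UNIV (\<lambda>\<omega>. potential \<alpha> f \<omega> n)"
  unfolding potential_def
  by (rule continuous_on_compose2[OF _ continuous_translate_circle, of UNIV "apply_bcontfun f"]) auto

lemma continuous_moment: "continuous_on UNIV (\<lambda>\<omega>. (jacobi (potential \<alpha> f \<omega>) ^^ k) site0 n)"
proof (induction k arbitrary: n)
  case (Suc k)
  then show ?case unfolding funpow.simps o_apply jacobi_def
    by (intro continuous_intros continuous_potential)
qed simp

lemma to_circle_measurable: "to_circle \<in> restrict_space lborel {0..<1} \<rightarrow>\<^sub>M borel"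
  by (rule measurable_restrict_space1) (simp add: borel_measurable_continuous_onI continuous_on_to_circle)

lemma prob_circle: "prob_space circle_measure"
  unfolding circle_measure_def
proof (rule prob_space.prob_space_distr[OF _ to_circle_measurable])
  show "prob_space (restrict_space lborel {0..<1::real})"
    by (rule prob_spaceI) (simp add: emeasure_restrict_space space_restrict_space)
qed

lemma sets_circle_measure: "sets circle_measure = sets borel"
  by (simp add: circle_measure_def)

lemma integral_circle:
  fixes h :: "circle \<Rightarrow> real"
  assumes "h \<in> borel_measurable borel"
  shows "(\<integral>\<omega>. h \<omega> \<partial>circle_measure) = (\<integral>x. indicator {0..<1} x * h (to_circle x) \<partial>lborel)"
proof -
  have "(\<integral>\<omega>. h \<omega> \<partial>circle_measure) = (\<integral>x. h (to_circle x) \<partial>restrict_space lborel {0..<1})"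
    unfolding circle_measure_def by (rule integral_distr[OF to_circle_measurable assms])
  also have "\<dots> = (\<integral>x. indicator {0..<1} x * h (to_circle x) \<partial>lborel)"
    by (subst integral_restrict_space) auto
  finally show ?thesis .
qed

definition site_measure :: "circle \<Rightarrow> (circle \<Rightarrow>\<^sub>C real) \<Rightarrow> circle \<Rightarrow> real measure"
  where "site_measure \<alpha> f \<omega> = bounded_selfadjoint.\<mu> (schrodinger \<alpha> f \<omega>) (norm f + 2) (delta 0)"

lemma site_measure:
  shows sets_site: "sets (site_measure \<alpha> f \<omega>) = sets borel"
    and prob_site: "prob_space (site_measure \<alpha> f \<omega>)"
    and supp_site: "emeasure (site_measure \<alpha> f \<omega>) (- {- (norm f + 2)..norm f + 2}) = 0"
    and power_site: "(\<integral>x. complex_of_real (x ^ n) \<partial>site_measure \<alpha> f \<omega>) = of_real (moment (potential \<alpha> f \<omega>) n)"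
    and normal_site: "normal_functional (norm f + 2) (\<lambda>g. \<integral>x. g x \<partial>site_measure \<alpha> f \<omega>)"
    and calculus_site: "g \<in> borel_measurable borel \<Longrightarrow> bounded (range g) \<Longrightarrow>
       cinner (delta 0) (borel_calculus g (schrodinger \<alpha> f \<omega>) (delta 0)) = (\<integral>x. g x \<partial>site_measure \<alpha> f \<omega>)"
proof -
  interpret bounded_selfadjoint "schrodinger \<alpha> f \<omega>" "norm f + 2" by (rule selfadjoint_schrodinger)
  have eq: "site_measure \<alpha> f \<omega> = \<mu> (delta 0)" by (simp add: site_measure_def)
  show s: "sets (site_measure \<alpha> f \<omega>) = sets borel" unfolding eq by (rule \<mu>)
  show "emeasure (site_measure \<alpha> f \<omega>) (- {- (norm f + 2)..norm f + 2}) = 0" unfolding eq by (rule \<mu>)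
  show pw: "(\<integral>x. complex_of_real (x ^ n) \<partial>site_measure \<alpha> f \<omega>) = of_real (moment (potential \<alpha> f \<omega>) n)" for n
    unfolding eq integral_power moment_def by (simp add: cinner_delta schrodinger_power_delta)
  show "normal_functional (norm f + 2) (\<lambda>g. \<integral>x. g x \<partial>site_measure \<alpha> f \<omega>)" unfolding eq by (rule normal_integral)
  show "g \<in> borel_measurable borel \<Longrightarrow> bounded (range g) \<Longrightarrow>
       cinner (delta 0) (borel_calculus g (schrodinger \<alpha> f \<omega>) (delta 0)) = (\<integral>x. g x \<partial>site_measure \<alpha> f \<omega>)"
    unfolding eq by (rule cinner_borel_calculus)
  interpret finite_measure "site_measure \<alpha> f \<omega>" unfolding eq by (rule \<mu>)
  have "complex_of_real (measure (site_measure \<alpha> f \<omega>) (space (site_measure \<alpha> f \<omega>))) = 1"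
    using pw[of 0] by (simp add: moment_def site0_def scaleR_conv_of_real)
  then have "measure (site_measure \<alpha> f \<omega>) (space (site_measure \<alpha> f \<omega>)) = 1" by (metis of_real_eq_1_iff)
  then show "prob_space (site_measure \<alpha> f \<omega>)" by (intro prob_spaceI) (simp add: emeasure_eq_measure)
qed

lemma measurable_site_integral:
  assumes "bounded_borel (norm f + 2) g"
  shows "(\<lambda>\<omega>. \<integral>x. g x \<partial>site_measure \<alpha> f \<omega>) \<in> borel_measurable borel"
proof -
  let ?R = "norm f + 2"
  obtain C where gC: "g \<in> borel_measurable borel" "\<And>x. \<bar>x\<bar> \<le> ?R \<Longrightarrow> cmod (g x) \<le> C" using assms by (auto simp: bounded_borel_def)
  have "bounded_borel ?R g \<and> (\<lambda>\<omega>. \<integral>x. g x \<partial>site_measure \<alpha> f \<omega>) \<in> borel_measurable borel"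
  proof (rule bounded_borel_induct[OF gC, where P = "\<lambda>g. bounded_borel ?R g \<and> (\<lambda>\<omega>. \<integral>x. g x \<partial>site_measure \<alpha> f \<omega>) \<in> borel_measurable borel"])
    fix n :: nat
    show "bounded_borel ?R (\<lambda>x. of_real (x ^ n)) \<and> (\<lambda>\<omega>. \<integral>x. complex_of_real (x ^ n) \<partial>site_measure \<alpha> f \<omega>) \<in> borel_measurable borel"
      unfolding power_site moment_def
      by (intro conjI bounded_borel_power borel_measurable_continuous_onI continuous_on_of_real continuous_moment)
  next
    fix c g h
    assume gh: "bounded_borel ?R g \<and> (\<lambda>\<omega>. \<integral>x. g x \<partial>site_measure \<alpha> f \<omega>) \<in> borel_measurable borel"
      "bounded_borel ?R h \<and> (\<lambda>\<omega>. \<integral>x. h x \<partial>site_measure \<alpha> f \<omega>) \<in> borel_measurable borel"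
    then show "bounded_borel ?R (\<lambda>x. c * g x + h x) \<and> (\<lambda>\<omega>. \<integral>x. c * g x + h x \<partial>site_measure \<alpha> f \<omega>) \<in> borel_measurable borel"
      using normal_functional_lin[OF normal_site] by (auto intro: bounded_borel_lin)
  next
    fix F h B
    assume lim: "\<And>n :: nat. bounded_borel ?R (F n) \<and> (\<lambda>\<omega>. \<integral>x. F n x \<partial>site_measure \<alpha> f \<omega>) \<in> borel_measurable borel"
       "\<And>n :: nat. F n \<in> borel_measurable borel" "h \<in> borel_measurable borel"
       "\<And>n x. \<bar>x\<bar> \<le> ?R \<Longrightarrow> cmod (F n x) \<le> B" "\<And>x. \<bar>x\<bar> \<le> ?R \<Longrightarrow> (\<lambda>n. F n x) \<longlonglongrightarrow> h x"
    have h: "bounded_borel ?R h" using lim(3,4,5) by (rule bounded_borel_lim)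
    have "(\<lambda>n. \<integral>x. F n x \<partial>site_measure \<alpha> f \<omega>) \<longlonglongrightarrow> (\<integral>x. h x \<partial>site_measure \<alpha> f \<omega>)" for \<omega>
      by (rule normal_functional_lim[OF normal_site _ h lim(4,5)]) (use lim(1) in auto)
    then have "(\<lambda>\<omega>. \<integral>x. h x \<partial>site_measure \<alpha> f \<omega>) \<in> borel_measurable borel"
      by (rule borel_measurable_LIMSEQ_metric[rotated]) (rule conjunct2[OF lim(1)])
    then show "bounded_borel ?R h \<and> (\<lambda>\<omega>. \<integral>x. h x \<partial>site_measure \<alpha> f \<omega>) \<in> borel_measurable borel" using h by blast
  qed
  then show ?thesis by simp
qed

text \<open>
  Measurability in \<open>\<omega>\<close> is clear for moments, which are continuous, and passes to indicators
  by induction over bounded Borel functions.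
\<close>

lemma prob_measurable_site: "site_measure \<alpha> f \<in> circle_measure \<rightarrow>\<^sub>M subprob_algebra borel"
proof (rule measurable_subprob_algebra)
  fix \<omega>
  show "subprob_space (site_measure \<alpha> f \<omega>)" by (rule prob_space_imp_subprob_space[OF prob_site])
  show "sets (site_measure \<alpha> f \<omega>) = sets borel" by (rule sets_site)
next
  fix A :: "real set" assume A: "A \<in> sets borel"
  have eq: "emeasure (site_measure \<alpha> f \<omega>) A = ennreal (Re (\<integral>x. indicator A x \<partial>site_measure \<alpha> f \<omega>))" for \<omega>
  proof -
    interpret prob_space "site_measure \<alpha> f \<omega>" by (rule prob_site)
    have "(\<lambda>x. indicator A x :: complex) = (\<lambda>x. complex_of_real (indicator A x))" by (auto simp: indicator_def)
    then show ?thesis using A sets_eq_imp_space_eq[OF sets_site[of \<alpha> f \<omega>]]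
      by (simp add: integral_complex_of_real emeasure_eq_measure)
  qed
  have "(\<lambda>\<omega>. ennreal (Re (\<integral>x. indicator A x \<partial>site_measure \<alpha> f \<omega>))) \<in> borel_measurable borel"
    using measurable_site_integral[OF bounded_borel_indicator[OF A], where f = f and \<alpha> = \<alpha>] by measurable
  then show "(\<lambda>\<omega>. emeasure (site_measure \<alpha> f \<omega>) A) \<in> borel_measurable circle_measure"
    unfolding eq by (simp add: measurable_cong_sets[OF sets_circle_measure refl])
qed

text \<open>
  The measure is the average of the spectral measures of \<open>delta 0\<close>, that is, the monadic bind of
  the normalized Lebesgue measure of the circle with the kernel \<open>\<omega> \<mapsto> site_measure \<alpha> f \<omega>\<close>.
\<close>

theorem density_of_states:
  shows prob_dos: "prob_space (density_of_states \<alpha> f)"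
    and sets_dos: "sets (density_of_states \<alpha> f) = sets borel"
    and supp_dos: "emeasure (density_of_states \<alpha> f) (- {- (norm f + 2)..norm f + 2}) = 0"
    and power_dos: "(\<integral>x. x ^ n \<partial>density_of_states \<alpha> f) = (\<integral>\<omega>. moment (potential \<alpha> f \<omega>) n \<partial>circle_measure)"
proof -
  let ?R = "norm f + 2"
  define k where "k = circle_measure \<bind> site_measure \<alpha> f"
  interpret C: prob_space circle_measure by (rule prob_circle)
  note ms = prob_measurable_site[of \<alpha> f]
  have ne: "space circle_measure \<noteq> {}" by (rule C.not_empty)
  have k: "prob_space k" unfolding k_def
    by (rule C.prob_space_bind[OF _ ms]) (simp add: prob_site)
  have sk: "sets k = sets borel" unfolding k_def by (rule sets_bind[OF sets_site ne])
  have ek: "emeasure k A = (\<integral>\<^sup>+\<omega>. emeasure (site_measure \<alpha> f \<omega>) A \<partial>circle_measure)" if "A \<in> sets borel" for A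
    unfolding k_def by (rule emeasure_bind[OF ne ms that])
  have supp: "emeasure k (- {-?R..?R}) = 0"
  proof -
    have "emeasure k (- {-?R..?R}) = (\<integral>\<^sup>+\<omega>. emeasure (site_measure \<alpha> f \<omega>) (- {-?R..?R}) \<partial>circle_measure)"
      by (rule ek) simp
    then show ?thesis unfolding supp_site by simp
  qed
  interpret K: prob_space k by (rule k)
  interpret KF: spectral_family "\<lambda>_. k" ?R
    by (rule spectral_family.intro) (rule K.finite_measure_axioms sk supp)+
  note nk = KF.normal_integral
  have mI: "(\<lambda>\<omega>. \<integral>x. g x \<partial>site_measure \<alpha> f \<omega>) \<in> borel_measurable circle_measure" if "bounded_borel ?R g" for g
    using measurable_site_integral[OF that] by (simp add: measurable_cong_sets[OF sets_circle_measure refl])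
  have bI: "cmod (\<integral>x. g x \<partial>site_measure \<alpha> f \<omega>) \<le> C" if g: "bounded_borel ?R g" "\<And>x. \<bar>x\<bar> \<le> ?R \<Longrightarrow> cmod (g x) \<le> C" for g C \<omega>
  proof -
    interpret s: prob_space "site_measure \<alpha> f \<omega>" by (rule prob_site)
    interpret SF: spectral_family "\<lambda>_. site_measure \<alpha> f \<omega>" ?R
      by (rule spectral_family.intro) (rule s.finite_measure_axioms sets_site supp_site)+
    have "cmod (\<integral>x. g x \<partial>site_measure \<alpha> f \<omega>) \<le> (\<integral>x. cmod (g x) \<partial>site_measure \<alpha> f \<omega>)" by (rule integral_norm_bound)
    also have "\<dots> \<le> (\<integral>x. C \<partial>site_measure \<alpha> f \<omega>)"
    proof (rule integral_mono_AE)
      show "AE x in site_measure \<alpha> f \<omega>. cmod (g x) \<le> C" using SF.AE_m by eventually_elim (rule g(2))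
    qed (use SF.integrable_m[OF g(1)] in auto)
    finally show ?thesis by (simp add: s.prob_space)
  qed
  have iI: "integrable circle_measure (\<lambda>\<omega>. \<integral>x. g x \<partial>site_measure \<alpha> f \<omega>)" if g: "bounded_borel ?R g" for g
  proof -
    obtain B where "\<And>x. \<bar>x\<bar> \<le> ?R \<Longrightarrow> cmod (g x) \<le> B" using g by (auto simp: bounded_borel_def)
    then show ?thesis by (intro C.integrable_const_bound[of _ B] AE_I2 bI mI g)
  qed
  have nI: "normal_functional ?R (\<lambda>g. \<integral>\<omega>. (\<integral>x. g x \<partial>site_measure \<alpha> f \<omega>) \<partial>circle_measure)"
    unfolding normal_functional_def
  proof (intro conjI allI impI)
    fix c g h assume gh: "bounded_borel ?R g" "bounded_borel ?R h"
    show "(\<integral>\<omega>. (\<integral>x. c * g x + h x \<partial>site_measure \<alpha> f \<omega>) \<partial>circle_measure) =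
        c * (\<integral>\<omega>. (\<integral>x. g x \<partial>site_measure \<alpha> f \<omega>) \<partial>circle_measure) + (\<integral>\<omega>. (\<integral>x. h x \<partial>site_measure \<alpha> f \<omega>) \<partial>circle_measure)"
      unfolding normal_functional_lin[OF normal_site gh] using iI[OF gh(1)] iI[OF gh(2)] by simp
  next
    fix F h B
    assume *: "\<forall>n. bounded_borel ?R (F n)" "bounded_borel ?R h" "\<forall>n x. \<bar>x\<bar> \<le> ?R \<longrightarrow> cmod (F n x) \<le> B"
       "\<forall>x. \<bar>x\<bar> \<le> ?R \<longrightarrow> (\<lambda>n. F n x) \<longlonglongrightarrow> h x"
    show "(\<lambda>n. \<integral>\<omega>. (\<integral>x. F n x \<partial>site_measure \<alpha> f \<omega>) \<partial>circle_measure) \<longlonglongrightarrow> (\<integral>\<omega>. (\<integral>x. h x \<partial>site_measure \<alpha> f \<omega>) \<partial>circle_measure)"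
    proof (rule integral_dominated_convergence[where w = "\<lambda>_. B"])
      show "AE \<omega> in circle_measure. (\<lambda>n. \<integral>x. F n x \<partial>site_measure \<alpha> f \<omega>) \<longlonglongrightarrow> (\<integral>x. h x \<partial>site_measure \<alpha> f \<omega>)"
        by (intro AE_I2 normal_functional_lim[OF normal_site, where B = B]) (use * in auto)
      show "AE \<omega> in circle_measure. cmod (\<integral>x. F n x \<partial>site_measure \<alpha> f \<omega>) \<le> B" for n
        by (intro AE_I2 bI) (use * in auto)
    qed (use * mI in auto)
  qed
  have ind_eq: "(\<integral>x. (indicator A x :: complex) \<partial>k) = (\<integral>\<omega>. (\<integral>x. indicator A x \<partial>site_measure \<alpha> f \<omega>) \<partial>circle_measure)"
    if A: "A \<in> sets borel" for A
  proof -
    have i: "(\<lambda>x. indicator A x :: complex) = (\<lambda>x. complex_of_real (indicator A x))" by (auto simp: indicator_def)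
    have si: "(\<integral>x. complex_of_real (indicator A x) \<partial>site_measure \<alpha> f \<omega>) = of_real (measure (site_measure \<alpha> f \<omega>) A)" for \<omega>
      using A sets_eq_imp_space_eq[OF sets_site[of \<alpha> f \<omega>]] by (simp add: integral_complex_of_real)
    have em: "emeasure (site_measure \<alpha> f \<omega>) A = ennreal (measure (site_measure \<alpha> f \<omega>) A)" for \<omega>
      using finite_measure.emeasure_eq_measure[of "site_measure \<alpha> f \<omega>"] prob_site[of \<alpha> f \<omega>] by (simp add: prob_space_def)
    have mm: "(\<lambda>\<omega>. measure (site_measure \<alpha> f \<omega>) A) \<in> borel_measurable circle_measure"
    proof -
      have "(\<lambda>\<omega>. Re (\<integral>x. complex_of_real (indicator A x) \<partial>site_measure \<alpha> f \<omega>)) \<in> borel_measurable circle_measure"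
        using mI[OF bounded_borel_indicator[OF A]] unfolding i by measurable
      then show ?thesis unfolding si by simp
    qed
    have "ennreal (measure k A) = (\<integral>\<^sup>+\<omega>. ennreal (measure (site_measure \<alpha> f \<omega>) A) \<partial>circle_measure)"
      using ek[OF A] unfolding em K.emeasure_eq_measure .
    also have "\<dots> = ennreal (\<integral>\<omega>. measure (site_measure \<alpha> f \<omega>) A \<partial>circle_measure)"
    proof (rule nn_integral_eq_integral)
      show "integrable circle_measure (\<lambda>\<omega>. measure (site_measure \<alpha> f \<omega>) A)"
        by (rule C.integrable_const_bound[of _ 1]) (use mm prob_space.prob_le_1[OF prob_site] in auto)
    qed simp
    finally have "measure k A = (\<integral>\<omega>. measure (site_measure \<alpha> f \<omega>) A \<partial>circle_measure)"
      by (simp add: integral_nonneg)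
    note mk = this
    have "(\<integral>x. (indicator A x :: complex) \<partial>k) = (\<integral>x. complex_of_real (indicator A x) \<partial>k)" by (simp only: i)
    also have "\<dots> = of_real (measure k A)"
      using A sets_eq_imp_space_eq[OF sk] sk by (simp add: integral_complex_of_real)
    also have "\<dots> = (\<integral>\<omega>. complex_of_real (measure (site_measure \<alpha> f \<omega>) A) \<partial>circle_measure)"
      unfolding mk by (rule integral_complex_of_real[symmetric])
    also have "\<dots> = (\<integral>\<omega>. (\<integral>x. complex_of_real (indicator A x) \<partial>site_measure \<alpha> f \<omega>) \<partial>circle_measure)"
      by (simp only: si)
    finally show ?thesis by (simp only: i)
  qed
  have keyeq: "(\<integral>x. g x \<partial>k) = (\<integral>\<omega>. (\<integral>x. g x \<partial>site_measure \<alpha> f \<omega>) \<partial>circle_measure)" if g: "bounded_borel ?R g" for g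
    by (rule normal_functional_eqI_indicator[OF nk nI g ind_eq])
  have dos: "density_of_states \<alpha> f = k"
    unfolding density_of_states_def
  proof (rule the_equality)
    show "prob_space k \<and> sets k = sets borel \<and> (\<forall>g :: real \<Rightarrow> complex. g \<in> borel_measurable borel \<longrightarrow> bounded (range g) \<longrightarrow>
      (\<integral>x. g x \<partial>k) = (\<integral>\<omega>. cinner (delta 0) (borel_calculus g (schrodinger \<alpha> f \<omega>) (delta 0)) \<partial>circle_measure))"
    proof (intro conjI allI impI k sk)
      fix g :: "real \<Rightarrow> complex" assume g: "g \<in> borel_measurable borel" "bounded (range g)"
      show "(\<integral>x. g x \<partial>k) = (\<integral>\<omega>. cinner (delta 0) (borel_calculus g (schrodinger \<alpha> f \<omega>) (delta 0)) \<partial>circle_measure)"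
        unfolding calculus_site[OF g] by (rule keyeq[OF bounded_borel_of_bounded[OF g]])
    qed
    fix k' assume k': "prob_space k' \<and> sets k' = sets borel \<and> (\<forall>g :: real \<Rightarrow> complex. g \<in> borel_measurable borel \<longrightarrow> bounded (range g) \<longrightarrow>
      (\<integral>x. g x \<partial>k') = (\<integral>\<omega>. cinner (delta 0) (borel_calculus g (schrodinger \<alpha> f \<omega>) (delta 0)) \<partial>circle_measure))"
    interpret K': prob_space k' using k' by simp
    have sk': "sets k' = sets borel" using k' by simp
    show "k' = k"
    proof (rule measure_eqI)
      show "sets k' = sets k" using sk sk' by simp
      fix A assume "A \<in> sets k'"
      then have A: "A \<in> sets borel" using sk' by simp
      define g where "g = (\<lambda>x. complex_of_real (indicator A x))"
      have g: "g \<in> borel_measurable borel" "bounded (range g)"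
        using A by (auto simp: g_def bounded_iff indicator_def intro!: exI[of _ 1])
      have "(\<integral>x. g x \<partial>k') = (\<integral>x. g x \<partial>k)"
        using k' g unfolding calculus_site[OF g] keyeq[OF bounded_borel_of_bounded[OF g]] by (simp add: calculus_site[OF g])
      then have "complex_of_real (measure k' A) = of_real (measure k A)"
        unfolding g_def using A sk sk' sets_eq_imp_space_eq[OF sk] sets_eq_imp_space_eq[OF sk'] by (simp add: integral_complex_of_real)
      then show "emeasure k' A = emeasure k A" by (simp add: K.emeasure_eq_measure K'.emeasure_eq_measure)
    qed
  qed
  show "prob_space (density_of_states \<alpha> f)" "sets (density_of_states \<alpha> f) = sets borel"
    "emeasure (density_of_states \<alpha> f) (- {-?R..?R}) = 0"
    unfolding dos by (rule k sk supp)+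
  have "complex_of_real (\<integral>x. x ^ n \<partial>k) = (\<integral>x. complex_of_real (x ^ n) \<partial>k)" by (rule integral_complex_of_real[symmetric])
  also have "\<dots> = (\<integral>\<omega>. complex_of_real (moment (potential \<alpha> f \<omega>) n) \<partial>circle_measure)"
    unfolding keyeq[OF bounded_borel_power] power_site ..
  also have "\<dots> = of_real (\<integral>\<omega>. moment (potential \<alpha> f \<omega>) n \<partial>circle_measure)" by (rule integral_complex_of_real)
  finally show "(\<integral>x. x ^ n \<partial>density_of_states \<alpha> f) = (\<integral>\<omega>. moment (potential \<alpha> f \<omega>) n \<partial>circle_measure)"
    unfolding dos by (simp only: of_real_eq_iff)
qed

section \<open>Continuants\<close>

text \<open>
  With \<open>x p = E - v p\<close> the transfer matrix across the \<open>n\<close> sites starting at \<open>i\<close> has the entries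
  \<open>continuant x i (n + 1)\<close>, \<open>- continuant x (i + 1) n\<close> in its first row and \<open>continuant x i n\<close>,
  \<open>- continuant x (i + 1) (n - 1)\<close> in its second.  The index is shifted by one so that the value \<open>0\<close> of
  the continuant of length \<open>-1\<close> is available.
\<close>

fun continuant :: "(nat \<Rightarrow> real) \<Rightarrow> nat \<Rightarrow> nat \<Rightarrow> real" where
  "continuant x i 0 = 0"
| "continuant x i (Suc 0) = 1"
| "continuant x i (Suc (Suc n)) = x (i + n) * continuant x i (Suc n) - continuant x i n"

lemma continuant_append:
  "continuant x i (Suc (m + n)) =
     continuant x i (Suc m) * continuant x (i + m) (Suc n) - continuant x i m * continuant x (Suc (i + m)) n"
proof (induction n rule: induct_nat_012)
  case (ge2 n)
  have "continuant x i (Suc (m + Suc (Suc n))) =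
      x (i + m + Suc n) * continuant x i (Suc (m + Suc n)) - continuant x i (Suc (m + n))"
    by (simp add: add.assoc)
  then show ?case unfolding ge2 by (simp add: algebra_simps)
qed simp_all

lemma continuant_cong:
  assumes "\<And>k. i \<le> k \<Longrightarrow> Suc k < i + n \<Longrightarrow> x k = y k"
  shows "continuant x i n = continuant y i n"
  using assms
proof (induction n rule: induct_nat_012)
  case (ge2 n)
  have "continuant x i n = continuant y i n" "continuant x i (Suc n) = continuant y i (Suc n)"
    by (rule ge2.IH; use ge2.prems in simp)+
  then show ?case using ge2.prems[of "i + n"] by simp
qed simp_all

lemma continuant_upd_outside:
  "Suc p \<ge> i + n \<or> p < i \<Longrightarrow> continuant (x(p := t)) i n = continuant x i n"
  by (rule continuant_cong) auto

lemma continuant_det: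
  "continuant x i (Suc (Suc n)) * continuant x (Suc i) n - continuant x i (Suc n) * continuant x (Suc i) (Suc n) = -1"
proof (induction n)
  case (Suc n)
  have "continuant x i (Suc (Suc (Suc n))) = x (i + Suc n) * continuant x i (Suc (Suc n)) - continuant x i (Suc n)"
    by simp
  moreover have "continuant x (Suc i) (Suc (Suc n)) = x (i + Suc n) * continuant x (Suc i) (Suc n) - continuant x (Suc i) n"
    by simp
  ultimately show ?case using Suc
    by (simp only:) (simp add: algebra_simps)
qed simp

text \<open>
  A continuant is affine in the letter at each site.  All estimates on random words rest on this.
\<close>

lemma continuant_split_site:
  "continuant x s (m + n + 2) = x (s + m) * (continuant x s (Suc m) * continuant x (Suc (s + m)) (Suc n))
    - (continuant x s (Suc m) * continuant x (Suc (Suc (s + m))) n + continuant x s m * continuant x (Suc (s + m)) (Suc n))"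
proof -
  have "continuant x (s + m) (Suc (Suc n)) = x (s + m) * continuant x (Suc (s + m)) (Suc n) - continuant x (Suc (Suc (s + m))) n"
    using continuant_append[of x "s + m" 1 n] by simp
  moreover have "continuant x s (m + n + 2) = continuant x s (Suc m) * continuant x (s + m) (Suc (Suc n))
      - continuant x s m * continuant x (Suc (s + m)) (Suc n)"
    using continuant_append[of x s m "Suc n"] by (simp del: continuant.simps)
  ultimately show ?thesis
    by (simp only:) (simp add: algebra_simps del: continuant.simps)
qed

definition separated :: "real \<Rightarrow> real set \<Rightarrow> bool"
  where "separated d G \<longleftrightarrow> finite G \<and> (\<forall>a\<in>G. \<forall>b\<in>G. a \<noteq> b \<longrightarrow> d \<le> \<bar>a - b\<bar>)"

lemma card_le_2_if_no_pair:
  assumes "\<And>a b. a \<in> S \<Longrightarrow> b \<in> S \<Longrightarrow> a \<noteq> b \<Longrightarrow> False"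
  shows "card S \<le> 2"
proof -
  have "card S \<le> 1"
    using assms by (metis card_le_Suc0_iff_eq card.infinite One_nat_def le0)
  then show ?thesis by simp
qed

text \<open>
  Two points with small values would be closer than \<open>d\<close>, so there is at most one.  The bound \<open>2\<close> is the
  one shared with the quadratic case.
\<close>

lemma card_affine_small:
  assumes "separated d G"
  shows "card {t \<in> G. \<bar>t * s - r\<bar> < d / 2 * \<bar>s\<bar>} \<le> 2"
proof (rule card_le_2_if_no_pair)
  fix a b :: real
  assume a: "a \<in> {t \<in> G. \<bar>t * s - r\<bar> < d / 2 * \<bar>s\<bar>}" and b: "b \<in> {t \<in> G. \<bar>t * s - r\<bar> < d / 2 * \<bar>s\<bar>}" and "a \<noteq> b"
  then have "d \<le> \<bar>a - b\<bar>" using assms by (auto simp: separated_def)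
  then have "d * \<bar>s\<bar> \<le> \<bar>a - b\<bar> * \<bar>s\<bar>" by (intro mult_right_mono) auto
  also have "\<dots> = \<bar>(a * s - r) - (b * s - r)\<bar>" by (simp add: abs_mult[symmetric] algebra_simps)
  also have "\<dots> < d / 2 * \<bar>s\<bar> + d / 2 * \<bar>s\<bar>" using a b unfolding mem_Collect_eq by linarith
  finally show False by simp
qed

text \<open>
  Among three points of the grid, divided differences of second order would recover the leading
  coefficient and contradict the smallness.
\<close>

lemma card_quadratic_small:
  assumes "separated d G" "d > 0"
  shows "card {t \<in> G. \<bar>t\<^sup>2 * s + t * r + q\<bar> < d\<^sup>2 / 2 * \<bar>s\<bar>} \<le> 2" (is "card ?S \<le> 2")
proof (rule ccontr)
  assume "\<not> card ?S \<le> 2"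
  then have "3 \<le> card ?S" by simp
  then obtain T where T: "T \<subseteq> ?S" "card T = 3" by (rule obtain_subset_with_card_n)
  then obtain a b c where abc: "T = {a, b, c}" "a \<noteq> b" "b \<noteq> c" "a \<noteq> c"
    by (auto simp: card_3_iff)
  have *: False if "a < b" "b < c" "a \<in> ?S" "b \<in> ?S" "c \<in> ?S" for a b c
  proof -
    let ?q = "\<lambda>t. t\<^sup>2 * s + t * r + q"
    have d: "d \<le> b - a" "d \<le> c - b" using that assms by (auto simp: separated_def abs_if split: if_splits dest!: bspec)
    have ca: "c - a = (c - b) + (b - a)" by simp
    have eq: "s * ((b - a) * (c - b) * (c - a)) = ?q a * (c - b) - ?q b * (c - a) + ?q c * (b - a)"
      by (simp add: algebra_simps power2_eq_square)
    have m: "\<bar>?q a\<bar> < d\<^sup>2 / 2 * \<bar>s\<bar>" "\<bar>?q b\<bar> < d\<^sup>2 / 2 * \<bar>s\<bar>" "\<bar>?q c\<bar> < d\<^sup>2 / 2 * \<bar>s\<bar>"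
      using that by auto
    have pos: "b - a > 0" "c - b > 0" "c - a > 0" using that by auto
    have "\<bar>s\<bar> * ((b - a) * (c - b) * (c - a)) = \<bar>?q a * (c - b) - ?q b * (c - a) + ?q c * (b - a)\<bar>"
      unfolding eq[symmetric] using pos by (simp add: abs_mult)
    also have "\<dots> \<le> \<bar>?q a\<bar> * (c - b) + \<bar>?q b\<bar> * (c - a) + \<bar>?q c\<bar> * (b - a)"
    proof -
      have tri: "\<bar>u - v + w\<bar> \<le> \<bar>u\<bar> + \<bar>v\<bar> + \<bar>w\<bar>" for u v w :: real by linarith
      show ?thesis
        using tri[of "?q a * (c - b)" "?q b * (c - a)" "?q c * (b - a)"] pos
        unfolding abs_mult by simp
    qed
    also have "\<dots> < d\<^sup>2 / 2 * \<bar>s\<bar> * (c - b) + d\<^sup>2 / 2 * \<bar>s\<bar> * (c - a) + d\<^sup>2 / 2 * \<bar>s\<bar> * (b - a)"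
      by (intro add_strict_mono mult_strict_right_mono m pos)
    also have "\<dots> = \<bar>s\<bar> * (d\<^sup>2 * (c - a))" by (simp add: field_simps)
    also have "\<dots> \<le> \<bar>s\<bar> * ((b - a) * (c - b) * (c - a))"
    proof -
      have "d\<^sup>2 \<le> (b - a) * (c - b)"
        unfolding power2_eq_square using d assms(2) by (intro mult_mono) auto
      then show ?thesis using pos by (intro mult_left_mono mult_right_mono) auto
    qed
    finally show False by simp
  qed
  have "a \<in> ?S" "b \<in> ?S" "c \<in> ?S" using T abc by auto
  moreover have "a < b \<and> b < c \<or> a < c \<and> c < b \<or> b < a \<and> a < c \<or> b < c \<and> c < a \<or> c < a \<and> a < b \<or> c < b \<and> b < a"
    using abc by linarith
  ultimately show False using * by blast
qed

text \<open>
  Fubini for counting: an event that holds for at most \<open>c\<close> values of one coordinate, whatever the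
  others, has probability at most \<open>c / card G\<close>.
\<close>

lemma card_PiE_line:
  fixes G :: "real set"
  assumes I: "finite I" "i \<in> I" and G: "finite G"
    and B: "\<And>f. card {t \<in> G. B (f(i := t))} \<le> c"
  shows "card {f \<in> PiE I (\<lambda>_. G). B f} * card G \<le> c * card (PiE I (\<lambda>_. G))"
proof -
  let ?P = "PiE (I - {i}) (\<lambda>_. G)"
  let ?F = "\<lambda>(t, g). g(i := t)"
  have ins: "insert i (I - {i}) = I" using I by auto
  have Om: "PiE I (\<lambda>_. G) = ?F ` (G \<times> ?P)"
    using PiE_insert_eq[of i "I - {i}" "\<lambda>_. G"] ins by simp
  have inj: "inj_on ?F (G \<times> ?P)"
    using inj_combinator[of i "I - {i}" "\<lambda>_. G"] by simp
  have fin: "finite ?P" using I G by (intro finite_PiE) auto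
  have "{f \<in> PiE I (\<lambda>_. G). B f} = ?F ` (SIGMA t:G. {g \<in> ?P. B (g(i := t))})"
    unfolding Om by auto
  then have "card {f \<in> PiE I (\<lambda>_. G). B f} = card (SIGMA t:G. {g \<in> ?P. B (g(i := t))})"
    by (simp add: card_image inj_on_subset[OF inj] Sigma_mono)
  also have "\<dots> = (\<Sum>t\<in>G. card {g \<in> ?P. B (g(i := t))})"
    using fin G by (intro card_SigmaI) auto
  also have "\<dots> = (\<Sum>t\<in>G. \<Sum>g\<in>?P. if B (g(i := t)) then 1 else 0)"
    using fin by (intro sum.cong refl) (simp add: sum.If_cases Int_def)
  also have "\<dots> = (\<Sum>g\<in>?P. \<Sum>t\<in>G. if B (g(i := t)) then 1 else 0)"
    by (rule sum.swap)
  also have "\<dots> = (\<Sum>g\<in>?P. card {t \<in> G. B (g(i := t))})"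
    using G by (intro sum.cong refl) (simp add: sum.If_cases Int_def)
  also have "\<dots> \<le> (\<Sum>g\<in>?P. c)" by (rule sum_mono) (rule B)
  finally have "card {f \<in> PiE I (\<lambda>_. G). B f} \<le> card ?P * c" by simp
  moreover have "card (PiE I (\<lambda>_. G)) = card G * card ?P"
    unfolding Om by (simp add: card_image[OF inj] card_cartesian_product)
  ultimately show ?thesis by (simp add: mult.commute mult.left_commute)
qed

definition branch :: "real \<Rightarrow> real \<Rightarrow> (real \<times> real) list \<Rightarrow> (real \<times> real) list"
  where "branch \<sigma> y L = map (\<lambda>(d, e). ((y + \<sigma>) * d - e, d)) L @ map (\<lambda>(d, e). ((y - \<sigma>) * d - e, d)) L"

text \<open>
  All \<open>2\<^sup>n\<close> pairs of consecutive continuants obtained by perturbing each letter by \<open>\<sigma>\<close> or \<open>- \<sigma>\<close>.  A list is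
  used because coincidences must be counted with multiplicity in the averages.
\<close>

fun tree_states :: "real \<Rightarrow> (nat \<Rightarrow> real) \<Rightarrow> nat \<Rightarrow> (real \<times> real) list" where
  "tree_states \<sigma> y 0 = [(1, 0)]"
| "tree_states \<sigma> y (Suc n) = branch \<sigma> (y n) (tree_states \<sigma> y n)"

lemma tree_states_continuant:
  "(d, e) \<in> set (tree_states \<sigma> y n) \<Longrightarrow>
    \<exists>\<eta>. (\<forall>k. \<bar>\<eta> k\<bar> \<le> \<bar>\<sigma>\<bar>) \<and> d = continuant (\<lambda>k. y k - \<eta> k) 0 (Suc n) \<and> e = continuant (\<lambda>k. y k - \<eta> k) 0 n"
proof (induction n arbitrary: d e)
  case 0
  then show ?case by (intro exI[of _ "\<lambda>_. 0"]) auto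
next
  case (Suc n)
  then obtain d' e' z where de: "(d', e') \<in> set (tree_states \<sigma> y n)" "z = \<sigma> \<or> z = - \<sigma>" "d = (y n - z) * d' - e'" "e = d'"
    by (fastforce simp: branch_def)
  from Suc.IH[OF de(1)] obtain \<eta> where \<eta>: "\<forall>k. \<bar>\<eta> k\<bar> \<le> \<bar>\<sigma>\<bar>"
      "d' = continuant (\<lambda>k. y k - \<eta> k) 0 (Suc n)" "e' = continuant (\<lambda>k. y k - \<eta> k) 0 n" by auto
  let ?\<eta> = "\<eta>(n := z)"
  have "continuant (\<lambda>k. y k - ?\<eta> k) 0 (Suc n) = d'" "continuant (\<lambda>k. y k - ?\<eta> k) 0 n = e'"
    unfolding \<eta>(2,3) by (rule continuant_cong; simp)+
  then show ?case
    using de \<eta>(1) by (intro exI[of _ ?\<eta>]) auto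
qed

text \<open>
  Let \<open>A\<close>, \<open>A'\<close>, \<open>B\<close> be the averages of \<open>d\<^sup>2\<close>, \<open>e\<^sup>2\<close>, \<open>d e\<close> over all choices of signs.  Each further letter
  increases the determinant \<open>A A' - B\<^sup>2\<close> by \<open>\<sigma>\<^sup>2 A\<^sup>2\<close>, whatever the unperturbed letter is, and this
  increment cannot be small twice in a row.  So the determinant grows at least linearly and the
  averages cannot stay bounded; some choice of signs has a large continuant.  The length needed does
  not depend on the letters.
\<close>

lemma exists_large_continuant:
  fixes \<sigma> \<Lambda> :: real
  assumes \<sigma>: "\<sigma> > 0"
  shows "\<exists>m. \<forall>y :: nat \<Rightarrow> real. \<exists>l\<le>m. \<exists>\<eta>. (\<forall>k. \<bar>\<eta> k\<bar> \<le> \<sigma>) \<and> \<Lambda> \<le> \<bar>continuant (\<lambda>k. y k - \<eta> k) 0 (Suc l)\<bar>"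
proof -
  define \<Lambda>' where "\<Lambda>' = max 1 \<Lambda>"
  obtain j0 where j0: "\<Lambda>' ^ 4 < real j0 * (2 * \<sigma> ^ 4)"
    using reals_Archimedean3[of "2 * \<sigma> ^ 4"] \<sigma> by auto
  show ?thesis
  proof (rule exI[of _ "2 * j0 + 2"], rule allI, rule ccontr)
    fix y :: "nat \<Rightarrow> real"
    assume neg: "\<not> (\<exists>l\<le>2 * j0 + 2. \<exists>\<eta>. (\<forall>k. \<bar>\<eta> k\<bar> \<le> \<sigma>) \<and> \<Lambda> \<le> \<bar>continuant (\<lambda>k. y k - \<eta> k) 0 (Suc l)\<bar>)"
    define T where "T n = tree_states \<sigma> y n" for n
    (* All these continuants being below \<Lambda>, the mean squares A stay below \<Lambda>' ^ 2. *)
    define A where "A n = sum_list (map (\<lambda>(d, e). d\<^sup>2) (T n)) / 2 ^ n" for n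
    define A' where "A' n = sum_list (map (\<lambda>(d, e). e\<^sup>2) (T n)) / 2 ^ n" for n
    define B where "B n = sum_list (map (\<lambda>(d, e). d * e) (T n)) / 2 ^ n" for n
    have s1: "sum_list (map (\<lambda>(d, e). d\<^sup>2) (branch \<sigma> z L)) = 2 * ((z\<^sup>2 + \<sigma>\<^sup>2) * sum_list (map (\<lambda>(d, e). d\<^sup>2) L)
       - 2 * z * sum_list (map (\<lambda>(d, e). d * e) L) + sum_list (map (\<lambda>(d, e). e\<^sup>2) L))" for z L
      unfolding branch_def by (induction L) (auto simp: algebra_simps power2_eq_square)
    have s2: "sum_list (map (\<lambda>(d, e). e\<^sup>2) (branch \<sigma> z L)) = 2 * sum_list (map (\<lambda>(d, e). d\<^sup>2) L)" for z L
      unfolding branch_def by (induction L) (auto simp: algebra_simps power2_eq_square)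
    have s3: "sum_list (map (\<lambda>(d, e). d * e) (branch \<sigma> z L)) = 2 * (z * sum_list (map (\<lambda>(d, e). d\<^sup>2) L)
       - sum_list (map (\<lambda>(d, e). d * e) L))" for z L
      unfolding branch_def by (induction L) (auto simp: algebra_simps power2_eq_square)
    have rA: "A (Suc n) = ((y n)\<^sup>2 + \<sigma>\<^sup>2) * A n - 2 * y n * B n + A' n"
      and rA': "A' (Suc n) = A n" and rB: "B (Suc n) = y n * A n - B n" for n
      unfolding A_def A'_def B_def T_def by (simp_all add: s1 s2 s3 add_divide_distrib diff_divide_distrib)
    define D where "D n = A n * A' n - (B n)\<^sup>2" for n
    have rD: "D (Suc n) = D n + \<sigma>\<^sup>2 * (A n)\<^sup>2" for n
      unfolding D_def rA rA' rB by (simp add: algebra_simps power2_eq_square)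
    have init: "A 0 = 1" "A' 0 = 0" "B 0 = 0" by (auto simp: A_def A'_def B_def T_def)
    have Dge: "D (Suc n) \<ge> \<sigma>\<^sup>2" for n
    proof (induction n)
      case 0
      show ?case using rD[of 0] init by (simp add: D_def)
    next
      case (Suc n)
      have "D (Suc (Suc n)) \<ge> D (Suc n)" using rD[of "Suc n"] by simp
      then show ?case using Suc by simp
    qed
    have step: "D (Suc (Suc (Suc n))) \<ge> D (Suc n) + 2 * \<sigma> ^ 4" for n
    proof -
      have "A (Suc (Suc n)) * A (Suc n) \<ge> D (Suc (Suc n))"
        unfolding D_def rA' by simp
      then have "A (Suc (Suc n)) * A (Suc n) \<ge> \<sigma>\<^sup>2" using Dge[of "Suc n"] by simp
      moreover have "2 * (A (Suc (Suc n)) * A (Suc n)) \<le> (A (Suc (Suc n)))\<^sup>2 + (A (Suc n))\<^sup>2"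
        using sum_squares_bound[of "A (Suc (Suc n))" "A (Suc n)"] by simp
      ultimately have "2 * \<sigma>\<^sup>2 \<le> (A (Suc (Suc n)))\<^sup>2 + (A (Suc n))\<^sup>2" by linarith
      then have "\<sigma>\<^sup>2 * (2 * \<sigma>\<^sup>2) \<le> \<sigma>\<^sup>2 * ((A (Suc (Suc n)))\<^sup>2 + (A (Suc n))\<^sup>2)"
        by (intro mult_left_mono) auto
      then have "2 * \<sigma> ^ 4 \<le> \<sigma>\<^sup>2 * (A (Suc (Suc n)))\<^sup>2 + \<sigma>\<^sup>2 * (A (Suc n))\<^sup>2"
        by (simp add: algebra_simps power2_eq_square power4_eq_xxxx)
      then show ?thesis using rD[of "Suc (Suc n)"] rD[of "Suc n"] by simp
    qed
    have grow: "D (Suc (2 * j)) \<ge> real j * (2 * \<sigma> ^ 4)" for j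
    proof (induction j)
      case 0
      have "0 \<le> \<sigma>\<^sup>2" by simp
      then have "0 \<le> D (Suc 0)" using Dge[of 0] by (rule order_trans)
      then show ?case by simp
    next
      case (Suc j)
      then show ?case using step[of "2 * j"] by (simp add: algebra_simps)
    qed
    have len: "length (T n) = 2 ^ n" for n
      unfolding T_def by (induction n) (auto simp: branch_def)
    have Ale: "A n \<le> \<Lambda>'\<^sup>2" "0 \<le> A n" if "n \<le> 2 * j0 + 2" for n
    proof -
      have b: "d\<^sup>2 \<le> \<Lambda>'\<^sup>2" if de: "(d, e) \<in> set (T n)" for d e
      proof -
        obtain \<eta> where "\<forall>k. \<bar>\<eta> k\<bar> \<le> \<bar>\<sigma>\<bar>" "d = continuant (\<lambda>k. y k - \<eta> k) 0 (Suc n)"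
          using tree_states_continuant de unfolding T_def by blast
        then have "\<bar>d\<bar> < \<Lambda>" using neg \<open>n \<le> 2 * j0 + 2\<close> \<sigma> by (metis abs_of_pos not_le)
        then have "\<bar>d\<bar> \<le> \<bar>\<Lambda>'\<bar>" by (simp add: \<Lambda>'_def)
        then show ?thesis by (simp only: abs_le_square_iff)
      qed
      have "sum_list (map (\<lambda>(d, e). d\<^sup>2) (T n)) \<le> sum_list (map (\<lambda>_. \<Lambda>'\<^sup>2) (T n))"
        by (rule sum_list_mono) (use b in auto)
      also have "\<dots> = 2 ^ n * \<Lambda>'\<^sup>2" by (simp add: sum_list_triv len)
      finally show "A n \<le> \<Lambda>'\<^sup>2" by (simp add: A_def field_simps)
      show "0 \<le> A n" unfolding A_def by (intro divide_nonneg_nonneg sum_list_nonneg) auto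
    qed
    have "D (Suc (2 * j0)) \<le> A (Suc (2 * j0)) * A (2 * j0)"
      unfolding D_def rA' by simp
    also have "\<dots> \<le> \<Lambda>'\<^sup>2 * \<Lambda>'\<^sup>2" using Ale[of "Suc (2 * j0)"] Ale[of "2 * j0"] by (intro mult_mono) auto
    also have "\<dots> = \<Lambda>' ^ 4" by (simp add: power2_eq_square power4_eq_xxxx)
    finally show False using grow[of j0] j0 by linarith
  qed
qed

section \<open>Rare events for random words\<close>

lemma continuant_bound:
  assumes "\<And>k. \<bar>x k\<bar> \<le> C"
  shows "\<bar>continuant x i n\<bar> \<le> (C + 1) ^ n"
proof (induction n rule: induct_nat_012)
  case 1
  have "0 \<le> C" using assms[of 0] by linarith
  then show ?case by simp
next
  case (ge2 n)
  have C: "0 \<le> C" using assms[of 0] by linarith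
  have "\<bar>continuant x i (Suc (Suc n))\<bar> \<le> \<bar>x (i + n)\<bar> * \<bar>continuant x i (Suc n)\<bar> + \<bar>continuant x i n\<bar>"
    by (simp add: abs_mult[symmetric])
  also have "\<dots> \<le> C * (C + 1) ^ Suc n + (C + 1) ^ n"
    by (intro add_mono mult_mono ge2 assms) (use C in auto)
  also have "\<dots> \<le> C * (C + 1) ^ Suc n + (C + 1) ^ Suc n"
    using C by (simp add: mult_left_mono algebra_simps)
  finally show ?case by (simp add: algebra_simps)
qed simp

lemma continuant_lipschitz:
  assumes x: "\<And>k. \<bar>x k\<bar> \<le> C" and x': "\<And>k. \<bar>x' k\<bar> \<le> C" and r: "\<And>k. \<bar>x k - x' k\<bar> \<le> r"
  shows "\<bar>continuant x i n - continuant x' i n\<bar> \<le> real n * (C + 1) ^ n * r"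
proof (induction n rule: induct_nat_012)
  case 1
  have "0 \<le> C" "0 \<le> r" using x[of 0] r[of 0] by linarith+
  then show ?case by simp
next
  case (ge2 n)
  have C: "0 \<le> C" "0 \<le> r" using x[of 0] r[of 0] by linarith+
  let ?K = "continuant x i" and ?K' = "continuant x' i"
  have "?K (Suc (Suc n)) - ?K' (Suc (Suc n)) =
      x (i + n) * (?K (Suc n) - ?K' (Suc n)) + (x (i + n) - x' (i + n)) * ?K' (Suc n) - (?K n - ?K' n)"
    by (simp add: algebra_simps)
  also have "\<bar>\<dots>\<bar> \<le> \<bar>x (i + n)\<bar> * \<bar>?K (Suc n) - ?K' (Suc n)\<bar> + \<bar>x (i + n) - x' (i + n)\<bar> * \<bar>?K' (Suc n)\<bar> + \<bar>?K n - ?K' n\<bar>"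
  proof -
    have "\<bar>a + b - c\<bar> \<le> \<bar>a\<bar> + \<bar>b\<bar> + \<bar>c\<bar>" for a b c :: real by linarith
    then show ?thesis by (metis (no_types) abs_mult)
  qed
  also have "\<dots> \<le> C * (real (Suc n) * (C + 1) ^ Suc n * r) + r * (C + 1) ^ Suc n + real n * (C + 1) ^ n * r"
    by (intro add_mono mult_mono ge2 x r continuant_bound x') (use C in auto)
  also have "\<dots> \<le> C * (real (Suc n) * (C + 1) ^ Suc n * r) + r * (C + 1) ^ Suc n + real n * (C + 1) ^ Suc n * r"
    using C by (intro add_left_mono mult_right_mono mult_left_mono) auto
  also have "\<dots> = (real (Suc n) * C + real (Suc n)) * ((C + 1) ^ Suc n * r)"
    by (simp add: algebra_simps)
  also have "\<dots> \<le> (real (Suc (Suc n)) * (C + 1)) * ((C + 1) ^ Suc n * r)"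
    using C by (intro mult_right_mono) (auto simp: algebra_simps)
  finally show ?case by (simp add: mult.assoc)
qed simp

text \<open>
  The letter at site \<open>p\<close> has the form \<open>c - t\<close>, because it is an energy minus a potential whose perturbation
  is \<open>t\<close>.
\<close>

definition rare :: "real set \<Rightarrow> nat \<Rightarrow> ((nat \<Rightarrow> real) \<Rightarrow> bool) \<Rightarrow> bool"
  where "rare G p P \<longleftrightarrow> (\<forall>y c. card {t \<in> G. P (y(p := c - t))} \<le> 2)"

text \<open>
  The letter at site \<open>s + m\<close> brings the continuant close to its zero: the right-hand side contains the
  coefficient of that letter.
\<close>

definition affine_small :: "real \<Rightarrow> nat \<Rightarrow> nat \<Rightarrow> nat \<Rightarrow> (nat \<Rightarrow> real) \<Rightarrow> bool"
  where "affine_small d s m n x \<longleftrightarrow>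
    \<bar>continuant x s (m + n + 2)\<bar> < d / 2 * \<bar>continuant x s (Suc m) * continuant x (Suc (s + m)) (Suc n)\<bar>"

lemma rare_affine:
  assumes G: "separated d G"
    and aff: "\<And>y c t. F (y(p := c - t)) = (c - t) * S y - T y"
    and P: "\<And>y c t. P (y(p := c - t)) \<longleftrightarrow> \<bar>F (y(p := c - t))\<bar> < d / 2 * \<bar>S y\<bar>"
  shows "rare G p P"
  unfolding rare_def
proof (intro allI)
  fix y c
  have "P (y(p := c - t)) \<longleftrightarrow> \<bar>t * S y - (c * S y - T y)\<bar> < d / 2 * \<bar>S y\<bar>" for t
  proof -
    have "\<bar>F (y(p := c - t))\<bar> = \<bar>t * S y - (c * S y - T y)\<bar>"
      unfolding aff by (simp add: algebra_simps abs_minus_commute)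
    then show ?thesis unfolding P by simp
  qed
  then show "card {t \<in> G. P (y(p := c - t))} \<le> 2"
    using card_affine_small[OF G, of "S y" "c * S y - T y"] by simp
qed

lemma rare_affine_small:
  assumes "separated d G" "p = s + m"
  shows "rare G p (affine_small d s m n)"
proof (rule rare_affine[OF assms(1), where F = "\<lambda>x. continuant x s (m + n + 2)"
      and S = "\<lambda>y. continuant y s (Suc m) * continuant y (Suc (s + m)) (Suc n)"
      and T = "\<lambda>y. continuant y s (Suc m) * continuant y (Suc (Suc (s + m))) n + continuant y s m * continuant y (Suc (s + m)) (Suc n)"])
  note u = continuant_upd_outside
  show "continuant (y(p := c - t)) s (m + n + 2) = (c - t) * (continuant y s (Suc m) * continuant y (Suc (s + m)) (Suc n)) -
       (continuant y s (Suc m) * continuant y (Suc (Suc (s + m))) n + continuant y s m * continuant y (Suc (s + m)) (Suc n))" for y c t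
    unfolding continuant_split_site assms(2) by (simp add: u del: continuant.simps)
  show "affine_small d s m n (y(p := c - t)) \<longleftrightarrow>
      \<bar>continuant (y(p := c - t)) s (m + n + 2)\<bar> < d / 2 * \<bar>continuant y s (Suc m) * continuant y (Suc (s + m)) (Suc n)\<bar>" for y c t
    unfolding affine_small_def assms(2) by (simp add: u del: continuant.simps)
qed

lemma continuant_first:
  "continuant x s (Suc (Suc n)) = x s * continuant x (Suc s) (Suc n) - continuant x (Suc (Suc s)) n"
  using continuant_split_site[of x s 0 n] by simp

text \<open>
  Two entries of a matrix of determinant one cannot both be small for two separated values of the
  letter, since their slopes would then be small too and the determinant less than one.
\<close>

lemma rare_column_small:
  assumes G: "separated d G" and d: "d > 0" "4 * \<kappa>\<^sup>2 \<le> d"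
    and u: "\<And>y c t. u (y(p := c - t)) = (c - t) * S y - S' y"
    and v: "\<And>y c t. v (y(p := c - t)) = (c - t) * T y - T' y"
    and det: "\<And>y c t. \<bar>u (y(p := c - t)) * T y - v (y(p := c - t)) * S y\<bar> = 1"
  shows "rare G p (\<lambda>x. \<bar>u x\<bar> < \<kappa> \<and> \<bar>v x\<bar> < \<kappa>)"
  unfolding rare_def
proof (intro allI card_le_2_if_no_pair)
  fix y :: "nat \<Rightarrow> real" and c a b :: real
  let ?Y = "\<lambda>t. y(p := c - t)"
  assume a: "a \<in> {t \<in> G. \<bar>u (?Y t)\<bar> < \<kappa> \<and> \<bar>v (?Y t)\<bar> < \<kappa>}"
    and b: "b \<in> {t \<in> G. \<bar>u (?Y t)\<bar> < \<kappa> \<and> \<bar>v (?Y t)\<bar> < \<kappa>}" and "a \<noteq> b"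
  then have ab: "d \<le> \<bar>a - b\<bar>" using G by (auto simp: separated_def)
  have \<kappa>: "0 < \<kappa>" using a by auto
  have S: "d * \<bar>S y\<bar> < 2 * \<kappa>"
  proof -
    have "d * \<bar>S y\<bar> \<le> \<bar>a - b\<bar> * \<bar>S y\<bar>" using ab by (intro mult_right_mono) auto
    also have "\<dots> = \<bar>u (?Y b) - u (?Y a)\<bar>" unfolding u by (simp add: abs_mult[symmetric] algebra_simps)
    also have "\<dots> < 2 * \<kappa>" using a b by auto
    finally show ?thesis .
  qed
  have T: "d * \<bar>T y\<bar> < 2 * \<kappa>"
  proof -
    have "d * \<bar>T y\<bar> \<le> \<bar>a - b\<bar> * \<bar>T y\<bar>" using ab by (intro mult_right_mono) auto
    also have "\<dots> = \<bar>v (?Y b) - v (?Y a)\<bar>" unfolding v by (simp add: abs_mult[symmetric] algebra_simps)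
    also have "\<dots> < 2 * \<kappa>" using a b by auto
    finally show ?thesis .
  qed
  have "d * 1 = d * \<bar>u (?Y a) * T y - v (?Y a) * S y\<bar>" unfolding det by simp
  also have "\<dots> \<le> d * (\<bar>u (?Y a)\<bar> * \<bar>T y\<bar> + \<bar>v (?Y a)\<bar> * \<bar>S y\<bar>)"
    using d by (intro mult_left_mono order_trans[OF abs_triangle_ineq4]) (auto simp: abs_mult)
  also have "\<dots> = \<bar>u (?Y a)\<bar> * (d * \<bar>T y\<bar>) + \<bar>v (?Y a)\<bar> * (d * \<bar>S y\<bar>)" by (simp add: algebra_simps)
  also have "\<dots> \<le> \<kappa> * (d * \<bar>T y\<bar>) + \<kappa> * (d * \<bar>S y\<bar>)"
    using a d by (intro add_mono mult_right_mono) auto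
  also have "\<dots> < \<kappa> * (2 * \<kappa>) + \<kappa> * (2 * \<kappa>)"
    using S T \<kappa> by (intro add_strict_mono mult_strict_left_mono)
  also have "\<dots> = 4 * \<kappa>\<^sup>2" by (simp add: power2_eq_square)
  finally show False using d by simp
qed

lemma rare_first_small:
  assumes "separated d G" "d > 0" "4 * \<kappa>\<^sup>2 \<le> d"
  shows "rare G s (\<lambda>x. \<bar>continuant x s (Suc (Suc (Suc n)))\<bar> < \<kappa> \<and> \<bar>continuant x s (Suc (Suc n))\<bar> < \<kappa>)"
proof (rule rare_column_small[OF assms, where S = "\<lambda>y. continuant y (Suc s) (Suc (Suc n))" and S' = "\<lambda>y. continuant y (Suc (Suc s)) (Suc n)"
      and T = "\<lambda>y. continuant y (Suc s) (Suc n)" and T' = "\<lambda>y. continuant y (Suc (Suc s)) n"])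
  fix y c t
  have o: "continuant (y(s := c - t)) (Suc s) k = continuant y (Suc s) k" for k
    by (rule continuant_upd_outside) auto
  show "\<bar>continuant (y(s := c - t)) s (Suc (Suc (Suc n))) * continuant y (Suc s) (Suc n) -
        continuant (y(s := c - t)) s (Suc (Suc n)) * continuant y (Suc s) (Suc (Suc n))\<bar> = 1"
    using continuant_det[of "y(s := c - t)" s "Suc n"] by (simp only: o)
qed (simp_all only: continuant_first[of _ s] continuant_upd_outside fun_upd_same less_Suc_eq simp_thms)

lemma rare_last_small:
  assumes "separated d G" "d > 0" "4 * \<kappa>\<^sup>2 \<le> d" "p = s + Suc n"
  shows "rare G p (\<lambda>x. \<bar>continuant x s (Suc (Suc (Suc n)))\<bar> < \<kappa> \<and> \<bar>continuant x (Suc s) (Suc (Suc n))\<bar> < \<kappa>)"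
proof (rule rare_column_small[OF assms(1-3), where S = "\<lambda>y. continuant y s (Suc (Suc n))" and S' = "\<lambda>y. continuant y s (Suc n)"
      and T = "\<lambda>y. continuant y (Suc s) (Suc n)" and T' = "\<lambda>y. continuant y (Suc s) n"])
  fix y c t
  have o: "continuant (y(p := c - t)) s (Suc (Suc n)) = continuant y s (Suc (Suc n))"
      "continuant (y(p := c - t)) s (Suc n) = continuant y s (Suc n)"
      "continuant (y(p := c - t)) (Suc s) (Suc n) = continuant y (Suc s) (Suc n)"
      "continuant (y(p := c - t)) (Suc s) n = continuant y (Suc s) n"
    by (rule continuant_upd_outside; simp add: assms(4))+
  show "\<bar>continuant (y(p := c - t)) s (Suc (Suc (Suc n))) * continuant y (Suc s) (Suc n) -
        continuant (y(p := c - t)) (Suc s) (Suc (Suc n)) * continuant y s (Suc (Suc n))\<bar> = 1"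
    using continuant_det[of "y(p := c - t)" s "Suc n"] unfolding o by (simp only: mult.commute)
  show "continuant (y(p := c - t)) s (Suc (Suc (Suc n))) = (c - t) * continuant y s (Suc (Suc n)) - continuant y s (Suc n)"
    using o by (simp only: continuant.simps(3)[of _ s "Suc n"]) (simp add: assms(4) del: continuant.simps)
  show "continuant (y(p := c - t)) (Suc s) (Suc (Suc n)) = (c - t) * continuant y (Suc s) (Suc n) - continuant y (Suc s) n"
    using o by (simp only: continuant.simps(3)[of _ "Suc s" n]) (simp add: assms(4) del: continuant.simps)
qed

text \<open>
  Here the same word occurs twice, so the letter enters quadratically.
\<close>

lemma rare_self_resonance:
  assumes "separated d G" "d > 0" "p = s + Suc n"
  shows "rare G p (\<lambda>x. \<bar>(continuant x s (Suc (Suc (Suc n))))\<^sup>2 - continuant x s (Suc (Suc n)) * continuant x (Suc s) (Suc (Suc n))\<bar>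
     < d\<^sup>2 / 2 * (continuant x s (Suc (Suc n)))\<^sup>2)"
  unfolding rare_def
proof (intro allI)
  fix y :: "nat \<Rightarrow> real" and c :: real
  let ?Y = "\<lambda>t. y(p := c - t)"
  have o: "continuant (?Y t) s (Suc (Suc n)) = continuant y s (Suc (Suc n))"
      "continuant (?Y t) s (Suc n) = continuant y s (Suc n)"
      "continuant (?Y t) (Suc s) (Suc n) = continuant y (Suc s) (Suc n)"
      "continuant (?Y t) (Suc s) n = continuant y (Suc s) n" for t
    by (rule continuant_upd_outside; simp add: assms(3))+
  define a' where "a' = continuant y s (Suc n)"
  define D where "D = continuant y s (Suc (Suc n))"
  define e where "e = continuant y (Suc s) (Suc n)"
  define e' where "e' = continuant y (Suc s) n"
  have 1: "continuant (?Y t) s (Suc (Suc (Suc n))) = (c - t) * D - a'" for t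
    using o[of t] unfolding a'_def D_def
    by (simp only: continuant.simps(3)[of _ s "Suc n"]) (simp add: assms(3) del: continuant.simps)
  have 2: "continuant (?Y t) (Suc s) (Suc (Suc n)) = (c - t) * e - e'" for t
    using o[of t] unfolding e_def e'_def
    by (simp only: continuant.simps(3)[of _ "Suc s" n]) (simp add: assms(3) del: continuant.simps)
  have 3: "continuant (?Y t) s (Suc (Suc n)) = D" for t using o by (simp only: D_def)
  have 4: "((c - t) * D - a')\<^sup>2 - D * ((c - t) * e - e') = t\<^sup>2 * D\<^sup>2 + t * (- 2 * c * D\<^sup>2 + 2 * D * a' + D * e)
     + (c\<^sup>2 * D\<^sup>2 - 2 * c * D * a' + a'\<^sup>2 - D * c * e + D * e')" for t
    by (simp add: power2_eq_square algebra_simps)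
  show "card {t \<in> G. \<bar>(continuant (?Y t) s (Suc (Suc (Suc n))))\<^sup>2 - continuant (?Y t) s (Suc (Suc n)) * continuant (?Y t) (Suc s) (Suc (Suc n))\<bar>
     < d\<^sup>2 / 2 * (continuant (?Y t) s (Suc (Suc n)))\<^sup>2} \<le> 2"
    unfolding 1 2 3 4 using card_quadratic_small[OF assms(1,2), of "D\<^sup>2"] by simp
qed

lemma rare_cross_resonance:
  assumes G: "separated d G" and p: "p = s + n" and out: "p < s' \<or> s' + h \<le> p"
  shows "rare G p (\<lambda>x. \<bar>continuant x s (Suc (Suc n)) * continuant x s' (Suc h) - continuant x s (Suc n) * continuant x (Suc s') h\<bar>
     < d / 2 * \<bar>continuant x s (Suc n) * continuant x s' (Suc h)\<bar>)"
proof (rule rare_affine[OF G, where F = "\<lambda>x. continuant x s (Suc (Suc n)) * continuant x s' (Suc h) - continuant x s (Suc n) * continuant x (Suc s') h"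
      and S = "\<lambda>y. continuant y s (Suc n) * continuant y s' (Suc h)"
      and T = "\<lambda>y. continuant y s n * continuant y s' (Suc h) + continuant y s (Suc n) * continuant y (Suc s') h"])
  fix y c t
  have o: "continuant (y(p := c - t)) s (Suc n) = continuant y s (Suc n)"
      "continuant (y(p := c - t)) s n = continuant y s n"
      "continuant (y(p := c - t)) s' (Suc h) = continuant y s' (Suc h)"
      "continuant (y(p := c - t)) (Suc s') h = continuant y (Suc s') h"
    by (rule continuant_upd_outside; use p out in auto)+
  show "continuant (y(p := c - t)) s (Suc (Suc n)) * continuant (y(p := c - t)) s' (Suc h) -
       continuant (y(p := c - t)) s (Suc n) * continuant (y(p := c - t)) (Suc s') h =
       (c - t) * (continuant y s (Suc n) * continuant y s' (Suc h)) -
       (continuant y s n * continuant y s' (Suc h) + continuant y s (Suc n) * continuant y (Suc s') h)"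
    unfolding continuant.simps(3) o using p by (simp add: algebra_simps del: continuant.simps)
  show "(\<bar>continuant (y(p := c - t)) s (Suc (Suc n)) * continuant (y(p := c - t)) s' (Suc h) -
        continuant (y(p := c - t)) s (Suc n) * continuant (y(p := c - t)) (Suc s') h\<bar>
       < d / 2 * \<bar>continuant (y(p := c - t)) s (Suc n) * continuant (y(p := c - t)) s' (Suc h)\<bar>) \<longleftrightarrow>
       (\<bar>continuant (y(p := c - t)) s (Suc (Suc n)) * continuant (y(p := c - t)) s' (Suc h) -
        continuant (y(p := c - t)) s (Suc n) * continuant (y(p := c - t)) (Suc s') h\<bar>
       < d / 2 * \<bar>continuant y s (Suc n) * continuant y s' (Suc h)\<bar>)"
    unfolding o by simp
qed

text \<open>
  If \<open>w1\<close> is not small then \<open>w\<close> is not small by the first exclusion; otherwise \<open>w2\<close> is not small and it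
  dominates \<open>y * w1\<close>.
\<close>

lemma lower_bound_last:
  fixes d \<kappa> C :: real
  assumes d: "d > 0" "\<kappa> > 0" "C > 0" and xb: "\<bar>y\<bar> \<le> C"
    and eq: "w = y * w1 - w2"
    and 1: "\<not> \<bar>w\<bar> < d / 2 * \<bar>w1\<bar>" and 2: "\<not> (\<bar>w1\<bar> < \<kappa> \<and> \<bar>w2\<bar> < \<kappa>)"
  shows "min (\<kappa> / 2) (min (d * \<kappa> / 2) (d * \<kappa> / (4 * C))) \<le> \<bar>w\<bar>"
proof (cases "\<bar>w1\<bar> < \<kappa> / (2 * C) \<and> \<bar>w1\<bar> < \<kappa>")
  case True
  then have "\<bar>y * w1\<bar> \<le> C * (\<kappa> / (2 * C))"
    unfolding abs_mult using d xb by (intro mult_mono) auto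
  also have "\<dots> = \<kappa> / 2" using d by simp
  finally have "\<bar>y * w1\<bar> \<le> \<kappa> / 2" .
  moreover have "\<bar>w2\<bar> \<ge> \<kappa>" using 2 True by auto
  ultimately have "\<kappa> / 2 \<le> \<bar>w\<bar>" unfolding eq by linarith
  then show ?thesis by (simp add: min_le_iff_disj)
next
  case False
  then consider "\<kappa> / (2 * C) \<le> \<bar>w1\<bar>" | "\<kappa> \<le> \<bar>w1\<bar>" by linarith
  then show ?thesis
  proof cases
    case 1
    then have "d / 2 * (\<kappa> / (2 * C)) \<le> d / 2 * \<bar>w1\<bar>" using d by (intro mult_left_mono) auto
    moreover have "d / 2 * (\<kappa> / (2 * C)) = d * \<kappa> / (4 * C)" by simp
    ultimately have "d * \<kappa> / (4 * C) \<le> \<bar>w\<bar>" using assms(6) by linarith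
    then show ?thesis by (simp add: min_le_iff_disj)
  next
    case 2
    then have "d / 2 * \<kappa> \<le> d / 2 * \<bar>w1\<bar>" using d by (intro mult_left_mono) auto
    then have "d * \<kappa> / 2 \<le> \<bar>w\<bar>" using assms(6) by linarith
    then show ?thesis by (simp add: min_le_iff_disj)
  qed
qed

text \<open>
  The norm of the transfer matrix of the block is at least \<open>\<Lambda>\<close> and is realized, up to a
  constant, by its upper left entry.
\<close>

definition dominant :: "real \<Rightarrow> real \<Rightarrow> (nat \<Rightarrow> real) \<Rightarrow> nat \<Rightarrow> nat \<Rightarrow> bool"
  where "dominant \<Lambda> C x s h \<longleftrightarrow> \<Lambda> \<le> \<bar>continuant x s (Suc h)\<bar> \<and>
     \<bar>continuant x (Suc s) h\<bar> \<le> C * \<bar>continuant x s (Suc h)\<bar> \<and> \<bar>continuant x s h\<bar> \<le> C * \<bar>continuant x s (Suc h)\<bar>"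

text \<open>
  The upper left entry of the product of the two transfer matrices is comparable to the product of
  their upper left entries, so that no cancellation of norms takes place at the junction.
\<close>

definition transversal :: "real \<Rightarrow> (nat \<Rightarrow> real) \<Rightarrow> nat \<Rightarrow> nat \<Rightarrow> nat \<Rightarrow> nat \<Rightarrow> bool"
  where "transversal c x s h s' h' \<longleftrightarrow> c * \<bar>continuant x s (Suc h) * continuant x s' (Suc h')\<bar> \<le>
     \<bar>continuant x s (Suc h) * continuant x s' (Suc h') - continuant x s h * continuant x (Suc s') h'\<bar>"

text \<open>
  The exclusions that propagate a large continuant on the \<open>l\<close> sites from \<open>s + i + 4\<close> on to the whole
  block: a start of length \<open>i + 3\<close> and an end of length \<open>g + 3\<close> must have continuants bounded below, and
  joining the three pieces at the two separating sites must not cancel.  The first two events keep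
  the remaining entries of the block under control.
\<close>

definition word_events :: "real \<Rightarrow> real \<Rightarrow> nat \<Rightarrow> nat \<Rightarrow> nat \<Rightarrow> nat \<Rightarrow> (nat \<times> ((nat \<Rightarrow> real) \<Rightarrow> bool)) list"
  where "word_events d \<kappa> s i l g = (let h = i + l + g + 8; j = i + l + 4; s2 = s + j + 1 in
    [(s, affine_small d s 0 (h - 1)),
     (s + h - 1, affine_small d s (h - 1) 0),
     (s + j, affine_small d s j (g + 3)),
     (s + i + 3, affine_small d s (i + 3) l),
     (s + i + 2, affine_small d s (i + 2) 0),
     (s, \<lambda>x. \<bar>continuant x s (Suc (Suc (Suc i)))\<bar> < \<kappa> \<and> \<bar>continuant x s (Suc (Suc i))\<bar> < \<kappa>),
     (s2, affine_small d s2 0 (g + 2)),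
     (s + h - 1, \<lambda>x. \<bar>continuant x (Suc s2) (Suc (Suc (Suc g)))\<bar> < \<kappa> \<and> \<bar>continuant x (Suc (Suc s2)) (Suc (Suc g))\<bar> < \<kappa>)])"

lemma length_word_events: "length (word_events d \<kappa> s i l g) = 8"
  by (simp add: word_events_def Let_def)

lemma sites_word_events: "(p, P) \<in> set (word_events d \<kappa> s i l g) \<Longrightarrow>
   p \<in> {s, s + i + 2, s + i + 3, s + i + l + 4, s + i + l + 5, s + (i + l + g + 8) - 1}"
  by (auto simp: word_events_def Let_def)

lemma rare_word_events:
  assumes "separated d G" "d > 0" "4 * \<kappa>\<^sup>2 \<le> d"
  shows "\<forall>(p, P)\<in>set (word_events d \<kappa> s i l g). rare G p P"
proof -
  note aff = rare_affine_small[OF assms(1)]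
  show ?thesis
    unfolding word_events_def Let_def list.set Set.ball_simps prod.case
    by (intro conjI TrueI; (rule aff rare_first_small[OF assms] rare_last_small[OF assms]; simp)?)
qed

lemma dominant_of_word_events:
  fixes d \<kappa> C :: real and i l g :: nat
  defines "h \<equiv> i + l + g + 8"
  assumes d: "d > 0" "\<kappa> > 0" "C > 0" and xb: "\<And>k. \<bar>x k\<bar> \<le> C"
    and ev: "\<forall>(p, P)\<in>set (word_events d \<kappa> s i l g). \<not> P x"
    and big: "\<Lambda> \<le> \<bar>continuant x (s + i + 4) (Suc l)\<bar>"
    and \<theta>: "\<theta> = min (\<kappa> / 2) (min (d * \<kappa> / 2) (d * \<kappa> / (4 * C)))"
    and \<Lambda>: "\<Lambda> \<ge> 0"
  shows "dominant (d\<^sup>2 / 4 * \<theta>\<^sup>2 * \<Lambda>) (2 / d) x s h"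
proof -
  define s2 where "s2 = s + (i + l + 4) + 1"
  have e: "\<not> affine_small d s 0 (h - 1) x" "\<not> affine_small d s (h - 1) 0 x"
     "\<not> affine_small d s (i + l + 4) (g + 3) x" "\<not> affine_small d s (i + 3) l x" "\<not> affine_small d s (i + 2) 0 x"
     "\<not> (\<bar>continuant x s (Suc (Suc (Suc i)))\<bar> < \<kappa> \<and> \<bar>continuant x s (Suc (Suc i))\<bar> < \<kappa>)"
     "\<not> affine_small d s2 0 (g + 2) x"
     "\<not> (\<bar>continuant x (Suc s2) (Suc (Suc (Suc g)))\<bar> < \<kappa> \<and> \<bar>continuant x (Suc (Suc s2)) (Suc (Suc g))\<bar> < \<kappa>)"
    using ev unfolding word_events_def Let_def h_def[symmetric] s2_def[symmetric] by simp_all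
  have h1: "0 + (h - 1) + 2 = Suc h" "h - 1 + 0 + 2 = Suc h" "Suc (h - 1) = h" by (auto simp: h_def)
  have \<theta>0: "\<theta> > 0" unfolding \<theta> using d by simp
  have a: "\<theta> \<le> \<bar>continuant x s (Suc (i + 3))\<bar>"
    unfolding \<theta>
  proof (rule lower_bound_last[OF d xb])
    show "continuant x s (Suc (i + 3)) = x (s + (i + 2)) * continuant x s (Suc (Suc (Suc i))) - continuant x s (Suc (Suc i))"
      using continuant.simps(3)[of x s "Suc (Suc i)"] by (simp add: numeral_eq_Suc del: continuant.simps)
    show "\<not> \<bar>continuant x s (Suc (i + 3))\<bar> < d / 2 * \<bar>continuant x s (Suc (Suc (Suc i)))\<bar>"
      using e(5) unfolding affine_small_def by (simp add: numeral_eq_Suc del: continuant.simps(3))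
  qed (rule e(6))
  have b: "\<theta> \<le> \<bar>continuant x s2 (Suc (g + 3))\<bar>"
    unfolding \<theta>
  proof (rule lower_bound_last[OF d xb])
    show "continuant x s2 (Suc (g + 3)) = x s2 * continuant x (Suc s2) (Suc (Suc (Suc g))) - continuant x (Suc (Suc s2)) (Suc (Suc g))"
      using continuant_first[of x s2 "Suc (Suc g)"] by (simp add: numeral_eq_Suc del: continuant.simps)
    show "\<not> \<bar>continuant x s2 (Suc (g + 3))\<bar> < d / 2 * \<bar>continuant x (Suc s2) (Suc (Suc (Suc g)))\<bar>"
      using e(7) unfolding affine_small_def by (simp add: numeral_eq_Suc del: continuant.simps(3))
  qed (rule e(8))
  have c: "d / 2 * (\<theta> * \<Lambda>) \<le> \<bar>continuant x s (Suc (i + l + 4))\<bar>"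
  proof -
    have "d / 2 * (\<theta> * \<Lambda>) \<le> d / 2 * (\<bar>continuant x s (Suc (i + 3))\<bar> * \<bar>continuant x (s + i + 4) (Suc l)\<bar>)"
      using d \<theta>0 a big \<Lambda> by (intro mult_left_mono mult_mono) auto
    also have "\<dots> \<le> \<bar>continuant x s (Suc (i + l + 4))\<bar>"
      using e(4) unfolding affine_small_def abs_mult by (simp add: numeral_eq_Suc not_less del: continuant.simps(3))
    finally show ?thesis .
  qed
  have "d / 2 * ((d / 2 * (\<theta> * \<Lambda>)) * \<theta>) \<le> d / 2 * (\<bar>continuant x s (Suc (i + l + 4))\<bar> * \<bar>continuant x s2 (Suc (g + 3))\<bar>)"
    using d \<theta>0 b c \<Lambda> by (intro mult_left_mono mult_mono) auto
  also have "\<dots> \<le> \<bar>continuant x s (Suc h)\<bar>"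
    using e(3) unfolding affine_small_def abs_mult h_def s2_def by (simp add: numeral_eq_Suc not_less del: continuant.simps(3))
  finally have 1: "d\<^sup>2 / 4 * \<theta>\<^sup>2 * \<Lambda> \<le> \<bar>continuant x s (Suc h)\<bar>"
    by (simp add: power2_eq_square algebra_simps)
  have 2: "\<bar>continuant x (Suc s) h\<bar> \<le> 2 / d * \<bar>continuant x s (Suc h)\<bar>"
    using e(1) d unfolding affine_small_def h1 by (simp add: h1 field_simps not_less del: continuant.simps(3))
  have 3: "\<bar>continuant x s h\<bar> \<le> 2 / d * \<bar>continuant x s (Suc h)\<bar>"
    using e(2) d unfolding affine_small_def h1 by (simp add: h1 field_simps not_less del: continuant.simps(3))
  show ?thesis unfolding dominant_def using 1 2 3 by simp
qed

text \<open>
  For \<open>b\<close> small compared with \<open>a\<close> the product \<open>b b'\<close> is less than half of \<open>a a'\<close>; for \<open>b\<close> comparable to \<open>a\<close>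
  the hypothesis applies.  The factor \<open>min 1 (|b| / |a|)\<close> covers the cross resonance and the weaker self
  resonance at once.
\<close>

lemma transversal_of_events:
  fixes d :: real
  assumes d: "0 < d" "d \<le> 1"
    and a: "\<bar>a\<bar> > 0" "\<bar>a'\<bar> > 0" and \<tau>: "\<bar>b'\<bar> \<le> 2 / d * \<bar>a'\<bar>"
    and e: "d\<^sup>2 / 2 * (\<bar>b\<bar> * \<bar>a'\<bar>) * (min 1 (\<bar>b\<bar> / \<bar>a\<bar>)) \<le> \<bar>a * a' - b * b'\<bar>"
  shows "d ^ 4 / 32 * \<bar>a * a'\<bar> \<le> \<bar>a * a' - b * b'\<bar>"
proof (cases "\<bar>b\<bar> \<le> d / 4 * \<bar>a\<bar>")
  case True
  then have "\<bar>b\<bar> * \<bar>b'\<bar> \<le> (d / 4 * \<bar>a\<bar>) * (2 / d * \<bar>a'\<bar>)"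
    using \<tau> d by (intro mult_mono) auto
  also have "\<dots> = \<bar>a * a'\<bar> / 2" using d by (simp add: abs_mult)
  finally have "\<bar>a * a' - b * b'\<bar> \<ge> \<bar>a * a'\<bar> / 2" unfolding abs_mult[symmetric] by linarith
  moreover have "d ^ 4 / 32 * \<bar>a * a'\<bar> \<le> 1 / 2 * \<bar>a * a'\<bar>"
  proof (rule mult_right_mono)
    have "d ^ 4 \<le> 1" using d by (intro power_le_one) auto
    then show "d ^ 4 / 32 \<le> 1 / 2" by simp
  qed simp
  ultimately show ?thesis by linarith
next
  case False
  then have b: "d / 4 * \<bar>a\<bar> \<le> \<bar>b\<bar>" by simp
  have m: "d / 4 \<le> min 1 (\<bar>b\<bar> / \<bar>a\<bar>)" using d b a by (simp add: field_simps)
  have "d ^ 4 / 32 * \<bar>a * a'\<bar> = d\<^sup>2 / 2 * ((d / 4 * \<bar>a\<bar>) * \<bar>a'\<bar>) * (d / 4)"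
    by (simp add: abs_mult power2_eq_square power4_eq_xxxx)
  also have "\<dots> \<le> d\<^sup>2 / 2 * (\<bar>b\<bar> * \<bar>a'\<bar>) * (min 1 (\<bar>b\<bar> / \<bar>a\<bar>))"
  proof (rule mult_mono[OF _ m])
    show "d\<^sup>2 / 2 * ((d / 4 * \<bar>a\<bar>) * \<bar>a'\<bar>) \<le> d\<^sup>2 / 2 * (\<bar>b\<bar> * \<bar>a'\<bar>)"
      by (intro mult_left_mono mult_right_mono b) auto
  qed (use d in auto)
  also note e
  finally show ?thesis .
qed

section \<open>Words that are hyperbolic at most energies\<close>

text \<open>
  The two words are stored one after the other, the first on the sites below \<open>A\<close> and the second on the
  \<open>B\<close> sites from \<open>A\<close> on.
\<close>

definition hyperbolic_pair :: "real \<Rightarrow> real \<Rightarrow> real \<Rightarrow> (nat \<Rightarrow> real) \<Rightarrow> nat \<Rightarrow> nat \<Rightarrow> bool"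
  where "hyperbolic_pair \<Lambda> C c x A B \<longleftrightarrow> dominant \<Lambda> C x 0 A \<and> dominant \<Lambda> C x A B \<and>
    transversal c x 0 A 0 A \<and> transversal c x 0 A A B \<and> transversal c x A B 0 A \<and> transversal c x A B A B"

lemma continuant_shift: "continuant x i n = continuant (\<lambda>k. x (i + k)) 0 n"
  by (induction n rule: induct_nat_012) (simp_all)

lemma choice2: "(\<And>a b. \<exists>c. Q a b c) \<Longrightarrow> \<exists>f. \<forall>a b. Q a b (f a b)"
  by metis

lemma card_some_event:
  assumes "finite \<Omega>" "\<forall>(p, P)\<in>set evs. card {\<xi> \<in> \<Omega>. P (X \<xi>)} * n \<le> 2 * card \<Omega>"
  shows "card {\<xi> \<in> \<Omega>. \<exists>(p, P)\<in>set evs. P (X \<xi>)} * n \<le> 2 * length evs * card \<Omega>"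
  using assms(2)
proof (induction evs)
  case (Cons e evs)
  obtain p P where e: "e = (p, P)" by (cases e)
  have "{\<xi> \<in> \<Omega>. \<exists>(p, P)\<in>set (e # evs). P (X \<xi>)} = {\<xi> \<in> \<Omega>. P (X \<xi>)} \<union> {\<xi> \<in> \<Omega>. \<exists>(p, P)\<in>set evs. P (X \<xi>)}"
    by (auto simp: e)
  then have "card {\<xi> \<in> \<Omega>. \<exists>(p, P)\<in>set (e # evs). P (X \<xi>)} \<le> card {\<xi> \<in> \<Omega>. P (X \<xi>)} + card {\<xi> \<in> \<Omega>. \<exists>(p, P)\<in>set evs. P (X \<xi>)}"
    by (simp add: card_Un_le)
  then have "card {\<xi> \<in> \<Omega>. \<exists>(p, P)\<in>set (e # evs). P (X \<xi>)} * n \<le>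
      card {\<xi> \<in> \<Omega>. P (X \<xi>)} * n + card {\<xi> \<in> \<Omega>. \<exists>(p, P)\<in>set evs. P (X \<xi>)} * n"
    unfolding add_mult_distrib[symmetric] by (rule mult_le_mono1)
  moreover have "card {\<xi> \<in> \<Omega>. P (X \<xi>)} * n \<le> 2 * card \<Omega>" using Cons.prems by (auto simp: e)
  moreover have "card {\<xi> \<in> \<Omega>. \<exists>(p, P)\<in>set evs. P (X \<xi>)} * n \<le> 2 * length evs * card \<Omega>"
    by (rule Cons.IH) (use Cons.prems in auto)
  ultimately show ?case by simp
qed simp

definition self_event :: "real \<Rightarrow> nat \<Rightarrow> nat \<Rightarrow> (nat \<Rightarrow> real) \<Rightarrow> bool"
  where "self_event d s h x \<longleftrightarrow> \<bar>(continuant x s (Suc h))\<^sup>2 - continuant x s h * continuant x (Suc s) h\<bar> < d\<^sup>2 / 2 * (continuant x s h)\<^sup>2"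

definition cross_event :: "real \<Rightarrow> nat \<Rightarrow> nat \<Rightarrow> nat \<Rightarrow> nat \<Rightarrow> (nat \<Rightarrow> real) \<Rightarrow> bool"
  where "cross_event d s h s' h' x \<longleftrightarrow>
    \<bar>continuant x s (Suc h) * continuant x s' (Suc h') - continuant x s h * continuant x (Suc s') h'\<bar>
      < d / 2 * \<bar>continuant x s h * continuant x s' (Suc h')\<bar>"

lemma rare_self_event:
  assumes "separated d G" "d > 0" "h \<ge> 2"
  shows "rare G (s + h - 1) (self_event d s h)"
proof -
  obtain n where n: "h = Suc (Suc n)" using assms(3) by (metis add_2_eq_Suc le_Suc_ex)
  have "self_event d s h = (\<lambda>x. \<bar>(continuant x s (Suc (Suc (Suc n))))\<^sup>2 - continuant x s (Suc (Suc n)) * continuant x (Suc s) (Suc (Suc n))\<bar>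
     < d\<^sup>2 / 2 * (continuant x s (Suc (Suc n)))\<^sup>2)"
    unfolding self_event_def[abs_def] n ..
  then show ?thesis using rare_self_resonance[OF assms(1,2), of "s + h - 1" s n] n by simp
qed

lemma rare_cross_event:
  assumes "separated d G" "h \<ge> 1" "s + h - 1 < s' \<or> s' + h' \<le> s + h - 1"
  shows "rare G (s + h - 1) (cross_event d s h s' h')"
proof -
  obtain n where n: "h = Suc n" using assms(2) by (cases h) auto
  have "cross_event d s h s' h' = (\<lambda>x. \<bar>continuant x s (Suc (Suc n)) * continuant x s' (Suc h') - continuant x s (Suc n) * continuant x (Suc s') h'\<bar>
     < d / 2 * \<bar>continuant x s (Suc n) * continuant x s' (Suc h')\<bar>)"
    unfolding cross_event_def[abs_def] n ..
  then show ?thesis using rare_cross_resonance[OF assms(1), of "s + h - 1" s n s' h'] n assms(3) by simp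
qed

lemma transversal_self:
  assumes d: "0 < d" "d \<le> 1" and dom: "dominant \<Lambda> (2 / d) x s h" "\<Lambda> > 0" and ev: "\<not> self_event d s h x"
  shows "transversal (d ^ 4 / 32) x s h s h"
  unfolding transversal_def
proof (rule transversal_of_events[OF d])
  let ?a = "continuant x s (Suc h)" and ?b = "continuant x s h"
  show a: "0 < \<bar>?a\<bar>" "0 < \<bar>?a\<bar>" using dom by (auto simp: dominant_def)
  show "\<bar>continuant x (Suc s) h\<bar> \<le> 2 / d * \<bar>?a\<bar>" using dom by (simp add: dominant_def)
  have "d\<^sup>2 / 2 * (\<bar>?b\<bar> * \<bar>?a\<bar>) * min 1 (\<bar>?b\<bar> / \<bar>?a\<bar>) \<le> d\<^sup>2 / 2 * (\<bar>?b\<bar> * \<bar>?a\<bar>) * (\<bar>?b\<bar> / \<bar>?a\<bar>)"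
    by (intro mult_left_mono) auto
  also have "\<dots> = d\<^sup>2 / 2 * ?b\<^sup>2" using a by (simp add: power2_eq_square)
  also have "\<dots> \<le> \<bar>?a * ?a - ?b * continuant x (Suc s) h\<bar>"
    using ev by (simp add: self_event_def not_less power2_eq_square)
  finally show "d\<^sup>2 / 2 * (\<bar>?b\<bar> * \<bar>?a\<bar>) * min 1 (\<bar>?b\<bar> / \<bar>?a\<bar>) \<le> \<bar>?a * ?a - ?b * continuant x (Suc s) h\<bar>" .
qed

lemma transversal_cross:
  assumes d: "0 < d" "d \<le> 1" and dom: "dominant \<Lambda> (2 / d) x s h" "dominant \<Lambda> (2 / d) x s' h'" "\<Lambda> > 0"
    and ev: "\<not> cross_event d s h s' h' x"
  shows "transversal (d ^ 4 / 32) x s h s' h'"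
  unfolding transversal_def
proof (rule transversal_of_events[OF d])
  let ?a = "continuant x s (Suc h)" and ?b = "continuant x s h" and ?a' = "continuant x s' (Suc h')"
  show a: "0 < \<bar>?a\<bar>" "0 < \<bar>?a'\<bar>" using dom by (auto simp: dominant_def)
  show "\<bar>continuant x (Suc s') h'\<bar> \<le> 2 / d * \<bar>?a'\<bar>" using dom by (simp add: dominant_def)
  have "d * d \<le> d * 1" using d by (intro mult_left_mono) auto
  then have "d\<^sup>2 / 2 * (\<bar>?b\<bar> * \<bar>?a'\<bar>) * min 1 (\<bar>?b\<bar> / \<bar>?a\<bar>) \<le> d / 2 * (\<bar>?b\<bar> * \<bar>?a'\<bar>) * 1"
    using d by (intro mult_mono mult_right_mono) (auto simp: power2_eq_square)
  also have "\<dots> \<le> \<bar>?a * ?a' - ?b * continuant x (Suc s') h'\<bar>"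
    using ev by (simp add: cross_event_def not_less abs_mult)
  finally show "d\<^sup>2 / 2 * (\<bar>?b\<bar> * \<bar>?a'\<bar>) * min 1 (\<bar>?b\<bar> / \<bar>?a\<bar>) \<le> \<bar>?a * ?a' - ?b * continuant x (Suc s') h'\<bar>" .
qed

text \<open>
  Eight events per word, two self resonances and two cross resonances are excluded, each of
  probability at most \<open>2 / card G\<close>.  The sites in \<open>N\<close> carry random letters; the remaining sites
  are free to hold the letters that make the continuant in the middle large.
\<close>

lemma card_not_hyperbolic:
  fixes G :: "real set" and i l g :: "bool \<Rightarrow> nat"
  assumes G: "separated d G" "finite G" "0 < d" "d \<le> 1" and \<kappa>: "0 < \<kappa>" "4 * \<kappa>\<^sup>2 \<le> d" and C: "C > 0"
    and X: "\<And>p. p \<in> N \<Longrightarrow> \<exists>c. \<forall>\<xi> t. X (\<xi>(p := t)) = (X \<xi>)(p := c - t)"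
    and I: "finite I" "N \<subseteq> I"
    and bound: "\<And>\<xi> k. \<xi> \<in> PiE I (\<lambda>_. G) \<Longrightarrow> \<bar>X \<xi> k\<bar> \<le> C"
    and h: "h False = i False + l False + g False + 8" "h True = i True + l True + g True + 8"
    and s: "s False = 0" "s True = h False"
    and sites: "\<And>b. {s b, s b + i b + 2, s b + i b + 3, s b + i b + l b + 4, s b + i b + l b + 5, s b + h b - 1} \<subseteq> N"
    and big: "\<And>b \<xi>. \<xi> \<in> PiE I (\<lambda>_. G) \<Longrightarrow> \<Lambda> \<le> \<bar>continuant (X \<xi>) (s b + i b + 4) (Suc (l b))\<bar>"
    and \<theta>: "\<theta> = min (\<kappa> / 2) (min (d * \<kappa> / 2) (d * \<kappa> / (4 * C)))" and \<Lambda>: "\<Lambda> > 0"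
  shows "card {\<xi> \<in> PiE I (\<lambda>_. G). \<not> hyperbolic_pair (d\<^sup>2 / 4 * \<theta>\<^sup>2 * \<Lambda>) (2 / d) (d ^ 4 / 32) (X \<xi>) (h False) (h True)} * card G
     \<le> 40 * card (PiE I (\<lambda>_. G))"
proof -
  let ?\<Omega> = "PiE I (\<lambda>_. G)"
  define evs where "evs = word_events d \<kappa> (s False) (i False) (l False) (g False) @ word_events d \<kappa> (s True) (i True) (l True) (g True) @
    [(s False + h False - 1, self_event d (s False) (h False)), (s True + h True - 1, self_event d (s True) (h True)),
     (s False + h False - 1, cross_event d (s False) (h False) (s True) (h True)),
     (s True + h True - 1, cross_event d (s True) (h True) (s False) (h False))]"
  have len: "length evs = 20" by (simp add: evs_def length_word_events)
  have h2: "h b \<ge> 2" for b using h by (cases b) auto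
  have rare: "rare G p P \<and> p \<in> N" if pP: "(p, P) \<in> set evs" for p P
  proof -
    consider b where "(p, P) \<in> set (word_events d \<kappa> (s b) (i b) (l b) (g b))"
      | b where "p = s b + h b - 1" "P = self_event d (s b) (h b)"
      | b where "p = s b + h b - 1" "P = cross_event d (s b) (h b) (s (\<not> b)) (h (\<not> b))"
    proof -
      have "(\<exists>b. (p, P) \<in> set (word_events d \<kappa> (s b) (i b) (l b) (g b))) \<or>
          (\<exists>b. p = s b + h b - 1 \<and> P = self_event d (s b) (h b)) \<or>
          (\<exists>b. p = s b + h b - 1 \<and> P = cross_event d (s b) (h b) (s (\<not> b)) (h (\<not> b)))"
        using pP unfolding evs_def ex_bool_eq by auto
      then show thesis using that by blast
    qed
    then show ?thesis
    proof cases
      case (1 b)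
      have "p \<in> {s b, s b + i b + 2, s b + i b + 3, s b + i b + l b + 4, s b + i b + l b + 5, s b + (i b + l b + g b + 8) - 1}"
        using sites_word_events[OF 1] .
      moreover have "i b + l b + g b + 8 = h b" using h by (cases b) auto
      ultimately have "p \<in> N" using sites[of b] by auto
      then show ?thesis using rare_word_events[OF G(1,3) \<kappa>(2)] 1 by blast
    next
      case (2 b)
      then show ?thesis using rare_self_event[OF G(1,3) h2[of b]] sites[of b] by auto
    next
      case (3 b)
      have "s b + h b - 1 < s (\<not> b) \<or> s (\<not> b) + h (\<not> b) \<le> s b + h b - 1"
        using s h by (cases b) auto
      then show ?thesis using 3 rare_cross_event[OF G(1), of "h b" "s b" "s (\<not> b)" "h (\<not> b)"] h2[of b] sites[of b] by auto
    qed
  qed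
  have fin: "finite ?\<Omega>" using I G by (intro finite_PiE) auto
  have "\<forall>(p, P)\<in>set evs. card {\<xi> \<in> ?\<Omega>. P (X \<xi>)} * card G \<le> 2 * card ?\<Omega>"
  proof safe
    fix p P assume "(p, P) \<in> set evs"
    from rare[OF this] have r: "rare G p P" and p: "p \<in> N" by auto
    obtain c where c: "\<And>\<xi> t. X (\<xi>(p := t)) = (X \<xi>)(p := c - t)" using X[OF p] by auto
    show "card {\<xi> \<in> ?\<Omega>. P (X \<xi>)} * card G \<le> 2 * card ?\<Omega>"
      by (rule card_PiE_line[of I p]) (use I p G r in \<open>auto simp: c rare_def\<close>)
  qed
  from card_some_event[OF fin this]
  have "card {\<xi> \<in> ?\<Omega>. \<exists>(p, P)\<in>set evs. P (X \<xi>)} * card G \<le> 40 * card ?\<Omega>" by (simp add: len)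
  moreover have "{\<xi> \<in> ?\<Omega>. \<not> hyperbolic_pair (d\<^sup>2 / 4 * \<theta>\<^sup>2 * \<Lambda>) (2 / d) (d ^ 4 / 32) (X \<xi>) (h False) (h True)}
      \<subseteq> {\<xi> \<in> ?\<Omega>. \<exists>(p, P)\<in>set evs. P (X \<xi>)}"
  proof safe
    fix \<xi> assume \<xi>: "\<xi> \<in> ?\<Omega>" and nh: "\<not> hyperbolic_pair (d\<^sup>2 / 4 * \<theta>\<^sup>2 * \<Lambda>) (2 / d) (d ^ 4 / 32) (X \<xi>) (h False) (h True)"
    show "\<exists>(p, P)\<in>set evs. P (X \<xi>)"
    proof (rule ccontr)
      assume "\<not> (\<exists>(p, P)\<in>set evs. P (X \<xi>))"
      then have no: "\<And>p P. (p, P) \<in> set evs \<Longrightarrow> \<not> P (X \<xi>)" by auto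
      have dom: "dominant (d\<^sup>2 / 4 * \<theta>\<^sup>2 * \<Lambda>) (2 / d) (X \<xi>) (s b) (h b)" for b
      proof -
        have hb: "h b = i b + l b + g b + 8" using h by (cases b) auto
        show ?thesis unfolding hb
        proof (rule dominant_of_word_events[OF G(3) \<kappa>(1) C bound[OF \<xi>] _ big[OF \<xi>] \<theta>])
          show "\<forall>(p, P)\<in>set (word_events d \<kappa> (s b) (i b) (l b) (g b)). \<not> P (X \<xi>)"
            using no by (cases b) (auto simp: evs_def)
        qed (use \<Lambda> in auto)
      qed
      have "0 < \<theta>" using \<theta> \<kappa> G C by simp
      then have pos: "d\<^sup>2 / 4 * \<theta>\<^sup>2 * \<Lambda> > 0" using G \<Lambda> by simp
      have self: "transversal (d ^ 4 / 32) (X \<xi>) (s b) (h b) (s b) (h b)" for b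
      proof (rule transversal_self[OF G(3,4) dom pos])
        show "\<not> self_event d (s b) (h b) (X \<xi>)"
          by (rule no[of "s b + h b - 1"]) (cases b; simp add: evs_def)
      qed
      have cross: "transversal (d ^ 4 / 32) (X \<xi>) (s b) (h b) (s (\<not> b)) (h (\<not> b))" for b
      proof (rule transversal_cross[OF G(3,4) dom dom pos])
        show "\<not> cross_event d (s b) (h b) (s (\<not> b)) (h (\<not> b)) (X \<xi>)"
          by (rule no[of "s b + h b - 1"]) (cases b; simp add: evs_def)
      qed
      show False
        using nh dom[of False] dom[of True] self[of False] self[of True] cross[of False] cross[of True] s
        by (simp add: hyperbolic_pair_def)
    qed
  qed
  then have "card {\<xi> \<in> ?\<Omega>. \<not> hyperbolic_pair (d\<^sup>2 / 4 * \<theta>\<^sup>2 * \<Lambda>) (2 / d) (d ^ 4 / 32) (X \<xi>) (h False) (h True)}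
      \<le> card {\<xi> \<in> ?\<Omega>. \<exists>(p, P)\<in>set evs. P (X \<xi>)}"
    using fin by (intro card_mono) auto
  ultimately show ?thesis by (meson le_trans mult_le_mono1)
qed

lemma continuous_continuant:
  assumes "\<And>k. continuous_on UNIV (\<lambda>E. x E k)"
  shows "continuous_on UNIV (\<lambda>E. continuant (x E) i n)"
  by (induction n rule: induct_nat_012) (auto intro!: continuous_intros assms)

lemma closed_hyperbolic:
  "closed {E. hyperbolic_pair \<Lambda> C c (\<lambda>p. E - v p) A B}"
proof -
  have [continuous_intros]: "continuous_on UNIV (\<lambda>E. continuant (\<lambda>p. E - v p) i n)" for i n
    by (rule continuous_continuant) (intro continuous_intros)
  show ?thesis
    unfolding hyperbolic_pair_def dominant_def transversal_def
    by (intro closed_Collect_conj closed_Collect_le continuous_intros)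
qed

text \<open>
  At a fixed energy, random perturbations from a grid of \<open>n\<close> points make the words hyperbolic with
  probability at least \<open>1 - 40 / n\<close>, provided that some stretch of each word has a large continuant.
  Such stretches are built deterministically: \<open>[-R, R]\<close> is covered by \<open>K\<close> short intervals, and each
  word reserves a slot of \<open>L\<close> sites for each of them, in which \<open>exists_large_continuant\<close> is applied at one
  energy and extended to the interval by Lipschitz continuity.  Averaging over the random
  letters and integrating over \<open>E\<close>, some choice has a bad set of measure below \<open>\<eta>\<close>.  The constants \<open>C\<close> and
  \<open>c\<close> depend on the grid only, so \<open>\<Lambda>\<close> can be fixed after them.
\<close>

theorem exists_hyperbolic_words:
  fixes \<epsilon> C\<^sub>0 R \<eta> :: real
  assumes pos: "\<epsilon> > 0" "C\<^sub>0 \<ge> 0" "R > 0" "\<eta> > 0"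
  obtains C c where "C > 0" "c > 0"
    "\<And>\<Lambda>. \<exists>N\<^sub>0. \<forall>A\<ge>N\<^sub>0. \<forall>B\<ge>N\<^sub>0. \<forall>u :: nat \<Rightarrow> real. (\<forall>p. \<bar>u p\<bar> \<le> C\<^sub>0) \<longrightarrow>
      (\<exists>\<zeta>. (\<forall>p. \<bar>\<zeta> p\<bar> \<le> \<epsilon>) \<and> measure lborel {E \<in> {-R..R}. \<not> hyperbolic_pair \<Lambda> C c (\<lambda>p. E - (u p + \<zeta> p)) A B} < \<eta>)"
proof -
  define e where "e = min \<epsilon> 1"
  have e: "0 < e" "e \<le> 1" "e \<le> \<epsilon>" using pos by (auto simp: e_def)
  obtain n where n: "80 * R / \<eta> < real n" using reals_Archimedean2 by blast
  have n0: "n > 0" using n pos by (auto intro!: gr0I simp: divide_less_0_iff)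
  define d where "d = e / real n"
  have d: "0 < d" "d \<le> 1" using e n0 by (auto simp: d_def field_simps)
  define G where "G = (\<lambda>j. d * real j) ` {..<n}"
  have inj: "inj_on (\<lambda>j. d * real j) {..<n}" using d by (auto simp: inj_on_def)
  have cG: "card G = n" unfolding G_def by (simp add: card_image[OF inj])
  have fG: "finite G" by (simp add: G_def)
  have Ge: "\<bar>t\<bar> \<le> e" if tG: "t \<in> G" for t
  proof -
    obtain j where "j < n" "t = d * real j" using tG by (auto simp: G_def)
    moreover have "d * real j \<le> d * real n" using d \<open>j < n\<close> by (intro mult_left_mono) auto
    moreover have "d * real n = e" using n0 by (simp add: d_def)
    moreover have "0 \<le> d * real j" using d by simp
    ultimately show ?thesis by simp
  qed
  have sepG: "separated d G"
    unfolding separated_def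
  proof (intro conjI ballI impI fG)
    fix a b assume "a \<in> G" "b \<in> G" "a \<noteq> b"
    then obtain j k where jk: "a = d * real j" "b = d * real k" "j \<noteq> k" by (auto simp: G_def)
    have "1 \<le> \<bar>real j - real k\<bar>" using jk(3) by linarith
    then have "d * 1 \<le> d * \<bar>real j - real k\<bar>" using d by (intro mult_left_mono) auto
    moreover have "\<bar>a - b\<bar> = d * \<bar>real j - real k\<bar>"
      using d by (simp add: jk right_diff_distrib[symmetric] abs_mult)
    ultimately show "d \<le> \<bar>a - b\<bar>" by simp
  qed
  define \<kappa> where "\<kappa> = sqrt d / 2"
  have \<kappa>: "0 < \<kappa>" "4 * \<kappa>\<^sup>2 \<le> d" using d by (auto simp: \<kappa>_def power_divide)
  define M where "M = R + C\<^sub>0 + 1"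
  have M: "M > 0" using pos by (simp add: M_def)
  define \<theta> where "\<theta> = min (\<kappa> / 2) (min (d * \<kappa> / 2) (d * \<kappa> / (4 * M)))"
  have \<theta>: "\<theta> > 0" using \<kappa> d M by (simp add: \<theta>_def)
  show thesis
  proof (rule that[of "2 / d" "d ^ 4 / 32"])
    show "2 / d > 0" "d ^ 4 / 32 > 0" using d by auto
    fix \<Lambda> :: real
    (* The loss from the middle stretch to the whole word is the factor d^2 / 4 * theta^2. *)
    define \<Lambda>1 where "\<Lambda>1 = max \<Lambda> 1 / (d\<^sup>2 / 4 * \<theta>\<^sup>2)"
    have \<Lambda>1: "\<Lambda>1 > 0" "d\<^sup>2 / 4 * \<theta>\<^sup>2 * \<Lambda>1 = max \<Lambda> 1" using d \<theta> by (auto simp: \<Lambda>1_def)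
    obtain m where m: "\<And>y :: nat \<Rightarrow> real. \<exists>l\<le>m. \<exists>\<eta>. (\<forall>k. \<bar>\<eta> k\<bar> \<le> e) \<and> \<Lambda>1 + 1 \<le> \<bar>continuant (\<lambda>k. y k - \<eta> k) 0 (Suc l)\<bar>"
      using exists_large_continuant[OF e(1), of "\<Lambda>1 + 1"] by auto
    (* Within distance r of an energy the continuants of index at most m + 1 change by at most 1,
       which is why the stretches are built with one unit to spare. *)
    define r where "r = 1 / (real (Suc m) * (M + 1) ^ Suc m)"
    have r: "r > 0" using M by (simp add: r_def)
    (* Every point of [-R, R] is within distance r of one of Ek 0, ..., Ek (K - 1). *)
    define K where "K = nat \<lceil>2 * R / r\<rceil> + 1"
    define Ek where "Ek k = - R + real k * r" for k
    (* A slot has m sites for the large continuant and four more for the random letters around it. *)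
    define L where "L = m + 4"
    show "\<exists>N\<^sub>0. \<forall>A\<ge>N\<^sub>0. \<forall>B\<ge>N\<^sub>0. \<forall>u :: nat \<Rightarrow> real. (\<forall>p. \<bar>u p\<bar> \<le> C\<^sub>0) \<longrightarrow>
      (\<exists>\<zeta>. (\<forall>p. \<bar>\<zeta> p\<bar> \<le> \<epsilon>) \<and> measure lborel {E \<in> {-R..R}. \<not> hyperbolic_pair \<Lambda> (2 / d) (d ^ 4 / 32) (\<lambda>p. E - (u p + \<zeta> p)) A B} < \<eta>)"
    proof (intro exI[of _ "K * L + 10"] allI impI)
      fix A B :: nat and u :: "nat \<Rightarrow> real"
      assume AB: "K * L + 10 \<le> A" "K * L + 10 \<le> B" and u: "\<forall>p. \<bar>u p\<bar> \<le> C\<^sub>0"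
      define h where "h b = (if b then B else A)" for b
      define s where "s b = (if b then A else 0)" for b
      have hL: "K * L + 10 \<le> h b" for b using AB by (simp add: h_def)
      define Q where "Q b k l \<eta> \<longleftrightarrow> l \<le> m \<and> (\<forall>j. \<bar>\<eta> j\<bar> \<le> e) \<and>
          \<Lambda>1 + 1 \<le> \<bar>continuant (\<lambda>j. (Ek k - u (s b + k * L + 4 + j)) - \<eta> j) 0 (Suc l)\<bar>" for b k l \<eta>
      have "\<exists>l \<eta>. Q b k l \<eta>" for b k
        using m[of "\<lambda>j. Ek k - u (s b + k * L + 4 + j)"] unfolding Q_def by auto
      then have "\<exists>l. \<forall>b k. \<exists>\<eta>. Q b k (l b k) \<eta>" by (intro choice2)
      then obtain l where "\<forall>b k. \<exists>\<eta>. Q b k (l b k) \<eta>" by auto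
      then obtain \<eta>' where "\<forall>b k. Q b k (l b k) (\<eta>' b k)" using choice2[of "\<lambda>b k. Q b k (l b k)"] by auto
      then have l: "\<And>b k. l b k \<le> m" "\<And>b k j. \<bar>\<eta>' b k j\<bar> \<le> e"
          "\<And>b k. \<Lambda>1 + 1 \<le> \<bar>continuant (\<lambda>j. (Ek k - u (s b + k * L + 4 + j)) - \<eta>' b k j) 0 (Suc (l b k))\<bar>"
        unfolding Q_def by auto
      (* Site p belongs to the word bl p, at position q p of that word; det p says that its letter is part
         of a prepared stretch. *)
      define bl where "bl p = (A \<le> p)" for p
      define q where "q p = p - s (bl p)" for p
      define det where "det p \<longleftrightarrow> 4 \<le> q p \<and> (q p - 4) div L < K \<and> (q p - 4) mod L < l (bl p) ((q p - 4) div L)" for p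
      define N where "N = {p. p < A + B \<and> \<not> det p}"
      define D where "D p = (if p < A + B \<and> det p then \<eta>' (bl p) ((q p - 4) div L) ((q p - 4) mod L) else 0)" for p
      define Z where "Z \<xi> p = (if p \<in> N then \<xi> p else D p)" for \<xi> p
      define \<Omega> where "\<Omega> = PiE {..<A + B} (\<lambda>_. G)"
      have D: "\<bar>D p\<bar> \<le> e" for p using l(2) e by (auto simp: D_def)
      have Z: "\<bar>Z \<xi> p\<bar> \<le> e" if "\<xi> \<in> \<Omega>" for \<xi> p
        using that Ge D by (auto simp: Z_def \<Omega>_def N_def PiE_iff)
      have pos_q: "bl (s b + t) = b" "q (s b + t) = t" if "t < h b" for b t
        using that by (auto simp: bl_def s_def h_def q_def split: if_splits)
      have stAB: "s b + t < A + B" if "t < h b" for b t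
        using that by (auto simp: s_def h_def split: if_splits)
      define Bad where "Bad \<xi> = {E \<in> {-R..R}. \<not> hyperbolic_pair (max \<Lambda> 1) (2 / d) (d ^ 4 / 32) (\<lambda>p. E - (u p + Z \<xi> p)) A B}" for \<xi>
      have L4: "L \<ge> 4" "m < L" by (auto simp: L_def)
      have count: "card {\<xi> \<in> \<Omega>. E \<in> Bad \<xi>} * n \<le> 40 * card \<Omega>" if E: "E \<in> {-R..R}" for E
      proof -
        define k where "k = nat \<lfloor>(E + R) / r\<rfloor>"
        have fl: "0 \<le> (E + R) / r" using E r by simp
        have k1: "real k \<le> (E + R) / r" "(E + R) / r < real k + 1" unfolding k_def using fl by linarith+
        have Ek1: "\<bar>E - Ek k\<bar> \<le> r" using k1 r unfolding Ek_def by (auto simp: field_simps abs_le_iff)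
        have "real k \<le> 2 * R / r" using k1(1) E r by (smt (verit) atLeastAtMost_iff divide_right_mono)
        then have kK: "k < K" unfolding K_def by linarith
        have kL: "k * L + L \<le> K * L" using kK by (metis Suc_leI mult_Suc mult_le_mono1 add.commute)
        define X where "X \<xi> = (\<lambda>p. E - (u p + Z \<xi> p))" for \<xi>
        have "card {\<xi> \<in> PiE {..<A + B} (\<lambda>_. G). \<not> hyperbolic_pair (d\<^sup>2 / 4 * \<theta>\<^sup>2 * \<Lambda>1) (2 / d) (d ^ 4 / 32) (X \<xi>) (h False) (h True)} * card G
          \<le> 40 * card (PiE {..<A + B} (\<lambda>_. G))"
        proof (rule card_not_hyperbolic[OF sepG fG d \<kappa> M, where N = N and s = s and i = "\<lambda>b. k * L"
              and l = "\<lambda>b. l b k" and g = "\<lambda>b. h b - (k * L + l b k + 8)"])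
          show "\<exists>c. \<forall>\<xi> t. X (\<xi>(p := t)) = (X \<xi>)(p := c - t)" if "p \<in> N" for p
            using that by (intro exI[of _ "E - u p"]) (auto simp: X_def Z_def fun_eq_iff)
          show "finite {..<A + B}" "N \<subseteq> {..<A + B}" by (auto simp: N_def)
          show "\<bar>X \<xi> p\<bar> \<le> M" if "\<xi> \<in> {..<A + B} \<rightarrow>\<^sub>E G" for \<xi> p
            using Z[of \<xi> p] that E u[rule_format, of p] e unfolding X_def M_def \<Omega>_def[symmetric]
            by (auto simp: abs_le_iff)
          have "k * L + l b k + 8 \<le> h b" for b using hL[of b] kL l(1)[of b k] by (simp add: L_def)
          then show "h False = k * L + l False k + (h False - (k * L + l False k + 8)) + 8"
             "h True = k * L + l True k + (h True - (k * L + l True k + 8)) + 8"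
            by (metis add.assoc add.commute le_add_diff_inverse)+
          show "s False = 0" "s True = h False" by (auto simp: s_def h_def)
          show "{s b, s b + k * L + 2, s b + k * L + 3, s b + k * L + l b k + 4, s b + k * L + l b k + 5, s b + h b - 1} \<subseteq> N" for b
          proof -
            have inN: "s b + t \<in> N" if "t < h b" "t < 4 \<or> (t - 4) div L \<ge> K \<or> (t - 4) mod L \<ge> l b ((t - 4) div L)" for t
              using that stAB[of t b] pos_q[of t b] by (auto simp: N_def det_def)
            have lb: "l b k' \<le> m" for k' by (rule l(1))
            have 1: "s b + (k * L + t) \<in> N" if "t = 2 \<or> t = 3" for t
            proof (rule inN)
              show "k * L + t < h b" using that hL[of b] kL by (auto simp: L_def)
              show "k * L + t < 4 \<or> (k * L + t - 4) div L \<ge> K \<or> (k * L + t - 4) mod L \<ge> l b ((k * L + t - 4) div L)"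
              proof (cases k)
                case 0
                then show ?thesis using that by auto
              next
                case (Suc k')
                then have "k * L + t - 4 = k' * L + (m + t)" using that by (auto simp: L_def)
                moreover have "m + t < L" using that by (auto simp: L_def)
                ultimately have "(k * L + t - 4) mod L = m + t" by simp
                then show ?thesis using lb[of "(k * L + t - 4) div L"] by auto
              qed
            qed
            have 2: "s b + (k * L + l b k + t) \<in> N" if "t = 4 \<or> t = 5" for t
            proof (rule inN)
              show "k * L + l b k + t < h b" using that hL[of b] kL lb[of k] by (auto simp: L_def)
              have *: "k * L + l b k + t - 4 = k * L + (l b k + (t - 4))" using that by auto
              have "l b k + (t - 4) < L" using that lb[of k] by (auto simp: L_def)
              then have "(k * L + l b k + t - 4) mod L = l b k + (t - 4)" "(k * L + l b k + t - 4) div L = k"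
                unfolding * using L4 by auto
              then show "k * L + l b k + t < 4 \<or> (k * L + l b k + t - 4) div L \<ge> K \<or> (k * L + l b k + t - 4) mod L \<ge> l b ((k * L + l b k + t - 4) div L)"
                by simp
            qed
            have 3: "s b + 0 \<in> N" by (rule inN) (use hL[of b] in auto)
            have 4: "s b + (h b - 1) \<in> N"
            proof (rule inN)
              show "h b - 1 < h b" using hL[of b] by simp
              have "K * L \<le> h b - 1 - 4" using hL[of b] by simp
              then have "K \<le> (h b - 1 - 4) div L" using L4 by (metis div_le_mono div_mult_self_is_m less_le_trans zero_less_numeral)
              then show "h b - 1 < 4 \<or> K \<le> (h b - 1 - 4) div L \<or> l b ((h b - 1 - 4) div L) \<le> (h b - 1 - 4) mod L" by blast
            qed
            show ?thesis using 1[of 2] 1[of 3] 2[of 4] 2[of 5] 3 4 hL[of b] by (auto simp: add.assoc)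
          qed
          show "\<Lambda>1 \<le> \<bar>continuant (X \<xi>) (s b + k * L + 4) (Suc (l b k))\<bar>" if "\<xi> \<in> {..<A + B} \<rightarrow>\<^sub>E G" for b \<xi>
          proof -
            let ?x = "\<lambda>j. E - u (s b + k * L + 4 + j) - \<eta>' b k j"
            let ?y = "\<lambda>j. (Ek k - u (s b + k * L + 4 + j)) - \<eta>' b k j"
            have Ekb: "\<bar>Ek k\<bar> \<le> R"
            proof -
              have "real k * r \<le> E + R" using k1(1) r by (simp add: field_simps)
              then show ?thesis using E r unfolding Ek_def by (auto simp: abs_le_iff)
            qed
            have "continuant (X \<xi>) (s b + k * L + 4) (Suc (l b k)) = continuant (\<lambda>j. X \<xi> (s b + k * L + 4 + j)) 0 (Suc (l b k))"
              by (rule continuant_shift)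
            also have "\<dots> = continuant ?x 0 (Suc (l b k))"
            proof (rule continuant_cong)
              fix j assume "Suc j < 0 + Suc (l b k)"
              then have j: "j < l b k" by simp
              define t where "t = k * L + 4 + j"
              have th: "t < h b" using j l(1)[of b k] kL hL[of b] by (auto simp: t_def L_def)
              have "t - 4 = k * L + j" "j < L" using j l(1)[of b k] by (auto simp: t_def L_def)
              then have dm: "(t - 4) div L = k" "(t - 4) mod L = j" by auto
              have "det (s b + t)" unfolding det_def pos_q[OF th] dm using kK j by (auto simp: t_def)
              then have "Z \<xi> (s b + t) = \<eta>' b k j"
                using stAB[OF th] by (simp add: Z_def N_def D_def pos_q[OF th] dm)
              then show "X \<xi> (s b + k * L + 4 + j) = ?x j" by (simp add: X_def t_def add.assoc)
            qed
            finally have eq: "continuant (X \<xi>) (s b + k * L + 4) (Suc (l b k)) = continuant ?x 0 (Suc (l b k))" .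
            have "\<bar>continuant ?x 0 (Suc (l b k)) - continuant ?y 0 (Suc (l b k))\<bar> \<le> real (Suc (l b k)) * (M + 1) ^ (Suc (l b k)) * r"
            proof (rule continuant_lipschitz)
              fix j
              have "\<bar>u (s b + k * L + 4 + j)\<bar> \<le> C\<^sub>0" "\<bar>\<eta>' b k j\<bar> \<le> e" using u l(2) by auto
              then show "\<bar>?x j\<bar> \<le> M" "\<bar>?y j\<bar> \<le> M" "\<bar>?x j - ?y j\<bar> \<le> r"
                using E Ekb e Ek1 unfolding M_def by (auto simp: abs_le_iff)
            qed
            also have "\<dots> \<le> real (Suc m) * (M + 1) ^ (Suc m) * r"
              using l(1)[of b k] M r by (intro mult_right_mono mult_mono power_increasing) auto
            also have "\<dots> = 1" unfolding r_def using M by simp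
            finally show ?thesis using l(3)[of k b] unfolding eq by linarith
          qed
        qed (use \<theta>_def \<Lambda>1 in auto)
        then show ?thesis
          unfolding cG \<Lambda>1(2) Bad_def \<Omega>_def X_def h_def using E by simp
      qed
      have fin\<Omega>: "finite \<Omega>" unfolding \<Omega>_def by (intro finite_PiE fG) auto
      have meas: "Bad \<xi> \<in> sets lborel" for \<xi>
      proof -
        have "Bad \<xi> = {-R..R} - {E. hyperbolic_pair (max \<Lambda> 1) (2 / d) (d ^ 4 / 32) (\<lambda>p. E - (u p + Z \<xi> p)) A B}"
          by (auto simp: Bad_def)
        then show ?thesis using closed_hyperbolic by (simp add: borel_closed sets.Diff)
      qed
      have sub: "Bad \<xi> \<subseteq> {-R..R}" for \<xi> by (auto simp: Bad_def)
      have fm: "emeasure lborel (Bad \<xi>) < \<infinity>" for \<xi>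
      proof -
        have "emeasure lborel (Bad \<xi>) \<le> emeasure lborel {-R..R}"
          by (rule emeasure_mono[OF sub]) simp
        also have "\<dots> = ennreal (2 * R)" using pos by simp
        finally show ?thesis by (simp add: le_less_trans)
      qed
      have "\<exists>\<xi>\<in>\<Omega>. measure lborel (Bad \<xi>) < \<eta>"
      proof (rule ccontr)
        assume "\<not> ?thesis"
        then have ge: "\<eta> \<le> measure lborel (Bad \<xi>)" if "\<xi> \<in> \<Omega>" for \<xi> using that by force
        have ne: "card \<Omega> > 0" unfolding \<Omega>_def using cG n0 by (simp add: card_PiE)
        have "real (card \<Omega>) * \<eta> \<le> (\<Sum>\<xi>\<in>\<Omega>. measure lborel (Bad \<xi>))"
          using sum_mono[of \<Omega> "\<lambda>_. \<eta>", OF ge] by simp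
        also have "\<dots> = (\<Sum>\<xi>\<in>\<Omega>. \<integral>E. indicator (Bad \<xi>) E \<partial>lborel)"
          by simp
        also have "\<dots> = (\<integral>E. (\<Sum>\<xi>\<in>\<Omega>. indicator (Bad \<xi>) E) \<partial>lborel)"
          by (rule Bochner_Integration.integral_sum[symmetric]) (use meas fm in auto)
        also have "\<dots> \<le> (\<integral>E. (40 * real (card \<Omega>) / real n) * indicator {-R..R} E \<partial>lborel)"
        proof (rule integral_mono)
          fix E
          show "(\<Sum>\<xi>\<in>\<Omega>. indicator (Bad \<xi>) E) \<le> (40 * real (card \<Omega>) / real n) * indicator {-R..R} E"
          proof (cases "E \<in> {-R..R}")
            case True
            have "(\<Sum>\<xi>\<in>\<Omega>. indicator (Bad \<xi>) E) = real (card {\<xi> \<in> \<Omega>. E \<in> Bad \<xi>})"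
            proof -
              have "(\<Sum>\<xi>\<in>\<Omega>. indicator (Bad \<xi>) E) = (\<Sum>\<xi>\<in>\<Omega>. if \<xi> \<in> {\<xi>. E \<in> Bad \<xi>} then 1 else 0 :: real)"
                by (rule sum.cong) (auto simp: indicator_def)
              also have "\<dots> = real (card (\<Omega> \<inter> {\<xi>. E \<in> Bad \<xi>}))"
                unfolding sum.inter_restrict[OF fin\<Omega>, symmetric] by simp
              finally show ?thesis by (simp only: Int_def mem_Collect_eq)
            qed
            moreover have "real (card {\<xi> \<in> \<Omega>. E \<in> Bad \<xi>}) * real n \<le> 40 * real (card \<Omega>)"
              using of_nat_mono[OF count[OF True], where 'a = real] by simp
            ultimately show ?thesis using True n0 by (simp add: pos_le_divide_eq)
          next
            case False
            then have "E \<notin> Bad \<xi>" for \<xi> using sub by blast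
            then show ?thesis using False by simp
          qed
        next
          show "integrable lborel (\<lambda>E. (40 * real (card \<Omega>) / real n) * indicator {-R..R} E)"
            using pos by (intro integrable_mult_right integrable_real_indicator) auto
        qed (use meas fm in auto)
        also have "\<dots> = 40 * real (card \<Omega>) / real n * (2 * R)" using pos by simp
        finally have "\<eta> * real (card \<Omega>) \<le> (80 * R / real n) * real (card \<Omega>)" by (simp add: field_simps)
        then have "\<eta> \<le> 80 * R / real n" by (rule mult_right_le_imp_le) (use ne in simp)
        then show False using n n0 pos by (simp add: field_simps)
      qed
      then obtain \<xi> where \<xi>: "\<xi> \<in> \<Omega>" "measure lborel (Bad \<xi>) < \<eta>" by auto
      show "\<exists>\<zeta>. (\<forall>p. \<bar>\<zeta> p\<bar> \<le> \<epsilon>) \<and> measure lborel {E \<in> {-R..R}. \<not> hyperbolic_pair \<Lambda> (2 / d) (d ^ 4 / 32) (\<lambda>p. E - (u p + \<zeta> p)) A B} < \<eta>"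
      proof (intro exI[of _ "Z \<xi>"] conjI allI)
        show "\<bar>Z \<xi> p\<bar> \<le> \<epsilon>" for p using Z[OF \<xi>(1), of p] e by simp
        have "{E \<in> {-R..R}. \<not> hyperbolic_pair \<Lambda> (2 / d) (d ^ 4 / 32) (\<lambda>p. E - (u p + Z \<xi> p)) A B} \<subseteq> Bad \<xi>"
          by (auto simp: Bad_def hyperbolic_pair_def dominant_def)
        moreover have "Bad \<xi> \<in> fmeasurable lborel" using meas fm by (auto simp: fmeasurable_def)
        moreover have "{E \<in> {-R..R}. \<not> hyperbolic_pair \<Lambda> (2 / d) (d ^ 4 / 32) (\<lambda>p. E - (u p + Z \<xi> p)) A B} \<in> sets lborel"
        proof -
          have "{E \<in> {-R..R}. \<not> hyperbolic_pair \<Lambda> (2 / d) (d ^ 4 / 32) (\<lambda>p. E - (u p + Z \<xi> p)) A B} =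
              {-R..R} - {E. hyperbolic_pair \<Lambda> (2 / d) (d ^ 4 / 32) (\<lambda>p. E - (u p + Z \<xi> p)) A B}" by auto
          then show ?thesis using closed_hyperbolic by (simp add: borel_closed sets.Diff)
        qed
        ultimately have "measure lborel {E \<in> {-R..R}. \<not> hyperbolic_pair \<Lambda> (2 / d) (d ^ 4 / 32) (\<lambda>p. E - (u p + Z \<xi> p)) A B} \<le> measure lborel (Bad \<xi>)"
          by (intro measure_mono_fmeasurable)
        then show "measure lborel {E \<in> {-R..R}. \<not> hyperbolic_pair \<Lambda> (2 / d) (d ^ 4 / 32) (\<lambda>p. E - (u p + Z \<xi> p)) A B} < \<eta>"
          using \<xi>(2) by simp
      qed
    qed
  qed
qed

section \<open>Hyperbolicity bounds the resolvent\<close>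

lemma sq_sum3: "(a + b + c)\<^sup>2 \<le> 3 * (a\<^sup>2 + b\<^sup>2 + c\<^sup>2)" for a b c :: real
proof -
  have "0 \<le> (a - b)\<^sup>2 + (b - c)\<^sup>2 + (a - c)\<^sup>2" by simp
  then show ?thesis by (simp add: power2_eq_square algebra_simps)
qed

lemma sq_sum4: "(a + b + c + d)\<^sup>2 \<le> 4 * (a\<^sup>2 + b\<^sup>2 + c\<^sup>2 + d\<^sup>2)" for a b c d :: real
proof -
  have "0 \<le> (a - b)\<^sup>2 + (b - c)\<^sup>2 + (a - c)\<^sup>2 + (a - d)\<^sup>2 + (b - d)\<^sup>2 + (c - d)\<^sup>2" by simp
  then show ?thesis by (simp add: power2_eq_square algebra_simps)
qed

lemma summable_finite_support:
  fixes f :: "int \<Rightarrow> real"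
  assumes "finite {n \<in> I. f n \<noteq> 0}"
  shows "(\<lambda>n. (f n)\<^sup>2) summable_on I"
proof (rule finite_nonzero_values_imp_summable_on)
  have "{n \<in> I. (f n)\<^sup>2 \<noteq> 0} = {n \<in> I. f n \<noteq> 0}" by auto
  then show "finite {n \<in> I. (f n)\<^sup>2 \<noteq> 0}" using assms by simp
qed

text \<open>
  Sequences with \<open>P\<close> bounded by a small multiple of the next \<open>P\<close>, and \<open>Q\<close> by a small multiple
  of the previous \<open>Q\<close>, up to coupling and sources \<open>S\<close>.  Summing the squares over \<open>I\<close>, which \<open>nx\<close> permutes,
  lets the small terms be absorbed on the left; finite supports make the subtraction legitimate.
\<close>

lemma junction_estimate:
  fixes P Q S :: "int \<Rightarrow> real" and k C D l :: real
  assumes nx: "bij_betw nx I I"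
    and fin: "finite {n \<in> I. P n \<noteq> 0}" "finite {n \<in> I. Q n \<noteq> 0}" "finite {n \<in> I. S n \<noteq> 0}"
    and nonneg: "\<And>n. 0 \<le> P n" "\<And>n. 0 \<le> Q n" "\<And>n. 0 \<le> S n" "0 \<le> k" "0 \<le> C" "0 \<le> D" "0 \<le> l"
    and P: "\<And>n. n \<in> I \<Longrightarrow> P (nx n) \<le> k * P (nx (nx n)) + k * (C * Q n) + D * S (nx n) + D * S n"
    and Q: "\<And>n. n \<in> I \<Longrightarrow> Q (nx n) \<le> C * P (nx n) + l * Q n + D * S n"
    and k: "4 * k\<^sup>2 * (1 + 6 * C ^ 4) \<le> 1 / 2" and l: "3 * l\<^sup>2 \<le> 1 / 2"
  defines "F \<equiv> (\<Sum>\<^sub>\<infinity>n\<in>I. (S n)\<^sup>2)"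
  shows "(\<Sum>\<^sub>\<infinity>n\<in>I. (P n)\<^sup>2) \<le> 2 * (8 * D\<^sup>2 + 4 * k\<^sup>2 * C\<^sup>2 * (6 * D\<^sup>2)) * F"
    and "(\<Sum>\<^sub>\<infinity>n\<in>I. (Q n)\<^sup>2) \<le> (6 * C\<^sup>2 * (2 * (8 * D\<^sup>2 + 4 * k\<^sup>2 * C\<^sup>2 * (6 * D\<^sup>2))) + 6 * D\<^sup>2) * F"
proof -
  have mem: "nx n \<in> I" if "n \<in> I" for n using nx that by (auto simp: bij_betw_def)
  note sP = summable_finite_support[OF fin(1)] and sQ = summable_finite_support[OF fin(2)] and sS = summable_finite_support[OF fin(3)]
  have nx2: "bij_betw (\<lambda>n. nx (nx n)) I I" using bij_betw_trans[OF nx nx] by (simp add: comp_def)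
  have sn: "(\<lambda>n. f (nx n)) summable_on I" "(\<lambda>n. f (nx (nx n))) summable_on I" if "f summable_on I" for f :: "int \<Rightarrow> real"
    using that summable_on_reindex_bij_betw[OF nx, of f] summable_on_reindex_bij_betw[OF nx2, of f] by auto
  have rn: "infsum (\<lambda>n. f (nx n)) I = infsum f I" "infsum (\<lambda>n. f (nx (nx n))) I = infsum f I" for f :: "int \<Rightarrow> real"
    using infsum_reindex_bij_betw[OF nx, of f] infsum_reindex_bij_betw[OF nx2, of f] by auto
  note sm = sP sQ sS sn[OF sP] sn[OF sQ] sn[OF sS]
  define p where "p = (\<Sum>\<^sub>\<infinity>n\<in>I. (P n)\<^sup>2)"
  define q where "q = (\<Sum>\<^sub>\<infinity>n\<in>I. (Q n)\<^sup>2)"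
  have p0: "0 \<le> p" and q0: "0 \<le> q" and F0: "0 \<le> F" unfolding p_def q_def F_def by (auto intro: infsum_nonneg)
  have "p = (\<Sum>\<^sub>\<infinity>n\<in>I. (P (nx n))\<^sup>2)" unfolding p_def by (rule rn(1)[symmetric])
  also have "\<dots> \<le> (\<Sum>\<^sub>\<infinity>n\<in>I. 4 * k\<^sup>2 * (P (nx (nx n)))\<^sup>2 + 4 * k\<^sup>2 * C\<^sup>2 * (Q n)\<^sup>2 + 4 * D\<^sup>2 * (S (nx n))\<^sup>2 + 4 * D\<^sup>2 * (S n)\<^sup>2)"
  proof (rule infsum_mono)
    fix n assume n: "n \<in> I"
    have "(P (nx n))\<^sup>2 \<le> (k * P (nx (nx n)) + k * (C * Q n) + D * S (nx n) + D * S n)\<^sup>2"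
      using P[OF n] nonneg by (intro power_mono) auto
    also have "\<dots> \<le> 4 * ((k * P (nx (nx n)))\<^sup>2 + (k * (C * Q n))\<^sup>2 + (D * S (nx n))\<^sup>2 + (D * S n)\<^sup>2)" by (rule sq_sum4)
    finally show "(P (nx n))\<^sup>2 \<le> 4 * k\<^sup>2 * (P (nx (nx n)))\<^sup>2 + 4 * k\<^sup>2 * C\<^sup>2 * (Q n)\<^sup>2 + 4 * D\<^sup>2 * (S (nx n))\<^sup>2 + 4 * D\<^sup>2 * (S n)\<^sup>2"
      by (simp add: power_mult_distrib algebra_simps)
  qed (intro summable_on_add summable_on_cmult_right sm)+
  also have "\<dots> = 4 * k\<^sup>2 * p + 4 * k\<^sup>2 * C\<^sup>2 * q + 4 * D\<^sup>2 * F + 4 * D\<^sup>2 * F"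
    unfolding p_def q_def F_def
    by (subst infsum_add infsum_cmult_right', (intro summable_on_add summable_on_cmult_right sm)+)+
      (simp add: rn[of "\<lambda>n. (P n)\<^sup>2"] rn[of "\<lambda>n. (S n)\<^sup>2"] infsum_cmult_right')
  finally have pe: "p \<le> 4 * k\<^sup>2 * p + 4 * k\<^sup>2 * C\<^sup>2 * q + 8 * D\<^sup>2 * F" by linarith
  have "q = (\<Sum>\<^sub>\<infinity>n\<in>I. (Q (nx n))\<^sup>2)" unfolding q_def by (rule rn(1)[symmetric])
  also have "\<dots> \<le> (\<Sum>\<^sub>\<infinity>n\<in>I. 3 * C\<^sup>2 * (P (nx n))\<^sup>2 + 3 * l\<^sup>2 * (Q n)\<^sup>2 + 3 * D\<^sup>2 * (S n)\<^sup>2)"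
  proof (rule infsum_mono)
    fix n assume n: "n \<in> I"
    have "(Q (nx n))\<^sup>2 \<le> (C * P (nx n) + l * Q n + D * S n)\<^sup>2"
      using Q[OF n] nonneg by (intro power_mono) auto
    also have "\<dots> \<le> 3 * ((C * P (nx n))\<^sup>2 + (l * Q n)\<^sup>2 + (D * S n)\<^sup>2)" by (rule sq_sum3)
    finally show "(Q (nx n))\<^sup>2 \<le> 3 * C\<^sup>2 * (P (nx n))\<^sup>2 + 3 * l\<^sup>2 * (Q n)\<^sup>2 + 3 * D\<^sup>2 * (S n)\<^sup>2"
      by (simp add: power_mult_distrib algebra_simps)
  qed (intro summable_on_add summable_on_cmult_right sm)+
  also have "\<dots> = 3 * C\<^sup>2 * p + 3 * l\<^sup>2 * q + 3 * D\<^sup>2 * F"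
    unfolding p_def q_def F_def
    by (subst infsum_add infsum_cmult_right', (intro summable_on_add summable_on_cmult_right sm)+)+
      (simp add: rn[of "\<lambda>n. (P n)\<^sup>2"] infsum_cmult_right')
  finally have "q \<le> 3 * C\<^sup>2 * p + 3 * l\<^sup>2 * q + 3 * D\<^sup>2 * F" .
  moreover have "3 * l\<^sup>2 * q \<le> 1 / 2 * q" using l q0 by (rule mult_right_mono)
  ultimately have qe: "q \<le> 6 * C\<^sup>2 * p + 6 * D\<^sup>2 * F" by linarith
  have "4 * k\<^sup>2 * C\<^sup>2 * q \<le> 4 * k\<^sup>2 * C\<^sup>2 * (6 * C\<^sup>2 * p + 6 * D\<^sup>2 * F)" by (intro mult_left_mono qe) auto
  then have "p \<le> 4 * k\<^sup>2 * p + 4 * k\<^sup>2 * C\<^sup>2 * (6 * C\<^sup>2 * p + 6 * D\<^sup>2 * F) + 8 * D\<^sup>2 * F" using pe by linarith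
  also have "\<dots> = 4 * k\<^sup>2 * (1 + 6 * C ^ 4) * p + (8 * D\<^sup>2 + 4 * k\<^sup>2 * C\<^sup>2 * (6 * D\<^sup>2)) * F"
    by (simp add: algebra_simps power2_eq_square power4_eq_xxxx)
  also have "\<dots> \<le> 1 / 2 * p + (8 * D\<^sup>2 + 4 * k\<^sup>2 * C\<^sup>2 * (6 * D\<^sup>2)) * F"
    using k p0 by (intro add_right_mono mult_right_mono) auto
  finally have "p \<le> 1 / 2 * p + (8 * D\<^sup>2 + 4 * k\<^sup>2 * C\<^sup>2 * (6 * D\<^sup>2)) * F" .
  moreover have "p \<le> 2 * Z * F" if "p \<le> 1 / 2 * p + Z * F" for Z
    using that by simp
  ultimately have pf: "p \<le> 2 * (8 * D\<^sup>2 + 4 * k\<^sup>2 * C\<^sup>2 * (6 * D\<^sup>2)) * F" by blast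
  then show "(\<Sum>\<^sub>\<infinity>n\<in>I. (P n)\<^sup>2) \<le> 2 * (8 * D\<^sup>2 + 4 * k\<^sup>2 * C\<^sup>2 * (6 * D\<^sup>2)) * F" unfolding p_def .
  have "6 * C\<^sup>2 * p \<le> 6 * C\<^sup>2 * (2 * (8 * D\<^sup>2 + 4 * k\<^sup>2 * C\<^sup>2 * (6 * D\<^sup>2)) * F)" by (intro mult_left_mono pf) auto
  then have "q \<le> 6 * C\<^sup>2 * (2 * (8 * D\<^sup>2 + 4 * k\<^sup>2 * C\<^sup>2 * (6 * D\<^sup>2)) * F) + 6 * D\<^sup>2 * F" using qe by linarith
  then show "(\<Sum>\<^sub>\<infinity>n\<in>I. (Q n)\<^sup>2) \<le> (6 * C\<^sup>2 * (2 * (8 * D\<^sup>2 + 4 * k\<^sup>2 * C\<^sup>2 * (6 * D\<^sup>2))) + 6 * D\<^sup>2) * F"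
    unfolding q_def by (simp add: algebra_simps)
qed

lemma block_propagation:
  fixes y :: "nat \<Rightarrow> real" and \<phi> :: "nat \<Rightarrow> real"
  assumes rec: "\<And>j. j < h \<Longrightarrow> y (Suc (Suc j)) = x (s + j) * y (Suc j) - y j + \<phi> j"
    and X: "1 \<le> X" "\<And>k. \<bar>x k\<bar> \<le> X" and S: "S = (\<Sum>j<h. \<bar>\<phi> j\<bar>)"
  shows "j \<le> h \<Longrightarrow> \<bar>y (Suc j) - (continuant x s (Suc j) * y 1 - continuant x (Suc s) j * y 0)\<bar> \<le> (X + 1) ^ j * S"
proof (induction j rule: induct_nat_012)
  case 0
  have "0 \<le> S" unfolding S by (intro sum_nonneg) auto
  then show ?case by simp
next
  case 1
  have "\<bar>\<phi> 0\<bar> \<le> S" unfolding S by (rule member_le_sum) (use 1 in auto)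
  moreover have "1 * S \<le> (X + 1) * S" using X calculation by (intro mult_right_mono) auto
  moreover have "y (Suc 1) = x s * y 1 - y 0 + \<phi> 0" using rec[of 0] 1 by simp
  ultimately show ?case by simp
next
  case (ge2 j)
  let ?z = "\<lambda>j. continuant x s (Suc j) * y 1 - continuant x (Suc s) j * y 0"
  define e where "e j = y (Suc j) - ?z j" for j
  have S0: "0 \<le> S" unfolding S by (intro sum_nonneg) auto
  have "?z (Suc (Suc j)) = x (s + Suc j) * ?z (Suc j) - ?z j"
    unfolding continuant.simps(3) by (simp add: algebra_simps del: continuant.simps)
  moreover have "y (Suc (Suc (Suc j))) = x (s + Suc j) * y (Suc (Suc j)) - y (Suc j) + \<phi> (Suc j)"
    using rec[of "Suc j"] ge2.prems by simp
  ultimately have "e (Suc (Suc j)) = x (s + Suc j) * e (Suc j) - e j + \<phi> (Suc j)"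
    unfolding e_def by (simp only:) (simp add: algebra_simps del: continuant.simps)
  then have "\<bar>e (Suc (Suc j))\<bar> \<le> \<bar>x (s + Suc j)\<bar> * \<bar>e (Suc j)\<bar> + \<bar>e j\<bar> + \<bar>\<phi> (Suc j)\<bar>"
    unfolding abs_mult[symmetric] by linarith
  also have "\<dots> \<le> X * ((X + 1) ^ Suc j * S) + (X + 1) ^ j * S + S"
  proof (intro add_mono mult_mono X)
    show "\<bar>e (Suc j)\<bar> \<le> (X + 1) ^ Suc j * S" "\<bar>e j\<bar> \<le> (X + 1) ^ j * S"
      unfolding e_def using ge2 by auto
    show "\<bar>\<phi> (Suc j)\<bar> \<le> S" unfolding S by (rule member_le_sum) (use ge2.prems in auto)
  qed (use X in auto)
  also have "\<dots> \<le> X * ((X + 1) ^ Suc j * S) + (X + 1) ^ Suc j * S"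
  proof -
    have "1 * 1 \<le> X * (X + 1) ^ j" using X by (intro mult_mono one_le_power) auto
    then have "(X + 1) ^ j + 1 \<le> (X + 1) ^ Suc j" by (simp add: algebra_simps)
    then have "((X + 1) ^ j + 1) * S \<le> (X + 1) ^ Suc j * S" using S0 by (rule mult_right_mono)
    then show ?thesis by (simp add: algebra_simps)
  qed
  also have "\<dots> = (X + 1) ^ Suc (Suc j) * S" by (simp add: algebra_simps)
  finally show ?case unfolding e_def .
qed

text \<open>
  The transfer relation expresses \<open>(p', q')\<close> at the right end of a block by \<open>(p, q)\<close> at the left end.  It is
  solved here for \<open>p\<close> and \<open>q'\<close>, one value at each end: in this form the value from the opposite end is
  divided by the large entry \<open>a\<close>.
\<close>

lemma block_transfer:
  fixes a b d f p q p' q' :: real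
  assumes det: "a * f - d * b = -1" and a: "\<Lambda> \<le> \<bar>a\<bar>" "1 \<le> \<Lambda>" and b: "\<bar>b\<bar> \<le> C * \<bar>a\<bar>" and d: "\<bar>d\<bar> \<le> C * \<bar>a\<bar>"
    and e: "\<bar>p' - (a * p - b * q)\<bar> \<le> S" "\<bar>q' - (d * p - f * q)\<bar> \<le> S"
  shows "\<bar>p - b / a * q - p' / a\<bar> \<le> S" and "\<bar>q' - d / a * p' - q / a\<bar> \<le> (C + 1) * S"
proof -
  have a0: "a \<noteq> 0" "1 \<le> \<bar>a\<bar>" using a by auto
  define e1 where "e1 = p' - (a * p - b * q)"
  define e2 where "e2 = q' - (d * p - f * q)"
  have S0: "0 \<le> S" using e(1) by linarith
  have "p - b / a * q - p' / a = - e1 / a" using a0 unfolding e1_def by (simp add: field_simps)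
  then have "\<bar>p - b / a * q - p' / a\<bar> = \<bar>e1\<bar> / \<bar>a\<bar>" by simp
  also have "\<dots> \<le> \<bar>e1\<bar> / 1" using a0 by (intro divide_left_mono) auto
  finally show "\<bar>p - b / a * q - p' / a\<bar> \<le> S" using e(1) by (simp add: e1_def)
  have "q' - d / a * p' - q / a = e2 - d / a * e1 + (a * f - d * b + 1) * (- q / a)"
    using a0 unfolding e1_def e2_def by (simp add: field_simps)
  then have eq: "q' - d / a * p' - q / a = e2 - d / a * e1" using det by simp
  have "\<bar>d / a\<bar> \<le> C" using d a0 by (simp add: divide_le_eq)
  moreover have "\<bar>e1\<bar> \<le> S" using e(1) by (simp add: e1_def)
  ultimately have "\<bar>d / a\<bar> * \<bar>e1\<bar> \<le> C * S" by (meson abs_ge_zero mult_mono order_trans)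
  then have "\<bar>d / a * e1\<bar> \<le> C * S" by (simp only: abs_mult)
  moreover have "\<bar>e2\<bar> \<le> S" using e(2) by (simp add: e2_def)
  moreover have "(C + 1) * S = C * S + S" by (simp add: algebra_simps)
  ultimately show "\<bar>q' - d / a * p' - q / a\<bar> \<le> (C + 1) * S"
    unfolding eq by linarith
qed

text \<open>
  At a junction the relation from the block on the right and the one from the block on the left
  form a linear system for \<open>p\<close> and \<open>q\<close> with determinant \<open>1 - \<rho> \<tau>\<close>, and transversality bounds
  that determinant from below.
\<close>

lemma junction_bounds:
  fixes a a' b' d :: real
  assumes a: "\<Lambda> \<le> \<bar>a\<bar>" "\<Lambda> \<le> \<bar>a'\<bar>" "1 \<le> \<Lambda>" and C: "\<bar>b'\<bar> \<le> C * \<bar>a'\<bar>" "\<bar>d\<bar> \<le> C * \<bar>a\<bar>" and c: "0 < c"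
    and tr: "c * \<bar>a * a'\<bar> \<le> \<bar>a * a' - d * b'\<bar>"
    and 1: "\<bar>p - b' / a' * q - p' / a'\<bar> \<le> S'" and 2: "\<bar>q - d / a * p - q0 / a\<bar> \<le> S"
  shows "\<bar>p\<bar> \<le> 1 / (c * \<Lambda>) * \<bar>p'\<bar> + 1 / (c * \<Lambda>) * (C * \<bar>q0\<bar>) + S' / c + C * S / c"
    and "\<bar>q\<bar> \<le> C * \<bar>p\<bar> + 1 / \<Lambda> * \<bar>q0\<bar> + S"
proof -
  have a0: "a \<noteq> 0" "a' \<noteq> 0" using a by auto
  define \<rho> where "\<rho> = b' / a'"
  define \<tau> where "\<tau> = d / a"
  have \<rho>\<tau>: "\<bar>\<rho>\<bar> \<le> C" "\<bar>\<tau>\<bar> \<le> C" using C a0 unfolding \<rho>_def \<tau>_def by (auto simp: divide_le_eq)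
  have C0: "0 \<le> C" using \<rho>\<tau> by linarith
  have "1 - \<rho> * \<tau> = (a * a' - d * b') / (a * a')" using a0 unfolding \<rho>_def \<tau>_def by (simp add: field_simps)
  then have t: "c \<le> \<bar>1 - \<rho> * \<tau>\<bar>" using tr a0 by (simp add: abs_mult le_divide_eq)
  define e1 where "e1 = p - \<rho> * q - p' / a'"
  define e2 where "e2 = q - \<tau> * p - q0 / a"
  have q: "q = \<tau> * p + q0 / a + e2" by (simp add: e2_def)
  have ia: "\<bar>z / a\<bar> \<le> \<bar>z\<bar> / \<Lambda>" "\<bar>z / a'\<bar> \<le> \<bar>z\<bar> / \<Lambda>" for z
    using a a0 by (auto simp: intro!: divide_left_mono mult_pos_pos)
  show "\<bar>q\<bar> \<le> C * \<bar>p\<bar> + 1 / \<Lambda> * \<bar>q0\<bar> + S"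
  proof -
    have "\<bar>q\<bar> \<le> \<bar>\<tau>\<bar> * \<bar>p\<bar> + \<bar>q0 / a\<bar> + \<bar>e2\<bar>" unfolding abs_mult[symmetric] q by linarith
    also have "\<dots> \<le> C * \<bar>p\<bar> + \<bar>q0\<bar> / \<Lambda> + S"
      using \<rho>\<tau> ia(1)[of q0] 2 by (intro add_mono mult_right_mono) (auto simp: e2_def \<tau>_def)
    finally show ?thesis by simp
  qed
  have "(1 - \<rho> * \<tau>) * p = p' / a' + \<rho> * (q0 / a) + e1 + \<rho> * e2"
    unfolding e1_def e2_def by (simp add: algebra_simps)
  then have "\<bar>1 - \<rho> * \<tau>\<bar> * \<bar>p\<bar> = \<bar>p' / a' + \<rho> * (q0 / a) + e1 + \<rho> * e2\<bar>" by (simp add: abs_mult[symmetric])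
  also have "\<dots> \<le> \<bar>p' / a'\<bar> + \<bar>\<rho>\<bar> * \<bar>q0 / a\<bar> + \<bar>e1\<bar> + \<bar>\<rho>\<bar> * \<bar>e2\<bar>" unfolding abs_mult[symmetric] by linarith
  also have "\<dots> \<le> \<bar>p'\<bar> / \<Lambda> + C * (\<bar>q0\<bar> / \<Lambda>) + S' + C * S"
  proof -
    have e: "\<bar>e1\<bar> \<le> S'" "\<bar>e2\<bar> \<le> S" using 1 2 by (simp_all add: e1_def e2_def \<rho>_def \<tau>_def)
    show ?thesis by (intro add_mono mult_mono \<rho>\<tau> ia e C0 abs_ge_zero)
  qed
  finally have "c * \<bar>p\<bar> \<le> \<bar>p'\<bar> / \<Lambda> + C * (\<bar>q0\<bar> / \<Lambda>) + S' + C * S"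
    using mult_right_mono[OF t, of "\<bar>p\<bar>"] by simp
  then have "\<bar>p\<bar> \<le> (\<bar>p'\<bar> / \<Lambda> + C * (\<bar>q0\<bar> / \<Lambda>) + S' + C * S) / c" using c by (simp add: le_divide_eq mult.commute)
  also have "\<dots> = 1 / (c * \<Lambda>) * \<bar>p'\<bar> + 1 / (c * \<Lambda>) * (C * \<bar>q0\<bar>) + S' / c + C * S / c"
    using c a by (simp add: add_divide_distrib mult.commute)
  finally show "\<bar>p\<bar> \<le> 1 / (c * \<Lambda>) * \<bar>p'\<bar> + 1 / (c * \<Lambda>) * (C * \<bar>q0\<bar>) + S' / c + C * S / c" .
qed

text \<open>
  Blocks start at the points of \<open>I\<close>; besides covering each integer exactly once, the end of a block is
  the start of the next, so the successor map permutes \<open>I\<close>.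
\<close>

definition tiling :: "(bool \<Rightarrow> nat) \<Rightarrow> int set \<Rightarrow> (int \<Rightarrow> bool) \<Rightarrow> bool"
  where "tiling h I ty \<longleftrightarrow> bij_betw (\<lambda>n. n + int (h (ty n))) I I \<and>
    bij_betw (\<lambda>(n, j). n + int j) (SIGMA n:I. {..<h (ty n)}) UNIV"

text \<open>
  \<open>u\<close> is governed by its pairs of values at the junctions, \<open>P n = |u n|\<close> and \<open>Q n = |u (n - 1)|\<close> for
  \<open>n \<in> I\<close>.  Hyperbolicity estimates them by neighbouring junctions with small factors, so their
  square sums are bounded by that of \<open>jacobi v u - E u\<close>, and the recurrence fills in the blocks.  The constant
  \<open>K\<close> is the same for all energies and all ways of concatenating the two words.
\<close>

theorem hyperbolic_lower_bound:
  fixes x :: "nat \<Rightarrow> real"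
  assumes hyp: "hyperbolic_pair \<Lambda> C c x A B" and AB: "A \<ge> 1" "B \<ge> 1" and C: "C > 0" and c: "c > 0"
    and \<Lambda>: "\<Lambda> \<ge> 3" "8 * (1 + 6 * C ^ 4) \<le> c\<^sup>2 * \<Lambda>\<^sup>2" and xb: "\<And>k. \<bar>x k\<bar> \<le> X"
  defines "h \<equiv> (\<lambda>b. if b then B else A)" and "s \<equiv> (\<lambda>b. if b then A else 0)"
  obtains K where "K > 0"
    "\<And>v E I ty u. tiling h I ty \<Longrightarrow> (\<And>n j. n \<in> I \<Longrightarrow> j < h (ty n) \<Longrightarrow> E - v (n + int j) = x (s (ty n) + j)) \<Longrightarrow>
       finite {n. u n \<noteq> 0} \<Longrightarrow> (\<Sum>\<^sub>\<infinity>n. (u n)\<^sup>2) \<le> K * (\<Sum>\<^sub>\<infinity>n. (jacobi v u n - E * u n)\<^sup>2)"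
proof -
  define Y where "Y = max X 1"
  have Y: "1 \<le> Y" "\<And>k. \<bar>x k\<bar> \<le> Y" using xb by (auto simp: Y_def le_max_iff_disj)
  define H where "H = A + B"
  have hH: "h b \<le> H" "1 \<le> h b" for b using AB by (auto simp: h_def H_def)
  (* G bounds all continuants inside a block, and D all factors that arise in front of the sources S. *)
  define G where "G = (Y + 1) ^ (H + 1)"
  have G: "1 \<le> G" unfolding G_def using Y by (intro one_le_power) auto
  (* The contraction factor at a junction; the hypothesis on \<Lambda> makes it small against C. *)
  define k where "k = 1 / (c * \<Lambda>)"
  define D where "D = (C + 1) * ((C + 1) * G) * (1 / c + 1)"
  define KP where "KP = 2 * (8 * D\<^sup>2 + 4 * k\<^sup>2 * C\<^sup>2 * (6 * D\<^sup>2))"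
  define KQ where "KQ = 6 * C\<^sup>2 * (2 * (8 * D\<^sup>2 + 4 * k\<^sup>2 * C\<^sup>2 * (6 * D\<^sup>2))) + 6 * D\<^sup>2"
  define K where "K = 3 * G\<^sup>2 * real H * ((KP + KQ + 1) * real H)"
  have KPQ: "0 \<le> KP" "0 \<le> KQ" unfolding KP_def KQ_def by simp_all
  have H0: "real H > 0" using AB by (simp add: H_def)
  have dom: "dominant \<Lambda> C x (s b) (h b)" for b
    using hyp by (cases b) (auto simp: hyperbolic_pair_def h_def s_def)
  have tr: "transversal c x (s b) (h b) (s b') (h b')" for b b'
    using hyp by (cases b; cases b') (auto simp: hyperbolic_pair_def h_def s_def)
  show thesis
  proof (rule that[of K])
    show "K > 0" unfolding K_def using G H0 KPQ by (intro mult_pos_pos) auto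
    fix v :: "int \<Rightarrow> real" and E I ty and u :: "int \<Rightarrow> real"
    assume til: "tiling h I ty" and val: "\<And>n j. n \<in> I \<Longrightarrow> j < h (ty n) \<Longrightarrow> E - v (n + int j) = x (s (ty n) + j)"
      and fu: "finite {n. u n \<noteq> 0}"
    define nx where "nx n = n + int (h (ty n))" for n
    define \<phi> where "\<phi> n = jacobi v u n - E * u n" for n
    define S where "S n = (\<Sum>j<h (ty n). \<bar>\<phi> (n + int j)\<bar>)" for n
    have bij: "bij_betw nx I I" using til by (simp add: tiling_def nx_def[abs_def])
    have tile: "bij_betw (\<lambda>(n, j). n + int j) (SIGMA n:I. {..<h (ty n)}) UNIV" using til by (simp add: tiling_def)
    have finsh: "finite {n. g (n + m) \<noteq> 0}" if "finite {n. g n \<noteq> 0}" for g :: "int \<Rightarrow> real" and m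
    proof -
      have "inj (\<lambda>n :: int. n + m)" by (simp add: inj_on_def)
      from finite_vimageI[OF that this] show ?thesis by (simp add: vimage_def)
    qed
    have f\<phi>: "finite {n. \<phi> n \<noteq> 0}"
    proof (rule finite_subset)
      show "{n. \<phi> n \<noteq> 0} \<subseteq> {n. u (n + 1) \<noteq> 0} \<union> {n. u (n + -1) \<noteq> 0} \<union> {n. u n \<noteq> 0}"
        by (auto simp: \<phi>_def jacobi_def)
    qed (use finsh[OF fu, of 1] finsh[OF fu, of "-1"] fu in simp)
    have fS: "finite {n \<in> I. S n \<noteq> 0}"
    proof (rule finite_subset)
      show "{n \<in> I. S n \<noteq> 0} \<subseteq> (\<Union>j<H. {n. \<phi> (n + int j) \<noteq> 0})"
      proof
        fix n assume "n \<in> {n \<in> I. S n \<noteq> 0}"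
        then obtain j where "j < h (ty n)" "\<bar>\<phi> (n + int j)\<bar> \<noteq> 0" unfolding S_def by (auto elim: sum.not_neutral_contains_not_neutral)
        then show "n \<in> (\<Union>j<H. {n. \<phi> (n + int j) \<noteq> 0})" using hH(1)[of "ty n"] by auto
      qed
    qed (use finsh[OF f\<phi>] in auto)
    have S0: "0 \<le> S n" for n unfolding S_def by (intro sum_nonneg) auto
    have propag: "\<bar>u (n + int j) - (continuant x (s (ty n)) (Suc j) * u n - continuant x (Suc (s (ty n))) j * u (n - 1))\<bar> \<le> G * S n"
      if n: "n \<in> I" and j: "j \<le> h (ty n)" for n j
    proof -
      define y where "y i = u (n + int i - 1)" for i
      have rec: "y (Suc (Suc i)) = x (s (ty n) + i) * y (Suc i) - y i + \<phi> (n + int i)" if "i < h (ty n)" for i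
        unfolding val[OF n that, symmetric] y_def \<phi>_def jacobi_def by (simp add: algebra_simps)
      have "\<bar>y (Suc j) - (continuant x (s (ty n)) (Suc j) * y 1 - continuant x (Suc (s (ty n))) j * y 0)\<bar> \<le> (Y + 1) ^ j * S n"
        by (rule block_propagation[OF rec Y _ j]) (auto simp: S_def)
      also have "\<dots> \<le> G * S n"
        unfolding G_def using Y j hH(1)[of "ty n"] S0 by (intro mult_right_mono power_increasing) auto
      finally show ?thesis by (simp add: y_def)
    qed
    have transfer: "\<bar>u n - continuant x (Suc (s (ty n))) (h (ty n)) / continuant x (s (ty n)) (Suc (h (ty n))) * u (n - 1) - u (nx n) / continuant x (s (ty n)) (Suc (h (ty n)))\<bar> \<le> G * S n"
      "\<bar>u (nx n - 1) - continuant x (s (ty n)) (h (ty n)) / continuant x (s (ty n)) (Suc (h (ty n))) * u (nx n) - u (n - 1) / continuant x (s (ty n)) (Suc (h (ty n)))\<bar> \<le> (C + 1) * (G * S n)"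
      if n: "n \<in> I" for n
    proof -
      let ?s = "s (ty n)"
      obtain m where m: "h (ty n) = Suc m" using hH(2)[of "ty n"] by (cases "h (ty n)") auto
      have det: "continuant x ?s (Suc (h (ty n))) * continuant x (Suc ?s) m - continuant x ?s (h (ty n)) * continuant x (Suc ?s) (h (ty n)) = -1"
        unfolding m by (rule continuant_det)
      have 1: "\<bar>u (nx n) - (continuant x ?s (Suc (h (ty n))) * u n - continuant x (Suc ?s) (h (ty n)) * u (n - 1))\<bar> \<le> G * S n"
        using propag[OF n order_refl] by (simp add: nx_def)
      have 2: "\<bar>u (nx n - 1) - (continuant x ?s (h (ty n)) * u n - continuant x (Suc ?s) m * u (n - 1))\<bar> \<le> G * S n"
        using propag[OF n, of m] by (simp add: nx_def m del: continuant.simps)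
      note d = dom[of "ty n", unfolded dominant_def]
      have "1 \<le> \<Lambda>" using \<Lambda> by simp
      from block_transfer[OF det conjunct1[OF d] this _ _ 1 2] d
      show "\<bar>u n - continuant x (Suc ?s) (h (ty n)) / continuant x ?s (Suc (h (ty n))) * u (n - 1) - u (nx n) / continuant x ?s (Suc (h (ty n)))\<bar> \<le> G * S n"
        "\<bar>u (nx n - 1) - continuant x ?s (h (ty n)) / continuant x ?s (Suc (h (ty n))) * u (nx n) - u (n - 1) / continuant x ?s (Suc (h (ty n)))\<bar> \<le> (C + 1) * (G * S n)"
        by blast+
    qed
    have nxI: "nx n \<in> I" if "n \<in> I" for n using bij that by (auto simp: bij_betw_def)
    have jb: "\<bar>u (nx n)\<bar> \<le> k * \<bar>u (nx (nx n))\<bar> + k * (C * \<bar>u (n - 1)\<bar>) + D * S (nx n) + D * S n"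
       "\<bar>u (nx n - 1)\<bar> \<le> C * \<bar>u (nx n)\<bar> + 1 / \<Lambda> * \<bar>u (n - 1)\<bar> + D * S n" if n: "n \<in> I" for n
    proof -
      note d1 = dom[of "ty n", unfolded dominant_def] and d2 = dom[of "ty (nx n)", unfolded dominant_def]
      have "1 \<le> \<Lambda>" using \<Lambda> by simp
      note J = junction_bounds[OF conjunct1[OF d1] conjunct1[OF d2] this conjunct1[OF conjunct2[OF d2]] conjunct2[OF conjunct2[OF d1]] c
        tr[of "ty n" "ty (nx n)", unfolded transversal_def] transfer(1)[OF nxI[OF n]] transfer(2)[OF n]]
      have GD: "G / c \<le> D" "C * ((C + 1) * G) / c \<le> D" "(C + 1) * G \<le> D"
      proof -
        have 1: "1 * (1 * G) \<le> (C + 1) * ((C + 1) * G)" "C * ((C + 1) * G) \<le> (C + 1) * ((C + 1) * G)" "1 * ((C + 1) * G) \<le> (C + 1) * ((C + 1) * G)"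
          using C G by (intro mult_mono mult_right_mono; simp)+
        have 2: "z * (1 / c) \<le> D" "z * 1 \<le> D" if "0 \<le> z" "z \<le> (C + 1) * ((C + 1) * G)" for z
          unfolding D_def using that c by (intro mult_mono; simp)+
        show "G / c \<le> D" using 2(1)[of G] 1 G by simp
        show "C * ((C + 1) * G) / c \<le> D" using 2(1)[of "C * ((C + 1) * G)"] 1 G C by simp
        show "(C + 1) * G \<le> D" using 2(2)[of "(C + 1) * G"] 1 G C by simp
      qed
      have "G * S (nx n) / c \<le> D * S (nx n)" "C * ((C + 1) * (G * S n)) / c \<le> D * S n" "(C + 1) * (G * S n) \<le> D * S n"
        using mult_right_mono[OF GD(1) S0[of "nx n"]] mult_right_mono[OF GD(2) S0[of n]] mult_right_mono[OF GD(3) S0[of n]] by (simp_all add: mult_ac)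
      then show "\<bar>u (nx n)\<bar> \<le> k * \<bar>u (nx (nx n))\<bar> + k * (C * \<bar>u (n - 1)\<bar>) + D * S (nx n) + D * S n"
         "\<bar>u (nx n - 1)\<bar> \<le> C * \<bar>u (nx n)\<bar> + 1 / \<Lambda> * \<bar>u (n - 1)\<bar> + D * S n"
        using J unfolding k_def by linarith+
    qed
    have fP: "finite {n \<in> I. \<bar>u n\<bar> \<noteq> 0}" by (rule finite_subset[OF _ fu]) auto
    have fQ: "finite {n \<in> I. \<bar>u (n - 1)\<bar> \<noteq> 0}" by (rule finite_subset[OF _ finsh[OF fu, of "-1"]]) auto
    have kk: "4 * k\<^sup>2 * (1 + 6 * C ^ 4) \<le> 1 / 2"
    proof -
      have "0 < c\<^sup>2 * \<Lambda>\<^sup>2" using c \<Lambda> by simp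
      then show ?thesis unfolding k_def using \<Lambda>(2) by (simp add: power_divide power_mult_distrib field_simps)
    qed
    have ll: "3 * (1 / \<Lambda>)\<^sup>2 \<le> 1 / 2"
    proof -
      have "3 * 3 \<le> \<Lambda> * \<Lambda>" using \<Lambda> by (intro mult_mono) auto
      then have "6 \<le> \<Lambda>\<^sup>2" by (simp add: power2_eq_square)
      then show ?thesis using \<Lambda> by (simp add: power_divide field_simps)
    qed
    have nn: "0 \<le> k" "0 \<le> D" using c \<Lambda> C G by (auto simp: k_def D_def)
    define F where "F = (\<Sum>\<^sub>\<infinity>n\<in>I. (S n)\<^sup>2)"
    have 1: "(\<Sum>\<^sub>\<infinity>n\<in>I. \<bar>u n\<bar>\<^sup>2) \<le> KP * F" and 2: "(\<Sum>\<^sub>\<infinity>n\<in>I. \<bar>u (n - 1)\<bar>\<^sup>2) \<le> KQ * F"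
      unfolding KP_def KQ_def F_def
      using junction_estimate[of nx I "\<lambda>n. \<bar>u n\<bar>" "\<lambda>n. \<bar>u (n - 1)\<bar>" S k C D "1 / \<Lambda>", OF bij fP fQ fS _ _ S0 nn(1) _ nn(2) _ jb kk ll]
        C \<Lambda> by auto
    note sm = summable_finite_support[OF fP] summable_finite_support[OF fQ] summable_finite_support[OF fS]
    have resum: "(\<Sum>\<^sub>\<infinity>n\<in>I. \<Sum>j<h (ty n). (g (n + int j))\<^sup>2) = (\<Sum>\<^sub>\<infinity>n. (g n)\<^sup>2)"
      and sresum: "(\<lambda>n. \<Sum>j<h (ty n). (g (n + int j))\<^sup>2) summable_on I"
      if "finite {n. g n \<noteq> 0}" for g :: "int \<Rightarrow> real"
    proof -
      have "(\<lambda>n. (g n)\<^sup>2) summable_on UNIV" by (rule summable_finite_support) (use that in simp)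
      then have s: "(\<lambda>(n, j). (g (n + int j))\<^sup>2) summable_on (SIGMA n:I. {..<h (ty n)})"
        using summable_on_reindex_bij_betw[OF tile, of "\<lambda>n. (g n)\<^sup>2"] by (simp add: case_prod_unfold)
      have "(\<Sum>\<^sub>\<infinity>n. (g n)\<^sup>2) = (\<Sum>\<^sub>\<infinity>(n, j)\<in>(SIGMA n:I. {..<h (ty n)}). (g (n + int j))\<^sup>2)"
        using infsum_reindex_bij_betw[OF tile, of "\<lambda>n. (g n)\<^sup>2"] by (simp add: case_prod_unfold)
      also have "\<dots> = (\<Sum>\<^sub>\<infinity>n\<in>I. \<Sum>\<^sub>\<infinity>j\<in>{..<h (ty n)}. (g (n + int j))\<^sup>2)"
        using infsum_Sigma_banach[OF s] by simp
      finally show "(\<Sum>\<^sub>\<infinity>n\<in>I. \<Sum>j<h (ty n). (g (n + int j))\<^sup>2) = (\<Sum>\<^sub>\<infinity>n. (g n)\<^sup>2)" by simp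
      show "(\<lambda>n. \<Sum>j<h (ty n). (g (n + int j))\<^sup>2) summable_on I"
        using summable_on_Sigma_banach[of "\<lambda>n j. (g (n + int j))\<^sup>2" I "\<lambda>n. {..<h (ty n)}"] s by simp
    qed
    have F: "F \<le> real H * (\<Sum>\<^sub>\<infinity>n. (\<phi> n)\<^sup>2)"
    proof -
      have "F \<le> (\<Sum>\<^sub>\<infinity>n\<in>I. real H * (\<Sum>j<h (ty n). (\<phi> (n + int j))\<^sup>2))"
        unfolding F_def
      proof (rule infsum_mono)
        fix n assume "n \<in> I"
        have "(S n)\<^sup>2 \<le> (\<Sum>j<h (ty n). \<bar>\<phi> (n + int j)\<bar>\<^sup>2) * (\<Sum>j<h (ty n). 1\<^sup>2)"
          unfolding S_def using Cauchy_Schwarz_ineq_sum[of "\<lambda>j. \<bar>\<phi> (n + int j)\<bar>" "\<lambda>_. 1" "{..<h (ty n)}"] by simp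
        also have "\<dots> = real (h (ty n)) * (\<Sum>j<h (ty n). (\<phi> (n + int j))\<^sup>2)" by simp
        also have "\<dots> \<le> real H * (\<Sum>j<h (ty n). (\<phi> (n + int j))\<^sup>2)"
          using hH(1)[of "ty n"] by (intro mult_right_mono sum_nonneg) auto
        finally show "(S n)\<^sup>2 \<le> real H * (\<Sum>j<h (ty n). (\<phi> (n + int j))\<^sup>2)" .
      qed (intro sm summable_on_cmult_right sresum f\<phi>)+
      also have "\<dots> = real H * (\<Sum>\<^sub>\<infinity>n. (\<phi> n)\<^sup>2)" by (simp add: infsum_cmult_right' resum[OF f\<phi>])
      finally show ?thesis .
    qed
    have ub: "(\<Sum>j<h (ty n). (u (n + int j))\<^sup>2) \<le> 3 * G\<^sup>2 * real H * (\<bar>u n\<bar>\<^sup>2 + \<bar>u (n - 1)\<bar>\<^sup>2 + (S n)\<^sup>2)" if n: "n \<in> I" for n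
    proof -
      have "(u (n + int j))\<^sup>2 \<le> 3 * G\<^sup>2 * (\<bar>u n\<bar>\<^sup>2 + \<bar>u (n - 1)\<bar>\<^sup>2 + (S n)\<^sup>2)" if j: "j < h (ty n)" for j
      proof -
        have cb: "\<bar>continuant x i m\<bar> \<le> G" if "m \<le> H + 1" for i m
        proof -
          have "\<bar>continuant x i m\<bar> \<le> (Y + 1) ^ m" by (rule continuant_bound[OF Y(2)])
          also have "\<dots> \<le> G" unfolding G_def using Y that by (intro power_increasing) auto
          finally show ?thesis .
        qed
        let ?a = "continuant x (s (ty n)) (Suc j)" and ?b = "continuant x (Suc (s (ty n))) j"
        have ab: "\<bar>?a\<bar> \<le> G" "\<bar>?b\<bar> \<le> G" using j hH(1)[of "ty n"] by (auto intro!: cb)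
        have "\<bar>u (n + int j)\<bar> \<le> \<bar>?a\<bar> * \<bar>u n\<bar> + \<bar>?b\<bar> * \<bar>u (n - 1)\<bar> + G * S n"
          using propag[OF n, of j] j unfolding abs_mult[symmetric] by linarith
        also have "\<dots> \<le> G * \<bar>u n\<bar> + G * \<bar>u (n - 1)\<bar> + G * S n"
          by (intro add_mono mult_right_mono ab order_refl) auto
        finally have "\<bar>u (n + int j)\<bar>\<^sup>2 \<le> (G * \<bar>u n\<bar> + G * \<bar>u (n - 1)\<bar> + G * S n)\<^sup>2"
          by (intro power_mono) simp_all
        also have "\<dots> \<le> 3 * ((G * \<bar>u n\<bar>)\<^sup>2 + (G * \<bar>u (n - 1)\<bar>)\<^sup>2 + (G * S n)\<^sup>2)" by (rule sq_sum3)
        finally show ?thesis by (simp add: power_mult_distrib algebra_simps)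
      qed
      then have "(\<Sum>j<h (ty n). (u (n + int j))\<^sup>2) \<le> (\<Sum>j<h (ty n). 3 * G\<^sup>2 * (\<bar>u n\<bar>\<^sup>2 + \<bar>u (n - 1)\<bar>\<^sup>2 + (S n)\<^sup>2))"
        by (intro sum_mono) auto
      also have "\<dots> = real (h (ty n)) * (3 * G\<^sup>2 * (\<bar>u n\<bar>\<^sup>2 + \<bar>u (n - 1)\<bar>\<^sup>2 + (S n)\<^sup>2))" by simp
      also have "\<dots> \<le> real H * (3 * G\<^sup>2 * (\<bar>u n\<bar>\<^sup>2 + \<bar>u (n - 1)\<bar>\<^sup>2 + (S n)\<^sup>2))"
        using hH(1)[of "ty n"] by (intro mult_right_mono) auto
      finally show ?thesis by (simp add: mult_ac)
    qed
    have "(\<Sum>\<^sub>\<infinity>n. (u n)\<^sup>2) = (\<Sum>\<^sub>\<infinity>n\<in>I. \<Sum>j<h (ty n). (u (n + int j))\<^sup>2)" by (rule resum[OF fu, symmetric])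
    also have "\<dots> \<le> (\<Sum>\<^sub>\<infinity>n\<in>I. 3 * G\<^sup>2 * real H * (\<bar>u n\<bar>\<^sup>2 + \<bar>u (n - 1)\<bar>\<^sup>2 + (S n)\<^sup>2))"
      by (rule infsum_mono) (intro sresum fu summable_on_cmult_right summable_on_add sm ub; assumption?)+
    also have "\<dots> = 3 * G\<^sup>2 * real H * ((\<Sum>\<^sub>\<infinity>n\<in>I. \<bar>u n\<bar>\<^sup>2) + (\<Sum>\<^sub>\<infinity>n\<in>I. \<bar>u (n - 1)\<bar>\<^sup>2) + F)"
    proof -
      have "(\<Sum>\<^sub>\<infinity>n\<in>I. \<bar>u n\<bar>\<^sup>2 + \<bar>u (n - 1)\<bar>\<^sup>2 + (S n)\<^sup>2) = (\<Sum>\<^sub>\<infinity>n\<in>I. \<bar>u n\<bar>\<^sup>2) + (\<Sum>\<^sub>\<infinity>n\<in>I. \<bar>u (n - 1)\<bar>\<^sup>2) + F"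
        unfolding F_def by (simp only: infsum_add[OF summable_on_add[OF sm(1,2)] sm(3)] infsum_add[OF sm(1,2)])
      then show ?thesis by (simp only: infsum_cmult_right')
    qed
    also have "\<dots> \<le> 3 * G\<^sup>2 * real H * ((KP + KQ + 1) * F)"
      using 1 2 by (intro mult_left_mono) (auto simp: algebra_simps)
    also have "\<dots> \<le> 3 * G\<^sup>2 * real H * ((KP + KQ + 1) * (real H * (\<Sum>\<^sub>\<infinity>n. (\<phi> n)\<^sup>2)))"
      using F KPQ by (intro mult_left_mono) auto
    also have "\<dots> = K * (\<Sum>\<^sub>\<infinity>n. (\<phi> n)\<^sup>2)" unfolding K_def by (simp add: mult_ac)
    finally show "(\<Sum>\<^sub>\<infinity>n. (u n)\<^sup>2) \<le> K * (\<Sum>\<^sub>\<infinity>n. (jacobi v u n - E * u n)\<^sup>2)" by (simp add: \<phi>_def)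
  qed
qed

section \<open>Two towers over an irrational rotation\<close>

lemma frac_add_of_int: "frac (x + of_int n) = frac x" for x :: real
  by (simp add: frac_def)

lemma frac_unique: "z - y \<in> \<int> \<Longrightarrow> 0 \<le> y \<Longrightarrow> y < 1 \<Longrightarrow> frac z = y" for z y :: real
  using frac_unique_iff[of z y] by simp

lemma irrational_multiple_not_int:
  fixes a :: real
  assumes "a \<notin> \<rat>" "m \<noteq> 0"
  shows "real_of_int m * a \<notin> \<int>"
proof
  assume "real_of_int m * a \<in> \<int>"
  then have "real_of_int m * a / real_of_int m \<in> \<rat>" by (intro Rats_divide) (auto intro: subsetD[OF Ints_subset_Rats])
  then show False using assms by simp
qed

lemma frac_multiple_pos:
  fixes a :: real
  assumes "a \<notin> \<rat>" "m > 0"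
  shows "0 < frac (real m * a)"
  using irrational_multiple_not_int[OF assms(1), of "int m"] assms(2) by (simp add: frac_gt_0_iff)

text \<open>
  Among the multiples \<open>m a\<close> with \<open>m\<close> up to a large \<open>N\<close>, let \<open>A a\<close> come closest to \<open>0\<close> from above, at
  distance \<open>a'\<close>, and \<open>B a\<close> from below, at distance \<open>b\<close>.  On the arc of length \<open>\<beta> = a' + b\<close> the points below
  \<open>b\<close> return under \<open>A\<close> and the others under \<open>B\<close>.  An earlier return at time \<open>m\<close> would make \<open>A - m\<close> or
  \<open>B - m\<close> a better approximation on the other side.
\<close>

theorem return_times:
  fixes a \<delta> :: real
  assumes a: "a \<notin> \<rat>" and \<delta>: "\<delta> > 0"
  obtains \<beta> b A B where "0 < b" "b < \<beta>" "\<beta> < \<delta>" "\<beta> < 1" "N\<^sub>0 \<le> A" "N\<^sub>0 \<le> B" "0 < A" "0 < B"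
    "\<And>z. frac z < b \<Longrightarrow> frac (z + real A * a) < \<beta>"
    "\<And>z m. frac z < b \<Longrightarrow> 0 < m \<Longrightarrow> m < A \<Longrightarrow> \<beta> \<le> frac (z + real m * a)"
    "\<And>z. b \<le> frac z \<Longrightarrow> frac z < \<beta> \<Longrightarrow> frac (z + real B * a) < \<beta>"
    "\<And>z m. b \<le> frac z \<Longrightarrow> frac z < \<beta> \<Longrightarrow> 0 < m \<Longrightarrow> m < B \<Longrightarrow> \<beta> \<le> frac (z + real m * a)"
proof -
  define fr where "fr m = frac (real m * a)" for m
  have fr0: "0 < fr m" if "m > 0" for m unfolding fr_def by (rule frac_multiple_pos[OF a that])
  have fr1: "fr m < 1" for m unfolding fr_def by (rule frac_lt_1)
  (* An arc this short contains no multiple m * a with m up to N_0, on either side of 0, which forces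
     both return times above N_0. *)
  define \<delta>1 where "\<delta>1 = Min (insert (min \<delta> 1) ((\<lambda>m. min (fr m) (1 - fr m)) ` {1..N\<^sub>0}))"
  have "\<delta>1 \<le> min \<delta> 1" unfolding \<delta>1_def by (rule Min_le) auto
  moreover have "0 < \<delta>1" unfolding \<delta>1_def using \<delta> fr0 fr1 by auto
  ultimately have \<delta>1: "0 < \<delta>1" "\<delta>1 \<le> \<delta>" "\<delta>1 \<le> 1" by auto
  have small: "\<delta>1 \<le> fr m" "\<delta>1 \<le> 1 - fr m" if "1 \<le> m" "m \<le> N\<^sub>0" for m
  proof -
    have "\<delta>1 \<le> min (fr m) (1 - fr m)" unfolding \<delta>1_def using that by (intro Min_le) auto
    then show "\<delta>1 \<le> fr m" "\<delta>1 \<le> 1 - fr m" by auto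
  qed
  have half: "\<delta>1 / 2 > 0" using \<delta>1 by simp
  obtain m1 where m1: "m1 > 0" "\<bar>fr m1 - 0\<bar> < \<delta>1 / 2"
    unfolding fr_def using Kronecker_approx_1_explicit[OF a order_refl zero_le_one half] by blast
  obtain m2 where m2: "m2 > 0" "\<bar>fr m2 - 1\<bar> < \<delta>1 / 2"
    unfolding fr_def using Kronecker_approx_1_explicit[OF a zero_le_one order_refl half] by blast
  define N where "N = max m1 m2"
  have ne: "finite {1..N}" "{1..N} \<noteq> {}" using m1 by (auto simp: N_def)
  obtain A where A: "A \<in> {1..N}" "\<And>m. m \<in> {1..N} \<Longrightarrow> fr A \<le> fr m"
    using ne arg_min_least[OF ne, where f = fr] arg_min_if_finite(1)[OF ne, where f = fr] by metis
  obtain B where B: "B \<in> {1..N}" "\<And>m. m \<in> {1..N} \<Longrightarrow> 1 - fr B \<le> 1 - fr m"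
    using ne arg_min_least[OF ne, where f = "\<lambda>m. 1 - fr m"] arg_min_if_finite(1)[OF ne, where f = "\<lambda>m. 1 - fr m"] by metis
  define a' where "a' = fr A"
  define b where "b = 1 - fr B"
  define \<beta> where "\<beta> = a' + b"
  have a'0: "0 < a'" "a' < 1" using fr0[of A] fr1[of A] A by (auto simp: a'_def)
  have b0: "0 < b" "b < 1" using fr0[of B] fr1[of B] B by (auto simp: b_def)
  have a's: "a' < \<delta>1 / 2" using A(2)[of m1] m1 by (auto simp: a'_def N_def)
  have bs: "b < \<delta>1 / 2"
  proof -
    have "1 - fr B \<le> 1 - fr m2" using B(2)[of m2] m2(1) by (simp add: N_def)
    then show ?thesis using m2(2) unfolding b_def by linarith
  qed
  have \<beta>: "\<beta> < \<delta>" "\<beta> < 1" "b < \<beta>" using a's bs \<delta>1 a'0 by (auto simp: \<beta>_def)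
  have NA: "N\<^sub>0 \<le> A"
  proof (rule ccontr)
    assume "\<not> N\<^sub>0 \<le> A"
    then show False using small(1)[of A] A(1) a's \<delta>1 by (auto simp: a'_def)
  qed
  have NB: "N\<^sub>0 \<le> B"
  proof (rule ccontr)
    assume "\<not> N\<^sub>0 \<le> B"
    then show False using small(2)[of B] B(1) bs \<delta>1 by (auto simp: b_def)
  qed
  have sub: "fr (k - m) = frac (fr k - fr m)" if "m \<le> k" for k m
  proof -
    have "fr k - fr m - (real (k - m) * a) = of_int (\<lfloor>real m * a\<rfloor> - \<lfloor>real k * a\<rfloor>)"
      using that unfolding fr_def frac_def by (simp add: of_nat_diff algebra_simps)
    then have "fr k - fr m = real (k - m) * a + of_int (\<lfloor>real m * a\<rfloor> - \<lfloor>real k * a\<rfloor>)" by (simp add: algebra_simps)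
    then show ?thesis unfolding fr_def[of "k - m"] by (simp only: frac_add_of_int)
  qed
  have ge: "a' \<le> fr m" "b \<le> 1 - fr m" if "0 < m" "m \<le> N" for m
    using A(2)[of m] B(2)[of m] that by (auto simp: a'_def b_def)
  have neqA: "fr m \<noteq> fr A" if "m < A" for m
    using sub[of m A] fr0[of "A - m"] that by auto
  have neqB: "fr m \<noteq> fr B" if "m < B" for m
    using sub[of m B] fr0[of "B - m"] that by auto
  show thesis
  proof (rule that[of b \<beta> A B])
    show "0 < b" "b < \<beta>" "\<beta> < \<delta>" "\<beta> < 1" "N\<^sub>0 \<le> A" "N\<^sub>0 \<le> B" "0 < A" "0 < B"
      using b0 \<beta> NA NB A(1) B(1) by auto
    fix z :: real
    let ?t = "frac z"
    have t0: "0 \<le> ?t" "?t < 1" by (auto simp: frac_lt_1)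
    show "frac (z + real A * a) < \<beta>" if "?t < b"
      unfolding frac_add fr_def[symmetric] a'_def[symmetric] using that \<beta> t0 a'0 by (auto simp: \<beta>_def)
    show "frac (z + real B * a) < \<beta>" if "b \<le> ?t" "?t < \<beta>"
      unfolding frac_add fr_def[symmetric] using that b0 \<beta> by (auto simp: b_def)
    show "\<beta> \<le> frac (z + real m * a)" if "?t < b" "0 < m" "m < A" for m
    proof (rule ccontr)
      assume "\<not> ?thesis"
      then have lt: "frac (z + real m * a) < \<beta>" by simp
      have mN: "m \<le> N" "A - m > 0" "A - m \<le> N" using that A(1) by auto
      note g = ge[OF that(2) mN(1)]
      show False
      proof (cases "?t + fr m < 1")
        case True
        have "frac (z + real m * a) = ?t + fr m" using True unfolding frac_add fr_def[symmetric] by simp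
        then have y: "fr m < \<beta>" using lt t0(1) by linarith
        have ya: "a' < fr m" using g(1) neqA[OF that(3)] by (auto simp: a'_def)
        have "fr (A - m) = 1 - (fr m - a')"
          unfolding sub[OF less_imp_le[OF that(3)]] a'_def[symmetric]
        proof (rule frac_unique)
          have "a' - fr m - (1 - (fr m - a')) = -1" by simp
          then show "a' - fr m - (1 - (fr m - a')) \<in> \<int>" by (simp only: Ints_minus Ints_1)
        qed (use ya a'0 fr1[of m] in auto)
        then have "b \<le> fr m - a'" using ge(2)[OF mN(2,3)] by simp
        then show False using y by (simp add: \<beta>_def)
      next
        case False
        then show False using g(2) that(1) by simp
      qed
    qed
    show "\<beta> \<le> frac (z + real m * a)" if "b \<le> ?t" "?t < \<beta>" "0 < m" "m < B" for m
    proof (rule ccontr)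
      assume "\<not> ?thesis"
      then have lt: "frac (z + real m * a) < \<beta>" by simp
      have mN: "m \<le> N" "B - m > 0" "B - m \<le> N" using that B(1) by auto
      note g = ge[OF that(3) mN(1)]
      show False
      proof (cases "?t + fr m < 1")
        case True
        then have "?t + fr m < \<beta>" using lt unfolding frac_add fr_def[symmetric] by auto
        then show False using g(1) that(1) by (simp add: \<beta>_def)
      next
        case False
        define w where "w = 1 - fr m"
        have wb: "b < w" using g(2) neqB[OF that(4)] by (auto simp: b_def w_def)
        have "fr (B - m) = w - b"
          unfolding sub[OF less_imp_le[OF that(4)]]
        proof (rule frac_unique)
          show "fr B - fr m - (w - b) \<in> \<int>" by (simp add: w_def b_def)
        qed (use wb b0 fr0[OF that(3)] in \<open>auto simp: w_def\<close>)
        then have "\<beta> \<le> w" using ge(1)[OF mN(2,3)] by (simp add: \<beta>_def)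
        then show False using False that(2) by (simp add: w_def)
      qed
    qed
  qed
qed

text \<open>
  Backward recurrence to the arc at the base; it makes the level of a point well defined.
\<close>

lemma recurrence:
  fixes a \<beta> z :: real
  assumes a: "a \<notin> \<rat>" and \<beta>: "0 < \<beta>" "\<beta> < 1"
  shows "\<exists>k. frac (z - real k * a) < \<beta>"
proof -
  have "\<beta> / 2 > 0" using \<beta> by simp
  from sequence_of_fractional_parts_is_dense[OF a this, of "z - \<beta> / 2"]
  obtain h k where k: "k > 0" "\<bar>of_int k * a - of_int h - (z - \<beta> / 2)\<bar> < \<beta> / 2" by blast
  have "frac (z - real (nat k) * a) = z - of_int k * a + of_int h"
  proof (rule frac_unique)
    have "z - real (nat k) * a - (z - of_int k * a + of_int h) = of_int (- h)" using k(1) by simp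
    then show "z - real (nat k) * a - (z - of_int k * a + of_int h) \<in> \<int>" by (simp only: Ints_of_int)
    show "0 \<le> z - of_int k * a + of_int h" "z - of_int k * a + of_int h < 1"
      using k(2) \<beta> unfolding abs_less_iff by linarith+
  qed
  then have "frac (z - real (nat k) * a) < \<beta>" using k(2) unfolding abs_less_iff by linarith
  then show ?thesis by blast
qed

lemma frac_less_right_constant:
  fixes z c :: real
  shows "\<exists>e>0. \<forall>t. 0 \<le> t \<longrightarrow> t < e \<longrightarrow> (frac (z + t) < c \<longleftrightarrow> frac z < c)"
proof -
  define e where "e = min (1 - frac z) (if frac z < c then c - frac z else 1)"
  have "e > 0" unfolding e_def by (auto simp: frac_lt_1)
  moreover have "frac (z + t) < c \<longleftrightarrow> frac z < c" if "0 \<le> t" "t < e" for t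
  proof -
    have te: "t < 1 - frac z" "frac z < c \<Longrightarrow> t < c - frac z" using that by (auto simp: e_def)
    have "t < 1" using te frac_ge_0[of z] by linarith
    then have ft: "frac t = t" using that by (simp add: frac_eq)
    have "frac (z + t) = frac z + t" unfolding frac_add ft using te by simp
    then show ?thesis using te that by auto
  qed
  ultimately show ?thesis by blast
qed

text \<open>
  The base arc \<open>[0, \<beta>)\<close> is cut at \<open>b\<close>; \<open>A\<close> and \<open>B\<close> are the first return times of its two parts.
\<close>

locale two_towers =
  fixes a \<beta> b :: real and A B :: nat
  assumes irr: "a \<notin> \<rat>" and b: "0 < b" "b < \<beta>" "\<beta> < 1" and AB: "0 < A" "0 < B"
    and retA: "\<And>z. frac z < b \<Longrightarrow> frac (z + real A * a) < \<beta>"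
    and firstA: "\<And>z m. frac z < b \<Longrightarrow> 0 < m \<Longrightarrow> m < A \<Longrightarrow> \<beta> \<le> frac (z + real m * a)"
    and retB: "\<And>z. b \<le> frac z \<Longrightarrow> frac z < \<beta> \<Longrightarrow> frac (z + real B * a) < \<beta>"
    and firstB: "\<And>z m. b \<le> frac z \<Longrightarrow> frac z < \<beta> \<Longrightarrow> 0 < m \<Longrightarrow> m < B \<Longrightarrow> \<beta> \<le> frac (z + real m * a)"
begin

text \<open>
  A point is addressed by the letter that it reads off: the position in the concatenation of the word
  of length \<open>A\<close> and the word of length \<open>B\<close>.  The kind \<open>False\<close> stands for the tower of height \<open>A\<close>.
\<close>

definition height :: "bool \<Rightarrow> nat" where "height t = (if t then B else A)"
definition offset :: "bool \<Rightarrow> nat" where "offset t = (if t then A else 0)"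
definition kind :: "real \<Rightarrow> bool" where "kind z \<longleftrightarrow> \<not> frac z < b"
definition level :: "real \<Rightarrow> nat" where "level z = (LEAST k. frac (z - real k * a) < \<beta>)"
definition address :: "real \<Rightarrow> nat" where "address z = offset (kind (z - real (level z) * a)) + level z"

lemma height_pos: "0 < height t" using AB by (simp add: height_def)

lemma return: "frac z < \<beta> \<Longrightarrow> frac (z + real (height (kind z)) * a) < \<beta>"
  using retA[of z] retB[of z] by (auto simp: height_def kind_def)

lemma first_return: "frac z < \<beta> \<Longrightarrow> 0 < m \<Longrightarrow> m < height (kind z) \<Longrightarrow> \<beta> \<le> frac (z + real m * a)"
  using firstA[of z m] firstB[of z m] by (auto simp: height_def kind_def split: if_splits)

lemma level: "frac (z - real (level z) * a) < \<beta>" "j < level z \<Longrightarrow> \<beta> \<le> frac (z - real j * a)"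
proof -
  have "\<exists>k. frac (z - real k * a) < \<beta>" using recurrence[OF irr] b by simp
  then show "frac (z - real (level z) * a) < \<beta>" unfolding level_def by (rule LeastI_ex)
  show "j < level z \<Longrightarrow> \<beta> \<le> frac (z - real j * a)" unfolding level_def using not_less_Least by force
qed

lemma level_eq: "frac (z - real k * a) < \<beta> \<Longrightarrow> (\<And>j. j < k \<Longrightarrow> \<beta> \<le> frac (z - real j * a)) \<Longrightarrow> level z = k"
  unfolding level_def by (rule Least_equality) (auto simp: not_le[symmetric])

lemma level_less_height: "level z < height (kind (z - real (level z) * a))"
proof (rule ccontr)
  let ?y = "z - real (level z) * a"
  let ?h = "height (kind ?y)"
  assume "\<not> ?thesis"
  then have le: "?h \<le> level z" by simp
  have "frac (?y + real ?h * a) < \<beta>" by (rule return[OF level(1)])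
  moreover have "?y + real ?h * a = z - real (level z - ?h) * a" using le by (simp add: of_nat_diff algebra_simps)
  moreover have "level z - ?h < level z" using le height_pos[of "kind ?y"] by linarith
  ultimately show False using level(2) by (metis not_le)
qed

lemma level_in_block:
  assumes "frac z < \<beta>" "j < height (kind z)"
  shows "level (z + real j * a) = j"
proof (rule level_eq)
  show "frac (z + real j * a - real j * a) < \<beta>" using assms by simp
  fix i assume "i < j"
  then have "\<beta> \<le> frac (z + real (j - i) * a)" using assms by (intro first_return) auto
  moreover have "z + real (j - i) * a = z + real j * a - real i * a" using \<open>i < j\<close> by (simp add: of_nat_diff algebra_simps)
  ultimately show "\<beta> \<le> frac (z + real j * a - real i * a)" by simp
qed

lemma address_in_block:
  assumes "frac z < \<beta>" "j < height (kind z)"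
  shows "address (z + real j * a) = offset (kind z) + j"
  unfolding address_def level_in_block[OF assms] by simp

lemma tiling_orbit:
  fixes z :: real
  defines "I \<equiv> {n :: int. frac (z + of_int n * a) < \<beta>}" and "ty \<equiv> \<lambda>n :: int. kind (z + of_int n * a)"
  shows "tiling height I ty"
proof -
  let ?z = "\<lambda>n :: int. z + of_int n * a"
  have zs: "?z (n + int j) = ?z n + real j * a" "?z (n - int j) = ?z n - real j * a" for n j by (auto simp: algebra_simps)
  have uniq: "n = n'" if "n \<in> I" "n' \<in> I" "n \<le> n'" "n' < n + int (height (ty n))" for n n'
  proof (rule ccontr)
    assume "n \<noteq> n'"
    define m where "m = nat (n' - n)"
    have m: "n' = n + int m" "0 < m" "m < height (ty n)" using that \<open>n \<noteq> n'\<close> by (auto simp: m_def)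
    have "\<beta> \<le> frac (?z n + real m * a)" using that(1) m by (intro first_return) (auto simp: I_def ty_def)
    moreover have "?z n' = ?z n + real m * a" unfolding m(1) by (rule zs)
    moreover have "frac (?z n') < \<beta>" using that(2) unfolding I_def by (rule CollectD)
    ultimately show False by (simp only: not_less[symmetric])
  qed
  have cover: "\<exists>n\<in>I. \<exists>j<height (ty n). n + int j = N" for N
  proof -
    let ?k = "level (?z N)"
    have "N - int ?k \<in> I" using level(1)[of "?z N"] unfolding I_def mem_Collect_eq zs .
    moreover have "?k < height (ty (N - int ?k))" using level_less_height[of "?z N"] unfolding ty_def zs .
    ultimately show ?thesis by (intro bexI[of _ "N - int ?k"] exI[of _ ?k]) auto
  qed
  have inj: "n = n' \<and> j = j'" if "n \<in> I" "n' \<in> I" "j < height (ty n)" "j' < height (ty n')" "n + int j = n' + int j'" for n n' j j'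
  proof (cases "n \<le> n'")
    case True
    then show ?thesis using uniq[OF that(1,2)] that by auto
  next
    case False
    then show ?thesis using uniq[OF that(2,1)] that by auto
  qed
  have bij1: "bij_betw (\<lambda>n. n + int (height (ty n))) I I"
    unfolding bij_betw_def
  proof
    show "inj_on (\<lambda>n. n + int (height (ty n))) I"
    proof (rule inj_onI)
      fix n n' assume nn: "n \<in> I" "n' \<in> I" "n + int (height (ty n)) = n' + int (height (ty n'))"
      have "n + int (height (ty n) - 1) = n' + int (height (ty n') - 1)"
        using nn(3) height_pos[of "ty n"] height_pos[of "ty n'"] by auto
      then show "n = n'" using inj[OF nn(1,2), of "height (ty n) - 1" "height (ty n') - 1"] height_pos by simp
    qed
    show "(\<lambda>n. n + int (height (ty n))) ` I = I"
    proof
      show "(\<lambda>n. n + int (height (ty n))) ` I \<subseteq> I"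
      proof safe
        fix n assume "n \<in> I"
        then show "n + int (height (ty n)) \<in> I"
          using return[of "?z n"] unfolding I_def mem_Collect_eq zs ty_def by simp
      qed
      show "I \<subseteq> (\<lambda>n. n + int (height (ty n))) ` I"
      proof
        fix N assume N: "N \<in> I"
        obtain n j where nj: "n \<in> I" "j < height (ty n)" "n + int j = N - 1" using cover[of "N - 1"] by blast
        have "\<not> N < n + int (height (ty n))" using uniq[OF nj(1) N] nj by auto
        then have "N = n + int (height (ty n))" using nj by auto
        then show "N \<in> (\<lambda>n. n + int (height (ty n))) ` I" using nj(1) by blast
      qed
    qed
  qed
  have bij2: "bij_betw (\<lambda>(n, j). n + int j) (SIGMA n:I. {..<height (ty n)}) UNIV"
    unfolding bij_betw_def
  proof
    show "inj_on (\<lambda>(n, j). n + int j) (SIGMA n:I. {..<height (ty n)})"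
      using inj by (auto simp: inj_on_def)
    show "(\<lambda>(n, j). n + int j) ` (SIGMA n:I. {..<height (ty n)}) = UNIV"
    proof (rule, simp, rule)
      fix N :: int
      obtain n j where "n \<in> I" "j < height (ty n)" "n + int j = N" using cover[of N] by blast
      then show "N \<in> (\<lambda>(n, j). n + int j) ` (SIGMA n:I. {..<height (ty n)})"
        by (intro image_eqI[of _ _ "(n, j)"]) auto
    qed
  qed
  show ?thesis unfolding tiling_def using bij1 bij2 by simp
qed

lemma address_periodic: "address (z + of_int n) = address z"
proof -
  have f: "frac (z + of_int n - y) = frac (z - y)" for y using frac_add_of_int[of "z - y" n] by (simp add: algebra_simps)
  then have "level (z + of_int n) = level z" unfolding level_def by simp
  then show ?thesis unfolding address_def kind_def by (simp add: f)
qed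

text \<open>
  The levels are half-open on the right, and the address of \<open>z\<close> depends on finitely many comparisons of
  \<open>z - j a\<close> with \<open>\<beta>\<close> and \<open>b\<close>.
\<close>

lemma address_right_constant: "\<exists>e>0. \<forall>t. 0 \<le> t \<longrightarrow> t < e \<longrightarrow> address (z + t) = address z"
proof -
  let ?P = "\<lambda>c j e. 0 < e \<and> (\<forall>t. 0 \<le> t \<longrightarrow> t < e \<longrightarrow> (frac (z - real j * a + t) < c \<longleftrightarrow> frac (z - real j * a) < c))"
  have "\<exists>e. ?P c j e" for c j using frac_less_right_constant[of "z - real j * a" c] by blast
  then have "\<exists>e. \<forall>c j. ?P c j (e c j)" by (intro choice2)
  then obtain e where e: "\<And>c j. ?P c j (e c j)" by blast
  define e0 where "e0 = min (e b (level z)) (Min (e \<beta> ` {..level z}))"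
  have "e0 > 0" unfolding e0_def using e by auto
  moreover have "address (z + t) = address z" if "0 \<le> t" "t < e0" for t
  proof -
    have le: "e0 \<le> e \<beta> j" if "j \<le> level z" for j
      unfolding e0_def using that by (intro min.coboundedI2 Min_le) auto
    have lb: "e0 \<le> e b (level z)" by (simp add: e0_def)
    have sh: "z + t - real j * a = z - real j * a + t" for j by simp
    have J: "frac (z + t - real j * a) < \<beta> \<longleftrightarrow> frac (z - real j * a) < \<beta>" if "j \<le> level z" for j
      unfolding sh using e[of \<beta> j] le[OF that] \<open>0 \<le> t\<close> \<open>t < e0\<close> by auto
    have lev: "level (z + t) = level z"
    proof (rule level_eq)
      show "frac (z + t - real (level z) * a) < \<beta>" using J[of "level z"] level(1) by simp
      fix j assume "j < level z"
      then show "\<beta> \<le> frac (z + t - real j * a)" using J[of j] level(2)[of j z] by (simp add: not_less[symmetric])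
    qed
    have "kind (z + t - real (level z) * a) = kind (z - real (level z) * a)"
      unfolding kind_def sh using e[of b "level z"] lb that by auto
    then show ?thesis unfolding address_def lev by simp
  qed
  ultimately show ?thesis by blast
qed

lemma measurable_address: "address \<in> borel \<rightarrow>\<^sub>M count_space UNIV"
proof -
  have frm: "(\<lambda>z. frac (z - y)) \<in> borel_measurable borel" for y :: real
    unfolding frac_def by measurable
  have lev: "level \<in> borel \<rightarrow>\<^sub>M count_space UNIV"
    unfolding level_def[abs_def]
    by (rule measurable_Least) (use frm in measurable)
  have kd: "Measurable.pred borel (\<lambda>z. kind (z - real k * a))" for k
    unfolding kind_def using frm by measurable
  have off: "(\<lambda>z. offset (kind (z - real k * a)) + k) \<in> borel \<rightarrow>\<^sub>M count_space UNIV" for k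
    unfolding offset_def using kd by measurable
  show ?thesis
    unfolding address_def[abs_def]
    by (rule measurable_compose_countable[OF off lev])
qed

end

section \<open>Moments of Jacobi operators\<close>

lemma jacobi_power_Suc:
  "(jacobi v ^^ Suc k) u n = (jacobi v ^^ k) u (n + 1) + (jacobi v ^^ k) u (n - 1) + v n * (jacobi v ^^ k) u n"
  by (simp add: jacobi_def)

lemma jacobi_power_bound:
  assumes "\<And>n. \<bar>v n\<bar> \<le> C"
  shows "\<bar>(jacobi v ^^ k) site0 n\<bar> \<le> (C + 2) ^ k"
proof (induction k arbitrary: n)
  case 0
  show ?case by (simp add: site0_def)
next
  case (Suc k)
  have C: "0 \<le> C" using assms[of 0] by linarith
  let ?u = "(jacobi v ^^ k) site0"
  have "\<bar>(jacobi v ^^ Suc k) site0 n\<bar> \<le> \<bar>?u (n + 1)\<bar> + \<bar>?u (n - 1)\<bar> + \<bar>v n\<bar> * \<bar>?u n\<bar>"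
    unfolding jacobi_power_Suc abs_mult[symmetric] by linarith
  also have "\<dots> \<le> (C + 2) ^ k + (C + 2) ^ k + C * (C + 2) ^ k"
    by (intro add_mono mult_mono Suc assms C abs_ge_zero)
  finally show ?case by (simp add: algebra_simps)
qed

lemma jacobi_power_tendsto:
  assumes "\<And>n. ((\<lambda>j. v j n) \<longlongrightarrow> w n) F"
  shows "((\<lambda>j. (jacobi (v j) ^^ k) site0 n) \<longlongrightarrow> (jacobi w ^^ k) site0 n) F"
proof (induction k arbitrary: n)
  case (Suc k)
  show ?case unfolding jacobi_power_Suc by (intro tendsto_intros Suc assms)
qed simp

lemma jacobi_power_measurable:
  assumes "\<And>n. (\<lambda>x. v x n) \<in> borel_measurable M"
  shows "(\<lambda>x. (jacobi (v x) ^^ k) site0 n) \<in> borel_measurable M"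
proof (induction k arbitrary: n)
  case (Suc k)
  show ?case unfolding jacobi_power_Suc by (intro borel_measurable_add borel_measurable_times Suc assms)
qed simp

lemma finite_support_jacobi_power: "finite {n. (jacobi v ^^ k) site0 n \<noteq> 0}"
proof -
  have "(jacobi v ^^ k) site0 n = 0" if "int k < \<bar>n\<bar>" for n
    using that
  proof (induction k arbitrary: n)
    case 0
    then show ?case by (simp add: site0_def)
  next
    case (Suc k)
    have "(jacobi v ^^ k) site0 (n + 1) = 0" "(jacobi v ^^ k) site0 (n - 1) = 0" "(jacobi v ^^ k) site0 n = 0"
      using Suc.prems by (intro Suc.IH; linarith)+
    then show ?case unfolding jacobi_power_Suc by simp
  qed
  then have "\<bar>n\<bar> \<le> int k" if "(jacobi v ^^ k) site0 n \<noteq> 0" for n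
    using that by (meson not_le)
  then have "{n. (jacobi v ^^ k) site0 n \<noteq> 0} \<subseteq> {- int k..int k}"
    by (auto simp: abs_le_iff minus_le_iff)
  then show ?thesis by (rule finite_subset) simp
qed

definition pairing :: "(int \<Rightarrow> real) \<Rightarrow> (int \<Rightarrow> real) \<Rightarrow> real"
  where "pairing u w = (\<Sum>\<^sub>\<infinity>n. u n * w n)"

definition finsupp :: "(int \<Rightarrow> real) \<Rightarrow> bool"
  where "finsupp u \<longleftrightarrow> finite {n. u n \<noteq> 0}"

lemma finsupp_shift: "finsupp u \<Longrightarrow> finsupp (\<lambda>n. u (n + m))"
proof -
  assume "finsupp u"
  moreover have "inj (\<lambda>n :: int. n + m)" by (simp add: inj_on_def)
  ultimately show ?thesis using finite_vimageI[of "{n. u n \<noteq> 0}" "\<lambda>n. n + m"] by (simp add: finsupp_def vimage_def)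
qed

lemma finsupp_mult: "finsupp u \<Longrightarrow> finsupp (\<lambda>n. w n * u n)"
  unfolding finsupp_def by (rule finite_subset[rotated]) auto

lemma finsupp_cmult: "finsupp u \<Longrightarrow> finsupp (\<lambda>n. c * u n)"
  by (rule finsupp_mult)

lemma finsupp_add: "finsupp u \<Longrightarrow> finsupp w \<Longrightarrow> finsupp (\<lambda>n. u n + w n)"
  unfolding finsupp_def by (rule finite_subset[of _ "{n. u n \<noteq> 0} \<union> {n. w n \<noteq> 0}"]) auto

lemma finsupp_power: "finsupp ((jacobi v ^^ k) site0)"
  unfolding finsupp_def by (rule finite_support_jacobi_power)

lemma finsupp_sum:
  fixes I :: "nat set"
  shows "(\<And>i. i \<in> I \<Longrightarrow> finsupp (f i)) \<Longrightarrow> finsupp (\<lambda>n. \<Sum>i\<in>I. f i n)"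
proof (induction I rule: infinite_finite_induct)
  case (insert i I)
  then show ?case using finsupp_add[of "f i" "\<lambda>n. \<Sum>i\<in>I. f i n"] by simp
qed (simp_all add: finsupp_def)

lemma summable_pairing: "finsupp u \<Longrightarrow> (\<lambda>n. w n * u n) summable_on UNIV"
  using finsupp_mult[of u w] unfolding finsupp_def by (intro finite_nonzero_values_imp_summable_on) simp

lemma pairing_commute: "pairing u w = pairing w u"
  by (simp add: pairing_def mult.commute)

lemma pairing_add_right: "finsupp u \<Longrightarrow> finsupp w \<Longrightarrow> pairing z (\<lambda>n. u n + w n) = pairing z u + pairing z w"
  unfolding pairing_def by (simp add: distrib_left infsum_add summable_pairing)

lemma pairing_cmult_right: "pairing z (\<lambda>n. c * u n) = c * pairing z u"
  unfolding pairing_def by (simp add: mult.left_commute infsum_cmult_right')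

lemma pairing_sum_right:
  fixes I :: "nat set"
  assumes "finite I" "\<And>i. i \<in> I \<Longrightarrow> finsupp (f i)"
  shows "pairing z (\<lambda>n. \<Sum>i\<in>I. f i n) = (\<Sum>i\<in>I. pairing z (f i))"
  using assms
proof (induction I)
  case (insert i I)
  then show ?case using pairing_add_right[of "f i" "\<lambda>n. \<Sum>i\<in>I. f i n" z] by (simp add: finsupp_sum)
qed (simp add: pairing_def)

lemma pairing_shift: "pairing (\<lambda>n. u (n + m)) w = pairing u (\<lambda>n. w (n - m))"
  unfolding pairing_def using infsum_reindex_bij_betw[OF bij_int_shift, of "\<lambda>n. u n * w (n - m)" m] by simp

lemma pairing_jacobi:
  assumes "finsupp u" "finsupp w"
  shows "pairing (jacobi v u) w = pairing u (jacobi v w)"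
proof -
  have s: "finsupp (\<lambda>n. f (n + 1))" "finsupp (\<lambda>n. f (n - 1))" if "finsupp f" for f
    using finsupp_shift[OF that, of 1] finsupp_shift[OF that, of "-1"] by simp_all
  have "pairing w (jacobi v u) = pairing w (\<lambda>n. u (n + 1)) + pairing w (\<lambda>n. u (n - 1)) + pairing w (\<lambda>n. v n * u n)"
    unfolding jacobi_def[abs_def] using s assms by (simp add: pairing_add_right finsupp_add finsupp_mult)
  moreover have "pairing u (jacobi v w) = pairing u (\<lambda>n. w (n + 1)) + pairing u (\<lambda>n. w (n - 1)) + pairing u (\<lambda>n. v n * w n)"
    unfolding jacobi_def[abs_def] using s assms by (simp add: pairing_add_right finsupp_add finsupp_mult)
  moreover have "pairing w (\<lambda>n. u (n + 1)) = pairing u (\<lambda>n. w (n - 1))"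
    using pairing_shift[of u 1 w] by (simp add: pairing_commute)
  moreover have "pairing w (\<lambda>n. u (n - 1)) = pairing u (\<lambda>n. w (n + 1))"
    using pairing_shift[of u "-1" w] by (simp add: pairing_commute)
  moreover have "pairing w (\<lambda>n. v n * u n) = pairing u (\<lambda>n. v n * w n)"
    unfolding pairing_def by (simp add: mult_ac)
  ultimately show ?thesis by (simp add: pairing_commute[of "jacobi v u" w])
qed

lemma pairing_site0: "pairing site0 w = w 0"
proof -
  have "pairing site0 w = (\<Sum>\<^sub>\<infinity>n\<in>{0}. w n)"
    unfolding pairing_def by (rule infsum_cong_neutral) (auto simp: site0_def)
  then show ?thesis by simp
qed

lemma pairing_power: "pairing ((jacobi v ^^ i) site0) ((jacobi v ^^ j) site0) = moment v (i + j)"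
proof (induction i arbitrary: j)
  case 0
  show ?case by (simp add: pairing_site0 moment_def)
next
  case (Suc i)
  have "pairing ((jacobi v ^^ Suc i) site0) ((jacobi v ^^ j) site0) = pairing ((jacobi v ^^ i) site0) ((jacobi v ^^ Suc j) site0)"
    using pairing_jacobi[OF finsupp_power[where v = v and k = i] finsupp_power[where v = v and k = j], of v] by simp
  then show ?case using Suc[of "Suc j"] by simp
qed

text \<open>
  With \<open>p(x) = \<Sum> b\<^sub>i x\<^sup>i\<close>, this is the integral of \<open>((x - E)\<^sup>2 - \<kappa>) p(x)\<^sup>2\<close> against a measure with moments \<open>m\<close>.
\<close>

definition shifted_square_form :: "(nat \<Rightarrow> real) \<Rightarrow> real \<Rightarrow> real \<Rightarrow> (nat \<Rightarrow> real) \<Rightarrow> nat \<Rightarrow> real"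
  where "shifted_square_form m E \<kappa> b d =
    (\<Sum>i\<le>d. \<Sum>j\<le>d. b i * b j * (m (i + j + 2) - 2 * E * m (i + j + 1) + (E\<^sup>2 - \<kappa>) * m (i + j)))"

text \<open>
  Apply the lower bound to the finitely supported vector \<open>p(H) \<delta>\<^sub>0\<close>.
\<close>

lemma shifted_square_form_moment:
  assumes low: "\<And>u. finite {n. u n \<noteq> 0} \<Longrightarrow> (\<Sum>\<^sub>\<infinity>n. (u n)\<^sup>2) \<le> K * (\<Sum>\<^sub>\<infinity>n. (jacobi v u n - E * u n)\<^sup>2)" and K: "K > 0"
  shows "0 \<le> shifted_square_form (moment v) E (1 / K) b d"
proof -
  define e where "e i = (jacobi v ^^ i) site0" for i
  have fe: "finsupp (e i)" for i unfolding e_def by (rule finsupp_power)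
  have pe: "pairing (e i) (e j) = moment v (i + j)" for i j unfolding e_def by (rule pairing_power)
  define e' where "e' i n = e (Suc i) n + (- E) * e i n" for i n
  have fe': "finsupp (e' i)" for i unfolding e'_def[abs_def] by (intro finsupp_add finsupp_cmult fe)
  define u where "u n = (\<Sum>i\<le>d. b i * e i n)" for n
  have fu: "finsupp u" unfolding u_def[abs_def] by (intro finsupp_sum finsupp_cmult fe)
  have ju: "jacobi v u n - E * u n = (\<Sum>i\<le>d. b i * e' i n)" for n
  proof -
    have "jacobi v u n = (\<Sum>i\<le>d. b i * jacobi v (e i) n)"
      unfolding jacobi_def u_def by (simp add: sum.distrib sum_distrib_left algebra_simps)
    also have "\<dots> = (\<Sum>i\<le>d. b i * e (Suc i) n)" by (simp add: e_def)
    finally show ?thesis unfolding u_def e'_def by (simp add: sum_subtractf[symmetric] sum_distrib_left algebra_simps)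
  qed
  have pp: "pairing (\<lambda>n. \<Sum>i\<le>d. b i * f i n) (\<lambda>n. \<Sum>i\<le>d. b i * f i n) = (\<Sum>i\<le>d. \<Sum>j\<le>d. b i * b j * pairing (f i) (f j))"
    if f: "\<And>i. finsupp (f i)" for f :: "nat \<Rightarrow> int \<Rightarrow> real"
  proof -
    let ?u = "\<lambda>n. \<Sum>i\<le>d. b i * f i n"
    have r: "pairing z ?u = (\<Sum>j\<le>d. b j * pairing z (f j))" for z
      by (subst pairing_sum_right) (auto intro: finsupp_cmult f simp: pairing_cmult_right)
    show ?thesis
      unfolding r[of ?u] pairing_commute[of ?u] unfolding r sum_distrib_left
      by (subst sum.swap) (simp add: mult_ac pairing_commute)
  qed
  have pe': "pairing (e' i) (e' j) = moment v (i + j + 2) - 2 * E * moment v (i + j + 1) + E\<^sup>2 * moment v (i + j)" for i j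
  proof -
    have r: "pairing z (e' j) = pairing z (e (Suc j)) + (- E) * pairing z (e j)" for z j
      unfolding e'_def[abs_def] pairing_add_right[OF fe finsupp_cmult[OF fe]] pairing_cmult_right ..
    show ?thesis unfolding r unfolding pairing_commute[of "e' i"] r pe by (simp add: algebra_simps power2_eq_square)
  qed
  have "pairing u u \<le> K * pairing (\<lambda>n. \<Sum>i\<le>d. b i * e' i n) (\<lambda>n. \<Sum>i\<le>d. b i * e' i n)"
    using low[OF fu[unfolded finsupp_def]] unfolding ju pairing_def power2_eq_square .
  then have "(\<Sum>i\<le>d. \<Sum>j\<le>d. b i * b j * moment v (i + j)) \<le> K * (\<Sum>i\<le>d. \<Sum>j\<le>d. b i * b j * pairing (e' i) (e' j))"
    unfolding u_def[abs_def] pp[of e, OF fe] pp[of e', OF fe'] pe .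
  then have "1 / K * (\<Sum>i\<le>d. \<Sum>j\<le>d. b i * b j * moment v (i + j)) \<le> (\<Sum>i\<le>d. \<Sum>j\<le>d. b i * b j * pairing (e' i) (e' j))"
    using K by (simp add: field_simps)
  moreover have "shifted_square_form (moment v) E (1 / K) b d =
      (\<Sum>i\<le>d. \<Sum>j\<le>d. b i * b j * pairing (e' i) (e' j)) - 1 / K * (\<Sum>i\<le>d. \<Sum>j\<le>d. b i * b j * moment v (i + j))"
    unfolding shifted_square_form_def pe' sum_distrib_left sum_subtractf[symmetric]
    by (intro sum.cong refl) (simp add: algebra_simps)
  ultimately show ?thesis by linarith
qed

section \<open>Measures on a bounded interval and their moments\<close>

lemma polynomial_near:
  fixes \<phi> :: "real \<Rightarrow> real"
  assumes "continuous_on UNIV \<phi>" "\<tau> > 0"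
  obtains b d where "\<And>x. \<bar>x\<bar> \<le> R \<Longrightarrow> \<bar>\<phi> x - (\<Sum>i\<le>d. b i * x ^ i)\<bar> < \<tau>"
proof -
  have "continuous_on {-R..R} \<phi>" using assms(1) continuous_on_subset by blast
  from Stone_Weierstrass_real_polynomial_function[OF compact_Icc this assms(2)]
  obtain p where p: "real_polynomial_function p" "\<And>x. x \<in> {-R..R} \<Longrightarrow> \<bar>\<phi> x - p x\<bar> < \<tau>" by blast
  obtain b d where "p = (\<lambda>x. \<Sum>i\<le>d. b i * x ^ i)" using p(1) real_polynomial_function_iff_sum by auto
  then have "\<bar>\<phi> x - (\<Sum>i\<le>d. b i * x ^ i)\<bar> < \<tau>" if "\<bar>x\<bar> \<le> R" for x
    using p(2)[of x] that by (simp add: abs_le_iff)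
  then show thesis by (rule that)
qed

text \<open>
  The interval is symmetric and enters through its radius, as the bounds for the operators are bounds
  of norms.
\<close>

locale interval_probability = prob_space k for k :: "real measure" +
  fixes R :: real
  assumes sets_k: "sets k = sets borel" and supp_k: "emeasure k (- {-R..R}) = 0"
begin

lemma AE_bound: "AE x in k. \<bar>x\<bar> \<le> R"
  using supp_k by (intro AE_I[of _ _ "- {-R..R}"]) (auto simp: sets_k)

lemma integrable_cont: "continuous_on UNIV \<phi> \<Longrightarrow> integrable k (\<phi> :: real \<Rightarrow> real)"
proof -
  assume c: "continuous_on UNIV \<phi>"
  have "compact (\<phi> ` {-R..R})"
    by (intro compact_continuous_image continuous_on_subset[OF c]) auto
  then obtain C where C: "\<And>x. x \<in> {-R..R} \<Longrightarrow> \<bar>\<phi> x\<bar> \<le> C"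
    using compact_imp_bounded[of "\<phi> ` {-R..R}"] unfolding bounded_iff by force
  show ?thesis
  proof (rule integrable_const_bound[of _ C])
    show "AE x in k. norm (\<phi> x) \<le> C" using AE_bound
    proof eventually_elim
      case (elim x)
      then have "x \<in> {-R..R}" by auto
      then show ?case by (simp add: C)
    qed
    show "\<phi> \<in> borel_measurable k" using c by (simp add: measurable_cong_sets[OF sets_k refl] borel_measurable_continuous_onI)
  qed
qed

lemma integral_poly: "(\<integral>x. (\<Sum>i\<le>d. b i * x ^ i) \<partial>k) = (\<Sum>i\<le>d. b i * (\<integral>x. x ^ i \<partial>k))"
proof -
  have "integrable k (\<lambda>x. b i * x ^ i)" for i by (rule integrable_cont) (intro continuous_intros)
  then have "(\<integral>x. (\<Sum>i\<le>d. b i * x ^ i) \<partial>k) = (\<Sum>i\<le>d. (\<integral>x. b i * x ^ i \<partial>k))" by (intro Bochner_Integration.integral_sum)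
  then show ?thesis by simp
qed

lemma integral_near:
  fixes \<phi> \<psi> :: "real \<Rightarrow> real"
  assumes "continuous_on UNIV \<phi>" "continuous_on UNIV \<psi>" "\<And>x. \<bar>x\<bar> \<le> R \<Longrightarrow> \<bar>\<phi> x - \<psi> x\<bar> < \<tau>"
  shows "\<bar>(\<integral>x. \<phi> x \<partial>k) - (\<integral>x. \<psi> x \<partial>k)\<bar> \<le> \<tau>"
proof -
  have i: "integrable k \<phi>" "integrable k \<psi>" using assms by (auto intro: integrable_cont)
  have "\<bar>(\<integral>x. \<phi> x \<partial>k) - (\<integral>x. \<psi> x \<partial>k)\<bar> = \<bar>\<integral>x. \<phi> x - \<psi> x \<partial>k\<bar>" using i by simp
  also have "\<dots> \<le> (\<integral>x. \<bar>\<phi> x - \<psi> x\<bar> \<partial>k)" by (rule integral_abs_bound)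
  also have "\<dots> \<le> (\<integral>x. \<tau> \<partial>k)"
  proof (rule integral_mono_AE)
    show "AE x in k. \<bar>\<phi> x - \<psi> x\<bar> \<le> \<tau>" using AE_bound by eventually_elim (use assms(3) in force)
  qed (use i in auto)
  finally show ?thesis by (simp add: prob_space)
qed

end

lemma weak_convergence_of_moments:
  fixes k :: "nat \<Rightarrow> real measure" and \<phi> :: "real \<Rightarrow> real"
  assumes k: "\<And>j. interval_probability (k j) R" and k0: "interval_probability k0 R"
    and m: "\<And>n. (\<lambda>j. \<integral>x. x ^ n \<partial>k j) \<longlonglongrightarrow> (\<integral>x. x ^ n \<partial>k0)" and \<phi>: "continuous_on UNIV \<phi>"
  shows "(\<lambda>j. \<integral>x. \<phi> x \<partial>k j) \<longlonglongrightarrow> (\<integral>x. \<phi> x \<partial>k0)"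
proof (rule LIMSEQ_I)
  fix e :: real assume e: "e > 0"
  obtain b d where p: "\<And>x. \<bar>x\<bar> \<le> R \<Longrightarrow> \<bar>\<phi> x - (\<Sum>i\<le>d. b i * x ^ i)\<bar> < e / 3"
    using polynomial_near[OF \<phi>, of "e / 3" R] e by auto
  have c: "continuous_on UNIV (\<lambda>x. \<Sum>i\<le>d. b i * x ^ i)" by (intro continuous_intros)
  have near: "\<bar>(\<integral>x. \<phi> x \<partial>k') - (\<integral>x. (\<Sum>i\<le>d. b i * x ^ i) \<partial>k')\<bar> \<le> e / 3" if "interval_probability k' R" for k'
    by (rule interval_probability.integral_near[OF that \<phi> c p])
  have "(\<lambda>j. \<integral>x. (\<Sum>i\<le>d. b i * x ^ i) \<partial>k j) \<longlonglongrightarrow> (\<integral>x. (\<Sum>i\<le>d. b i * x ^ i) \<partial>k0)"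
    unfolding interval_probability.integral_poly[OF k] interval_probability.integral_poly[OF k0] by (intro tendsto_intros m)
  moreover have "e / 3 > 0" using e by simp
  ultimately obtain j0 where j0: "\<And>j. j \<ge> j0 \<Longrightarrow> \<bar>(\<integral>x. (\<Sum>i\<le>d. b i * x ^ i) \<partial>k j) - (\<integral>x. (\<Sum>i\<le>d. b i * x ^ i) \<partial>k0)\<bar> < e / 3"
    unfolding real_norm_def[symmetric] using LIMSEQ_D by blast
  show "\<exists>j0. \<forall>j\<ge>j0. norm ((\<integral>x. \<phi> x \<partial>k j) - (\<integral>x. \<phi> x \<partial>k0)) < e"
  proof (intro exI[of _ j0] allI impI)
    fix j assume "j0 \<le> j"
    from j0[OF this] near[OF k[of j]] near[OF k0] show "norm ((\<integral>x. \<phi> x \<partial>k j) - (\<integral>x. \<phi> x \<partial>k0)) < e"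
      unfolding real_norm_def by linarith
  qed
qed

text \<open>
  Take for \<open>p\<close> a polynomial approximation of a tent function that is \<open>1\<close> at \<open>E\<close> and vanishes at distance
  \<open>sqrt \<kappa> / 2\<close>.  On the ball \<open>((x - E)\<^sup>2 - \<kappa>) p(x)\<^sup>2\<close> is below a negative constant, and elsewhere it is
  at most a small positive number, so a nonnegative limit of its integrals leaves no mass on the ball.
\<close>

lemma ball_mass_vanishes:
  fixes k :: "nat \<Rightarrow> real measure"
  assumes k: "\<And>j. interval_probability (k j) R" and \<kappa>: "\<kappa> > 0" and E: "\<bar>E\<bar> \<le> R"
    and m: "\<And>n. (\<lambda>j. \<integral>x. x ^ n \<partial>k j) \<longlonglongrightarrow> m n"
    and pos: "\<And>b d. 0 \<le> shifted_square_form m E \<kappa> b d"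
  shows "(\<lambda>j. measure (k j) (ball E (sqrt \<kappa> / 4))) \<longlonglongrightarrow> 0"
proof (rule LIMSEQ_I)
  fix e :: real assume e: "e > 0"
  define r where "r = sqrt \<kappa>"
  have r: "r > 0" "r\<^sup>2 = \<kappa>" using \<kappa> by (auto simp: r_def)
  define \<phi> where "\<phi> x = max 0 (1 - 2 * \<bar>x - E\<bar> / r)" for x :: real
  have c\<phi>: "continuous_on UNIV \<phi>" unfolding \<phi>_def by (intro continuous_intros) (use r in auto)
  define M where "M = (2 * R)\<^sup>2 + 1"
  have M: "M > 0" unfolding M_def by (simp add: add_nonneg_pos)
  (* On the ball the tent is at least 1/2 and p at least 1/4, while (x - E)^2 - kappa is at most
     -3/4 kappa; hence the constant 3/64 kappa.  M bounds (x - E)^2 on the interval. *)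
  define \<tau> where "\<tau> = min (1 / 4) (sqrt (3 * \<kappa> / 64 * (e / 4) / M))"
  have \<tau>0: "\<tau> > 0" using \<kappa> e M by (simp add: \<tau>_def)
  have "\<tau>\<^sup>2 \<le> (sqrt (3 * \<kappa> / 64 * (e / 4) / M))\<^sup>2" using \<tau>0 by (intro power_mono) (auto simp: \<tau>_def)
  also have "\<dots> = 3 * \<kappa> / 64 * (e / 4) / M" using \<kappa> e M by simp
  finally have \<tau>2: "M * \<tau>\<^sup>2 \<le> 3 * \<kappa> / 64 * (e / 4)" using M by (simp add: field_simps)
  obtain b d where p: "\<And>x. \<bar>x\<bar> \<le> R \<Longrightarrow> \<bar>\<phi> x - (\<Sum>i\<le>d. b i * x ^ i)\<bar> < \<tau>"
    using polynomial_near[OF c\<phi> \<tau>0, of R] by blast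
  define P where "P x = (\<Sum>i\<le>d. b i * x ^ i)" for x :: real
  have cP: "continuous_on UNIV P" unfolding P_def by (intro continuous_intros)
  define q where "q x = ((x - E)\<^sup>2 - \<kappa>) * (P x)\<^sup>2" for x
  have cq: "continuous_on UNIV q" unfolding q_def by (intro continuous_intros cP)
  have iq: "(\<integral>x. q x \<partial>k j) = shifted_square_form (\<lambda>n. \<integral>x. x ^ n \<partial>k j) E \<kappa> b d" for j
  proof -
    interpret K: interval_probability "k j" R by (rule k)
    have ip: "integrable (k j) (\<lambda>x. x ^ n)" for n by (rule K.integrable_cont) (intro continuous_intros)
    have "q x = (\<Sum>i\<le>d. \<Sum>l\<le>d. b i * b l * (x ^ (i + l + 2) - 2 * E * x ^ (i + l + 1) + (E\<^sup>2 - \<kappa>) * x ^ (i + l)))" for x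
    proof -
      have "(P x)\<^sup>2 = (\<Sum>i\<le>d. \<Sum>l\<le>d. b i * b l * x ^ (i + l))"
        unfolding P_def power2_eq_square sum_product by (simp add: power_add mult_ac)
      then have "q x = (\<Sum>i\<le>d. \<Sum>l\<le>d. ((x - E)\<^sup>2 - \<kappa>) * (b i * b l * x ^ (i + l)))"
        unfolding q_def by (simp add: sum_distrib_left)
      also have "\<dots> = (\<Sum>i\<le>d. \<Sum>l\<le>d. b i * b l * (x ^ (i + l + 2) - 2 * E * x ^ (i + l + 1) + (E\<^sup>2 - \<kappa>) * x ^ (i + l)))"
        by (intro sum.cong refl) (simp add: power2_eq_square algebra_simps)
      finally show ?thesis .
    qed
    moreover define t where "t i l x = b i * b l * (x ^ (i + l + 2) - 2 * E * x ^ (i + l + 1) + (E\<^sup>2 - \<kappa>) * x ^ (i + l))" for i l x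
    ultimately have qt: "q = (\<lambda>x. \<Sum>i\<le>d. \<Sum>l\<le>d. t i l x)" by (simp add: fun_eq_iff)
    have it: "integrable (k j) (t i l)" for i l
      unfolding t_def[abs_def] by (rule K.integrable_cont) (intro continuous_intros)
    have lin: "(\<integral>x. c * (f x - 2 * E * g x + c' * h x) \<partial>k j) = c * ((\<integral>x. f x \<partial>k j) - 2 * E * (\<integral>x. g x \<partial>k j) + c' * (\<integral>x. h x \<partial>k j))"
      if "integrable (k j) f" "integrable (k j) g" "integrable (k j) h" for f g h :: "real \<Rightarrow> real" and c c'
      using that by simp
    have "(\<integral>x. q x \<partial>k j) = (\<Sum>i\<le>d. \<Sum>l\<le>d. \<integral>x. t i l x \<partial>k j)"
      unfolding qt by (simp add: it Bochner_Integration.integral_sum integrable_sum)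
    then show ?thesis
      unfolding shifted_square_form_def t_def lin[OF ip ip ip] .
  qed
  have "(\<lambda>j. \<integral>x. q x \<partial>k j) \<longlonglongrightarrow> shifted_square_form m E \<kappa> b d"
    unfolding iq shifted_square_form_def by (intro tendsto_intros m)
  moreover have "3 * \<kappa> / 64 * (e / 4) > 0" using \<kappa> e by simp
  ultimately obtain j0 where "\<And>j. j \<ge> j0 \<Longrightarrow> norm ((\<integral>x. q x \<partial>k j) - shifted_square_form m E \<kappa> b d) < 3 * \<kappa> / 64 * (e / 4)"
    using LIMSEQ_D by blast
  then have j0: "\<And>j. j \<ge> j0 \<Longrightarrow> - (3 * \<kappa> / 64 * (e / 4)) < (\<integral>x. q x \<partial>k j)"
    using pos[of b d] unfolding real_norm_def by (smt (verit))
  show "\<exists>j0. \<forall>j\<ge>j0. norm (measure (k j) (ball E (sqrt \<kappa> / 4)) - 0) < e"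
  proof (intro exI[of _ j0] allI impI)
    fix j assume j: "j0 \<le> j"
    interpret K: interval_probability "k j" R by (rule k)
    let ?B = "ball E (r / 4)"
    have pw: "q x \<le> - (3 * \<kappa> / 64) * indicator ?B x + M * \<tau>\<^sup>2" if x: "\<bar>x\<bar> \<le> R" for x
    proof -
      have px: "\<bar>\<phi> x - P x\<bar> < \<tau>" using p[OF x] by (simp add: P_def)
      have \<tau>4: "\<tau> \<le> 1 / 4" by (simp add: \<tau>_def)
      consider "\<bar>x - E\<bar> < r / 4" | "\<bar>x - E\<bar> \<ge> r / 4" "\<bar>x - E\<bar> \<le> r / 2" | "\<bar>x - E\<bar> > r / 2" by linarith
      then show ?thesis
      proof cases
        case 1
        have "2 * \<bar>x - E\<bar> / r \<le> 1 / 2" using 1 r by (simp add: field_simps)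
        then have "\<phi> x \<ge> 1 / 2" unfolding \<phi>_def by simp
        then have "1 / 4 \<le> P x" using px \<tau>4 by linarith
        then have "(1 / 4)\<^sup>2 \<le> (P x)\<^sup>2" by (intro power_mono) auto
        then have P2: "1 / 16 \<le> (P x)\<^sup>2" by (simp add: power_divide)
        have "\<bar>x - E\<bar>\<^sup>2 \<le> (r / 4)\<^sup>2" using 1 by (intro power_mono) auto
        then have s: "(x - E)\<^sup>2 - \<kappa> \<le> - (3 * \<kappa> / 4)" using \<kappa> by (simp add: power_divide r)
        have "q x \<le> - (3 * \<kappa> / 4) * (P x)\<^sup>2" unfolding q_def by (intro mult_right_mono s) auto
        also have "\<dots> \<le> - (3 * \<kappa> / 4) * (1 / 16)" using P2 \<kappa> by simp
        also have "\<dots> = - (3 * \<kappa> / 64)" by simp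
        finally have "q x \<le> - (3 * \<kappa> / 64)" .
        moreover have "x \<in> ?B" using 1 by (simp add: dist_real_def abs_minus_commute)
        moreover have "0 \<le> M * \<tau>\<^sup>2" using M by simp
        ultimately show ?thesis by simp
      next
        case 2
        have "\<bar>x - E\<bar>\<^sup>2 \<le> (r / 2)\<^sup>2" using 2 by (intro power_mono) auto
        then have "(x - E)\<^sup>2 - \<kappa> \<le> 0" using \<kappa> by (simp add: power_divide r)
        then have "q x \<le> 0" unfolding q_def by (intro mult_nonpos_nonneg) auto
        moreover have "x \<notin> ?B" using 2 by (simp add: dist_real_def abs_minus_commute)
        moreover have "0 \<le> M * \<tau>\<^sup>2" using M by simp
        ultimately show ?thesis by simp
      next
        case 3
        have "2 * \<bar>x - E\<bar> / r \<ge> 1" using 3 r by (simp add: field_simps)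
        then have "\<phi> x = 0" unfolding \<phi>_def by simp
        then have "\<bar>P x\<bar>\<^sup>2 \<le> \<tau>\<^sup>2" using px by (intro power_mono) auto
        moreover have "(x - E)\<^sup>2 - \<kappa> \<le> M"
        proof -
          have "\<bar>x - E\<bar>\<^sup>2 \<le> (2 * R)\<^sup>2" using x E by (intro power_mono) auto
          then show ?thesis using \<kappa> by (simp add: M_def)
        qed
        ultimately have "q x \<le> M * \<tau>\<^sup>2" unfolding q_def using M
          by (metis mult_mono order_less_imp_le power2_abs zero_le_power2)
        moreover have "x \<notin> ?B" using 3 r by (simp add: dist_real_def abs_minus_commute)
        ultimately show ?thesis by simp
      qed
    qed
    have mB: "?B \<in> sets (k j)" by (simp add: K.sets_k)
    have "(\<integral>x. q x \<partial>k j) \<le> (\<integral>x. - (3 * \<kappa> / 64) * indicator ?B x + M * \<tau>\<^sup>2 \<partial>k j)"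
    proof (rule integral_mono_AE)
      show "integrable (k j) q" by (rule K.integrable_cont[OF cq])
      show "integrable (k j) (\<lambda>x. - (3 * \<kappa> / 64) * indicator ?B x + M * \<tau>\<^sup>2)" using mB by (auto intro!: integrable_real_indicator simp: K.emeasure_eq_measure)
      show "AE x in k j. q x \<le> - (3 * \<kappa> / 64) * indicator ?B x + M * \<tau>\<^sup>2" using K.AE_bound by eventually_elim (rule pw)
    qed
    also have "\<dots> = - (3 * \<kappa> / 64) * measure (k j) ?B + M * \<tau>\<^sup>2"
    proof -
      have "space (k j) = UNIV" using sets_eq_imp_space_eq[OF K.sets_k] by simp
      then show ?thesis using mB K.prob_space by (simp add: K.emeasure_eq_measure)
    qed
    finally have "3 * \<kappa> / 64 * measure (k j) ?B \<le> 3 * \<kappa> / 64 * (e / 2)"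
      using j0[OF j] \<tau>2 by simp
    then have "measure (k j) ?B \<le> e / 2" using \<kappa> by simp
    then show "norm (measure (k j) (ball E (sqrt \<kappa> / 4)) - 0) < e" using e by (simp add: r_def)
  qed
qed

section \<open>Measures concentrated on small open sets\<close>

lemma interval_probability_dos:
  assumes "norm f + 2 \<le> R"
  shows "interval_probability (density_of_states \<alpha> f) R"
proof -
  interpret prob_space "density_of_states \<alpha> f" by (rule prob_dos)
  have "emeasure (density_of_states \<alpha> f) (- {-R..R}) \<le> emeasure (density_of_states \<alpha> f) (- {- (norm f + 2)..norm f + 2})"
    by (rule emeasure_mono) (use assms in \<open>auto simp: sets_dos\<close>)
  then show ?thesis
    by unfold_locales (auto simp: sets_dos supp_dos[simplified])
qed

lemma potential_bound: "\<bar>potential \<alpha> f \<omega> n\<bar> \<le> norm f"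
  unfolding potential_def using norm_bounded[of f] by (simp only: real_norm_def)

lemma moment_measurable: "(\<lambda>\<omega>. moment (potential \<alpha> f \<omega>) n) \<in> borel_measurable circle_measure"
  unfolding moment_def measurable_cong_sets[OF sets_circle_measure refl]
  by (rule borel_measurable_continuous_onI[OF continuous_moment])

lemma dos_moments_tendsto:
  assumes "f \<longlonglongrightarrow> l"
  shows "(\<lambda>j. \<integral>x. x ^ n \<partial>density_of_states \<alpha> (f j)) \<longlonglongrightarrow> (\<integral>x. x ^ n \<partial>density_of_states \<alpha> l)"
  unfolding power_dos
proof -
  interpret C: prob_space circle_measure by (rule prob_circle)
  have "Bseq f" by (rule convergent_imp_Bseq) (use assms in \<open>auto simp: convergent_def\<close>)
  then obtain K where K: "\<And>j. norm (f j) \<le> K" unfolding Bseq_def by blast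
  have pt: "(\<lambda>j. potential \<alpha> (f j) \<omega> n) \<longlonglongrightarrow> potential \<alpha> l \<omega> n" for \<omega> n
  proof -
    have "(\<lambda>j. dist (f j) l) \<longlonglongrightarrow> 0" using assms by (rule tendsto_dist_iff[THEN iffD1])
    then have "(\<lambda>j. dist (potential \<alpha> (f j) \<omega> n) (potential \<alpha> l \<omega> n)) \<longlonglongrightarrow> 0"
      by (rule Lim_null_comparison[rotated]) (auto simp: potential_def dist_bounded)
    then show ?thesis by (rule tendsto_dist_iff[THEN iffD2])
  qed
  show "(\<lambda>j. \<integral>\<omega>. moment (potential \<alpha> (f j) \<omega>) n \<partial>circle_measure) \<longlonglongrightarrow> (\<integral>\<omega>. moment (potential \<alpha> l \<omega>) n \<partial>circle_measure)"
  proof (rule integral_dominated_convergence[where w = "\<lambda>_. (K + 2) ^ n"])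
    show "AE \<omega> in circle_measure. (\<lambda>j. moment (potential \<alpha> (f j) \<omega>) n) \<longlonglongrightarrow> moment (potential \<alpha> l \<omega>) n"
      unfolding moment_def by (intro AE_I2 jacobi_power_tendsto pt)
    show "AE \<omega> in circle_measure. norm (moment (potential \<alpha> (f j) \<omega>) n) \<le> (K + 2) ^ n" for j
      unfolding moment_def real_norm_def
      by (intro AE_I2 jacobi_power_bound) (use potential_bound K order_trans in blast)
  qed (auto intro: moment_measurable)
qed

text \<open>
  The bound \<open>1/(n+1)\<close> serves for both the Lebesgue measure and the missing mass, so that one index suffices.
\<close>

definition concentrated :: "nat \<Rightarrow> real measure \<Rightarrow> bool"
  where "concentrated n k \<longleftrightarrow> (\<exists>U. open U \<and> emeasure lborel U < ennreal (1 / real (Suc n)) \<and> 1 - 1 / real (Suc n) < measure k U)"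

lemma open_inner_function:
  fixes U :: "real set"
  assumes "prob_space k" "sets k = sets borel" "open U" "U \<noteq> UNIV" "c < measure k U"
  obtains \<phi> :: "real \<Rightarrow> real" where "continuous_on UNIV \<phi>" "\<And>x. 0 \<le> \<phi> x" "\<And>x. \<phi> x \<le> indicator U x" "c < (\<integral>x. \<phi> x \<partial>k)"
proof -
  interpret prob_space k by fact
  define \<phi> where "\<phi> m x = min 1 (real m * infdist x (- U))" for m and x :: real
  have cU: "closed (- U)" "- U \<noteq> {}" using assms by auto
  have c: "continuous_on UNIV (\<phi> m)" for m unfolding \<phi>_def by (intro continuous_intros)
  have \<phi>0: "0 \<le> \<phi> m x" for m x unfolding \<phi>_def by (simp add: infdist_nonneg)
  have \<phi>1: "\<phi> m x \<le> indicator U x" for m x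
  proof (cases "x \<in> U")
    case False
    then have "infdist x (- U) = 0" by simp
    then show ?thesis using False by (simp add: \<phi>_def)
  qed (simp add: \<phi>_def)
  have lim: "(\<lambda>m. \<phi> m x) \<longlonglongrightarrow> indicator U x" for x
  proof (cases "x \<in> U")
    case True
    then have p: "infdist x (- U) > 0" using in_closed_iff_infdist_zero[OF cU] infdist_nonneg[of x "- U"] by fastforce
    obtain m0 where m0: "1 / infdist x (- U) < real m0" using reals_Archimedean2 by blast
    have "\<forall>\<^sub>F m in sequentially. \<phi> m x = 1"
      using eventually_ge_at_top[of m0]
    proof eventually_elim
      case (elim m)
      have "1 < real m0 * infdist x (- U)" using m0 p by (simp add: field_simps)
      also have "\<dots> \<le> real m * infdist x (- U)" using elim p by (intro mult_right_mono) auto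
      finally show ?case by (simp add: \<phi>_def)
    qed
    then show ?thesis using True by (simp add: tendsto_eventually)
  next
    case False
    then have "\<phi> m x = 0" for m using \<phi>0[of m x] \<phi>1[of m x] by simp
    then show ?thesis using False by simp
  qed
  have "(\<lambda>m. \<integral>x. \<phi> m x \<partial>k) \<longlonglongrightarrow> (\<integral>x. indicator U x \<partial>k)"
  proof (rule integral_dominated_convergence[where w = "\<lambda>_. 1"])
    show "AE x in k. norm (\<phi> m x) \<le> 1" for m
      by (rule AE_I2) (use \<phi>0 in \<open>simp add: \<phi>_def\<close>)
    show "\<phi> m \<in> borel_measurable k" for m
      using borel_measurable_continuous_onI[OF c] by (simp add: measurable_cong_sets[OF assms(2) refl])
    show "indicator U \<in> borel_measurable k"
      by (rule borel_measurable_indicator) (use assms(2,3) in simp)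
  qed (use lim in auto)
  moreover have "(\<integral>x. indicator U x \<partial>k) = measure k U"
    using assms(2,3) sets_eq_imp_space_eq[OF assms(2)] by simp
  ultimately have "\<forall>\<^sub>F m in sequentially. c < (\<integral>x. \<phi> m x \<partial>k)"
    using assms(5) by (intro order_tendstoD(1)) auto
  then obtain m where "c < (\<integral>x. \<phi> m x \<partial>k)" by (auto simp: eventually_sequentially)
  then show thesis using that[of "\<phi> m"] c \<phi>0 \<phi>1 by blast
qed

text \<open>
  If \<open>f j\<close> converges to \<open>l\<close> and \<open>U\<close> witnesses concentration for \<open>l\<close>, a continuous function below the
  indicator of \<open>U\<close> already has large integral, and this persists for \<open>f j\<close> with the same \<open>U\<close>.
\<close>

lemma open_concentrated: "open {f. concentrated n (density_of_states \<alpha> f)}"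
proof -
  have "closed (- {f. concentrated n (density_of_states \<alpha> f)})"
    unfolding closed_sequential_limits
  proof (intro allI impI, elim conjE)
    fix f l assume f: "\<forall>j. f j \<in> - {f. concentrated n (density_of_states \<alpha> f)}" and l: "f \<longlonglongrightarrow> l"
    show "l \<in> - {f. concentrated n (density_of_states \<alpha> f)}"
    proof
      assume "l \<in> {f. concentrated n (density_of_states \<alpha> f)}"
      then obtain U where U: "open U" "emeasure lborel U < ennreal (1 / real (Suc n))" "1 - 1 / real (Suc n) < measure (density_of_states \<alpha> l) U"
        by (auto simp: concentrated_def)
      have "U \<noteq> UNIV" using U(2) by auto
      then obtain \<phi> :: "real \<Rightarrow> real" where \<phi>: "continuous_on UNIV \<phi>" "\<And>x. 0 \<le> \<phi> x" "\<And>x. \<phi> x \<le> indicator U x"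
          "1 - 1 / real (Suc n) < (\<integral>x. \<phi> x \<partial>density_of_states \<alpha> l)"
        using open_inner_function[OF prob_dos sets_dos U(1) _ U(3)] by blast
      have "Bseq f" by (rule convergent_imp_Bseq) (use l in \<open>auto simp: convergent_def\<close>)
      then obtain K where K: "\<And>j. norm (f j) \<le> K" unfolding Bseq_def by blast
      define R where "R = max K (norm l) + 2"
      have ipj: "interval_probability (density_of_states \<alpha> (f j)) R" for j
        by (rule interval_probability_dos) (use K[of j] in \<open>simp add: R_def\<close>)
      have ipl: "interval_probability (density_of_states \<alpha> l) R"
        by (rule interval_probability_dos) (simp add: R_def)
      have "(\<lambda>j. \<integral>x. \<phi> x \<partial>density_of_states \<alpha> (f j)) \<longlonglongrightarrow> (\<integral>x. \<phi> x \<partial>density_of_states \<alpha> l)"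
        by (rule weak_convergence_of_moments[OF ipj ipl dos_moments_tendsto[OF l] \<phi>(1)])
      then have "\<forall>\<^sub>F j in sequentially. 1 - 1 / real (Suc n) < (\<integral>x. \<phi> x \<partial>density_of_states \<alpha> (f j))"
        using \<phi>(4) by (rule order_tendstoD(1))
      then obtain j where j: "1 - 1 / real (Suc n) < (\<integral>x. \<phi> x \<partial>density_of_states \<alpha> (f j))" by (auto simp: eventually_sequentially)
      interpret J: interval_probability "density_of_states \<alpha> (f j)" R by (rule ipj)
      have "(\<integral>x. \<phi> x \<partial>density_of_states \<alpha> (f j)) \<le> (\<integral>x. indicator U x \<partial>density_of_states \<alpha> (f j))"
        by (rule integral_mono) (use \<phi> U J.integrable_cont[OF \<phi>(1)] in \<open>auto intro!: integrable_real_indicator simp: sets_dos J.emeasure_eq_measure\<close>)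
      also have "\<dots> = measure (density_of_states \<alpha> (f j)) U"
        using U(1) sets_eq_imp_space_eq[OF sets_dos] by (simp add: sets_dos)
      finally have "concentrated n (density_of_states \<alpha> (f j))" unfolding concentrated_def using U j by (intro exI[of _ U]) auto
      then show False using f by auto
    qed
  qed
  then show ?thesis by (simp only: closed_def double_compl)
qed

text \<open>
  From left to right by outer regularity.  From right to left, take witnesses along a sequence of indices with
  summable bounds; by Borel and Cantelli, twice, their limit superior is a Lebesgue null set that carries all the mass.
\<close>

lemma singular_iff_concentrated:
  assumes "prob_space k" "sets k = sets borel"
  shows "singular k \<longleftrightarrow> (\<forall>n. concentrated n k)"
proof
  interpret prob_space k by fact
  have sp: "space k = UNIV" using sets_eq_imp_space_eq[OF assms(2)] by simp
  {
    assume "singular k"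
    then obtain N where N: "N \<in> sets borel" "emeasure lborel N = 0" "emeasure k (- N) = 0" by (auto simp: singular_def)
    show "\<forall>n. concentrated n k"
    proof
      fix n
      have e: "0 < 1 / real (Suc n)" by simp
      obtain U where U: "open U" "N \<subseteq> U" "emeasure lborel (U - N) < ennreal (1 / real (Suc n))"
        using outer_regular_lborel[OF N(1) e] by blast
      have "emeasure lborel U \<le> emeasure lborel (U - N) + emeasure lborel N"
        using emeasure_subadditive[of "U - N" lborel N] U N(1) by (simp add: Un_absorb2)
      then have 1: "emeasure lborel U < ennreal (1 / real (Suc n))" using U(3) N(2) by simp
      have "measure k (- U) \<le> measure k (- N)" using U N assms(2) by (intro finite_measure_mono) auto
      also have "\<dots> = 0" using N(3) by (simp add: measure_def)
      finally have "measure k (- U) = 0" using measure_nonneg[of k "- U"] by linarith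
      then have "measure k U = 1" using prob_compl[of U] U(1) assms(2) sp by (simp add: Compl_eq_Diff_UNIV)
      then show "concentrated n k" unfolding concentrated_def using U(1) 1 e by (intro exI[of _ U]) auto
    qed
  }
  {
    assume "\<forall>n. concentrated n k"
    then have "\<exists>U. open U \<and> emeasure lborel U < ennreal (1 / real (Suc (2 ^ n))) \<and> 1 - 1 / real (Suc (2 ^ n)) < measure k U" for n
      unfolding concentrated_def by (rule spec)
    then obtain U where U: "\<And>n. open (U n)" "\<And>n. emeasure lborel (U n) < ennreal (1 / real (Suc (2 ^ n)))"
        "\<And>n. 1 - 1 / real (Suc (2 ^ n)) < measure k (U n)" by metis
    have U': "U n \<in> sets borel" for n using U(1) by simp
    have small: "1 / real (Suc (2 ^ n)) \<le> (1 / 2) ^ n" for n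
      unfolding power_one_over by (rule divide_left_mono) (auto simp: of_nat_Suc intro!: mult_pos_pos add_pos_pos)
    have mU: "measure lborel (U n) \<le> (1 / 2) ^ n" for n
    proof -
      have "measure lborel (U n) \<le> 1 / real (Suc (2 ^ n))"
        unfolding measure_def using U(2)[of n] by (intro enn2real_leI) auto
      then show ?thesis using small[of n] by linarith
    qed
    have mC: "measure k (- U n) \<le> (1 / 2) ^ n" for n
    proof -
      have "measure k (- U n) = 1 - measure k (U n)"
        using prob_compl[of "U n"] U' assms(2) sp by (simp add: Compl_eq_Diff_UNIV)
      then show ?thesis using U(3)[of n] small[of n] by linarith
    qed
    have sg: "summable (\<lambda>n. (1 / 2 :: real) ^ n)" by (rule summable_geometric) simp
    have 1: "AE x in lborel. \<forall>\<^sub>F n in sequentially. x \<in> space lborel - U n"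
    proof (rule borel_cantelli_AE1)
      show "emeasure lborel (U n) < \<infinity>" for n unfolding infinity_ennreal_def by (rule less_trans[OF U(2) ennreal_less_top])
      show "summable (\<lambda>n. measure lborel (U n))"
        by (rule summable_comparison_test'[OF sg, of 0]) (use mU in auto)
    qed (use U' in simp)
    have 2: "AE x in k. \<forall>\<^sub>F n in sequentially. x \<in> space k - (- U n)"
    proof (rule borel_cantelli_AE1)
      show "emeasure k (- U n) < \<infinity>" for n by (simp add: emeasure_eq_measure)
      show "summable (\<lambda>n. measure k (- U n))"
        by (rule summable_comparison_test'[OF sg, of 0]) (use mC in auto)
    qed (use U' assms(2) in auto)
    define N where "N = (\<Inter>m. \<Union>n\<in>{m..}. U n)"
    have N: "N \<in> sets borel" unfolding N_def using U' by (intro sets.countable_INT'' sets.countable_UN') auto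
    have "AE x in lborel. x \<notin> N"
      using 1
    proof eventually_elim
      case (elim x)
      then obtain m where "\<forall>n\<ge>m. x \<notin> U n" by (auto simp: eventually_sequentially)
      then show ?case by (auto simp: N_def)
    qed
    then have N0: "emeasure lborel N = 0"
      using N AE_iff_measurable[of N lborel "\<lambda>x. x \<notin> N"] by simp
    have "AE x in k. x \<in> N"
      using 2
    proof eventually_elim
      case (elim x)
      then obtain m where "\<forall>n\<ge>m. x \<in> U n" by (auto simp: eventually_sequentially)
      then have "\<exists>n\<ge>m'. x \<in> U n" for m' by (intro exI[of _ "max m m'"]) auto
      then show ?case by (force simp: N_def)
    qed
    moreover have "{x \<in> space k. \<not> x \<in> N} = - N" using sp by auto
    ultimately have "emeasure k (- N) = 0"
      using N assms(2) AE_iff_measurable[of "- N" k "\<lambda>x. x \<in> N"] by auto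
    then show "singular k" unfolding singular_def using N N0 by auto
  }
qed

section \<open>Continuous approximation of right-continuous step functions\<close>

text \<open>
  The average over an interval to the right of \<open>z\<close>: it is continuous, and for a function that is constant
  just to the right of \<open>z\<close> it equals the value at \<open>z\<close> as soon as \<open>s\<close> is small.
\<close>

definition smear :: "real \<Rightarrow> (real \<Rightarrow> real) \<Rightarrow> real \<Rightarrow> real"
  where "smear s g z = (1 / s) * (\<integral>t. indicator {0..s} t * g (z + t) \<partial>lborel)"

lemma smear_integrable:
  fixes g :: "real \<Rightarrow> real" and a b z C :: real
  assumes "g \<in> borel_measurable borel" "\<And>x. \<bar>g x\<bar> \<le> C"
  shows "integrable lborel (\<lambda>t. indicator {a..b} t * g (z + t))"
proof (rule Bochner_Integration.integrable_bound[of _ "\<lambda>t. C * indicator {a..b} t"])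
  show "integrable lborel (\<lambda>t. C * indicator {a..b} t)"
    by (intro integrable_mult_right integrable_real_indicator) (auto simp: emeasure_lborel_Icc_eq)
  show "AE t in lborel. norm (indicator {a..b} t * g (z + t)) \<le> norm (C * indicator {a..b} t)"
    by (rule AE_I2) (use assms(2) abs_ge_self[of C] order_trans in \<open>fastforce simp: indicator_def\<close>)
  show "(\<lambda>t. indicator {a..b} t * g (z + t)) \<in> borel_measurable lborel" using assms(1) by measurable
qed

lemma smear_near:
  fixes g :: "real \<Rightarrow> real" and z c e C s :: real
  assumes g: "g \<in> borel_measurable borel" "\<And>x. \<bar>g x\<bar> \<le> C" and s: "s > 0"
    and near: "\<And>t. 0 \<le> t \<Longrightarrow> t \<le> s \<Longrightarrow> \<bar>g (z + t) - c\<bar> \<le> e"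
  shows "\<bar>smear s g z - c\<bar> \<le> e"
proof -
  have i: "integrable lborel (\<lambda>t. indicator {0..s} t * g (z + t))" by (rule smear_integrable[OF g])
  have ii: "integrable lborel (\<lambda>t. y * indicator {0..s} t)" for y :: real
    using s by (intro integrable_mult_right integrable_real_indicator) auto
  have "(\<integral>t. c * indicator {0..s} t \<partial>lborel) = c * s" using s by simp
  then have "s * (smear s g z - c) = (\<integral>t. indicator {0..s} t * g (z + t) - c * indicator {0..s} t \<partial>lborel)"
    using i ii[of c] s by (simp add: smear_def right_diff_distrib mult.commute)
  also have "\<bar>\<dots>\<bar> \<le> (\<integral>t. \<bar>indicator {0..s} t * g (z + t) - c * indicator {0..s} t\<bar> \<partial>lborel)" by (rule integral_abs_bound)
  also have "\<dots> \<le> (\<integral>t. e * indicator {0..s} t \<partial>lborel)"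
  proof (rule integral_mono)
    show "integrable lborel (\<lambda>t. \<bar>indicator {0..s} t * g (z + t) - c * indicator {0..s} t\<bar>)"
      by (intro integrable_abs Bochner_Integration.integrable_diff i ii)
    show "\<bar>indicator {0..s} t * g (z + t) - c * indicator {0..s} t\<bar> \<le> e * indicator {0..s} t" for t
      using near[of t] by (auto simp: indicator_def)
  qed (rule ii)
  also have "\<dots> = s * e" using s by simp
  finally have "s * \<bar>smear s g z - c\<bar> \<le> s * e" using s by (simp add: abs_mult)
  then show ?thesis using s by simp
qed

lemma smear_lipschitz:
  fixes g :: "real \<Rightarrow> real" and z z' C s :: real
  assumes g: "g \<in> borel_measurable borel" "\<And>x. \<bar>g x\<bar> \<le> C" and s: "s > 0" and le: "z \<le> z'"
  shows "\<bar>smear s g z - smear s g z'\<bar> \<le> 2 * C / s * (z' - z)"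
proof -
  have sh: "(\<integral>t. indicator {0..s} t * g (z + t) \<partial>lborel) = (\<integral>u. indicator {z..z + s} u * g u \<partial>lborel)" for z
    using lborel_integral_real_affine[of 1 "\<lambda>u. indicator {z..z + s} u * g u" z] by (simp add: indicator_def)
  have i: "integrable lborel (\<lambda>u. indicator {a..b} u * g u)" for a b
    using smear_integrable[OF g, of a b 0] by simp
  have ic: "integrable lborel (\<lambda>u. C * indicator {a..b} u)" for a b :: real
    by (intro integrable_mult_right integrable_real_indicator) (auto simp: emeasure_lborel_Icc_eq)
  have C: "0 \<le> C" using g(2)[of 0] by linarith
  have "\<bar>(\<integral>u. indicator {z..z + s} u * g u \<partial>lborel) - (\<integral>u. indicator {z'..z' + s} u * g u \<partial>lborel)\<bar> =
      \<bar>\<integral>u. indicator {z..z + s} u * g u - indicator {z'..z' + s} u * g u \<partial>lborel\<bar>" using i by simp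
  also have "\<dots> \<le> (\<integral>u. \<bar>indicator {z..z + s} u * g u - indicator {z'..z' + s} u * g u\<bar> \<partial>lborel)" by (rule integral_abs_bound)
  also have "\<dots> \<le> (\<integral>u. C * indicator {z..z'} u + C * indicator {z + s..z' + s} u \<partial>lborel)"
  proof (rule integral_mono)
    show "integrable lborel (\<lambda>u. \<bar>indicator {z..z + s} u * g u - indicator {z'..z' + s} u * g u\<bar>)"
      by (intro integrable_abs Bochner_Integration.integrable_diff i)
    show "\<bar>indicator {z..z + s} u * g u - indicator {z'..z' + s} u * g u\<bar> \<le> C * indicator {z..z'} u + C * indicator {z + s..z' + s} u" for u
      using g(2)[of u] le C by (auto simp: indicator_def)
  qed (intro Bochner_Integration.integrable_add ic)
  also have "\<dots> = 2 * C * (z' - z)" using ic le by (simp add: algebra_simps)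
  finally have "\<bar>(\<integral>u. indicator {z..z + s} u * g u \<partial>lborel) - (\<integral>u. indicator {z'..z' + s} u * g u \<partial>lborel)\<bar> \<le> 2 * C * (z' - z)" .
  then have "1 / s * \<bar>(\<integral>u. indicator {z..z + s} u * g u \<partial>lborel) - (\<integral>u. indicator {z'..z' + s} u * g u \<partial>lborel)\<bar> \<le> 1 / s * (2 * C * (z' - z))"
    using s by (intro mult_left_mono) auto
  then show ?thesis unfolding smear_def sh right_diff_distrib[symmetric] abs_mult using s by simp
qed

lemma continuous_smear:
  fixes g :: "real \<Rightarrow> real" and C s :: real
  assumes g: "g \<in> borel_measurable borel" "\<And>x. \<bar>g x\<bar> \<le> C" and s: "s > 0"
  shows "continuous_on UNIV (smear s g)"
proof -
  have C: "0 \<le> C" using g(2)[of 0] by linarith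
  have "(2 * C / s)-lipschitz_on UNIV (smear s g)"
  proof (rule lipschitz_onI)
    fix x y :: real
    show "dist (smear s g x) (smear s g y) \<le> 2 * C / s * dist x y"
      using smear_lipschitz[OF g s, of x y] smear_lipschitz[OF g s, of y x]
      by (cases "x \<le> y") (auto simp: dist_real_def abs_minus_commute)
  qed (use C s in auto)
  then show ?thesis by (rule lipschitz_on_continuous_on)
qed

lemma exists_circle_function:
  fixes m :: "real \<Rightarrow> real"
  assumes c: "continuous_on UNIV m" and per: "\<And>z n. m (z + of_int n) = m z"
  obtains h :: "circle \<Rightarrow>\<^sub>C real" where "\<And>x. apply_bcontfun h (to_circle x) = m x"
proof -
  define h0 where "h0 = (\<lambda>c. m (rep_circle c))"
  have h0: "h0 (to_circle x) = m x" for x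
  proof -
    have "to_circle (rep_circle (to_circle x)) = to_circle x" by (metis Quotient3_abs_rep Quotient3_circle)
    then have "rep_circle (to_circle x) - x \<in> \<int>" by (simp add: circle.abs_eq_iff)
    then obtain n where "rep_circle (to_circle x) = x + of_int n" by (metis Ints_cases add.commute diff_add_cancel)
    then show ?thesis by (simp add: h0_def per)
  qed
  have "continuous_on UNIV h0"
  proof -
    have "open (h0 -` U)" if "open U" for U :: "real set"
    proof -
      have "to_circle -` (h0 -` U) = m -` U" by (auto simp: h0)
      moreover have "open (m -` U)" using c that by (simp add: continuous_on_open_vimage)
      ultimately show ?thesis by (simp add: open_circle_def)
    qed
    then show ?thesis by (simp add: continuous_on_open_vimage)
  qed
  then have "h0 \<in> bcontfun" by (simp add: continuous_circle_bcontfun)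
  then have "apply_bcontfun (Bcontfun h0) = h0" by (rule Bcontfun_inverse)
  then show thesis using that[of "Bcontfun h0"] h0 by simp
qed

lemma uniformly_continuous_lift:
  fixes f :: "circle \<Rightarrow>\<^sub>C real"
  assumes "e > 0"
  obtains \<delta> where "\<delta> > 0" "\<And>x y. \<bar>x - y\<bar> < \<delta> \<Longrightarrow> \<bar>apply_bcontfun f (to_circle x) - apply_bcontfun f (to_circle y)\<bar> < e"
proof -
  define F where "F x = apply_bcontfun f (to_circle x)" for x
  have "continuous_on {-1..2} F"
    unfolding F_def by (rule continuous_on_compose2[OF _ continuous_on_to_circle, of UNIV "apply_bcontfun f"]) auto
  then have "uniformly_continuous_on {-1..2} F" by (rule compact_uniformly_continuous) simp
  then obtain d where d: "d > 0" "\<And>x y. x \<in> {-1..2} \<Longrightarrow> y \<in> {-1..2} \<Longrightarrow> dist y x < d \<Longrightarrow> dist (F y) (F x) < e"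
    using assms unfolding uniformly_continuous_on_def by metis
  have per: "F (x - of_int n) = F x" for x n
  proof -
    have "to_circle (x - of_int n) = to_circle x" by (simp add: circle.abs_eq_iff)
    then show ?thesis by (simp add: F_def)
  qed
  have "\<bar>F x - F y\<bar> < e" if "\<bar>x - y\<bar> < min d 1" for x y
  proof -
    have 1: "x - of_int \<lfloor>x\<rfloor> \<in> {-1..2}" "y - of_int \<lfloor>x\<rfloor> \<in> {-1..2}"
      using that by (simp_all, linarith+)
    have "dist (F (x - of_int \<lfloor>x\<rfloor>)) (F (y - of_int \<lfloor>x\<rfloor>)) < e"
      by (rule d(2)[OF 1(2,1)]) (use that in \<open>simp add: dist_real_def\<close>)
    then show ?thesis unfolding per dist_real_def .
  qed
  then show thesis using that[of "min d 1"] d(1) unfolding F_def by simp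
qed

section \<open>Functions whose density of states is concentrated are dense\<close>

lemma smear_eventually_eq:
  fixes g :: "real \<Rightarrow> real"
  assumes g: "g \<in> borel_measurable borel" "\<And>x. \<bar>g x\<bar> \<le> C"
    and e: "e > 0" "\<And>t. 0 \<le> t \<Longrightarrow> t < e \<Longrightarrow> g (z + t) = g z"
    and s: "\<And>j. s j > 0" "s \<longlonglongrightarrow> 0"
  shows "(\<lambda>j. smear (s j) g z) \<longlonglongrightarrow> g z"
proof (rule tendsto_eventually)
  have "\<forall>\<^sub>F j in sequentially. s j < e" using s(2) e(1) by (rule order_tendstoD(2))
  then show "\<forall>\<^sub>F j in sequentially. smear (s j) g z = g z"
  proof eventually_elim
    case (elim j)
    have "\<bar>smear (s j) g z - g z\<bar> \<le> 0" by (rule smear_near[OF g s(1)]) (use e(2) elim in auto)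
    then show ?case by simp
  qed
qed

lemma potential_to_circle:
  "potential (to_circle a) f (to_circle x) k = apply_bcontfun f (to_circle (x + of_int k * a))"
  by (simp add: potential_def circle_scale.abs_eq plus_circle.abs_eq)

text \<open>
  The limit moments belong to a discontinuous function, for which no density of states is defined, so
  they are kept as numbers and not as moments of a measure.
\<close>

lemma moments_of_smeared:
  fixes g :: "real \<Rightarrow> real" and f :: "nat \<Rightarrow> circle \<Rightarrow>\<^sub>C real"
  assumes g: "g \<in> borel_measurable borel" "\<And>x. \<bar>g x\<bar> \<le> C"
    and right: "\<And>z. \<exists>e>0. \<forall>t. 0 \<le> t \<longrightarrow> t < e \<longrightarrow> g (z + t) = g z"
    and s: "\<And>j. s j > 0" "s \<longlonglongrightarrow> 0"
    and f: "\<And>j x. apply_bcontfun (f j) (to_circle x) = smear (s j) g x"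
  shows "(\<lambda>j. \<integral>x. x ^ n \<partial>density_of_states (to_circle a) (f j)) \<longlonglongrightarrow>
    (\<integral>x. indicator {0..<1} x * moment (\<lambda>k. g (x + of_int k * a)) n \<partial>lborel)"
    and "integrable lborel (\<lambda>x. indicator {0..<1} x * moment (\<lambda>k. g (x + of_int k * a)) n :: real)"
proof -
  define M where "M v x = indicator {0..<1} x * moment (\<lambda>k. v (x + of_int k * a)) n" for v :: "real \<Rightarrow> real" and x :: real
  have meas: "M v \<in> borel_measurable lborel" if "v \<in> borel_measurable borel" for v
  proof -
    have "(\<lambda>x. v (x + of_int k * a)) \<in> borel_measurable lborel" for k using that by measurable
    then have "(\<lambda>x. moment (\<lambda>k. v (x + of_int k * a)) n) \<in> borel_measurable lborel"
      unfolding moment_def by (rule jacobi_power_measurable)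
    then show ?thesis unfolding M_def by measurable
  qed
  have bound: "norm (M v x) \<le> indicator {0..<1} x * (C + 2) ^ n" if "\<And>x. \<bar>v x\<bar> \<le> C" for v x
    using jacobi_power_bound[of "\<lambda>k. v (x + of_int k * a)" C n 0] that by (auto simp: M_def moment_def indicator_def)
  have dom: "integrable lborel (\<lambda>x. indicator {0..<1::real} x * (C + 2) ^ n)"
    by (intro integrable_mult_left integrable_real_indicator) auto
  have sc: "continuous_on UNIV (smear (s j) g)" for j by (rule continuous_smear[OF g s(1)])
  have sb: "\<bar>smear (s j) g x\<bar> \<le> C" for j x
    using smear_near[OF g s(1)[of j], where z = x and c = 0 and e = C] g(2) by simp
  have lim: "(\<lambda>j. M (smear (s j) g) x) \<longlonglongrightarrow> M g x" for x
  proof -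
    have "(\<lambda>j. smear (s j) g z) \<longlonglongrightarrow> g z" for z
    proof -
      obtain e where "e > 0" "\<And>t. 0 \<le> t \<Longrightarrow> t < e \<Longrightarrow> g (z + t) = g z" using right[of z] by blast
      then show ?thesis by (rule smear_eventually_eq[OF g _ _ s])
    qed
    then show ?thesis unfolding M_def moment_def by (intro tendsto_mult tendsto_const jacobi_power_tendsto)
  qed
  have eq: "(\<integral>x. x ^ n \<partial>density_of_states (to_circle a) (f j)) = (\<integral>x. M (smear (s j) g) x \<partial>lborel)" for j
  proof -
    have "(\<lambda>\<omega>. moment (potential (to_circle a) (f j) \<omega>) n) \<in> borel_measurable borel"
      using moment_measurable by (simp add: measurable_cong_sets[OF sets_circle_measure refl])
    from integral_circle[OF this] show ?thesis
      unfolding power_dos M_def by (simp add: potential_to_circle[abs_def] f)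
  qed
  have "(\<lambda>j. \<integral>x. M (smear (s j) g) x \<partial>lborel) \<longlonglongrightarrow> (\<integral>x. M g x \<partial>lborel)"
    by (rule integral_dominated_convergence[OF meas[OF g(1)] meas dom])
      (use lim bound sb borel_measurable_continuous_onI[OF sc] in auto)
  then show "(\<lambda>j. \<integral>x. x ^ n \<partial>density_of_states (to_circle a) (f j)) \<longlonglongrightarrow>
    (\<integral>x. indicator {0..<1} x * moment (\<lambda>k. g (x + of_int k * a)) n \<partial>lborel)"
    unfolding eq M_def .
  have "integrable lborel (M g)"
  proof (rule Bochner_Integration.integrable_bound[OF dom meas[OF g(1)]])
    show "AE x in lborel. norm (M g x) \<le> norm (indicator {0..<1} x * (C + 2) ^ n)"
      unfolding real_norm_def[of "indicator {0..<1} _ * _"]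
      by (intro AE_I2 order_trans[OF bound[OF g(2)]] abs_ge_self)
  qed
  then show "integrable lborel (\<lambda>x. indicator {0..<1} x * moment (\<lambda>k. g (x + of_int k * a)) n :: real)"
    unfolding M_def .
qed

lemma shifted_square_form_integral:
  assumes int: "\<And>n. integrable M (\<lambda>x. w x * m x n)"
    and pos: "\<And>x. 0 \<le> w x" "\<And>x. 0 \<le> shifted_square_form (m x) E \<kappa> b d"
  shows "0 \<le> shifted_square_form (\<lambda>n. \<integral>x. w x * m x n \<partial>M) E \<kappa> b d"
proof -
  define t where "t i j x = b i * b j * (w x * m x (i + j + 2) - 2 * E * (w x * m x (i + j + 1)) + (E\<^sup>2 - \<kappa>) * (w x * m x (i + j)))" for i j x
  have it: "integrable M (t i j)" for i j
    unfolding t_def[abs_def]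
    by (intro integrable_mult_right Bochner_Integration.integrable_add Bochner_Integration.integrable_diff int)
  have lin: "(\<integral>x. c * (f x - 2 * E * g x + c' * h x) \<partial>M) = c * ((\<integral>x. f x \<partial>M) - 2 * E * (\<integral>x. g x \<partial>M) + c' * (\<integral>x. h x \<partial>M))"
    if "integrable M f" "integrable M g" "integrable M h" for f g h :: "_ \<Rightarrow> real" and c c'
    using that by simp
  have "(\<Sum>i\<le>d. \<Sum>j\<le>d. t i j x) = w x * shifted_square_form (m x) E \<kappa> b d" for x
    unfolding t_def shifted_square_form_def sum_distrib_left
    by (intro sum.cong refl) (simp add: algebra_simps)
  then have "0 \<le> (\<integral>x. (\<Sum>i\<le>d. \<Sum>j\<le>d. t i j x) \<partial>M)"
    using pos by (intro integral_nonneg_AE AE_I2) simp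
  also have "\<dots> = (\<Sum>i\<le>d. \<Sum>j\<le>d. \<integral>x. t i j x \<partial>M)"
    by (simp add: it Bochner_Integration.integral_sum integrable_sum)
  also have "\<dots> = shifted_square_form (\<lambda>n. \<integral>x. w x * m x n \<partial>M) E \<kappa> b d"
    unfolding shifted_square_form_def t_def lin[OF int int int] ..
  finally show ?thesis .
qed

lemma compact_mass_vanishes:
  fixes k :: "nat \<Rightarrow> real measure"
  assumes k: "\<And>j. interval_probability (k j) R" and S: "compact S" "\<And>E. E \<in> S \<Longrightarrow> \<bar>E\<bar> \<le> R"
    and m: "\<And>n. (\<lambda>j. \<integral>x. x ^ n \<partial>k j) \<longlonglongrightarrow> m n"
    and pos: "\<And>E. E \<in> S \<Longrightarrow> \<exists>\<kappa>>0. \<forall>b d. 0 \<le> shifted_square_form m E \<kappa> b d"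
  shows "(\<lambda>j. measure (k j) S) \<longlonglongrightarrow> 0"
proof -
  obtain \<kappa> where \<kappa>: "\<And>E. E \<in> S \<Longrightarrow> 0 < \<kappa> E \<and> (\<forall>b d. 0 \<le> shifted_square_form m E (\<kappa> E) b d)"
    using pos by metis
  have "S \<subseteq> (\<Union>E\<in>S. ball E (sqrt (\<kappa> E) / 4))" using \<kappa> by force
  then obtain D where D: "D \<subseteq> S" "finite D" "S \<subseteq> (\<Union>E\<in>D. ball E (sqrt (\<kappa> E) / 4))"
    using compactE_image[OF S(1), of S "\<lambda>E. ball E (sqrt (\<kappa> E) / 4)"] by auto
  have le: "measure (k j) S \<le> (\<Sum>E\<in>D. measure (k j) (ball E (sqrt (\<kappa> E) / 4)))" for j
  proof -
    interpret K: interval_probability "k j" R by (rule k)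
    have "measure (k j) S \<le> measure (k j) (\<Union>E\<in>D. ball E (sqrt (\<kappa> E) / 4))"
      using D by (intro K.finite_measure_mono) (auto simp: K.sets_k intro!: borel_open)
    also have "\<dots> \<le> (\<Sum>E\<in>D. measure (k j) (ball E (sqrt (\<kappa> E) / 4)))"
      by (rule K.finite_measure_subadditive_finite) (use D in \<open>auto simp: K.sets_k\<close>)
    finally show ?thesis .
  qed
  have "(\<lambda>j. measure (k j) (ball E (sqrt (\<kappa> E) / 4))) \<longlonglongrightarrow> 0" if "E \<in> D" for E
    by (rule ball_mass_vanishes[OF k _ _ m]) (use \<kappa> S D that in auto)
  then have "(\<lambda>j. \<Sum>E\<in>D. measure (k j) (ball E (sqrt (\<kappa> E) / 4))) \<longlonglongrightarrow> 0" by (intro tendsto_null_sum)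
  then show ?thesis by (rule Lim_null_comparison[rotated]) (use le in auto)
qed

text \<open>
  A point at level \<open>k\<close> lies within \<open>\<beta>\<close> to the right of \<open>k a\<close> modulo one, so \<open>F\<close> at the left end of the level is a good
  letter for all of it.
\<close>

lemma (in two_towers) word_near:
  assumes per: "\<And>x n. F (x + of_int n) = (F x :: real)" and uc: "\<And>x y. \<bar>x - y\<bar> < \<delta> \<Longrightarrow> \<bar>F x - F y\<bar> < e" and "\<beta> < \<delta>"
  shows "\<bar>F (real (if address z < A then address z else address z - A) * a) - F z\<bar> < e"
proof -
  define k where "k = level z"
  define z0 where "z0 = z - real k * a"
  have k: "frac z0 < \<beta>" "k < height (kind z0)" using level(1) level_less_height by (auto simp: z0_def k_def)
  have "(if address z < A then address z else address z - A) = k"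
    using k(2) unfolding address_def z0_def k_def by (auto simp: offset_def height_def split: if_splits)
  moreover have "\<bar>F (real k * a) - F (frac z0 + real k * a)\<bar> < e"
    by (rule uc) (use k(1) frac_ge_0[of z0] \<open>\<beta> < \<delta>\<close> in simp)
  moreover have "F z = F (frac z0 + real k * a)"
    using per[of "frac z0 + real k * a" "\<lfloor>z0\<rfloor>"] by (simp add: frac_def z0_def)
  ultimately show ?thesis by simp
qed

text \<open>
  The words are the values of \<open>f\<close> at the left ends of the levels plus the perturbation \<open>\<zeta>\<close>.  A quarter of
  \<open>\<epsilon>\<close> goes to each of three errors: constancy on levels, the perturbation, and the averaging
  that restores continuity.  The energies in \<open>S\<close>, where the words are hyperbolic, lose their mass in the limit;
  what remains is the open set \<open>U\<close> of small measure.
\<close>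

lemma concentrated_near:
  fixes f :: "circle \<Rightarrow>\<^sub>C real" and a :: real
  assumes a: "a \<notin> \<rat>" and \<epsilon>: "\<epsilon> > 0"
  obtains f' where "dist f' f < \<epsilon>" "concentrated n (density_of_states (to_circle a) f')"
proof -
  define N where "N = norm f"
  define R where "R = N + \<epsilon> + 2"
  define \<eta> where "\<eta> = 1 / real (Suc n)"
  define F where "F x = apply_bcontfun f (to_circle x)" for x
  have FN: "\<bar>F x\<bar> \<le> N" for x unfolding F_def N_def using norm_bounded[of f] by (simp only: real_norm_def)
  have perF: "F (x + of_int m) = F x" for x m
  proof -
    have "to_circle (x + of_int m) = to_circle x" by (simp add: circle.abs_eq_iff)
    then show ?thesis by (simp add: F_def)
  qed
  have N0: "0 \<le> N" by (simp add: N_def)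
  have pos: "\<epsilon> / 4 > 0" "R + 1 > 0" "\<eta> > 0" using \<epsilon> N0 by (auto simp: \<eta>_def R_def)
  obtain C c where C: "C > 0" "c > 0" and words: "\<And>\<Lambda>. \<exists>N\<^sub>0. \<forall>A\<ge>N\<^sub>0. \<forall>B\<ge>N\<^sub>0. \<forall>u :: nat \<Rightarrow> real. (\<forall>p. \<bar>u p\<bar> \<le> N) \<longrightarrow>
      (\<exists>\<zeta>. (\<forall>p. \<bar>\<zeta> p\<bar> \<le> \<epsilon> / 4) \<and> measure lborel {E \<in> {-(R+1)..R+1}. \<not> hyperbolic_pair \<Lambda> C c (\<lambda>p. E - (u p + \<zeta> p)) A B} < \<eta>)"
    by (rule exists_hyperbolic_words[OF pos(1) N0 pos(2,3)]) (rule that, assumption+)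
  (* The expansion must beat the constants C and c of the words, which are already fixed. *)
  define \<Lambda> where "\<Lambda> = max 3 (sqrt (8 * (1 + 6 * C ^ 4)) / c)"
  have \<Lambda>: "\<Lambda> \<ge> 3" "8 * (1 + 6 * C ^ 4) \<le> c\<^sup>2 * \<Lambda>\<^sup>2"
  proof -
    have "sqrt (8 * (1 + 6 * C ^ 4)) \<le> c * \<Lambda>" using C(2) by (simp add: \<Lambda>_def max_mult_distrib_left field_simps)
    then have "(sqrt (8 * (1 + 6 * C ^ 4)))\<^sup>2 \<le> (c * \<Lambda>)\<^sup>2" by (intro power_mono) auto
    then show "8 * (1 + 6 * C ^ 4) \<le> c\<^sup>2 * \<Lambda>\<^sup>2" using C(1) by (simp add: power_mult_distrib)
  qed (simp add: \<Lambda>_def)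
  obtain N\<^sub>0 where N\<^sub>0: "\<forall>A\<ge>N\<^sub>0. \<forall>B\<ge>N\<^sub>0. \<forall>u :: nat \<Rightarrow> real. (\<forall>p. \<bar>u p\<bar> \<le> N) \<longrightarrow>
      (\<exists>\<zeta>. (\<forall>p. \<bar>\<zeta> p\<bar> \<le> \<epsilon> / 4) \<and> measure lborel {E \<in> {-(R+1)..R+1}. \<not> hyperbolic_pair \<Lambda> C c (\<lambda>p. E - (u p + \<zeta> p)) A B} < \<eta>)"
    using words[of \<Lambda>] by (rule exE)
  obtain \<delta> where \<delta>: "\<delta> > 0" "\<And>x y. \<bar>x - y\<bar> < \<delta> \<Longrightarrow> \<bar>F x - F y\<bar> < \<epsilon> / 4"
    using uniformly_continuous_lift[OF pos(1), of f] unfolding F_def by blast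
  obtain \<beta> b A B where b: "0 < b" "b < \<beta>" "\<beta> < \<delta>" "\<beta> < 1" and AB: "N\<^sub>0 \<le> A" "N\<^sub>0 \<le> B" "0 < A" "0 < B"
    and ret: "\<And>z. frac z < b \<Longrightarrow> frac (z + real A * a) < \<beta>"
      "\<And>z m. frac z < b \<Longrightarrow> 0 < m \<Longrightarrow> m < A \<Longrightarrow> \<beta> \<le> frac (z + real m * a)"
      "\<And>z. b \<le> frac z \<Longrightarrow> frac z < \<beta> \<Longrightarrow> frac (z + real B * a) < \<beta>"
      "\<And>z m. b \<le> frac z \<Longrightarrow> frac z < \<beta> \<Longrightarrow> 0 < m \<Longrightarrow> m < B \<Longrightarrow> \<beta> \<le> frac (z + real m * a)"
    by (rule return_times[OF a \<delta>(1), of N\<^sub>0]) (rule that, assumption+)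
  interpret T: two_towers a \<beta> b A B
    by unfold_locales (use a b AB ret in auto)
  define u where "u p = F (real (if p < A then p else p - A) * a)" for p
  obtain \<zeta> where \<zeta>: "\<And>p. \<bar>\<zeta> p\<bar> \<le> \<epsilon> / 4"
    and small: "measure lborel {E \<in> {-(R+1)..R+1}. \<not> hyperbolic_pair \<Lambda> C c (\<lambda>p. E - (u p + \<zeta> p)) A B} < \<eta>"
  proof -
    have "\<forall>p. \<bar>u p\<bar> \<le> N" using FN by (simp add: u_def)
    with N\<^sub>0 AB(1,2) have "\<exists>\<zeta>. (\<forall>p. \<bar>\<zeta> p\<bar> \<le> \<epsilon> / 4) \<and>
        measure lborel {E \<in> {-(R+1)..R+1}. \<not> hyperbolic_pair \<Lambda> C c (\<lambda>p. E - (u p + \<zeta> p)) A B} < \<eta>" by blast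
    then show thesis using that by blast
  qed
  define y where "y p = u p + \<zeta> p" for p
  define g where "g z = y (T.address z)" for z
  have y: "\<bar>y p\<bar> \<le> N + \<epsilon> / 4" for p
    using FN[of "real (if p < A then p else p - A) * a"] \<zeta>[of p] unfolding y_def u_def by linarith
  have g: "g \<in> borel_measurable borel" "\<And>x. \<bar>g x\<bar> \<le> N + \<epsilon> / 4"
    unfolding g_def using measurable_compose[OF T.measurable_address, of y borel] y by auto
  have right: "\<exists>e>0. \<forall>t. 0 \<le> t \<longrightarrow> t < e \<longrightarrow> g (z + t) = g z" for z
    using T.address_right_constant[of z] unfolding g_def by metis
  have near: "\<bar>g z - F z\<bar> \<le> \<epsilon> / 2" for z
    using T.word_near[of F, OF perF \<delta>(2) b(3), of z] \<zeta>[of "T.address z"] unfolding g_def y_def u_def by linarith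
  define s where "s j = \<delta> / 2 * inverse (real (Suc j))" for j
  have s: "s j > 0" "s j < \<delta>" for j
  proof -
    show "s j > 0" using \<delta>(1) by (simp add: s_def)
    have "s j \<le> \<delta> / 2 * 1" unfolding s_def using \<delta>(1) by (intro mult_left_mono) (auto simp: field_simps)
    then show "s j < \<delta>" using \<delta>(1) by simp
  qed
  have s0: "s \<longlonglongrightarrow> 0" unfolding s_def[abs_def] by (intro tendsto_mult_right_zero LIMSEQ_inverse_real_of_nat)
  have "\<exists>h :: circle \<Rightarrow>\<^sub>C real. \<forall>x. apply_bcontfun h (to_circle x) = smear (s j) g x" for j
  proof -
    have "g (z + of_int m + t) = g (z + t)" for z m t
      using T.address_periodic[of "z + t" m] by (simp add: g_def algebra_simps)
    then have "smear (s j) g (z + of_int m) = smear (s j) g z" for z m by (simp add: smear_def)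
    then show ?thesis using exists_circle_function[OF continuous_smear[OF g s(1)[of j]]] by metis
  qed
  then obtain f' :: "nat \<Rightarrow> circle \<Rightarrow>\<^sub>C real" where f': "\<And>j x. apply_bcontfun (f' j) (to_circle x) = smear (s j) g x" by metis
  have dist: "dist (f' j) f \<le> 3 * \<epsilon> / 4" for j
  proof (rule dist_bound)
    fix \<omega> :: circle
    obtain x where x: "\<omega> = to_circle x" by (metis Quotient3_abs_rep Quotient3_circle)
    have "\<bar>smear (s j) g x - F x\<bar> \<le> 3 * \<epsilon> / 4"
    proof (rule smear_near[OF g s(1)])
      fix t :: real assume t: "0 \<le> t" "t \<le> s j"
      have "\<bar>F (x + t) - F x\<bar> < \<epsilon> / 4" using t s(2)[of j] by (intro \<delta>(2)) simp
      then show "\<bar>g (x + t) - F x\<bar> \<le> 3 * \<epsilon> / 4" using near[of "x + t"] by linarith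
    qed
    then show "dist (apply_bcontfun (f' j) \<omega>) (apply_bcontfun f \<omega>) \<le> 3 * \<epsilon> / 4"
      unfolding x f' dist_real_def F_def .
  qed
  define k where "k j = density_of_states (to_circle a) (f' j)" for j
  define m where "m n = (\<integral>x. indicator {0..<1} x * moment (\<lambda>k. g (x + of_int k * a)) n \<partial>lborel)" for n
  have ip: "interval_probability (k j) R" for j
    unfolding k_def
  proof (rule interval_probability_dos)
    have "norm (f' j) \<le> norm f + dist (f' j) f" using norm_triangle_ineq2[of "f' j" f] by (simp add: dist_norm)
    then show "norm (f' j) + 2 \<le> R" using dist[of j] \<epsilon> by (simp add: R_def N_def)
  qed
  have km: "(\<lambda>j. \<integral>x. x ^ i \<partial>k j) \<longlonglongrightarrow> m i" for i
    unfolding k_def m_def by (rule moments_of_smeared(1)[OF g right s(1) s0 f'])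
  let ?hyp = "\<lambda>E. hyperbolic_pair \<Lambda> C c (\<lambda>p. E - y p) A B"
  have cl: "closed {E. ?hyp E}" by (rule closed_hyperbolic)
  (* The words are good on the larger interval [-R-1, R+1], so that U below can be open and still
     contain every energy of [-R, R] outside S. *)
  define S where "S = {-R..R} \<inter> {E. ?hyp E}"
  have pos: "\<exists>\<kappa>>0. \<forall>b d. 0 \<le> shifted_square_form m E \<kappa> b d" if E: "E \<in> S" for E
  proof -
    have hyp: "?hyp E" using E by (simp add: S_def)
    have X: "\<bar>E - y p\<bar> \<le> \<bar>E\<bar> + (N + \<epsilon> / 4)" for p using y[of p] by linarith
    have AB1: "A \<ge> 1" "B \<ge> 1" using AB by auto
    obtain K where K: "K > 0" and low: "\<And>v E' I ty w. tiling (\<lambda>b. if b then B else A) I ty \<Longrightarrow>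
        (\<And>n j. n \<in> I \<Longrightarrow> j < (if ty n then B else A) \<Longrightarrow> E' - v (n + int j) = E - y ((if ty n then A else 0) + j)) \<Longrightarrow>
       finite {n. w n \<noteq> 0} \<Longrightarrow> (\<Sum>\<^sub>\<infinity>n. (w n)\<^sup>2) \<le> K * (\<Sum>\<^sub>\<infinity>n. (jacobi v w n - E' * w n)\<^sup>2)"
    proof (rule hyperbolic_lower_bound[OF hyp AB1 C \<Lambda> X], goal_cases)
      case (1 K)
      show ?case by (rule 1(1)[OF 1(2)]) (rule 1(3), assumption, blast, assumption)
    qed
    have "0 \<le> shifted_square_form (moment (\<lambda>k. g (z + of_int k * a))) E (1 / K) b d" for z b d
    proof (rule shifted_square_form_moment[OF _ K])
      fix w :: "int \<Rightarrow> real" assume w: "finite {n. w n \<noteq> 0}"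
      let ?I = "{n :: int. frac (z + of_int n * a) < \<beta>}" and ?ty = "\<lambda>n :: int. T.kind (z + of_int n * a)"
      have h: "T.height = (\<lambda>b. if b then B else A)" by (simp add: T.height_def fun_eq_iff)
      show "(\<Sum>\<^sub>\<infinity>n. (w n)\<^sup>2) \<le> K * (\<Sum>\<^sub>\<infinity>n. (jacobi (\<lambda>k. g (z + of_int k * a)) w n - E * w n)\<^sup>2)"
      proof (rule low[OF T.tiling_orbit[of z, unfolded h] _ w])
        fix n :: int and j assume nj: "n \<in> ?I" "j < (if ?ty n then B else A)"
        have shift: "z + of_int (n + int j) * a = z + of_int n * a + real j * a" by (simp add: algebra_simps)
        have "T.address (z + of_int (n + int j) * a) = T.offset (?ty n) + j"
          unfolding shift by (rule T.address_in_block) (use nj in \<open>simp_all add: h\<close>)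
        then show "E - g (z + of_int (n + int j) * a) = E - y ((if ?ty n then A else 0) + j)"
          by (simp add: g_def T.offset_def)
      qed
    qed
    then have "0 \<le> shifted_square_form m E (1 / K) b d" for b d
      unfolding m_def
      by (intro shifted_square_form_integral moments_of_smeared(2)[OF g right s(1) s0 f']) auto
    then show ?thesis using K by (intro exI[of _ "1 / K"]) auto
  qed
  have "(\<lambda>j. measure (k j) S) \<longlonglongrightarrow> 0"
  proof (rule compact_mass_vanishes[OF ip _ _ km pos])
    show "compact S" unfolding S_def by (intro compact_Int_closed cl) auto
  qed (auto simp: S_def)
  then have "\<forall>\<^sub>F j in sequentially. measure (k j) S < \<eta>" using \<open>\<eta> > 0\<close> by (rule order_tendstoD(2))
  then obtain j where j: "measure (k j) S < \<eta>" by (auto simp: eventually_sequentially)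
  define U where "U = {-(R+1)<..<R+1} - {E. ?hyp E}"
  have "open U" unfolding U_def using cl by (intro open_Diff) auto
  moreover have "emeasure lborel U < ennreal (1 / real (Suc n))"
  proof -
    let ?V = "{E \<in> {-(R+1)..R+1}. \<not> ?hyp E}"
    have V: "?V = {-(R+1)..R+1} - {E. ?hyp E}" by auto
    have VB: "?V \<in> sets borel" unfolding V using cl by (intro sets.Diff) auto
    have "emeasure lborel ?V \<le> emeasure lborel {-(R+1)..R+1}" unfolding V using VB V by (intro emeasure_mono) auto
    also have "\<dots> < \<infinity>" using emeasure_lborel_Icc_eq by (simp add: emeasure_lborel_Icc_eq)
    finally have "emeasure lborel ?V = ennreal (measure lborel ?V)" by (intro emeasure_eq_ennreal_measure) auto
    also have "\<dots> < ennreal \<eta>" using small \<open>\<eta> > 0\<close> unfolding y_def[symmetric] by (intro ennreal_lessI)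
    finally have "emeasure lborel ?V < ennreal \<eta>" .
    moreover have "emeasure lborel U \<le> emeasure lborel ?V" unfolding U_def using VB by (intro emeasure_mono) auto
    ultimately show ?thesis by (simp add: \<eta>_def)
  qed
  moreover have "1 - 1 / real (Suc n) < measure (k j) U"
  proof -
    interpret K: interval_probability "k j" R by (rule ip)
    have sp: "space (k j) = UNIV" using sets_eq_imp_space_eq[OF K.sets_k] by simp
    have US: "U \<in> sets (k j)" "S \<in> sets (k j)"
      using \<open>open U\<close> cl by (auto simp: K.sets_k S_def intro!: sets.Int)
    have "AE x in k j. x \<in> U \<union> S" using K.AE_bound by eventually_elim (auto simp: U_def S_def)
    then have "1 \<le> measure (k j) (U \<union> S)"
      using K.prob_eq_1[of "U \<union> S"] US by simp
    also have "\<dots> \<le> measure (k j) U + measure (k j) S" using US by (intro measure_Un_le)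
    finally show ?thesis using j by (simp add: \<eta>_def)
  qed
  ultimately have "concentrated n (density_of_states (to_circle a) (f' j))"
    unfolding concentrated_def k_def by blast
  moreover have "dist (f' j) f < \<epsilon>" using dist[of j] \<epsilon> by linarith
  ultimately show thesis using that by blast
qed

section \<open>Genericity of singular density of states\<close>

text \<open>
  Completeness of the target is enough; the circle has a topology but no chosen metric.
\<close>

lemma complete_bcontfun: "uniform_space_class.complete (UNIV :: ('a::topological_space \<Rightarrow>\<^sub>C 'b::complete_space) set)"
  unfolding Real_Vector_Spaces.complete_def
proof (intro allI impI)
  fix f :: "nat \<Rightarrow> 'a \<Rightarrow>\<^sub>C 'b"
  assume "(\<forall>n. f n \<in> UNIV) \<and> Cauchy f"
  then have c: "\<exists>M. \<forall>m\<ge>M. \<forall>n\<ge>M. dist (f m) (f n) < e" if "e > 0" for e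
    using that unfolding Cauchy_def by blast
  have "\<forall>e>0. \<exists>M. \<forall>m n x. M \<le> m \<and> M \<le> n \<and> True \<longrightarrow> dist (apply_bcontfun (f m) x) (apply_bcontfun (f n) x) < e"
  proof (intro allI impI)
    fix e :: real assume "e > 0"
    then obtain M where M: "\<forall>m\<ge>M. \<forall>n\<ge>M. dist (f m) (f n) < e" using c by blast
    show "\<exists>M. \<forall>m n x. M \<le> m \<and> M \<le> n \<and> True \<longrightarrow> dist (apply_bcontfun (f m) x) (apply_bcontfun (f n) x) < e"
      using M dist_fun_lt_imp_dist_val_lt by (intro exI[of _ M]) blast
  qed
  from uniformly_convergent_eq_cauchy[THEN iffD2, OF this]
  obtain g where "uniform_limit UNIV (\<lambda>n. apply_bcontfun (f n)) g sequentially"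
    unfolding uniform_limit_sequentially_iff by auto
  then obtain l where "f \<longlonglongrightarrow> l" by (rule uniform_limit_bcontfunE[OF _ sequentially_bot])
  then show "\<exists>l\<in>UNIV. f \<longlonglongrightarrow> l" by blast
qed

theorem corollary2:
  fixes \<alpha> :: circle
  assumes "irrational \<alpha>"
  shows "gdelta_in euclidean {f :: circle \<Rightarrow>\<^sub>C real. singular (density_of_states \<alpha> f)} \<and>
    closure {f :: circle \<Rightarrow>\<^sub>C real. singular (density_of_states \<alpha> f)} = UNIV"
proof -
  define G where "G n = {f. concentrated n (density_of_states \<alpha> f)}" for n
  have eq: "{f. singular (density_of_states \<alpha> f)} = \<Inter> (range G)"
    using singular_iff_concentrated[OF prob_dos sets_dos, of \<alpha>] by (auto simp: G_def)
  have op: "open (G n)" for n unfolding G_def by (rule open_concentrated)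
  obtain a where a: "\<alpha> = to_circle a" "a \<notin> \<rat>"
  proof -
    have "\<alpha> = to_circle (rep_circle \<alpha>)" using Quotient3_abs_rep[OF Quotient3_circle] by simp
    then show thesis using assms that unfolding irrational_def by blast
  qed
  have dense: "closure (G n) = UNIV" for n
  proof -
    have "f \<in> closure (G n)" for f
      unfolding closure_approachable
    proof (intro allI impI)
      fix e :: real assume "e > 0"
      then obtain f' where "dist f' f < e" "concentrated n (density_of_states (to_circle a) f')"
        using concentrated_near[OF a(2)] by blast
      then show "\<exists>f'\<in>G n. dist f' f < e" by (auto simp: G_def a(1))
    qed
    then show ?thesis by blast
  qed
  have "gdelta_in euclidean (\<Inter> (range G))"
    by (rule gdelta_in_Inter) (use op in \<open>auto intro: open_imp_gdelta_in\<close>)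
  moreover have "completely_metrizable_space (euclidean :: (circle \<Rightarrow>\<^sub>C real) topology)"
    using Met_TC.completely_metrizable_space_mtopology[where 'a = "circle \<Rightarrow>\<^sub>C real"] complete_bcontfun by auto
  then have "euclidean closure_of (\<Inter> (range G)) = topspace euclidean"
    by (intro Baire_category) (use op dense in auto)
  ultimately show ?thesis unfolding eq by simp
qed

end
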